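(* Let $\Phi:(\mathbb{C}^2,0)\to(\mathbb{C}^3,0)$ be a finitely $\mathscr{A}$-determined germ of $\Sigma^{1,0}$-type, $\Phi(s,t)=(s,t^2,t\,d(s,t))$, where $d(s,t)=g(s,t^2)$ for some holomorphic germ $g$ and $d$ is not divisible by $t$. Let $D_1,\dots,D_l$ be the irreducible components of its double point curve $D=\{d=0\}$ and $\mathfrak{vi}_j$ ($j\in J$) its vertical indices. Then $$\sum_{j\in J}\mathfrak{vi}_j=-\sum_{i\ne k}D_i\cdot D_k-C(\Phi),$$ where the sum on the right runs over ordered pairs $(i,k)$ with $i\neq k$, and $C(\Phi)$ is the number of cross caps of a stabilization of $\Phi$.
   Context: $\Phi$ is finitely $\mathscr{A}$-determined if for some $k$ every holomorphic germ with the same $k$-th Taylor polynomial is equivalent to $\Phi$ by germs of biholomorphisms of source and target. $C(\Phi)$ also equals $\dim_{\mathbb{C}}\mathcal{O}_{(\mathbb{C}^2,0)}/J(\Phi)$, where $J(\Phi)$ is generated by the $2\times2$ minors of the Jacobian matrix of $\Phi$. $C_1\cdot C_2$ is the local intersection multiplicity of curves at $0\in\mathbb{C}^2$. Let $f$ be the reduced equation of $X=\mathrm{im}\,\Phi$; $\Sigma$ the reduced singular locus of $X$ (closure of the double values); $D=\Phi^{-1}(\Sigma)$ (reduced) with reduced equation $d$. The involution $(s,t)\mapsto(s,-t)$ of $D$, which interchanges double points, induces a permutation $\sigma$ of $\{1,\dots,l\}$; $J$ is the set of unordered pairs $j=\{i,\sigma(i)\}$, indexing the components $\Sigma_j=\Phi(D_i)$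 of $\Sigma$. Vertical index $\mathfrak{vi}_j$. Let $H:(\mathbb{C}^3,0)\to(\mathbb{C},0)$ be a transverse section: $\Sigma\subset H^{-1}(0)$ and at each point of $\Sigma\setminus\{0\}$ the surface $H^{-1}(0)$ is smooth and intersects both local components of $X$ transversally. Write $H\circ\Phi=d\cdot d_\sharp$, let $D_\sharp$ be the (possibly non-reduced) divisor of $d_\sharp$ and $\lambda_i=-\sum_{k\ne i}D_k\cdot D_i-D_\sharp\cdot D_i$. Let $\tau\mapsto p(\tau)$ be the normalization of $\Sigma_j$; near points of $\Sigma_j\setminus\{0\}$ write $f=f_1f_2$ with $f_1,f_2$ holomorphic equations of the two smooth branches of $X$, and at $p(\tau)$ write the linear terms as $T_1(H)=\beta_1(\tau)T_1(f_1)+\beta_2(\tau)T_1(f_2)$. The product $\beta_1\beta_2$ is independent of choices and gives a Laurent series in $\tau$; $\mathfrak{v}_j$ is the exponent of its lowest order nonzero term. Then $$\mathfrak{vi}_j=\lambda_i+\lambda_{\sigma(i)}+\mathfrak{v}_j\ \text{ if } i\neq\sigma(i),\qquad \mathfrak{vi}_j=\lambda_i+\mathfrak{v}_j\ \text{ if } i=\sigma(i).$$ This is independent of the choice of $H$. *)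

theory Defs
  imports "HOL-Complex_Analysis.Complex_Analysis" "HOL-Combinatorics.Permutations"
begin

section \<open>Holomorphic functions of several variables\<close>

text \<open>Germs of functions and maps are represented by total functions; every notion below only
  depends on their values near the base point.\<close>

definition holo_at :: "(complex ^ 'n \<Rightarrow> complex) \<Rightarrow> complex ^ 'n \<Rightarrow> bool" where
  "holo_at f a \<longleftrightarrow>
     (\<forall>\<^sub>F x in nhds a. \<exists>L. (f has_derivative L) (at x) \<and> (\<forall>c v. L (c *s v) = c * L v))"

definition holo_map_at :: "(complex ^ 'n \<Rightarrow> complex ^ 'm) \<Rightarrow> complex ^ 'n \<Rightarrow> bool" where
  "holo_map_at F a \<longleftrightarrow> (\<forall>i. holo_at (\<lambda>x. F x $ i) a)"

lemma holo_at_const: "holo_at (\<lambda>_. c) a"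
  unfolding holo_at_def
  by (intro always_eventually allI exI[of _ "\<lambda>_. 0"]) (auto intro!: derivative_eq_intros)

lemma holo_at_add:
  assumes "holo_at f a" "holo_at g a"
  shows "holo_at (\<lambda>x. f x + g x) a"
  using assms unfolding holo_at_def
proof eventually_elim
  case (elim x)
  then obtain L M where
    "(f has_derivative L) (at x)" "\<And>c v. L (c *s v) = c * L v"
    "(g has_derivative M) (at x)" "\<And>c v. M (c *s v) = c * M v" by blast
  then show ?case
    by (intro exI[of _ "\<lambda>v. L v + M v"])
       (auto intro!: derivative_eq_intros simp: algebra_simps)
qed

lemma holo_at_mult:
  assumes "holo_at f a" "holo_at g a"
  shows "holo_at (\<lambda>x. f x * g x) a"
  using assms unfolding holo_at_def
proof eventually_elim
  case (elim x)
  then obtain L M where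
    "(f has_derivative L) (at x)" "\<And>c v. L (c *s v) = c * L v"
    "(g has_derivative M) (at x)" "\<And>c v. M (c *s v) = c * M v" by blast
  then show ?case
    by (intro exI[of _ "\<lambda>v. f x * M v + L v * g x"] conjI has_derivative_mult)
       (auto simp: algebra_simps)
qed

lemma holo_at_uminus: "holo_at f a \<Longrightarrow> holo_at (\<lambda>x. - f x) a"
  using holo_at_mult[OF holo_at_const[of "-1" a]] by simp

lemma holo_at_diff: "holo_at f a \<Longrightarrow> holo_at g a \<Longrightarrow> holo_at (\<lambda>x. f x - g x) a"
  using holo_at_add[OF _ holo_at_uminus] by fastforce


section \<open>The local ring of holomorphic germs at the origin\<close>

definition germ_eq :: "(complex ^ 'n \<Rightarrow> complex) \<Rightarrow> (complex ^ 'n \<Rightarrow> complex) \<Rightarrow> bool" where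
  "germ_eq f g \<longleftrightarrow> holo_at f 0 \<and> holo_at g 0 \<and> (\<forall>\<^sub>F x in nhds 0. f x = g x)"

quotient_type 'n hgerm = "complex ^ 'n::finite \<Rightarrow> complex" / partial: germ_eq
  morphisms rep_hgerm germ
proof (rule part_equivpI)
  show "\<exists>f :: complex ^ 'n \<Rightarrow> complex. germ_eq f f"
    using holo_at_const by (auto simp: germ_eq_def)
  show "symp (germ_eq :: (complex ^ 'n \<Rightarrow> complex) \<Rightarrow> _)"
    by (auto intro!: sympI simp: germ_eq_def eq_commute elim: eventually_mono)
  show "transp (germ_eq :: (complex ^ 'n \<Rightarrow> complex) \<Rightarrow> _)"
  proof (rule transpI)
    fix f g h :: "complex ^ 'n \<Rightarrow> complex"
    assume fg: "germ_eq f g" and gh: "germ_eq g h"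
    then have "\<forall>\<^sub>F x in nhds 0. f x = g x" "\<forall>\<^sub>F x in nhds 0. g x = h x"
      by (auto simp: germ_eq_def)
    then have "\<forall>\<^sub>F x in nhds 0. f x = h x"
      by eventually_elim simp
    with fg gh show "germ_eq f h"
      by (simp add: germ_eq_def)
  qed
qed

instantiation hgerm :: (finite) comm_ring_1
begin

lift_definition zero_hgerm :: "'a hgerm" is "\<lambda>_. 0"
  by (simp add: germ_eq_def holo_at_const)

lift_definition one_hgerm :: "'a hgerm" is "\<lambda>_. 1"
  by (simp add: germ_eq_def holo_at_const)

lift_definition plus_hgerm :: "'a hgerm \<Rightarrow> 'a hgerm \<Rightarrow> 'a hgerm" is "\<lambda>f g x. f x + g x"
  by (auto simp: germ_eq_def holo_at_add elim: eventually_elim2)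

lift_definition minus_hgerm :: "'a hgerm \<Rightarrow> 'a hgerm \<Rightarrow> 'a hgerm" is "\<lambda>f g x. f x - g x"
  by (auto simp: germ_eq_def holo_at_diff elim: eventually_elim2)

lift_definition uminus_hgerm :: "'a hgerm \<Rightarrow> 'a hgerm" is "\<lambda>f x. - f x"
  by (auto simp: germ_eq_def holo_at_uminus elim: eventually_mono)

lift_definition times_hgerm :: "'a hgerm \<Rightarrow> 'a hgerm \<Rightarrow> 'a hgerm" is "\<lambda>f g x. f x * g x"
  by (auto simp: germ_eq_def holo_at_mult elim: eventually_elim2)

instance
proof
  show "(0 :: 'a hgerm) \<noteq> 1"
    by transfer (auto simp: germ_eq_def dest: eventually_nhds_x_imp_x)
qed (transfer; auto simp: germ_eq_def algebra_simps
       intro!: holo_at_const holo_at_add holo_at_mult holo_at_diff holo_at_uminus)+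

end

lift_definition scale_hgerm :: "complex \<Rightarrow> 'n::finite hgerm \<Rightarrow> 'n hgerm" is "\<lambda>c f x. c * f x"
  by (auto simp: germ_eq_def holo_at_mult holo_at_const elim: eventually_mono)

global_interpretation hgerm: vector_space scale_hgerm
  by unfold_locales
     (transfer; auto simp: germ_eq_def algebra_simps intro!: holo_at_const holo_at_add holo_at_mult)+

text \<open>The dimension of the quotient of the local ring by \<open>I\<close>: the least size of a finite set of
  germs spanning the ring modulo \<open>I\<close>.  It is unspecified if the quotient has infinite dimension.\<close>

definition codim_hgerm :: "'n::finite hgerm set \<Rightarrow> nat" where
  "codim_hgerm I = (LEAST n. \<exists>B. finite B \<and> card B = n \<and> hgerm.span (I \<union> B) = UNIV)"

definition intersection_mult :: "(complex ^ 2 \<Rightarrow> complex) \<Rightarrow> (complex ^ 2 \<Rightarrow> complex) \<Rightarrow> nat" where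
  "intersection_mult a b = codim_hgerm {u * germ a + v * germ b | u v. True}"

text \<open>\<open>D 1, \<dots>, D l\<close> are equations of the distinct irreducible components of the curve \<open>d = 0\<close>,
  i.e. the irreducible divisors of \<open>d\<close> up to units, without multiplicities.\<close>

definition irreducible_components ::
    "(complex ^ 2 \<Rightarrow> complex) \<Rightarrow> nat \<Rightarrow> (nat \<Rightarrow> complex ^ 2 \<Rightarrow> complex) \<Rightarrow> bool" where
  "irreducible_components d l D \<longleftrightarrow>
     (\<forall>i\<in>{1..l}. holo_at (D i) 0 \<and> irreducible (germ (D i)) \<and> germ (D i) dvd germ d) \<and>
     (\<forall>i\<in>{1..l}. \<forall>k\<in>{1..l}. i \<noteq> k \<longrightarrow> \<not> germ (D i) dvd germ (D k)) \<and>
     (\<forall>q. irreducible q \<and> q dvd germ d \<longrightarrow>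
        (\<exists>i\<in>{1..l}. q dvd germ (D i) \<and> germ (D i) dvd q))"


section \<open>Equivalence and finite determinacy of map germs\<close>

definition biholo_germ :: "(complex ^ 'n \<Rightarrow> complex ^ 'n) \<Rightarrow> bool" where
  "biholo_germ h \<longleftrightarrow> holo_map_at h 0 \<and> h 0 = 0 \<and>
     (\<exists>h'. holo_map_at h' 0 \<and> h' 0 = 0 \<and>
        (\<forall>\<^sub>F x in nhds 0. h' (h x) = x) \<and> (\<forall>\<^sub>F x in nhds 0. h (h' x) = x))"

definition A_equivalent ::
    "(complex ^ 'n \<Rightarrow> complex ^ 'm) \<Rightarrow> (complex ^ 'n \<Rightarrow> complex ^ 'm) \<Rightarrow> bool" where
  "A_equivalent F G \<longleftrightarrow>
     (\<exists>h k. biholo_germ h \<and> biholo_germ k \<and> (\<forall>\<^sub>F x in nhds 0. G x = k (F (h x))))"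

definition partial_deriv :: "'n \<Rightarrow> (complex ^ 'n \<Rightarrow> complex) \<Rightarrow> complex ^ 'n \<Rightarrow> complex" where
  "partial_deriv i f x = deriv (\<lambda>z. f (x + axis i z)) 0"

definition same_jet ::
    "nat \<Rightarrow> (complex ^ 'n \<Rightarrow> complex ^ 'm) \<Rightarrow> (complex ^ 'n \<Rightarrow> complex ^ 'm) \<Rightarrow> bool" where
  "same_jet k F G \<longleftrightarrow>
     (\<forall>is. length is \<le> k \<longrightarrow> (\<forall>j.
        foldr partial_deriv is (\<lambda>x. F x $ j) 0 = foldr partial_deriv is (\<lambda>x. G x $ j) 0))"

definition finitely_A_determined :: "(complex ^ 'n \<Rightarrow> complex ^ 'm) \<Rightarrow> bool" where
  "finitely_A_determined F \<longleftrightarrow>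
     (\<exists>k. \<forall>G. holo_map_at G 0 \<and> same_jet k F G \<longrightarrow> A_equivalent F G)"

text \<open>Thom--Boardman type \<open>\<Sigma>\<^sup>1\<^sup>,\<^sup>0\<close>: the kernel of the differential is a line, and the second
  intrinsic derivative (from the kernel to the cokernel) does not vanish on it.\<close>

definition Sigma_1_0 :: "(complex ^ 2 \<Rightarrow> complex ^ 3) \<Rightarrow> bool" where
  "Sigma_1_0 \<Phi> \<longleftrightarrow>
     (\<exists>w. w \<noteq> 0 \<and> {v. frechet_derivative \<Phi> (at 0) v = 0} = range (\<lambda>c. c *s w) \<and>
        (\<chi> i. (deriv ^^ 2) (\<lambda>z. \<Phi> (z *s w) $ i) 0) \<notin> range (frechet_derivative \<Phi> (at 0)))"


section \<open>Stabilizations and cross caps\<close>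

definition cross_cap :: "(complex ^ 2 \<Rightarrow> complex ^ 3) \<Rightarrow> complex ^ 2 \<Rightarrow> bool" where
  "cross_cap \<Psi> a \<longleftrightarrow> holo_map_at \<Psi> a \<and>
     A_equivalent (\<lambda>x. vector [x $ 1, (x $ 2)\<^sup>2, x $ 1 * x $ 2]) (\<lambda>x. \<Psi> (a + x) - \<Psi> a)"

text \<open>The stable maps from surfaces to threefolds are those whose only singularities are
  cross caps, transversal double curves and transversal triple points.\<close>

definition stable_on :: "(complex ^ 2) set \<Rightarrow> (complex ^ 2 \<Rightarrow> complex ^ 3) \<Rightarrow> bool" where
  "stable_on U \<Psi> \<longleftrightarrow>
     (\<forall>x\<in>U. holo_map_at \<Psi> x) \<and>
     (\<forall>q. let S = {x \<in> U. \<Psi> x = q}; T = (\<lambda>x. range (frechet_derivative \<Psi> (at x))) in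
        (\<exists>x. S = {x} \<and> cross_cap \<Psi> x) \<or>
        (finite S \<and> card S \<le> 3 \<and>
         (\<forall>x\<in>S. inj (frechet_derivative \<Psi> (at x))) \<and>
         (\<forall>x\<in>S. \<forall>y\<in>S. x \<noteq> y \<longrightarrow> T x \<noteq> T y) \<and>
         (\<forall>x\<in>S. \<forall>y\<in>S. \<forall>z\<in>S. x \<noteq> y \<and> y \<noteq> z \<and> x \<noteq> z \<longrightarrow> T x \<inter> T y \<inter> T z = {0})))"

text \<open>The deformation parameter is the third coordinate of the source of \<open>F\<close>.\<close>

definition slice :: "(complex ^ 3 \<Rightarrow> complex ^ 3) \<Rightarrow> complex \<Rightarrow> complex ^ 2 \<Rightarrow> complex ^ 3" where
  "slice F \<epsilon> x = F (vector [x $ 1, x $ 2, \<epsilon>])"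

definition stabilization ::
    "(complex ^ 2 \<Rightarrow> complex ^ 3) \<Rightarrow> (complex ^ 3 \<Rightarrow> complex ^ 3) \<Rightarrow> bool" where
  "stabilization \<Phi> F \<longleftrightarrow> holo_map_at F 0 \<and> (\<forall>\<^sub>F x in nhds 0. slice F 0 x = \<Phi> x) \<and>
     (\<exists>\<rho>>0. \<forall>\<^sub>F \<epsilon> in at 0. stable_on (ball 0 \<rho>) (slice F \<epsilon>))"

definition number_of_cross_caps :: "(complex ^ 3 \<Rightarrow> complex ^ 3) \<Rightarrow> nat \<Rightarrow> bool" where
  "number_of_cross_caps F C \<longleftrightarrow>
     (\<forall>\<^sub>F \<rho> in at_right 0. \<forall>\<^sub>F \<epsilon> in at 0.
        finite {x \<in> ball 0 \<rho>. cross_cap (slice F \<epsilon>) x} \<and>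
        card {x \<in> ball 0 \<rho>. cross_cap (slice F \<epsilon>) x} = C)"


section \<open>Vertical indices\<close>

text \<open>\<open>f\<close> generates the ideal of the germs vanishing on the image of \<open>\<Phi>\<close>.\<close>

definition reduced_image_equation ::
    "(complex ^ 2 \<Rightarrow> complex ^ 3) \<Rightarrow> (complex ^ 3 \<Rightarrow> complex) \<Rightarrow> bool" where
  "reduced_image_equation \<Phi> f \<longleftrightarrow> holo_at f 0 \<and>
     (\<forall>h. holo_at h 0 \<longrightarrow> ((\<forall>\<^sub>F x in nhds 0. h (\<Phi> x) = 0) \<longleftrightarrow> germ f dvd germ h))"

text \<open>For all sufficiently small \<open>\<rho>\<close>, \<open>double_locus \<Phi> \<rho>\<close> represents the germ \<open>\<Sigma>\<close> at the origin.\<close>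

definition double_locus :: "(complex ^ 2 \<Rightarrow> complex ^ 3) \<Rightarrow> real \<Rightarrow> (complex ^ 3) set" where
  "double_locus \<Phi> \<rho> =
     closure {q. \<exists>x\<in>ball 0 \<rho>. \<exists>y\<in>ball 0 \<rho>. x \<noteq> y \<and> \<Phi> x = q \<and> \<Phi> y = q}"

definition transverse_section ::
    "(complex ^ 2 \<Rightarrow> complex ^ 3) \<Rightarrow> (complex ^ 3 \<Rightarrow> complex) \<Rightarrow> bool" where
  "transverse_section \<Phi> H \<longleftrightarrow> holo_at H 0 \<and> H 0 = 0 \<and>
     (\<forall>\<^sub>F \<rho> in at_right 0. \<forall>\<^sub>F q in nhds 0. q \<in> double_locus \<Phi> \<rho> \<longrightarrow>
        H q = 0 \<and>
        (q \<noteq> 0 \<longrightarrow>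
          (\<exists>v. frechet_derivative H (at q) v \<noteq> 0) \<and>
          (\<forall>x\<in>ball 0 \<rho>. \<Phi> x = q \<longrightarrow>
             {u + w | u w. frechet_derivative H (at q) u = 0 \<and>
                           w \<in> range (frechet_derivative \<Phi> (at x))} = UNIV)))"

text \<open>\<open>p\<close> is the normalization of the irreducible curve germ \<open>\<Phi> (D\<^sub>i)\<close>: an injective
  parametrization.\<close>

definition normalization_of_image ::
    "(complex ^ 2 \<Rightarrow> complex ^ 3) \<Rightarrow> (complex ^ 2 \<Rightarrow> complex) \<Rightarrow> (complex \<Rightarrow> complex ^ 3) \<Rightarrow> bool"
  where
  "normalization_of_image \<Phi> Di p \<longleftrightarrow>
     (\<forall>k. (\<lambda>\<tau>. p \<tau> $ k) analytic_on {0}) \<and> p 0 = 0 \<and> (\<exists>r>0. inj_on p (ball 0 r)) \<and>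
     (\<forall>\<^sub>F r in at_right 0. \<forall>\<^sub>F q in nhds 0.
        q \<in> p ` ball 0 r \<longleftrightarrow> q \<in> \<Phi> ` {x \<in> ball 0 r. Di x = 0})"

text \<open>\<open>c\<close> is the product \<open>\<beta>\<^sub>1\<beta>\<^sub>2\<close> at the point \<open>q\<close>, for some local factorization \<open>f = f1 * f2\<close>
  into equations of the branches of the image at the two preimages \<open>x\<close>, \<open>y\<close> of \<open>q\<close>.\<close>

definition beta_product ::
    "(complex ^ 2 \<Rightarrow> complex ^ 3) \<Rightarrow> (complex ^ 3 \<Rightarrow> complex) \<Rightarrow> (complex ^ 3 \<Rightarrow> complex) \<Rightarrow>
     real \<Rightarrow> complex ^ 3 \<Rightarrow> complex \<Rightarrow> bool" where
  "beta_product \<Phi> f H \<rho> q c \<longleftrightarrow>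
     (\<exists>x\<in>ball 0 \<rho>. \<exists>y\<in>ball 0 \<rho>. \<exists>f1 f2 \<beta>1 \<beta>2.
        x \<noteq> y \<and> \<Phi> x = q \<and> \<Phi> y = q \<and>
        holo_at f1 q \<and> holo_at f2 q \<and> (\<forall>\<^sub>F z in nhds q. f z = f1 z * f2 z) \<and>
        (\<forall>\<^sub>F x' in nhds x. f1 (\<Phi> x') = 0) \<and> (\<exists>v. frechet_derivative f1 (at q) v \<noteq> 0) \<and>
        (\<forall>\<^sub>F y' in nhds y. f2 (\<Phi> y') = 0) \<and> (\<exists>v. frechet_derivative f2 (at q) v \<noteq> 0) \<and>
        (\<forall>v. frechet_derivative H (at q) v =
             \<beta>1 * frechet_derivative f1 (at q) v + \<beta>2 * frechet_derivative f2 (at q) v) \<and>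
        c = \<beta>1 * \<beta>2)"

definition is_v_exponent ::
    "(complex ^ 2 \<Rightarrow> complex ^ 3) \<Rightarrow> (complex ^ 3 \<Rightarrow> complex) \<Rightarrow> (complex ^ 3 \<Rightarrow> complex) \<Rightarrow>
     (complex \<Rightarrow> complex ^ 3) \<Rightarrow> int \<Rightarrow> bool" where
  "is_v_exponent \<Phi> f H p v \<longleftrightarrow>
     (\<exists>b B. (\<forall>\<^sub>F \<rho> in at_right 0. \<forall>\<^sub>F \<tau> in at 0. beta_product \<Phi> f H \<rho> (p \<tau>) (b \<tau>)) \<and>
        b has_laurent_expansion B \<and> B \<noteq> 0 \<and> v = fls_subdegree B)"

definition lambda_index ::
    "nat \<Rightarrow> (nat \<Rightarrow> complex ^ 2 \<Rightarrow> complex) \<Rightarrow> (complex ^ 2 \<Rightarrow> complex) \<Rightarrow> nat \<Rightarrow> int" where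
  "lambda_index l D dsharp i =
     - (\<Sum>k\<in>{1..l} - {i}. int (intersection_mult (D k) (D i)))
     - int (intersection_mult dsharp (D i))"

text \<open>\<open>m\<close> is the vertical index of the component \<open>\<Sigma>\<^sub>j\<close>, \<open>j = {i, \<sigma> i}\<close>, computed from some
  transverse section \<open>H\<close>; it does not depend on the choices.\<close>

definition is_vertical_index ::
    "(complex ^ 2 \<Rightarrow> complex ^ 3) \<Rightarrow> (complex ^ 3 \<Rightarrow> complex) \<Rightarrow> (complex ^ 2 \<Rightarrow> complex) \<Rightarrow>
     nat \<Rightarrow> (nat \<Rightarrow> complex ^ 2 \<Rightarrow> complex) \<Rightarrow> (nat \<Rightarrow> nat) \<Rightarrow> nat set \<Rightarrow> int \<Rightarrow> bool" where
  "is_vertical_index \<Phi> f d l D \<sigma> j m \<longleftrightarrow>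
     (\<exists>i\<in>{1..l}. j = {i, \<sigma> i} \<and>
       (\<exists>H dsharp p v.
          transverse_section \<Phi> H \<and>
          holo_at dsharp 0 \<and> (\<forall>\<^sub>F x in nhds 0. H (\<Phi> x) = d x * dsharp x) \<and>
          normalization_of_image \<Phi> (D i) p \<and>
          is_v_exponent \<Phi> f H p v \<and>
          m = (if i \<noteq> \<sigma> i then lambda_index l D dsharp i + lambda_index l D dsharp (\<sigma> i) + v
               else lambda_index l D dsharp i + v)))"

text \<open>The permutation of the components induced by the involution \<open>(s,t) \<mapsto> (s,-t)\<close>.\<close>

definition involution_permutation ::
    "nat \<Rightarrow> (nat \<Rightarrow> complex ^ 2 \<Rightarrow> complex) \<Rightarrow> (nat \<Rightarrow> nat) \<Rightarrow> bool" where
  "involution_permutation l D \<sigma> \<longleftrightarrow> \<sigma> permutes {1..l} \<and>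
     (\<forall>i\<in>{1..l}. germ (D (\<sigma> i)) dvd germ (\<lambda>x. D i (vector [x $ 1, - x $ 2])) \<and>
                 germ (\<lambda>x. D i (vector [x $ 1, - x $ 2])) dvd germ (D (\<sigma> i)))"

end

theory Submission
  imports Defs
begin

text \<open>The double curve is \<open>d = 0\<close>, and the two preimages of a double point are exchanged by
  \<open>(s, t) \<mapsto> (s, -t)\<close>. A transverse section forces \<open>g\<close> to have nonzero differential along the image of
  the curve away from \<open>0\<close>, so \<open>d\<close> is reduced and each \<open>D\<^sub>i\<close> has a parametrization
  \<open>\<theta> \<mapsto> (\<xi> \<theta>, \<theta>\<^sup>n)\<close> with \<open>n = D\<^sub>i \<cdot> {t = 0}\<close>; intersection numbers with \<open>D\<^sub>i\<close> are orders of vanishing along it.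

  The equation \<open>f\<close> of the image is a unit times \<open>z\<^sup>2 - y g\<^sup>2\<close>. Comparing linear terms at the double
  point with preimages \<open>(s, \<plusminus>t)\<close> shows that \<open>\<beta>\<^sub>1\<beta>\<^sub>2\<close> is, up to a unit, \<open>d\<^sub>\<sharp>(s, t) d\<^sub>\<sharp>(s, -t) / t\<^sup>2\<close>. Hence the
  contributions of \<open>d\<^sub>\<sharp>\<close> to \<open>v\<^sub>j\<close> and to the \<open>\<lambda>\<^sub>i\<close> cancel, and \<open>vi\<^sub>j\<close> is the sum of
  \<open>- \<Sum>\<^sub>k D\<^sub>k \<cdot> D\<^sub>i - D\<^sub>i \<cdot> {t = 0}\<close> over \<open>i \<in> j\<close>.

  It remains to see that \<open>C(\<Phi>)\<close> is the order of \<open>d(s, 0)\<close>. In a deformation the singular points of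
  the slices are the zeros of a function \<open>m\<close> of one variable close to \<open>d(s, 0)\<close>; stability makes them
  cross caps and simple zeros of \<open>m\<close>, so Rouche's theorem counts them.\<close>

section \<open>Holomorphic functions of two variables\<close>

text \<open>Neither unique factorization of germs nor Puiseux series is invoked. Each vertical index
  comes with a curve \<open>p\<close> in the image, which is lifted through the fold
  \<open>y = t^2\<close>. If the second coordinate of \<open>p\<close> is made
  \<open>\<theta> ^ N\<close>, an odd \<open>N\<close> gives one branch fixed by
  \<open>t \<mapsto> - t\<close>, an even \<open>N\<close> two branches exchanged by it. As
  \<open>D i\<close> is irreducible and vanishes along such a branch, it generates the kernel of a
  ring homomorphism into power series. So it is prime, and this is all that the factorization of
  \<open>d\<close> requires. The denominator \<open>t^2\<close> of \<beta>1\<beta>2 is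
  \<open>\<theta> ^ N\<close>; passing from \<open>v\<close> to the orders of \<open>dsharp\<close>
  therefore costs exactly \<open>N\<close>, which is the sum of the orders on \<open>t = 0\<close>
  over the orbit. Codimension is a least number of spanning elements, so it must be bounded from
  both sides. The upper bound removes leading terms one after the other; this ends because, by the
  conductor of the branch, all sufficiently high orders lie in the ideal. Instead of the unit in
  front of \<open>z^2 - y g^2\<close>, the proof works with the second vertical derivative of
  \<open>f\<close>, which is nonzero at 0.\<close>

lemma continuous_on_circle_integral:
  fixes K :: "'a::topological_space \<Rightarrow> complex \<Rightarrow> complex"
  assumes K: "continuous_on (P \<times> sphere z r) (\<lambda>(p, w). K p w)" and r: "r > 0"
  shows "continuous_on P (\<lambda>p. contour_integral (circlepath z r) (K p))"
proof -
  have eq: "contour_integral (circlepath z r) (K p) =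
      integral (cbox 0 1) (\<lambda>x. K p (circlepath z r x) * (2 * pi * \<i> * r * exp (2 * of_real pi * \<i> * x)))" for p
    by (simp add: contour_integral_integral vector_derivative_circlepath cbox_interval)
  have c: "continuous_on (P \<times> cbox 0 1) (\<lambda>(p, x). K p (circlepath z r x))"
  proof -
    have "continuous_on (P \<times> cbox 0 1) ((\<lambda>(p, w). K p w) \<circ> (\<lambda>(p, x). (p, circlepath z r x)))"
    proof (rule continuous_on_compose)
      show "continuous_on (P \<times> cbox 0 1) (\<lambda>(p, x). (p, circlepath z r x))"
        unfolding circlepath split_beta by (intro continuous_intros)
      have "(\<lambda>(p, x). (p, circlepath z r x)) ` (P \<times> cbox 0 1) \<subseteq> P \<times> sphere z r"
        using path_image_circlepath[of z r] r by (fastforce simp: path_image_def)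
      then show "continuous_on ((\<lambda>(p, x). (p, circlepath z r x)) ` (P \<times> cbox 0 1)) (\<lambda>(p, w). K p w)"
        using K continuous_on_subset by blast
    qed
    then show ?thesis by (simp add: o_def split_beta)
  qed
  show ?thesis unfolding eq
    by (rule integral_continuous_on_param)
       (use c in \<open>auto simp: split_beta intro!: continuous_intros\<close>)
qed

text \<open>Cauchy's formula controls a derivative only on a disc inside the domain. This glues the
  joint continuity obtained on such discs, keeping the parameter set whole.\<close>

lemma continuous_on_local_Times:
  fixes f :: "'a::t2_space \<times> 'b::t2_space \<Rightarrow> 'c::topological_space"
  assumes "\<And>z. z \<in> V \<Longrightarrow> \<exists>W. open W \<and> z \<in> W \<and> W \<subseteq> V \<and> continuous_on (P \<times> W) f"
  shows "continuous_on (P \<times> V) f"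
proof (clarsimp simp: continuous_on_eq_continuous_within)
  fix p z assume p: "p \<in> P" and z: "z \<in> V"
  obtain W where W: "open W" "z \<in> W" "W \<subseteq> V" "continuous_on (P \<times> W) f"
    using assms z by blast
  have "continuous (at (p, z) within P \<times> W) f"
    using W p by (auto simp: continuous_on_eq_continuous_within)
  moreover have "at (p, z) within P \<times> W = at (p, z) within P \<times> V"
    by (rule at_within_nhd[where S="UNIV \<times> W"]) (use W in \<open>auto intro: open_Times\<close>)
  ultimately show "continuous (at (p, z) within P \<times> V) f" by simp
qed

text \<open>On a small disc the derivative is a Cauchy integral over one fixed circle, whose
  integrand depends continuously on parameter and point together. The parameter space carries no
  complex structure, so pairs may serve as parameters later.\<close>

lemma continuous_on_deriv_param:
  fixes f :: "'a::t2_space \<Rightarrow> complex \<Rightarrow> complex"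
  assumes f: "continuous_on (P \<times> V) (\<lambda>(p, z). f p z)" and V: "open V"
    and hol: "\<And>p. p \<in> P \<Longrightarrow> f p holomorphic_on V"
  shows "continuous_on (P \<times> V) (\<lambda>(p, z). deriv (f p) z)"
proof (rule continuous_on_local_Times)
  fix z0 assume "z0 \<in> V"
  then obtain r where r: "r > 0" "cball z0 r \<subseteq> V" using V open_contains_cball by blast
  let ?G = "\<lambda>(p, z). contour_integral (circlepath z0 r) (\<lambda>w. f p w / (w - z)\<^sup>2)"
  have "continuous_on ((P \<times> ball z0 r) \<times> sphere z0 r) ((\<lambda>(p, w). f p w) \<circ> (\<lambda>q. (fst (fst q), snd q)))"
    by (rule continuous_on_compose)
       (use r in \<open>auto intro!: continuous_intros continuous_on_subset[OF f]\<close>)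
  then have c1: "continuous_on ((P \<times> ball z0 r) \<times> sphere z0 r) (\<lambda>q. f (fst (fst q)) (snd q))"
    by (simp add: o_def)
  have "continuous_on (P \<times> ball z0 r) (\<lambda>pz. contour_integral (circlepath z0 r) (\<lambda>w. f (fst pz) w / (w - snd pz)\<^sup>2))"
    by (rule continuous_on_circle_integral)
       (use r in \<open>auto simp: split_beta intro!: continuous_intros c1\<close>)
  then have "continuous_on (P \<times> ball z0 r) (\<lambda>pz. ?G pz / (2 * of_real pi * \<i>))"
    by (auto simp: split_beta intro!: continuous_intros)
  moreover have "(\<lambda>(p, z). deriv (f p) z) pz = ?G pz / (2 * of_real pi * \<i>)"
    if "pz \<in> P \<times> ball z0 r" for pz
  proof -
    obtain p z where pz: "pz = (p, z)" by (cases pz)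
    with that have pz: "pz = (p, z)" "p \<in> P" "z \<in> ball z0 r" by auto
    have "continuous_on (cball z0 r) (f p)" "f p holomorphic_on ball z0 r"
      using hol[OF pz(2)] r ball_subset_cball holomorphic_on_imp_continuous_on holomorphic_on_subset
      by (blast, meson ball_subset_cball holomorphic_on_subset order_trans)
    from Cauchy_derivative_integral_circlepath(2)[OF this pz(3)]
    show ?thesis by (simp add: pz DERIV_imp_deriv)
  qed
  ultimately have "continuous_on (P \<times> ball z0 r) (\<lambda>(p, z). deriv (f p) z)"
    by (simp cong: continuous_on_cong)
  then show "\<exists>W. open W \<and> z0 \<in> W \<and> W \<subseteq> V \<and> continuous_on (P \<times> W) (\<lambda>(p, z). deriv (f p) z)"
    using r by (intro exI[of _ "ball z0 r"]) auto
qed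

text \<open>Differentiation under the integral sign. The derivative of the integrand is jointly
  continuous by \<open>continuous_on_deriv_param\<close>, after exchanging the two
  arguments.\<close>

lemma holomorphic_circle_integral:
  assumes K: "continuous_on (U \<times> sphere z r) (\<lambda>(p, w). K p w)" and r: "r > 0" and U: "open U"
    and hol: "\<And>w. w \<in> sphere z r \<Longrightarrow> (\<lambda>p. K p w) holomorphic_on U"
  shows "(\<lambda>p. contour_integral (circlepath z r) (K p)) holomorphic_on U"
proof -
  have eq: "contour_integral (circlepath z r) (K p) =
      integral (cbox 0 1) (\<lambda>x. K p (circlepath z r x) * (2 * pi * \<i> * r * exp (2 * of_real pi * \<i> * x)))" for p
    by (simp add: contour_integral_integral vector_derivative_circlepath cbox_interval)
  have sph: "circlepath z r x \<in> sphere z r" if "x \<in> {0..1}" for x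
    using path_image_circlepath[of z r] r that by (fastforce simp: path_image_def)
  have cp: "continuous_on A (circlepath z r)" for A
    unfolding circlepath by (intro continuous_intros)
  have "continuous_on (sphere z r \<times> U) ((\<lambda>(p, w). K p w) \<circ> (\<lambda>q. (snd q, fst q)))"
    by (rule continuous_on_compose) (auto intro!: continuous_intros continuous_on_subset[OF K])
  then have "continuous_on (sphere z r \<times> U) (\<lambda>(w, p). K p w)" by (simp add: o_def split_beta)
  from continuous_on_deriv_param[OF this U hol]
  have dK: "continuous_on (sphere z r \<times> U) (\<lambda>(w, p). deriv (\<lambda>p. K p w) p)" by simp
  \<comment> \<open>Leibniz' rule is stated for convex domains, hence the detour over balls inside
    \<open>U\<close>.\<close>
  have loc: "(\<lambda>p. contour_integral (circlepath z r) (K p)) holomorphic_on V"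
    if V: "V \<subseteq> U" "open V" "convex V" for V
    unfolding eq
  proof (rule leibniz_rule_holomorphic[where fx="\<lambda>p x. deriv (\<lambda>p. K p (circlepath z r x)) p * (2 * pi * \<i> * r * exp (2 * of_real pi * \<i> * x))"])
    fix p x assume p: "p \<in> V" and x: "x \<in> cbox 0 (1::real)"
    have "((\<lambda>p. K p (circlepath z r x)) has_field_derivative deriv (\<lambda>p. K p (circlepath z r x)) p) (at p within V)"
      using p x V hol[OF sph[of x]] U
      by (metis DERIV_subset cbox_interval holomorphic_derivI subsetD subset_UNIV)
    then show "((\<lambda>p. K p (circlepath z r x) * (2 * pi * \<i> * r * exp (2 * of_real pi * \<i> * x))) has_field_derivative
        deriv (\<lambda>p. K p (circlepath z r x)) p * (2 * pi * \<i> * r * exp (2 * of_real pi * \<i> * x))) (at p within V)"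
      by (rule DERIV_cmult_right)
  next
    fix p assume p: "p \<in> V"
    have "continuous_on (cbox 0 1) ((\<lambda>(p, w). K p w) \<circ> (\<lambda>x. (p, circlepath z r x)))"
      by (rule continuous_on_compose)
         (use p V sph in \<open>auto intro!: continuous_intros cp continuous_on_subset[OF K]\<close>)
    then show "(\<lambda>x. K p (circlepath z r x) * (2 * pi * \<i> * r * exp (2 * of_real pi * \<i> * x))) integrable_on cbox 0 1"
      by (intro integrable_continuous continuous_intros) (simp add: o_def)
  next
    have "continuous_on (V \<times> cbox 0 1) ((\<lambda>(w, p). deriv (\<lambda>p. K p w) p) \<circ> (\<lambda>q. (circlepath z r (snd q), fst q)))"
      by (rule continuous_on_compose)
         (use V sph in \<open>auto intro!: continuous_intros continuous_on_compose2[OF cp] continuous_on_subset[OF dK]\<close>)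
    then show "continuous_on (V \<times> cbox 0 1) (\<lambda>(p, x). deriv (\<lambda>p. K p (circlepath z r x)) p * (2 * pi * \<i> * r * exp (2 * of_real pi * \<i> * x)))"
      by (auto simp: split_beta o_def intro!: continuous_intros)
  qed (use V in auto)
  show ?thesis
  proof (rule holomorphic_onI)
    fix p assume "p \<in> U"
    then obtain e where e: "e > 0" "ball p e \<subseteq> U" using U open_contains_ball by blast
    from loc[of "ball p e"] e
    show "(\<lambda>p. contour_integral (circlepath z r) (K p)) field_differentiable at p within U"
      by (simp add: field_differentiable_at_within holomorphic_on_imp_differentiable_at)
  qed
qed

text \<open>Separate holomorphy together with joint continuity, on a square polydisc: this is what
  passes through a circle integral in either variable. Differentiability in both variables at once
  is recovered in \<open>hol2_has_derivative\<close>.\<close>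

definition hol2 :: "real \<Rightarrow> (complex \<Rightarrow> complex \<Rightarrow> complex) \<Rightarrow> bool" where
  "hol2 r f \<longleftrightarrow> continuous_on (ball 0 r \<times> ball 0 r) (\<lambda>(s, t). f s t) \<and>
     (\<forall>s\<in>ball 0 r. f s holomorphic_on ball 0 r) \<and>
     (\<forall>t\<in>ball 0 r. (\<lambda>s. f s t) holomorphic_on ball 0 r)"

lemma hol2D:
  assumes "hol2 r f"
  shows "continuous_on (ball 0 r \<times> ball 0 r) (\<lambda>(s, t). f s t)"
    "\<And>s. s \<in> ball 0 r \<Longrightarrow> f s holomorphic_on ball 0 r"
    "\<And>t. t \<in> ball 0 r \<Longrightarrow> (\<lambda>s. f s t) holomorphic_on ball 0 r"
  using assms unfolding hol2_def by blast+

lemma hol2_mono: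
  assumes f: "hol2 r f" and r: "r' \<le> r"
  shows "hol2 r' f"
proof -
  have sub: "ball 0 r' \<subseteq> ball (0::complex) r" using r by (rule subset_ball)
  show ?thesis
    unfolding hol2_def
  proof (intro conjI ballI)
    show "continuous_on (ball 0 r' \<times> ball 0 r') (\<lambda>(s, t). f s t)"
      by (rule continuous_on_subset[OF hol2D(1)[OF f] Sigma_mono]) (use sub in auto)
    show "f s holomorphic_on ball 0 r'" if "s \<in> ball 0 r'" for s
      by (rule holomorphic_on_subset[OF hol2D(2)[OF f] sub]) (use that sub in blast)
    show "(\<lambda>s. f s t) holomorphic_on ball 0 r'" if "t \<in> ball 0 r'" for t
      by (rule holomorphic_on_subset[OF hol2D(3)[OF f] sub]) (use that sub in blast)
  qed
qed

lemma hol2_const: "hol2 r (\<lambda>_ _. c)"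
  unfolding hol2_def case_prod_unfold by (intro conjI ballI continuous_on_const holomorphic_on_const)

lemma hol2_fst:
  assumes f: "f holomorphic_on ball 0 r"
  shows "hol2 r (\<lambda>s t. f s)"
proof -
  have "continuous_on (ball 0 r \<times> ball 0 r) (\<lambda>p. f (fst p))"
    by (rule continuous_on_compose2[OF holomorphic_on_imp_continuous_on[OF f]])
       (auto intro!: continuous_on_fst continuous_on_id)
  then show ?thesis
    using f by (simp add: hol2_def case_prod_unfold)
qed

lemma hol2_snd:
  assumes f: "f holomorphic_on ball 0 r"
  shows "hol2 r (\<lambda>s t. f t)"
proof -
  have "continuous_on (ball 0 r \<times> ball 0 r) (\<lambda>p. f (snd p))"
    by (rule continuous_on_compose2[OF holomorphic_on_imp_continuous_on[OF f]])
       (auto intro!: continuous_on_snd continuous_on_id)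
  then show ?thesis
    using f by (simp add: hol2_def case_prod_unfold)
qed

lemma hol2_add: "hol2 r f \<Longrightarrow> hol2 r g \<Longrightarrow> hol2 r (\<lambda>s t. f s t + g s t)"
  unfolding hol2_def case_prod_unfold by (auto intro!: continuous_intros holomorphic_intros)

lemma hol2_diff: "hol2 r f \<Longrightarrow> hol2 r g \<Longrightarrow> hol2 r (\<lambda>s t. f s t - g s t)"
  unfolding hol2_def case_prod_unfold by (auto intro!: continuous_intros holomorphic_intros)

lemma hol2_mult: "hol2 r f \<Longrightarrow> hol2 r g \<Longrightarrow> hol2 r (\<lambda>s t. f s t * g s t)"
  unfolding hol2_def case_prod_unfold by (auto intro!: continuous_intros holomorphic_intros)

lemma hol2_sum: "(\<And>i. i \<in> I \<Longrightarrow> hol2 r (f i)) \<Longrightarrow> hol2 r (\<lambda>s t. \<Sum>i\<in>I. f i s t)"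
  by (induction I rule: infinite_finite_induct) (auto intro: hol2_const hol2_add)

lemma hol2_prod: "(\<And>i. i \<in> I \<Longrightarrow> hol2 r (f i)) \<Longrightarrow> hol2 r (\<lambda>s t. \<Prod>i\<in>I. f i s t)"
  by (induction I rule: infinite_finite_induct) (auto intro: hol2_const hol2_mult)

lemma hol2_swap: "hol2 r f \<Longrightarrow> hol2 r (\<lambda>s t. f t s)"
proof -
  assume f: "hol2 r f"
  have "continuous_on (ball 0 r \<times> ball 0 r) ((\<lambda>(s, t). f s t) \<circ> (\<lambda>q. (snd q, fst q)))"
    by (rule continuous_on_compose)
       (auto intro!: continuous_intros continuous_on_subset[OF hol2D(1)[OF f]])
  then show ?thesis using f by (auto simp: hol2_def split_beta o_def)
qed

text \<open>Holomorphy in \<open>s\<close> is the point. It follows from Cauchy's formula for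
  \<open>deriv (f s) t\<close>, whose integrand is holomorphic in \<open>s\<close> for each point of
  a circle around \<open>t\<close>.\<close>

lemma hol2_deriv_snd:
  assumes f: "hol2 r f"
  shows "hol2 r (\<lambda>s t. deriv (f s) t)"
  unfolding hol2_def
proof (intro conjI ballI)
  show "continuous_on (ball 0 r \<times> ball 0 r) (\<lambda>(s, t). deriv (f s) t)"
    using hol2D[OF f] by (intro continuous_on_deriv_param) auto
  show "deriv (f s) holomorphic_on ball 0 r" if "s \<in> ball 0 r" for s
    using hol2D(2)[OF f that] by (intro holomorphic_deriv) auto
  fix t :: complex assume t: "t \<in> ball 0 r"
  then obtain e where e: "e > 0" "cball t e \<subseteq> ball 0 r"
    using open_contains_cball by (metis open_ball)
  let ?G = "\<lambda>s. contour_integral (circlepath t e) (\<lambda>w. f s w / (w - t)\<^sup>2)"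
  have sub: "sphere t e \<subseteq> ball 0 r" using e by auto
  have ne: "w \<noteq> t" if "w \<in> sphere t e" for w using that e by auto
  have "?G holomorphic_on ball 0 r"
  proof (rule holomorphic_circle_integral)
    show "continuous_on (ball 0 r \<times> sphere t e) (\<lambda>(s, w). f s w / (w - t)\<^sup>2)"
      using continuous_on_subset[OF hol2D(1)[OF f], of "ball 0 r \<times> sphere t e"] sub ne
      by (auto simp: split_beta intro!: continuous_intros)
    show "(\<lambda>s. f s w / (w - t)\<^sup>2) holomorphic_on ball 0 r" if "w \<in> sphere t e" for w
      using hol2D(3)[OF f, of w] that sub ne by (auto intro!: holomorphic_intros)
  qed (use e in auto)
  then have hol: "(\<lambda>s. ?G s / (2 * of_real pi * \<i>)) holomorphic_on ball 0 r"
    by (intro holomorphic_intros) auto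
  have eq: "?G s / (2 * of_real pi * \<i>) = deriv (f s) t" if "s \<in> ball 0 r" for s
  proof -
    have h: "f s holomorphic_on ball 0 r" using hol2D(2)[OF f that] .
    have "continuous_on (cball t e) (f s)" "f s holomorphic_on ball t e"
      using h e ball_subset_cball[of t e]
      by (meson holomorphic_on_imp_continuous_on holomorphic_on_subset order_trans)+
    from Cauchy_derivative_integral_circlepath(2)[OF this, of t] e
    show ?thesis by (simp add: DERIV_imp_deriv)
  qed
  show "(\<lambda>s. deriv (f s) t) holomorphic_on ball 0 r"
    by (rule holomorphic_transform[OF hol eq])
qed

text \<open>Both partial derivatives exist and the one in \<open>t\<close> is jointly continuous,
  which is enough for total differentiability. It leads from \<open>hol2\<close> back to
  \<open>holo_at\<close>.\<close>

lemma hol2_has_derivative: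
  assumes f: "hol2 r f" and a: "a \<in> ball 0 r" and b: "b \<in> ball 0 r"
  shows "((\<lambda>(s, t). f s t) has_derivative
     (\<lambda>(h, k). deriv (\<lambda>s. f s b) a * h + deriv (f a) b * k)) (at (a, b))"
proof -
  have c: "continuous_on (ball 0 r \<times> ball 0 r) (\<lambda>(s, t). deriv (f s) t)"
    using hol2D(1)[OF hol2_deriv_snd[OF f]] .
  have "((\<lambda>(s, t). f s t) has_derivative
     (\<lambda>(h, k). deriv (\<lambda>s. f s b) a * h + blinfun_apply (blinfun_mult_right (deriv (f a) b)) k))
     (at (a, b) within ball 0 r \<times> ball 0 r)"
  proof (rule has_derivative_partialsI)
    show "((\<lambda>s. f s b) has_derivative (*) (deriv (\<lambda>s. f s b) a)) (at a within ball 0 r)"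
      using holomorphic_derivI[OF hol2D(3)[OF f b] open_ball a]
      unfolding has_field_derivative_def by (rule has_derivative_at_withinI)
    show "(f s has_derivative blinfun_apply (blinfun_mult_right (deriv (f s) t))) (at t within ball 0 r)"
      if "s \<in> ball 0 r" "t \<in> ball 0 r" for s t
      using holomorphic_derivI[OF hol2D(2)[OF f that(1)] open_ball that(2)]
      unfolding has_field_derivative_def blinfun_mult_right.rep_eq by (rule has_derivative_at_withinI)
    have "continuous_on (ball 0 r \<times> ball 0 r) (\<lambda>(s, t). blinfun_mult_right (deriv (f s) t))"
      using bounded_linear.continuous_on[OF bounded_linear_blinfun_mult_right c]
      by (simp add: case_prod_unfold)
    then show "continuous (at (a, b) within ball 0 r \<times> ball 0 r) (\<lambda>(s, t). blinfun_mult_right (deriv (f s) t))"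
      using a b by (auto simp: continuous_on_eq_continuous_within)
  qed (use b in auto)
  moreover have "at (a, b) within ball 0 r \<times> ball 0 r = at (a, b)"
    using a b by (intro at_within_open) (auto intro: open_Times)
  ultimately show ?thesis by simp
qed

text \<open>\<open>holo_at\<close> hides the differential under an existential quantifier; naming it
  lets its values on tangent vectors be computed.\<close>

definition cdiff_at :: "(complex ^ 'n \<Rightarrow> complex) \<Rightarrow> (complex ^ 'n \<Rightarrow> complex) \<Rightarrow> complex ^ 'n \<Rightarrow> bool" where
  "cdiff_at f L a \<longleftrightarrow> (f has_derivative L) (at a) \<and> (\<forall>c v. L (c *s v) = c * L v)"

lemma holo_at_iff: "holo_at f a \<longleftrightarrow> (\<forall>\<^sub>F x in nhds a. \<exists>L. cdiff_at f L x)"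
  by (simp add: holo_at_def cdiff_at_def)

lemma bounded_linear_axis: "bounded_linear (\<lambda>z. axis i z :: complex ^ 'n)"
  by (rule linear_conv_bounded_linear[THEN iffD1], rule linearI)
     (auto simp: vec_eq_iff axis_def)

lemma cvec_eq_sum_axis: "(x :: complex ^ 'n) = (\<Sum>i\<in>UNIV. axis i (x $ i))"
  by (simp add: vec_eq_iff axis_def if_distrib cong: if_cong)

lemma has_derivative_cvec:
  fixes \<gamma> :: "complex \<Rightarrow> complex ^ 'n"
  assumes "\<And>i. ((\<lambda>z. \<gamma> z $ i) has_field_derivative c $ i) (at z0)"
  shows "(\<gamma> has_derivative (\<lambda>h. h *s c)) (at z0)"
proof -
  have "((\<lambda>z. \<Sum>i\<in>UNIV. axis i (\<gamma> z $ i)) has_derivative (\<lambda>h. \<Sum>i\<in>UNIV. axis i ((c $ i) * h))) (at z0)"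
    by (intro has_derivative_sum bounded_linear.has_derivative[OF bounded_linear_axis]
        assms[unfolded has_field_derivative_def])
  moreover have "(\<Sum>i\<in>UNIV. axis i ((c $ i) * h)) = h *s c" for h
    by (subst (2) cvec_eq_sum_axis) (simp add: mult.commute)
  ultimately show ?thesis by (simp add: cvec_eq_sum_axis[symmetric])
qed

lemma cdiff_at_chain:
  fixes \<gamma> :: "complex \<Rightarrow> complex ^ 'n"
  assumes f: "cdiff_at f L (\<gamma> z0)"
    and \<gamma>: "\<And>i. ((\<lambda>z. \<gamma> z $ i) has_field_derivative c $ i) (at z0)"
  shows "((\<lambda>z. f (\<gamma> z)) has_field_derivative L c) (at z0)"
proof -
  have "((\<lambda>z. f (\<gamma> z)) has_derivative (\<lambda>h. L (h *s c))) (at z0)"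
    using has_derivative_compose[OF has_derivative_cvec[of \<gamma> c, OF \<gamma>]] f
    unfolding cdiff_at_def by blast
  then show ?thesis
    using f unfolding has_field_derivative_def cdiff_at_def by (simp add: mult.commute[of _ "L c"])
qed

lemma cdiff_at_frechet: "cdiff_at f L a \<Longrightarrow> frechet_derivative f (at a) = L"
  unfolding cdiff_at_def by (metis frechet_derivative_at)

lemma cdiff_at_add: "cdiff_at f L a \<Longrightarrow> L (v + w) = L v + L w"
  unfolding cdiff_at_def by (metis has_derivative_bounded_linear linear_simps(1))

lemma cdiff_at_scale: "cdiff_at f L a \<Longrightarrow> L (c *s v) = c * L v"
  unfolding cdiff_at_def by blast

lemma holo_at_imp_continuous_on:
  assumes "holo_at f a"
  shows "\<exists>e>0. continuous_on (ball a e) f \<and> (\<forall>x\<in>ball a e. \<exists>L. cdiff_at f L x)"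
proof -
  obtain e where e: "e > 0" "\<And>x. dist x a < e \<Longrightarrow> \<exists>L. cdiff_at f L x"
    using assms unfolding holo_at_iff eventually_nhds_metric by blast
  then have "continuous_on (ball a e) f"
    unfolding cdiff_at_def
    by (metis continuous_at_imp_continuous_on has_derivative_continuous dist_commute mem_ball)
  with e show ?thesis by (metis dist_commute mem_ball)
qed

lemma holo_at_nearby: "holo_at f a \<Longrightarrow> \<forall>\<^sub>F x in nhds a. holo_at f x"
  unfolding holo_at_def by (rule eventually_eventually[THEN iffD2])

lemma continuous_on_vector_2:
  "continuous_on A f \<Longrightarrow> continuous_on A g \<Longrightarrow> continuous_on A (\<lambda>x. vector [f x, g x] :: complex ^ 2)"
proof -
  assume "continuous_on A f" "continuous_on A g"
  then have "continuous_on A (\<lambda>x. axis 1 (f x) + axis 2 (g x) :: complex ^ 2)"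
    by (intro continuous_on_add bounded_linear.continuous_on[OF bounded_linear_axis])
  moreover have "axis 1 (f x) + axis 2 (g x) = (vector [f x, g x] :: complex ^ 2)" for x
    by (simp add: vec_eq_iff forall_2 axis_def)
  ultimately show ?thesis by simp
qed

lemma vector_2_eta [simp]: "vector [x $ 1, x $ 2] = (x :: complex ^ 2)"
  by (simp add: vec_eq_iff forall_2)

lemma vector_2_0 [simp]: "vector [0, 0] = (0 :: complex ^ 2)"
  by (simp add: vec_eq_iff forall_2)

lemma norm_vector_2_le: "norm (vector [s, t] :: complex ^ 2) \<le> norm s + norm t"
  using L2_set_le_sum[of UNIV "\<lambda>i. norm ((vector [s, t] :: complex ^ 2) $ i)"]
  by (simp add: norm_vec_def sum_2)

lemma cdiff_at_line:
  assumes "cdiff_at f L x"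
  shows "((\<lambda>z. f (x + z *s v)) has_field_derivative L v) (at 0)"
proof -
  have "((\<lambda>z. x $ i + z * v $ i) has_field_derivative v $ i) (at 0)" for i
    by (auto intro!: derivative_eq_intros)
  with cdiff_at_chain[of f L "\<lambda>z. x + z *s v" 0 v] assms show ?thesis by simp
qed

lemma holo_at_imp_hol2:
  assumes "holo_at \<phi> (0 :: complex ^ 2)"
  obtains r where "r > 0" "hol2 r (\<lambda>s t. \<phi> (vector [s, t]))"
proof -
  obtain e where e: "e > 0" "continuous_on (ball 0 e) \<phi>" "\<And>x. x \<in> ball 0 e \<Longrightarrow> \<exists>L. cdiff_at \<phi> L x"
    using holo_at_imp_continuous_on[OF assms] by blast
  \<comment> \<open>Radius \<open>e / 2\<close> in each coordinate, since the norm of a pair is at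
    most the sum of the norms.\<close>
  have sub: "vector [s, t] \<in> ball (0 :: complex ^ 2) e" if "s \<in> ball 0 (e/2)" "t \<in> ball 0 (e/2)" for s t
    using norm_vector_2_le[of s t] that by auto
  have h: "hol2 (e/2) (\<lambda>s t. \<phi> (vector [s, t]))"
    unfolding hol2_def case_prod_unfold
  proof (intro conjI ballI)
    show "continuous_on (ball 0 (e/2) \<times> ball 0 (e/2)) (\<lambda>p. \<phi> (vector [fst p, snd p]))"
      by (rule continuous_on_compose2[OF e(2) continuous_on_vector_2])
         (use sub in \<open>auto intro!: continuous_on_fst continuous_on_snd continuous_on_id\<close>)
    fix s :: complex assume s: "s \<in> ball 0 (e/2)"
    show "(\<lambda>t. \<phi> (vector [s, t])) holomorphic_on ball 0 (e/2)"
      unfolding holomorphic_on_open[OF open_ball]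
    proof
      fix t :: complex assume "t \<in> ball 0 (e/2)"
      then obtain L where L: "cdiff_at \<phi> L (vector [s, t])" using e(3) sub s by blast
      have "((\<lambda>t. \<phi> (vector [s, t])) has_field_derivative L (vector [0, 1])) (at t)"
      proof (rule cdiff_at_chain[where \<gamma>="\<lambda>t. vector [s, t]", OF L])
        show "((\<lambda>z. vector [s, z] $ i) has_field_derivative vector [0, 1] $ i) (at t)" for i :: 2
          using exhaust_2[of i] by auto
      qed
      then show "\<exists>f'. ((\<lambda>t. \<phi> (vector [s, t])) has_field_derivative f') (at t)" by blast
    qed
  next
    fix t :: complex assume t: "t \<in> ball 0 (e/2)"
    show "(\<lambda>s. \<phi> (vector [s, t])) holomorphic_on ball 0 (e/2)"
      unfolding holomorphic_on_open[OF open_ball]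
    proof
      fix s :: complex assume "s \<in> ball 0 (e/2)"
      then obtain L where L: "cdiff_at \<phi> L (vector [s, t])" using e(3) sub t by blast
      have "((\<lambda>s. \<phi> (vector [s, t])) has_field_derivative L (vector [1, 0])) (at s)"
      proof (rule cdiff_at_chain[where \<gamma>="\<lambda>s. vector [s, t]", OF L])
        show "((\<lambda>z. vector [z, t] $ i) has_field_derivative vector [1, 0] $ i) (at s)" for i :: 2
          using exhaust_2[of i] by auto
      qed
      then show "\<exists>f'. ((\<lambda>s. \<phi> (vector [s, t])) has_field_derivative f') (at s)" by blast
    qed
  qed
  show thesis by (rule that[OF _ h]) (use e in simp)
qed

lemma hol2_cdiff_at:
  fixes a :: "complex ^ 2"
  assumes f: "hol2 r f" and a: "a $ 1 \<in> ball 0 r" "a $ 2 \<in> ball 0 r"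
  shows "cdiff_at (\<lambda>x. f (x $ 1) (x $ 2))
    (\<lambda>v. deriv (\<lambda>s. f s (a $ 2)) (a $ 1) * v $ 1 + deriv (f (a $ 1)) (a $ 2) * v $ 2) (a :: complex ^ 2)"
proof -
  have "((\<lambda>x :: complex ^ 2. (x $ 1, x $ 2)) has_derivative (\<lambda>x. (x $ 1, x $ 2))) (at a)"
    by (intro has_derivative_Pair bounded_linear.has_derivative[OF bounded_linear_vec_nth] has_derivative_ident)
  from has_derivative_compose[OF this hol2_has_derivative[OF f a]]
  have "((\<lambda>x. f (x $ 1) (x $ 2)) has_derivative
    (\<lambda>v. deriv (\<lambda>s. f s (a $ 2)) (a $ 1) * v $ 1 + deriv (f (a $ 1)) (a $ 2) * v $ 2)) (at a)"
    by simp
  then show ?thesis by (simp add: cdiff_at_def algebra_simps)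
qed

lemma hol2_imp_holo_at:
  fixes a :: "complex ^ 2"
  assumes f: "hol2 r f" and a: "a $ 1 \<in> ball 0 r" "a $ 2 \<in> ball 0 r"
  shows "holo_at (\<lambda>x. f (x $ 1) (x $ 2)) (a :: complex ^ 2)"
proof -
  have "open {x :: complex ^ 2. x $ 1 \<in> ball 0 r \<and> x $ 2 \<in> ball 0 r}"
    by (intro open_Collect_conj open_vimage[unfolded vimage_def]) (auto intro!: continuous_intros)
  from eventually_nhds_in_open[OF this] a
  have "\<forall>\<^sub>F x in nhds a. x $ 1 \<in> ball 0 r \<and> x $ 2 \<in> ball 0 r" by simp
  then show ?thesis
    unfolding holo_at_iff by eventually_elim (use hol2_cdiff_at[OF f] in blast)
qed

lemma holo_at_germ_hol2:
  assumes "r > 0" "hol2 r f" shows "holo_at (\<lambda>x. f (x $ 1) (x $ 2)) (0 :: complex ^ 2)"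
  using hol2_imp_holo_at[OF assms(2), of 0] assms(1) by simp

section \<open>Germs, their representatives and divisibility\<close>

lemma germ_eq_refl_iff [simp]: "germ_eq f f \<longleftrightarrow> holo_at f 0"
  by (simp add: germ_eq_def)

lemma germ_eq_iff:
  assumes "holo_at f 0" "holo_at g 0"
  shows "germ f = germ g \<longleftrightarrow> (\<forall>\<^sub>F x in nhds 0. f x = g x)"
  using Quotient_rel[OF Quotient_hgerm, of f g] assms by (auto simp: germ_eq_def)

lemma germ_cases: obtains f where "holo_at f 0" "u = germ f"
proof -
  have "germ_eq (rep_hgerm u) (rep_hgerm u)" "germ (rep_hgerm u) = u"
    by (rule Quotient_rep_reflp[OF Quotient_hgerm], rule Quotient_abs_rep[OF Quotient_hgerm])
  then show thesis using that by (metis germ_eq_refl_iff)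
qed

lemma rep_germ:
  assumes "holo_at f 0"
  shows "holo_at (rep_hgerm (germ f)) 0" "\<forall>\<^sub>F x in nhds 0. rep_hgerm (germ f) x = f x"
  using Quotient_rep_abs[OF Quotient_hgerm, of f] assms by (auto simp: germ_eq_def)

lemma germ_mult: "holo_at f 0 \<Longrightarrow> holo_at g 0 \<Longrightarrow> germ f * germ g = germ (\<lambda>x. f x * g x)"
  by (simp add: times_hgerm.abs_eq)

lemma germ_add: "holo_at f 0 \<Longrightarrow> holo_at g 0 \<Longrightarrow> germ f + germ g = germ (\<lambda>x. f x + g x)"
  by (simp add: plus_hgerm.abs_eq)

lemma germ_scale: "holo_at f 0 \<Longrightarrow> scale_hgerm c (germ f) = germ (\<lambda>x. c * f x)"
  by (simp add: scale_hgerm.abs_eq)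

lemma germ_one: "1 = germ (\<lambda>_. 1)"
  by (simp add: one_hgerm_def)

lemma germ_dvd_iff:
  assumes "holo_at a 0" "holo_at b 0"
  shows "germ a dvd germ b \<longleftrightarrow> (\<exists>q. holo_at q 0 \<and> (\<forall>\<^sub>F x in nhds 0. b x = a x * q x))"
proof
  assume "germ a dvd germ b"
  then obtain k where k: "germ b = germ a * k" by (elim dvdE)
  obtain q where q: "holo_at q 0" "k = germ q" by (rule germ_cases)
  from k q assms have "germ b = germ (\<lambda>x. a x * q x)" by (simp add: germ_mult)
  then have "\<forall>\<^sub>F x in nhds 0. b x = a x * q x"
    using germ_eq_iff holo_at_mult assms q by fast
  with q show "\<exists>q. holo_at q 0 \<and> (\<forall>\<^sub>F x in nhds 0. b x = a x * q x)" by blast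
next
  assume "\<exists>q. holo_at q 0 \<and> (\<forall>\<^sub>F x in nhds 0. b x = a x * q x)"
  then obtain q where q: "holo_at q 0" "\<forall>\<^sub>F x in nhds 0. b x = a x * q x" by blast
  then have "germ b = germ (\<lambda>x. a x * q x)"
    using germ_eq_iff holo_at_mult assms q by fast
  then show "germ a dvd germ b" using q assms by (simp add: germ_mult[symmetric])
qed

text \<open>Functions equal near \<open>a\<close> are equal near every point close to
  \<open>a\<close>, so they have the same differentials there.\<close>

lemma holo_at_cong:
  assumes "\<forall>\<^sub>F x in nhds a. f x = g x" "holo_at f a" shows "holo_at g a"
proof -
  have "\<forall>\<^sub>F x in nhds a. \<forall>\<^sub>F y in nhds x. f y = g y"
    using assms(1) by (subst eventually_eventually)
  then show ?thesis
    using assms(2) unfolding holo_at_def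
  proof eventually_elim
    case (elim x)
    then obtain L where L: "(f has_derivative L) (at x)" "\<forall>c v. L (c *s v) = c * L v" by blast
    have "(g has_derivative L) (at x)"
      by (rule has_derivative_transform_eventually[OF L(1)])
         (use elim(1) eventually_nhds_x_imp_x in \<open>auto simp: eventually_at_filter elim: eventually_mono\<close>)
    with L(2) show ?case by blast
  qed
qed

lemma holo_at_inverse:
  assumes "holo_at f a" "f a \<noteq> 0" shows "holo_at (\<lambda>x. inverse (f x)) a"
proof -
  obtain e where e: "e > 0" "continuous_on (ball a e) f"
    using holo_at_imp_continuous_on[OF assms(1)] by blast
  then have "isCont f a" using continuous_on_eq_continuous_at centre_in_ball open_ball by blast
  then have "\<forall>\<^sub>F x in nhds a. f x \<noteq> 0"
    using assms(2) by (auto simp: isCont_def tendsto_imp_eventually_ne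
        dest!: tendsto_imp_eventually_ne[of f "f a" "at a" 0] simp: eventually_at_filter elim: eventually_mono)
  with assms(1) show ?thesis unfolding holo_at_def
  proof eventually_elim
    case (elim x)
    then obtain L where L: "(f has_derivative L) (at x)" "\<forall>c v. L (c *s v) = c * L v" by blast
    have "((\<lambda>x. inverse (f x)) has_derivative (\<lambda>h. - (inverse (f x) * L h * inverse (f x)))) (at x)"
      by (rule Deriv.has_derivative_inverse[OF elim(2) L(1)])
    then show ?case using L(2) by (intro exI[of _ "\<lambda>h. - (inverse (f x) * L h * inverse (f x))"] conjI) auto
  qed
qed

text \<open>An inverse forces a nonzero value at 0; conversely the reciprocal of a function with
  nonzero value is holomorphic near 0. So the germs vanishing at 0 are exactly the nonunits.\<close>

lemma germ_unit_iff:
  assumes "holo_at f 0"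
  shows "germ f dvd 1 \<longleftrightarrow> f 0 \<noteq> 0"
proof
  assume "germ f dvd 1"
  then obtain q where "\<forall>\<^sub>F x in nhds 0. 1 = f x * q x"
    unfolding germ_one germ_dvd_iff[OF assms holo_at_const] by blast
  then show "f 0 \<noteq> 0" by (auto dest: eventually_nhds_x_imp_x)
next
  assume f: "f 0 \<noteq> 0"
  obtain e where e: "e > 0" "continuous_on (ball 0 e) f"
    using holo_at_imp_continuous_on[OF assms(1)] by blast
  then have "(f \<longlongrightarrow> f 0) (at 0)"
    using continuous_on_eq_continuous_at centre_in_ball open_ball isCont_def by blast
  from tendsto_imp_eventually_ne[OF this f]
  have "\<forall>\<^sub>F x in nhds 0. x \<noteq> 0 \<longrightarrow> f x \<noteq> 0" by (simp add: eventually_at_filter)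
  then have "\<forall>\<^sub>F x in nhds 0. 1 = f x * inverse (f x)"
    by (rule eventually_mono) (metis f right_inverse)
  then have "germ f dvd germ (\<lambda>_. 1)"
    unfolding germ_dvd_iff[OF assms holo_at_const] using holo_at_inverse[OF assms f] by blast
  then show "germ f dvd 1" by (simp only: germ_one)
qed

section \<open>Division with holomorphic parameters\<close>

text \<open>The singularity of \<open>f w / (w - a)\<close> at a zero \<open>a\<close> is removable
  (\<open>pole_lemma\<close>). The zeros form a set, so one division for each of them
  suffices.\<close>

lemma holomorphic_factor_roots:
  assumes "finite S" "S \<subseteq> ball 0 R" "f holomorphic_on ball 0 R" "\<And>z. z \<in> S \<Longrightarrow> f z = 0"
  shows "\<exists>q. q holomorphic_on ball 0 R \<and> (\<forall>w\<in>ball 0 R. f w = (\<Prod>z\<in>S. w - z) * q w)"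
  using assms
proof (induction S arbitrary: f rule: finite_induct)
  case empty
  then show ?case by auto
next
  case (insert a S)
  define h where "h = (\<lambda>z. if z = a then deriv f a else (f z - f a) / (z - a))"
  have h: "h holomorphic_on ball 0 R"
    unfolding h_def by (rule pole_lemma) (use insert.prems in auto)
  have fh: "f w = (w - a) * h w" for w
    using insert.prems(3)[of a] by (auto simp: h_def)
  have "h z = 0" if "z \<in> S" for z
    using fh[of z] insert.prems(3)[of z] insert.hyps that by auto
  from insert.IH[OF _ h this] insert.prems(1)
  obtain q where q: "q holomorphic_on ball 0 R" "\<forall>w\<in>ball 0 R. h w = (\<Prod>z\<in>S. w - z) * q w" by auto
  show ?case
    by (rule exI[of _ q]) (use q insert.hyps fh in \<open>auto simp: mult.assoc\<close>)
qed

text \<open>Serves twice: for the quotient in \<open>hol2_divide\<close> and for the descent from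
  \<theta> to \<open>\<theta> ^ n\<close>. The three conditions of \<open>hol2\<close> pass through
  the integral separately.\<close>

lemma hol2_circle_integral:
  assumes r: "r > 0"
    and K: "continuous_on ((ball 0 \<rho> \<times> ball 0 \<rho>) \<times> sphere 0 r) (\<lambda>(p, w). K (fst p) (snd p) w)"
    and K1: "\<And>t w. t \<in> ball 0 \<rho> \<Longrightarrow> w \<in> sphere 0 r \<Longrightarrow> (\<lambda>s. K s t w) holomorphic_on ball 0 \<rho>"
    and K2: "\<And>s w. s \<in> ball 0 \<rho> \<Longrightarrow> w \<in> sphere 0 r \<Longrightarrow> (\<lambda>t. K s t w) holomorphic_on ball 0 \<rho>"
  shows "hol2 \<rho> (\<lambda>s t. contour_integral (circlepath 0 r) (K s t))"
  unfolding hol2_def case_prod_unfold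
proof (intro conjI ballI)
  show "continuous_on (ball 0 \<rho> \<times> ball 0 \<rho>) (\<lambda>p. contour_integral (circlepath 0 r) (K (fst p) (snd p)))"
    by (rule continuous_on_circle_integral[OF K r])
  have K': "continuous_on ((ball 0 \<rho> \<times> ball 0 \<rho>) \<times> sphere 0 r) (\<lambda>q. K (fst (fst q)) (snd (fst q)) (snd q))"
    using K by (simp add: case_prod_unfold)
  show "(\<lambda>t. contour_integral (circlepath 0 r) (K s t)) holomorphic_on ball 0 \<rho>" if s: "s \<in> ball 0 \<rho>" for s
  proof (rule holomorphic_circle_integral[OF _ r open_ball K2[OF s]])
    show "continuous_on (ball 0 \<rho> \<times> sphere 0 r) (\<lambda>(t, w). K s t w)"
      unfolding case_prod_unfold
    proof (rule continuous_on_compose2[OF K', of "ball 0 \<rho> \<times> sphere 0 r" "\<lambda>q. ((s, fst q), snd q)", simplified fst_conv snd_conv])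
      show "continuous_on (ball 0 \<rho> \<times> sphere 0 r) (\<lambda>q. ((s, fst q), snd q))"
        by (intro continuous_on_Pair continuous_on_fst continuous_on_snd continuous_on_id continuous_on_const)
      show "(\<lambda>q. ((s, fst q), snd q)) ` (ball 0 \<rho> \<times> sphere 0 r) \<subseteq> (ball 0 \<rho> \<times> ball 0 \<rho>) \<times> sphere 0 r"
        using s by auto
    qed
  qed
  show "(\<lambda>s. contour_integral (circlepath 0 r) (K s t)) holomorphic_on ball 0 \<rho>" if t: "t \<in> ball 0 \<rho>" for t
  proof (rule holomorphic_circle_integral[OF _ r open_ball K1[OF t]])
    show "continuous_on (ball 0 \<rho> \<times> sphere 0 r) (\<lambda>(s, w). K s t w)"
      unfolding case_prod_unfold
    proof (rule continuous_on_compose2[OF K', of "ball 0 \<rho> \<times> sphere 0 r" "\<lambda>q. ((fst q, t), snd q)", simplified fst_conv snd_conv])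
      show "continuous_on (ball 0 \<rho> \<times> sphere 0 r) (\<lambda>q. ((fst q, t), snd q))"
        by (intro continuous_on_Pair continuous_on_fst continuous_on_snd continuous_on_id continuous_on_const)
      show "(\<lambda>q. ((fst q, t), snd q)) ` (ball 0 \<rho> \<times> sphere 0 r) \<subseteq> (ball 0 \<rho> \<times> ball 0 \<rho>) \<times> sphere 0 r"
        using t by auto
    qed
  qed
qed

lemma hol2_continuous_on_compose:
  assumes "hol2 R f" "continuous_on X a" "continuous_on X b"
    "\<And>x. x \<in> X \<Longrightarrow> a x \<in> ball 0 R \<and> b x \<in> ball 0 R"
  shows "continuous_on X (\<lambda>x. f (a x) (b x))"
proof -
  have "(\<lambda>x. (a x, b x)) ` X \<subseteq> ball 0 R \<times> ball 0 R" using assms(4) by blast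
  from continuous_on_compose2[OF hol2D(1)[OF assms(1)] continuous_on_Pair[OF assms(2,3)] this]
  show ?thesis by (simp only: prod.case)
qed

text \<open>The quotient at \<open>(s, t)\<close> is the Cauchy integral of
  \<open>B w t / A w t\<close> over the circle of radius \<open>r\<close>. This formula sees
  \<open>A\<close> only on the circle, where it has no zeros, and so it is holomorphic in
  \<open>t\<close> as well, however the zeros of \<open>A\<close> inside move and merge. The value
  \<open>t = 0\<close>, where they may collide, is left out of the hypothesis and recovered by
  continuity.\<close>

lemma hol2_divide:
  assumes A: "hol2 R A" and B: "hol2 R B" and r: "0 < r" "r < R" and \<delta>: "0 < \<delta>" "\<delta> \<le> R"
    and nz: "\<And>t w. t \<in> ball 0 \<delta> \<Longrightarrow> w \<in> sphere 0 r \<Longrightarrow> A w t \<noteq> 0"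
    and q: "\<And>t. t \<in> ball 0 \<delta> \<Longrightarrow> t \<noteq> 0 \<Longrightarrow> \<exists>q. q holomorphic_on ball 0 R \<and> (\<forall>w\<in>ball 0 R. B w t = A w t * q w)"
  shows "\<exists>\<rho>>0. \<exists>Q. hol2 \<rho> Q \<and> \<rho> \<le> R \<and> (\<forall>s\<in>ball 0 \<rho>. \<forall>t\<in>ball 0 \<rho>. B s t = A s t * Q s t)"
proof -
  \<comment> \<open>\<open>\<rho> \<le> r\<close> keeps \<open>s\<close> inside the circle,
    \<open>\<rho> \<le> \<delta>\<close> keeps \<open>A\<close> free of zeros on it.\<close>
  define \<rho> where "\<rho> = min r \<delta>"
  have \<rho>: "\<rho> > 0" "\<rho> \<le> r" "\<rho> \<le> \<delta>" "\<rho> \<le> R" "\<rho> < R" using r \<delta> by (auto simp: \<rho>_def)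
  define Q where "Q = (\<lambda>s t. contour_integral (circlepath 0 r) (\<lambda>w. B w t / (A w t * (w - s)) / (2 * of_real pi * \<i>)))"
  have Q: "hol2 \<rho> Q"
    unfolding Q_def
  proof (rule hol2_circle_integral[OF r(1)])
    have in1: "snd x \<in> ball 0 R \<and> snd (fst x) \<in> ball 0 R"
      and in2: "A (snd x) (snd (fst x)) * (snd x - fst (fst x)) \<noteq> 0"
      if "x \<in> (ball 0 \<rho> \<times> ball 0 \<rho>) \<times> sphere 0 r" for x
    proof -
      obtain s t w where x: "x = ((s, t), w)" by (metis surj_pair)
      with that have "norm s < \<rho>" "norm t < \<rho>" "norm w = r" by auto
      then show "snd x \<in> ball 0 R \<and> snd (fst x) \<in> ball 0 R"
        "A (snd x) (snd (fst x)) * (snd x - fst (fst x)) \<noteq> 0"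
        using nz[of t w] \<rho> r by (auto simp: x)
    qed
    show "continuous_on ((ball 0 \<rho> \<times> ball 0 \<rho>) \<times> sphere 0 r)
      (\<lambda>(p, w). B w (snd p) / (A w (snd p) * (w - fst p)) / (2 * of_real pi * \<i>))"
      unfolding case_prod_unfold
      by (intro continuous_on_divide continuous_on_mult continuous_on_diff continuous_on_const
            hol2_continuous_on_compose[OF A] hol2_continuous_on_compose[OF B]
            continuous_on_fst continuous_on_snd continuous_on_id ballI in1 in2) auto
    fix w :: complex assume w: "w \<in> sphere 0 r"
    then have w': "w \<in> ball 0 R" using r by auto
    show "(\<lambda>s. B w t / (A w t * (w - s)) / (2 * of_real pi * \<i>)) holomorphic_on ball 0 \<rho>" if "t \<in> ball 0 \<rho>" for t
    proof (intro holomorphic_intros)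
      fix s :: complex assume "s \<in> ball 0 \<rho>"
      then show "A w t * (w - s) \<noteq> 0" using nz[of t w] \<rho> w that by auto
    qed auto
    show "(\<lambda>t. B w t / (A w t * (w - s)) / (2 * of_real pi * \<i>)) holomorphic_on ball 0 \<rho>" if "s \<in> ball 0 \<rho>" for s
    proof -
      have "B w holomorphic_on ball 0 \<rho>" "A w holomorphic_on ball 0 \<rho>"
        by (rule holomorphic_on_subset[OF hol2D(2)[OF B w'] subset_ball[OF \<rho>(4)]]
                 holomorphic_on_subset[OF hol2D(2)[OF A w'] subset_ball[OF \<rho>(4)]])+
      moreover have "A w t * (w - s) \<noteq> 0" if "t \<in> ball 0 \<rho>" for t
        using nz[of t w] \<rho> w that \<open>s \<in> ball 0 \<rho>\<close> by auto
      ultimately show ?thesis by (intro holomorphic_intros) auto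
    qed
  qed
  have eq: "B s t = A s t * Q s t" if s: "s \<in> ball 0 \<rho>" and t: "t \<in> ball 0 \<rho>" "t \<noteq> 0" for s t
  proof -
    obtain q where q: "q holomorphic_on ball 0 R" "\<And>w. w \<in> ball 0 R \<Longrightarrow> B w t = A w t * q w"
      using q[of t] t \<rho> by force
    have qq: "q holomorphic_on ball 0 r" "continuous_on (cball 0 r) q"
      using q(1) r by (auto elim!: holomorphic_on_subset intro: holomorphic_on_imp_continuous_on)
    have "((\<lambda>w. q w / (w - s)) has_contour_integral 2 * of_real pi * \<i> * q s) (circlepath 0 r)"
      by (rule Cauchy_integral_circlepath) (use qq s \<rho> in auto)
    then have "((\<lambda>w. q w / (w - s) / (2 * of_real pi * \<i>)) has_contour_integral
        2 * of_real pi * \<i> * q s / (2 * of_real pi * \<i>)) (circlepath 0 r)"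
      by (rule has_contour_integral_div)
    then have "((\<lambda>w. q w / (w - s) / (2 * of_real pi * \<i>)) has_contour_integral q s) (circlepath 0 r)"
      by simp
    then have "((\<lambda>w. B w t / (A w t * (w - s)) / (2 * of_real pi * \<i>)) has_contour_integral q s) (circlepath 0 r)"
    proof (rule has_contour_integral_eq)
      fix w assume "w \<in> path_image (circlepath 0 r)"
      then have w: "w \<in> sphere 0 r" using r by simp
      then have "A w t \<noteq> 0" "w \<in> ball 0 R" using nz[of t w] t \<rho> r by auto
      then show "q w / (w - s) / (2 * of_real pi * \<i>) = B w t / (A w t * (w - s)) / (2 * of_real pi * \<i>)"
        using q(2)[of w] by simp
    qed
    then have "Q s t = q s" unfolding Q_def by (rule contour_integral_unique)
    then show ?thesis using q(2)[of s] s \<rho> by auto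
  qed
  \<comment> \<open>Both sides are continuous in \<open>t\<close> and agree off
    \<open>t = 0\<close>.\<close>
  have "B s t = A s t * Q s t" if s: "s \<in> ball 0 \<rho>" and t: "t \<in> ball 0 \<rho>" for s t
  proof (cases "t = 0")
    case True
    have h: "hol2 \<rho> (\<lambda>s t. B s t - A s t * Q s t)"
      by (intro hol2_diff hol2_mult Q hol2_mono[OF A] hol2_mono[OF B]) (use \<rho> in auto)
    have "isCont (\<lambda>t. B s t - A s t * Q s t) 0"
      using holomorphic_on_imp_continuous_on[OF hol2D(2)[OF h s]] \<rho>(1)
      by (simp add: continuous_on_eq_continuous_at)
    then have l1: "((\<lambda>t. B s t - A s t * Q s t) \<longlongrightarrow> B s 0 - A s 0 * Q s 0) (at 0)"
      unfolding isCont_def .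
    have "\<forall>\<^sub>F t in at 0. B s t - A s t * Q s t = 0"
      unfolding eventually_at using \<rho>(1) eq[OF s] by (intro exI[of _ \<rho>]) simp
    from tendsto_unique[OF at_neq_bot l1 tendsto_eventually[OF this]]
    have "B s 0 - A s 0 * Q s 0 = 0" .
    then show ?thesis using True by simp
  qed (use eq s t in auto)
  then show ?thesis using Q \<rho> by blast
qed

section \<open>Plane branches parametrized by \<open>\<theta> \<mapsto> (\<xi> \<theta>, \<theta>\<^sup>n)\<close>\<close>

abbreviation unity_roots :: "nat \<Rightarrow> complex set" where
  "unity_roots n \<equiv> {\<omega>. \<omega> ^ n = 1}"

text \<open>Multiplication by a primitive root \<open>\<zeta>\<close> permutes the summands and
  multiplies the sum by \<open>\<zeta> ^ k\<close>, which is not 1 for these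
  \<open>k\<close>.\<close>

lemma sum_powers_unity_roots:
  assumes "0 < k" "k < n"
  shows "(\<Sum>\<omega>\<in>unity_roots n. \<omega> ^ k) = 0"
proof -
  define \<zeta> where "\<zeta> = cis (2 * pi / n)"
  have \<zeta>n: "\<zeta> ^ n = 1" using assms by (simp add: \<zeta>_def Complex.DeMoivre)
  have \<zeta>: "\<zeta> ^ k \<noteq> 1"
  proof
    assume "\<zeta> ^ k = 1"
    then have eq: "cis (2 * pi * real k / real n) = cis (2 * pi * real 0 / real n)"
      by (simp add: \<zeta>_def Complex.DeMoivre mult.commute)
    have "inj_on (\<lambda>k. cis (2 * pi * real k / real n)) {..<n}"
      using Complex.bij_betw_roots_unity[of n] assms by (simp add: bij_betw_def)
    from inj_onD[OF this eq] assms show False by simp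
  qed
  have "\<zeta> \<noteq> 0" by (simp add: \<zeta>_def)
  have "(\<Sum>\<omega>\<in>unity_roots n. \<omega> ^ k) = (\<Sum>\<omega>\<in>unity_roots n. (\<zeta> * \<omega>) ^ k)"
    by (rule sum.reindex_bij_witness[of _ "\<lambda>\<omega>. \<zeta> * \<omega>" "\<lambda>\<omega>. \<omega> / \<zeta>"])
       (use \<zeta>n \<open>\<zeta> \<noteq> 0\<close> in \<open>auto simp: power_mult_distrib power_divide\<close>)
  also have "\<dots> = \<zeta> ^ k * (\<Sum>\<omega>\<in>unity_roots n. \<omega> ^ k)"
    by (simp add: power_mult_distrib sum_distrib_left)
  finally show ?thesis using \<zeta> by auto
qed

lemma finite_unity_roots: "n > 0 \<Longrightarrow> finite (unity_roots n)"
  using finite_roots_unity[of n] by simp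

text \<open>Both sides are the logarithmic derivative in \<open>w\<close> of
  \<open>w ^ n - \<theta> ^ n\<close>. Here each summand is expanded by the finite geometric series,
  and \<open>sum_powers_unity_roots\<close> leaves only the term with
  \<open>p = n - 1\<close>.\<close>

lemma sum_inverse_unity_roots:
  fixes w \<theta> :: complex
  assumes n: "n > 0" and w: "w ^ n \<noteq> \<theta> ^ n"
  shows "(\<Sum>\<omega>\<in>unity_roots n. 1 / (w - \<omega> * \<theta>)) = of_nat n * w ^ (n - 1) / (w ^ n - \<theta> ^ n)"
proof -
  obtain m where m: "n = Suc m" using n by (cases n) auto
  have "1 / (w - \<omega> * \<theta>) = (\<Sum>p<n. w ^ p * (\<omega> * \<theta>) ^ (m - p)) / (w ^ n - \<theta> ^ n)"
    if "\<omega> \<in> unity_roots n" for \<omega>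
  proof -
    have e: "(\<omega> * \<theta>) ^ n = \<theta> ^ n" using that by (simp add: power_mult_distrib)
    have eq: "w ^ n - \<theta> ^ n = (w - \<omega> * \<theta>) * (\<Sum>p<n. w ^ p * (\<omega> * \<theta>) ^ (m - p))"
      using diff_power_eq_sum[of w m "\<omega> * \<theta>"] unfolding m[symmetric] e .
    then have "w - \<omega> * \<theta> \<noteq> 0" using w by auto
    then show ?thesis using w eq by (simp add: field_simps)
  qed
  then have "(\<Sum>\<omega>\<in>unity_roots n. 1 / (w - \<omega> * \<theta>)) =
      (\<Sum>\<omega>\<in>unity_roots n. \<Sum>p<n. w ^ p * (\<omega> * \<theta>) ^ (m - p)) / (w ^ n - \<theta> ^ n)"
    by (simp add: sum_divide_distrib)
  also have "(\<Sum>\<omega>\<in>unity_roots n. \<Sum>p<n. w ^ p * (\<omega> * \<theta>) ^ (m - p)) =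
      (\<Sum>p<n. w ^ p * \<theta> ^ (m - p) * (\<Sum>\<omega>\<in>unity_roots n. \<omega> ^ (m - p)))"
    by (subst sum.swap) (simp add: sum_distrib_left power_mult_distrib mult_ac)
  also have "\<dots> = (\<Sum>p<n. if p = m then w ^ m * of_nat n else 0)"
  proof (rule sum.cong)
    fix p assume p: "p \<in> {..<n}"
    show "w ^ p * \<theta> ^ (m - p) * (\<Sum>\<omega>\<in>unity_roots n. \<omega> ^ (m - p)) = (if p = m then w ^ m * of_nat n else 0)"
    proof (cases "p = m")
      case True
      then show ?thesis using card_roots_unity_eq[OF n] by simp
    next
      case False
      then have "(\<Sum>\<omega>\<in>unity_roots n. \<omega> ^ (m - p)) = 0"
        using p m by (intro sum_powers_unity_roots) auto
      then show ?thesis using False by simp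
    qed
  qed simp
  also have "\<dots> = of_nat n * w ^ (n - 1)" using m by simp
  finally show ?thesis .
qed

lemma norm_unity_root:
  assumes "(\<omega> :: complex) ^ n = 1" "n > 0" shows "norm \<omega> = 1"
proof -
  have "norm (\<omega> ^ n) = 1 ^ n" unfolding assms(1) by simp
  then show ?thesis using assms(2) power_eq_iff_eq_base[of n "norm \<omega>" 1] by (simp add: norm_power)
qed

lemma unity_root_nonzero: "(\<omega> :: complex) ^ n = 1 \<Longrightarrow> n > 0 \<Longrightarrow> \<omega> \<noteq> 0"
  by (auto simp: power_0_left)

lemma norm_less_of_power:
  assumes "norm ((\<theta>::complex) ^ n) < r ^ n" "r > 0" shows "norm \<theta> < r"
  using assms power_less_imp_less_base[of "norm \<theta>" n r] by (simp add: norm_power)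

text \<open>A function of \<open>(s, \<theta>)\<close> that is invariant under the \<open>n\<close>-th roots of unity is a holomorphic
  function of \<open>(s, \<theta>\<^sup>n)\<close>: its Cauchy integral averages to one with kernel in \<open>\<theta>\<^sup>n\<close>.\<close>

lemma hol2_descend:
  assumes n: "n > 0" and R: "R > 0" and q: "hol2 R q"
    and inv: "\<And>s \<theta> \<omega>. \<theta> \<in> ball 0 R \<Longrightarrow> \<omega> ^ n = 1 \<Longrightarrow> q s (\<omega> * \<theta>) = q s \<theta>"
  shows "\<exists>\<rho>>0. \<rho> \<le> R \<and> (\<forall>\<theta> :: complex. \<theta> ^ n \<in> ball 0 \<rho> \<longrightarrow> \<theta> \<in> ball 0 R) \<and>
    (\<exists>X. hol2 \<rho> X \<and> (\<forall>s\<in>ball 0 \<rho>. \<forall>\<theta>. \<theta> ^ n \<in> ball 0 \<rho> \<longrightarrow> X s (\<theta> ^ n) = q s \<theta>))"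
proof -
  define r where "r = R / 2"
  \<comment> \<open>With \<open>\<rho> \<le> r ^ n\<close> every \<open>n\<close>-th root of a point
    of the disc lies inside the circle of integration.\<close>
  define \<rho> where "\<rho> = min R (r ^ n)"
  have r: "0 < r" "r < R" using R by (auto simp: r_def)
  have \<rho>: "0 < \<rho>" "\<rho> \<le> R" "\<rho> \<le> r ^ n" using r R by (auto simp: \<rho>_def)
  have root: "norm \<theta> < r" if "\<theta> ^ n \<in> ball 0 \<rho>" for \<theta> :: complex
    using norm_less_of_power[of \<theta> n r] that \<rho> r by auto
  have nz: "w ^ n \<noteq> t" if "w \<in> sphere 0 r" "t \<in> ball 0 \<rho>" for w t :: complex
    using that \<rho> by (auto simp: norm_power)
  \<comment> \<open>The average over \<omega> of the Cauchy kernels at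
    \<open>\<omega> * \<theta>\<close>, summed by \<open>sum_inverse_unity_roots\<close>; the factor
    \<open>n\<close> there cancels against the averaging.\<close>
  define X where "X = (\<lambda>s t. contour_integral (circlepath 0 r)
     (\<lambda>w. q s w * w ^ (n - 1) / (w ^ n - t) / (2 * of_real pi * \<i>)))"
  have hX: "hol2 \<rho> X"
    unfolding X_def
  proof (rule hol2_circle_integral[OF r(1)])
    have in1: "fst (fst x) \<in> ball 0 R \<and> snd x \<in> ball 0 R" and in2: "snd x ^ n - snd (fst x) \<noteq> 0"
      if "x \<in> (ball 0 \<rho> \<times> ball 0 \<rho>) \<times> sphere 0 r"
      for x :: "(complex \<times> complex) \<times> complex"
    proof -
      obtain s t w :: complex where x: "x = ((s, t), w)" by (metis surj_pair)
      with that have "norm s < \<rho>" "norm t < \<rho>" "norm w = r" by auto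
      then show "fst (fst x) \<in> ball 0 R \<and> snd x \<in> ball 0 R" "snd x ^ n - snd (fst x) \<noteq> 0"
        using nz[of w t] \<rho> r by (auto simp: x)
    qed
    show "continuous_on ((ball 0 \<rho> \<times> ball 0 \<rho>) \<times> sphere 0 r)
      (\<lambda>(p, w). q (fst p) w * w ^ (n - 1) / (w ^ n - snd p) / (2 * of_real pi * \<i>))"
      unfolding case_prod_unfold
      by (intro continuous_on_divide continuous_on_mult continuous_on_diff continuous_on_const
            hol2_continuous_on_compose[OF q] continuous_on_power
            continuous_on_fst continuous_on_snd continuous_on_id ballI in1 in2) auto
    fix w :: complex assume w: "w \<in> sphere 0 r"
    then have w': "w \<in> ball 0 R" using r by auto
    have "(\<lambda>s. q s w) holomorphic_on ball 0 \<rho>"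
      by (rule holomorphic_on_subset[OF hol2D(3)[OF q w'] subset_ball[OF \<rho>(2)]])
    then show "(\<lambda>s. q s w * w ^ (n - 1) / (w ^ n - t) / (2 * of_real pi * \<i>)) holomorphic_on ball 0 \<rho>"
      if "t \<in> ball 0 \<rho>" for t
      using nz[OF w that] by (intro holomorphic_intros) auto
    show "(\<lambda>t. q s w * w ^ (n - 1) / (w ^ n - t) / (2 * of_real pi * \<i>)) holomorphic_on ball 0 \<rho>"
      if "s \<in> ball 0 \<rho>" for s
      using nz[OF w] by (intro holomorphic_intros) auto
  qed
  have eqX: "X s (\<theta> ^ n) = q s \<theta>" if s: "s \<in> ball 0 \<rho>" and \<theta>: "\<theta> ^ n \<in> ball 0 \<rho>" for s \<theta>
  proof -
    have s': "s \<in> ball 0 R" using s \<rho> by auto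
    have qq: "q s holomorphic_on ball 0 r" "continuous_on (cball 0 r) (q s)"
      using hol2D(2)[OF q s'] r
      by (auto elim!: holomorphic_on_subset intro!: holomorphic_on_imp_continuous_on)
    have int: "((\<lambda>w. q s w / (w - \<omega> * \<theta>)) has_contour_integral 2 * of_real pi * \<i> * q s \<theta>) (circlepath 0 r)"
      if "\<omega> \<in> unity_roots n" for \<omega>
    proof -
      have 1: "norm (\<omega> * \<theta> - 0) < r"
        using norm_unity_root[of \<omega> n] that n root[OF \<theta>] by (simp add: norm_mult)
      have 2: "q s (\<omega> * \<theta>) = q s \<theta>" using inv[of \<theta> \<omega> s] that root[OF \<theta>] r by simp
      show ?thesis using Cauchy_integral_circlepath[OF qq(2,1) 1] unfolding 2 .
    qed
    have "((\<lambda>w. \<Sum>\<omega>\<in>unity_roots n. q s w / (w - \<omega> * \<theta>)) has_contour_integral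
        (\<Sum>\<omega>\<in>unity_roots n. 2 * of_real pi * \<i> * q s \<theta>)) (circlepath 0 r)"
      using int finite_unity_roots[OF n] by (intro has_contour_integral_sum)
    then have "((\<lambda>w. (\<Sum>\<omega>\<in>unity_roots n. q s w / (w - \<omega> * \<theta>)) / (of_nat n * (2 * of_real pi * \<i>))) has_contour_integral
        (\<Sum>\<omega>\<in>unity_roots n. 2 * of_real pi * \<i> * q s \<theta>) / (of_nat n * (2 * of_real pi * \<i>))) (circlepath 0 r)"
      by (rule has_contour_integral_div)
    moreover have "(\<Sum>\<omega>\<in>unity_roots n. 2 * of_real pi * \<i> * q s \<theta>) / (of_nat n * (2 * of_real pi * \<i>)) = q s \<theta>"
      using card_roots_unity_eq[OF n] n by simp
    ultimately have int2: "((\<lambda>w. (\<Sum>\<omega>\<in>unity_roots n. q s w / (w - \<omega> * \<theta>)) / (of_nat n * (2 * of_real pi * \<i>))) has_contour_integral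
        q s \<theta>) (circlepath 0 r)"
      by simp
    have "((\<lambda>w. q s w * w ^ (n - 1) / (w ^ n - \<theta> ^ n) / (2 * of_real pi * \<i>)) has_contour_integral q s \<theta>) (circlepath 0 r)"
    proof (rule has_contour_integral_eq[OF int2])
      fix w assume "w \<in> path_image (circlepath 0 r)"
      then have w: "w \<in> sphere 0 r" using r by simp
      have "(\<Sum>\<omega>\<in>unity_roots n. q s w / (w - \<omega> * \<theta>)) = q s w * (\<Sum>\<omega>\<in>unity_roots n. 1 / (w - \<omega> * \<theta>))"
        by (simp add: sum_distrib_left)
      also have "\<dots> = q s w * (of_nat n * w ^ (n - 1) / (w ^ n - \<theta> ^ n))"
        using sum_inverse_unity_roots[OF n nz[OF w \<theta>]] by simp
      finally have e: "(\<Sum>\<omega>\<in>unity_roots n. q s w / (w - \<omega> * \<theta>)) = q s w * (of_nat n * w ^ (n - 1) / (w ^ n - \<theta> ^ n))" .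
      show "(\<Sum>\<omega>\<in>unity_roots n. q s w / (w - \<omega> * \<theta>)) / (of_nat n * (2 * of_real pi * \<i>)) =
          q s w * w ^ (n - 1) / (w ^ n - \<theta> ^ n) / (2 * of_real pi * \<i>)"
        unfolding e using n by simp
    qed
    then show ?thesis unfolding X_def by (rule contour_integral_unique)
  qed
  have rb: "\<theta> \<in> ball 0 R" if "\<theta> ^ n \<in> ball 0 \<rho>" for \<theta> :: complex
    using root[OF that] r by simp
  show ?thesis
    by (intro exI[of _ \<rho>] conjI allI impI exI[of _ X] ballI \<rho>(1,2) hX) (erule rb, erule (1) eqX)
qed

text \<open>Points with equal second coordinate have parameters that differ by a root of unity, so
  \<open>inj\<close> says that the parametrization covers its image only once.\<close>

locale plane_branch =
  fixes n :: nat and \<xi> :: "complex \<Rightarrow> complex" and R :: real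
  assumes n: "n > 0" and R: "R > 0" and \<xi>: "\<xi> holomorphic_on ball 0 R" and \<xi>0: "\<xi> 0 = 0"
    and inj: "\<And>\<theta> \<omega>. \<theta> \<in> ball 0 R \<Longrightarrow> \<theta> \<noteq> 0 \<Longrightarrow> \<omega> ^ n = 1 \<Longrightarrow> \<xi> (\<omega> * \<theta>) = \<xi> \<theta> \<Longrightarrow> \<omega> = 1"
begin

lemma rot_in_ball: "\<theta> \<in> ball 0 R \<Longrightarrow> (\<omega> :: complex) ^ n = 1 \<Longrightarrow> \<omega> * \<theta> \<in> ball 0 R"
  using norm_unity_root[of \<omega> n] n by (simp add: norm_mult)

lemma \<xi>_rot: "\<omega> ^ n = 1 \<Longrightarrow> (\<lambda>\<theta>. \<xi> (\<omega> * \<theta>)) holomorphic_on ball 0 R"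
proof -
  assume \<omega>: "\<omega> ^ n = 1"
  have "(\<lambda>\<theta>. \<omega> * \<theta>) ` ball 0 R \<subseteq> ball 0 R"
    by (rule image_subsetI) (rule rot_in_ball[OF _ \<omega>])
  from holomorphic_on_compose_gen[OF _ \<xi> this]
  show ?thesis by (auto simp: o_def intro!: holomorphic_intros)
qed

lemma rot_inj: "\<theta> \<in> ball 0 R \<Longrightarrow> \<theta> \<noteq> 0 \<Longrightarrow> inj_on (\<lambda>\<omega>. \<xi> (\<omega> * \<theta>)) (unity_roots n)"
proof (rule inj_onI)
  fix \<omega> \<omega>' assume \<theta>: "\<theta> \<in> ball 0 R" "\<theta> \<noteq> 0" and \<omega>: "\<omega> \<in> unity_roots n" "\<omega>' \<in> unity_roots n"
    and eq: "\<xi> (\<omega> * \<theta>) = \<xi> (\<omega>' * \<theta>)"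
  have nz: "\<omega>' \<noteq> 0" using \<omega> n unity_root_nonzero by blast
  have "\<omega> / \<omega>' = 1"
  proof (rule inj[of "\<omega>' * \<theta>"])
    show "\<xi> (\<omega> / \<omega>' * (\<omega>' * \<theta>)) = \<xi> (\<omega>' * \<theta>)" using eq nz by simp
  qed (use \<theta> \<omega> nz rot_in_ball in \<open>auto simp: power_divide\<close>)
  then show "\<omega> = \<omega>'" using nz by simp
qed

text \<open>This product is the norm of \<open>s - \<xi> \<theta>\<close>, that is, the Weierstrass
  polynomial of the branch. Rotating \<theta> by a root of unity permutes the factors, so
  \<open>hol2_descend\<close> applies.\<close>

lemma equation_exists:
  "\<exists>\<rho>>0. \<rho> \<le> R \<and> (\<forall>\<theta> :: complex. \<theta> ^ n \<in> ball 0 \<rho> \<longrightarrow> \<theta> \<in> ball 0 R) \<and>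
    (\<exists>A. hol2 \<rho> A \<and> (\<forall>s\<in>ball 0 \<rho>. \<forall>\<theta>. \<theta> ^ n \<in> ball 0 \<rho> \<longrightarrow>
       A s (\<theta> ^ n) = (\<Prod>\<omega>\<in>unity_roots n. s - \<xi> (\<omega> * \<theta>))))"
proof (rule hol2_descend[OF n R])
  show "hol2 R (\<lambda>s \<theta>. \<Prod>\<omega>\<in>unity_roots n. s - \<xi> (\<omega> * \<theta>))"
    by (intro hol2_prod hol2_diff hol2_fst hol2_snd \<xi>_rot holomorphic_intros) auto
  fix s \<theta> \<omega>0 :: complex assume "\<omega>0 ^ n = 1"
  moreover from this have "\<omega>0 \<noteq> 0" using n unity_root_nonzero by blast
  ultimately show "(\<Prod>\<omega>\<in>unity_roots n. s - \<xi> (\<omega> * (\<omega>0 * \<theta>))) = (\<Prod>\<omega>\<in>unity_roots n. s - \<xi> (\<omega> * \<theta>))"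
    by (intro prod.reindex_bij_witness[of _ "\<lambda>\<omega>. \<omega> / \<omega>0" "\<lambda>\<omega>. \<omega> * \<omega>0"])
       (auto simp: power_mult_distrib power_divide mult_ac)
qed

end

lemma eventually_in_polydisc:
  assumes "\<rho> > 0"
  shows "\<forall>\<^sub>F x in nhds (0 :: complex ^ 2). x $ 1 \<in> ball 0 \<rho> \<and> x $ 2 \<in> ball 0 \<rho>"
proof -
  have "\<forall>\<^sub>F x in nhds (0 :: complex ^ 2). norm x < \<rho>"
    using assms by (auto simp: eventually_nhds_metric)
  then show ?thesis
    by eventually_elim (auto intro: le_less_trans[OF Finite_Cartesian_Product.norm_nth_le])
qed

lemma analytic_at_eventually:
  "f analytic_on {z} \<longleftrightarrow> (\<forall>\<^sub>F w in nhds z. f field_differentiable at w)"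
proof
  assume "f analytic_on {z}"
  then obtain S where S: "open S" "z \<in> S" "f holomorphic_on S" unfolding analytic_at by blast
  then show "\<forall>\<^sub>F w in nhds z. f field_differentiable at w"
    unfolding eventually_nhds using holomorphic_on_imp_differentiable_at by blast
next
  assume "\<forall>\<^sub>F w in nhds z. f field_differentiable at w"
  then obtain S where S: "open S" "z \<in> S" "\<forall>w\<in>S. f field_differentiable at w"
    unfolding eventually_nhds by blast
  then have "f holomorphic_on S"
    unfolding holomorphic_on_def by (blast intro: field_differentiable_at_within)
  with S show "f analytic_on {z}" unfolding analytic_at by blast
qed

lemma tendsto_cvec:
  fixes \<gamma> :: "'b \<Rightarrow> complex ^ 'n"
  assumes "\<And>i. ((\<lambda>\<theta>. \<gamma> \<theta> $ i) \<longlongrightarrow> a $ i) F"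
  shows "(\<gamma> \<longlongrightarrow> a) F"
  by (rule vec_tendstoI) (rule assms)

lemma isCont_tendsto_nhds:
  assumes "isCont f x" shows "(f \<longlongrightarrow> f x) (nhds x)"
proof (rule topological_tendstoI)
  fix S assume "open S" "f x \<in> S"
  moreover from this have "\<forall>\<^sub>F y in at x. f y \<in> S"
    using assms unfolding isCont_def by (rule topological_tendstoD[rotated])
  ultimately show "\<forall>\<^sub>F y in nhds x. f y \<in> S"
    unfolding eventually_at_filter by (auto elim: eventually_mono)
qed

text \<open>Analyticity at a point means differentiability at all points nearby, where the chain
  rule applies.\<close>

lemma holo_at_comp_analytic:
  fixes \<gamma> :: "complex \<Rightarrow> complex ^ 'n"
  assumes b: "holo_at b (\<gamma> z)" and \<gamma>: "\<And>i. (\<lambda>\<theta>. \<gamma> \<theta> $ i) analytic_on {z}"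
  shows "(\<lambda>\<theta>. b (\<gamma> \<theta>)) analytic_on {z}"
proof -
  have "isCont (\<lambda>\<theta>. \<gamma> \<theta> $ i) z" for i
    using \<gamma>[of i] analytic_at_imp_isCont by blast
  then have "filterlim \<gamma> (nhds (\<gamma> z)) (nhds z)"
    by (intro tendsto_cvec isCont_tendsto_nhds)
  from eventually_compose_filterlim[OF b[unfolded holo_at_iff] this]
  have 1: "\<forall>\<^sub>F \<theta> in nhds z. \<exists>L. cdiff_at b L (\<gamma> \<theta>)" .
  have 2: "\<forall>\<^sub>F \<theta> in nhds z. \<forall>i\<in>UNIV. (\<lambda>\<theta>. \<gamma> \<theta> $ i) field_differentiable at \<theta>"
    using \<gamma> by (intro eventually_ball_finite) (auto simp: analytic_at_eventually)
  show ?thesis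
    unfolding analytic_at_eventually using 1 2
  proof eventually_elim
    case (elim \<theta>)
    then obtain L where L: "cdiff_at b L (\<gamma> \<theta>)" by blast
    have "((\<lambda>\<theta>. \<gamma> \<theta> $ i) has_field_derivative (\<chi> i. deriv (\<lambda>\<theta>. \<gamma> \<theta> $ i) \<theta>) $ i) (at \<theta>)" for i
      using elim(2) by (simp add: field_differentiable_derivI)
    from cdiff_at_chain[OF L this] show ?case by (auto simp: field_differentiable_def)
  qed
qed

section \<open>The equation and the conductor of a branch\<close>

context plane_branch
begin

definition curve :: "complex \<Rightarrow> complex ^ 2" where "curve \<theta> = vector [\<xi> \<theta>, \<theta> ^ n]"

lemma curve_nth [simp]: "curve \<theta> $ 1 = \<xi> \<theta>" "curve \<theta> $ 2 = \<theta> ^ n"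
  by (simp_all add: curve_def)

lemma curve_0 [simp]: "curve 0 = 0"
  using n by (simp add: vec_eq_iff forall_2 \<xi>0)

lemma \<xi>_analytic: "\<xi> analytic_on {0}"
  unfolding analytic_at using \<xi> R by (intro exI[of _ "ball 0 R"]) simp

lemma curve_analytic: "(\<lambda>\<theta>. curve \<theta> $ i) analytic_on {0}"
  using exhaust_2[of i] \<xi>_analytic by (auto intro!: analytic_intros)

lemma curve_tendsto: "filterlim curve (nhds 0) (nhds 0)"
proof -
  have "((\<lambda>\<theta>. curve \<theta> $ i) \<longlongrightarrow> curve 0 $ i) (nhds 0)" for i
    using analytic_at_imp_isCont[OF curve_analytic[of i]] by (rule isCont_tendsto_nhds)
  then show ?thesis by (intro tendsto_cvec) simp
qed

lemma eventually_curve: "\<forall>\<^sub>F x in nhds 0. P x \<Longrightarrow> \<forall>\<^sub>F \<theta> in nhds 0. P (curve \<theta>)"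
  by (rule eventually_compose_filterlim[OF _ curve_tendsto])

text \<open>The ideal of the branch is principal. For small nonzero \<open>t = \<theta> ^ n\<close>
  the function \<open>a\<close> has the \<open>n\<close> distinct simple zeros
  \<open>\<xi> (\<omega> * \<theta>)\<close>, and a germ vanishing on the branch is zero at each of
  them. So the quotient exists for each such \<open>t\<close>, and \<open>hol2_divide\<close> makes
  it holomorphic in both variables.\<close>

lemma branch_equation:
  "\<exists>a. holo_at a 0 \<and> (\<forall>\<^sub>F s in nhds 0. a (vector [s, 0]) = s ^ n) \<and>
     (\<forall>\<^sub>F x in nhds 0. \<forall>\<theta>. x $ 2 = \<theta> ^ n \<longrightarrow> a x = (\<Prod>\<omega>\<in>unity_roots n. x $ 1 - \<xi> (\<omega> * \<theta>))) \<and>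
     (\<forall>b. holo_at b 0 \<longrightarrow> ((\<forall>\<^sub>F \<theta> in nhds 0. b (curve \<theta>) = 0) \<longleftrightarrow> germ a dvd germ b))"
proof -
  obtain \<rho> A where \<rho>: "\<rho> > 0" "\<rho> \<le> R" "\<And>\<theta> :: complex. \<theta> ^ n \<in> ball 0 \<rho> \<Longrightarrow> \<theta> \<in> ball 0 R" and A: "hol2 \<rho> A"
    and A_eq: "\<And>s \<theta>. s \<in> ball 0 \<rho> \<Longrightarrow> \<theta> ^ n \<in> ball 0 \<rho> \<Longrightarrow>
       A s (\<theta> ^ n) = (\<Prod>\<omega>\<in>unity_roots n. s - \<xi> (\<omega> * \<theta>))"
    using equation_exists by blast
  define a where "a = (\<lambda>x :: complex ^ 2. A (x $ 1) (x $ 2))"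
  have a: "holo_at a 0" unfolding a_def by (rule holo_at_germ_hol2[OF \<rho>(1) A])
  have "\<forall>\<^sub>F s in nhds 0. s \<in> ball (0::complex) \<rho>"
    using \<rho>(1) by (intro eventually_nhds_in_open) auto
  \<comment> \<open>On \<open>t = 0\<close> all \<open>n\<close> factors of the product equal
    \<open>s\<close>.\<close>
  then have a0: "\<forall>\<^sub>F s in nhds 0. a (vector [s, 0]) = s ^ n"
  proof eventually_elim
    case (elim s)
    then show ?case using A_eq[of s 0] \<rho>(1) n card_roots_unity_eq[OF n] by (simp add: a_def \<xi>0 power_0_left)
  qed
  have prod: "\<forall>\<^sub>F x in nhds 0. \<forall>\<theta>. x $ 2 = \<theta> ^ n \<longrightarrow>
      a x = (\<Prod>\<omega>\<in>unity_roots n. x $ 1 - \<xi> (\<omega> * \<theta>))"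
    using eventually_in_polydisc[OF \<rho>(1)]
  proof eventually_elim
    case (elim x)
    then show ?case using A_eq[of "x $ 1"] by (auto simp: a_def)
  qed
  have van: "\<forall>\<^sub>F \<theta> in nhds 0. a (curve \<theta>) = 0"
    using eventually_curve[OF eventually_in_polydisc[OF \<rho>(1)]]
  proof eventually_elim
    case (elim \<theta>)
    have "(\<Prod>\<omega>\<in>unity_roots n. \<xi> \<theta> - \<xi> (\<omega> * \<theta>)) = 0"
      using finite_unity_roots[OF n] by (intro prod_zero bexI[of _ 1]) auto
    then show ?case using A_eq[of "\<xi> \<theta>" \<theta>] elim by (simp add: a_def)
  qed
  have "germ a dvd germ b" if b: "holo_at b 0" and b0: "\<forall>\<^sub>F \<theta> in nhds 0. b (curve \<theta>) = 0" for b
  proof -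
    obtain r0 where r0: "r0 > 0" "hol2 r0 (\<lambda>s t. b (vector [s, t]))" using holo_at_imp_hol2[OF b] .
    define R1 where "R1 = min \<rho> r0"
    have R1: "R1 > 0" "R1 \<le> \<rho>" "R1 \<le> r0" using r0 \<rho> by (auto simp: R1_def)
    define B where "B = (\<lambda>s t. b (vector [s, t]))"
    have B: "hol2 R1 B" unfolding B_def by (rule hol2_mono[OF r0(2) R1(3)])
    have A1: "hol2 R1 A" by (rule hol2_mono[OF A R1(2)])
    define r where "r = R1 / 2"
    have r: "0 < r" "r < R1" using R1 by (auto simp: r_def)
    have "\<forall>\<^sub>F \<theta> in nhds 0. b (curve \<theta>) = 0 \<and> norm (\<xi> \<theta>) < r"
      using b0 eventually_curve[OF eventually_in_polydisc[OF r(1)]]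
      by eventually_elim simp
    then obtain \<eta> where \<eta>: "\<eta> > 0" "\<And>\<theta>. norm \<theta> < \<eta> \<Longrightarrow> b (curve \<theta>) = 0 \<and> norm (\<xi> \<theta>) < r"
      unfolding eventually_nhds_metric by auto
    \<comment> \<open>\<open>\<delta> \<le> \<eta> ^ n\<close> puts all \<open>n\<close>-th roots of
      \<open>t\<close> into the disc where \<open>b\<close> vanishes along the curve and \<xi> stays
      inside the circle of radius \<open>r\<close>.\<close>
    define \<delta> where "\<delta> = min R1 (\<eta> ^ n)"
    have \<delta>: "0 < \<delta>" "\<delta> \<le> R1" "\<delta> \<le> \<eta> ^ n" using R1 \<eta> by (auto simp: \<delta>_def)
    have root: "\<exists>\<theta>. t = \<theta> ^ n" for t :: complex
      using exists_complex_root[of n t] n by (metis less_not_refl)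
    have small: "norm (\<omega> * \<theta>) < \<eta>" "(\<omega> * \<theta>) ^ n = \<theta> ^ n"
      if "\<theta> ^ n \<in> ball 0 \<delta>" "\<omega> \<in> unity_roots n" for \<omega> \<theta>
      using norm_less_of_power[of \<theta> n \<eta>] that \<delta> \<eta> norm_unity_root[of \<omega> n] n
      by (auto simp: norm_mult power_mult_distrib)
    have "\<exists>\<rho>'>0. \<exists>Q. hol2 \<rho>' Q \<and> \<rho>' \<le> R1 \<and> (\<forall>s\<in>ball 0 \<rho>'. \<forall>t\<in>ball 0 \<rho>'. B s t = A s t * Q s t)"
    proof (rule hol2_divide[OF A1 B r \<delta>(1,2)])
      fix t w :: complex assume t: "t \<in> ball 0 \<delta>" and w: "w \<in> sphere 0 r"
      obtain \<theta> where \<theta>: "t = \<theta> ^ n" using root by blast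
      have "w - \<xi> (\<omega> * \<theta>) \<noteq> 0" if "\<omega> \<in> unity_roots n" for \<omega>
        using small[of \<theta> \<omega>] \<eta>(2)[of "\<omega> * \<theta>"] that t w \<theta> by auto
      then have "(\<Prod>\<omega>\<in>unity_roots n. w - \<xi> (\<omega> * \<theta>)) \<noteq> 0"
        using finite_unity_roots[OF n] by simp
      then show "A w t \<noteq> 0"
        using A_eq[of w \<theta>] t w r R1 \<delta> by (simp add: \<theta>)
    next
      fix t :: complex assume t: "t \<in> ball 0 \<delta>" "t \<noteq> 0"
      obtain \<theta> where \<theta>: "t = \<theta> ^ n" using root by blast
      with t n have \<theta>0: "\<theta> \<noteq> 0" by auto
      have \<theta>R: "\<theta> \<in> ball 0 R" using \<rho>(3)[of \<theta>] t \<delta> R1 \<theta> by auto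
      define S where "S = (\<lambda>\<omega>. \<xi> (\<omega> * \<theta>)) ` unity_roots n"
      have "\<exists>q. q holomorphic_on ball 0 R1 \<and> (\<forall>w\<in>ball 0 R1. B w t = (\<Prod>z\<in>S. w - z) * q w)"
      proof (rule holomorphic_factor_roots)
        show "finite S" unfolding S_def using finite_unity_roots[OF n] by simp
        have "norm (\<xi> (\<omega> * \<theta>)) < R1" if "\<omega> \<in> unity_roots n" for \<omega>
          using small[of \<theta> \<omega>] \<eta>(2)[of "\<omega> * \<theta>"] that t \<theta> r by simp
        then show "S \<subseteq> ball 0 R1" by (auto simp: S_def)
        show "(\<lambda>w. B w t) holomorphic_on ball 0 R1"
          by (rule hol2D(3)[OF B]) (use t \<delta> in auto)
        show "B z t = 0" if "z \<in> S" for z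
        proof -
          obtain \<omega> where \<omega>: "\<omega> \<in> unity_roots n" "z = \<xi> (\<omega> * \<theta>)" using \<open>z \<in> S\<close> by (auto simp: S_def)
          then show ?thesis
            using small[of \<theta> \<omega>] \<eta>(2)[of "\<omega> * \<theta>"] t \<theta> by (simp add: B_def curve_def)
        qed
      qed
      then obtain q where q: "q holomorphic_on ball 0 R1" "\<And>w. w \<in> ball 0 R1 \<Longrightarrow> B w t = (\<Prod>z\<in>S. w - z) * q w"
        by blast
      have "(\<Prod>z\<in>S. w - z) = A w t" if "w \<in> ball 0 R1" for w
      proof -
        have "(\<Prod>z\<in>S. w - z) = (\<Prod>\<omega>\<in>unity_roots n. w - \<xi> (\<omega> * \<theta>))"
          unfolding S_def using prod.reindex[OF rot_inj[OF \<theta>R \<theta>0]] by simp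
        also have "\<dots> = A w t"
          using A_eq[of w \<theta>] that R1 t \<theta> \<delta> by auto
        finally show ?thesis .
      qed
      with q show "\<exists>q. q holomorphic_on ball 0 R1 \<and> (\<forall>w\<in>ball 0 R1. B w t = A w t * q w)"
        by (intro exI[of _ q]) simp
    qed
    then obtain \<rho>' Q where Q: "\<rho>' > 0" "hol2 \<rho>' Q" "\<And>s t. s \<in> ball 0 \<rho>' \<Longrightarrow> t \<in> ball 0 \<rho>' \<Longrightarrow> B s t = A s t * Q s t"
      by blast
    have "\<forall>\<^sub>F x in nhds 0. b x = a x * Q (x $ 1) (x $ 2)"
      using eventually_in_polydisc[OF Q(1)]
    proof eventually_elim
      case (elim x)
      then show ?case using Q(3)[of "x $ 1" "x $ 2"] by (simp add: B_def a_def)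
    qed
    then show "germ a dvd germ b"
      unfolding germ_dvd_iff[OF a b] using holo_at_germ_hol2[OF Q(1,2)] by blast
  qed
  moreover have "\<forall>\<^sub>F \<theta> in nhds 0. b (curve \<theta>) = 0" if b: "holo_at b 0" and dvd: "germ a dvd germ b" for b
  proof -
    obtain q where "\<forall>\<^sub>F x in nhds 0. b x = a x * q x" using dvd germ_dvd_iff[OF a b] by blast
    from eventually_curve[OF this] van show ?thesis by eventually_elim simp
  qed
  ultimately show ?thesis using a a0 prod by blast
qed

text \<open>Lagrange interpolation at the conjugates \<open>\<xi> (\<omega> * \<theta>)\<close>. The
  function \<open>\<delta>\<close> is the derivative of the branch equation in \<open>s\<close>,
  restricted to the curve. For any \<phi>, the product of \<open>\<delta>\<close> and \<phi> is the
  value on the curve of a polynomial in \<open>s\<close> that is symmetric under the roots of unity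
  and therefore descends to a germ on the plane. So every convergent multiple of \<Delta> is a
  pullback.\<close>

lemma conductor:
  "\<exists>\<Delta>. \<Delta> \<noteq> 0 \<and> (\<forall>\<phi> F. \<phi> has_fps_expansion F \<longrightarrow>
     (\<exists>b. holo_at b 0 \<and> (\<lambda>\<theta>. b (curve \<theta>)) has_fps_expansion \<Delta> * F))"
proof -
  define \<delta> where "\<delta> = (\<lambda>\<theta>. \<Prod>\<omega>\<in>unity_roots n - {1}. \<xi> \<theta> - \<xi> (\<omega> * \<theta>))"
  have "\<delta> holomorphic_on ball 0 R"
    unfolding \<delta>_def by (intro holomorphic_intros \<xi> \<xi>_rot) auto
  then have \<delta>: "\<delta> has_fps_expansion fps_expansion \<delta> 0"
    using R by (intro analytic_at_imp_has_fps_expansion_0) (auto simp: analytic_at intro!: exI[of _ "ball 0 R"])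
  have \<delta>0: "\<delta> \<theta> \<noteq> 0" if "\<theta> \<in> ball 0 R" "\<theta> \<noteq> 0" for \<theta>
    using inj[OF that] finite_unity_roots[OF n] by (auto simp: \<delta>_def)
  have "fps_expansion \<delta> 0 \<noteq> 0"
  proof
    assume "fps_expansion \<delta> 0 = 0"
    with \<delta> have "\<delta> has_fps_expansion 0" by simp
    then have "\<forall>\<^sub>F \<theta> in nhds 0. \<delta> \<theta> = 0" by (simp add: has_fps_expansion_0_iff)
    then have "\<forall>\<^sub>F \<theta> in at 0. \<delta> \<theta> = 0" by (simp add: eventually_nhds_conv_at)
    moreover have "\<forall>\<^sub>F \<theta> in at (0::complex). \<theta> \<in> ball 0 R - {0}"
      using R by (intro eventually_at_in_open) auto
    ultimately have "\<forall>\<^sub>F \<theta> in at (0::complex). False"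
      by eventually_elim (use \<delta>0 in auto)
    then show False by simp
  qed
  moreover have "\<exists>b. holo_at b 0 \<and> (\<lambda>\<theta>. b (curve \<theta>)) has_fps_expansion fps_expansion \<delta> 0 * F"
    if \<phi>: "\<phi> has_fps_expansion F" for \<phi> F
  proof -
    obtain S where S: "open S" "0 \<in> S" "\<phi> holomorphic_on S"
      using has_fps_expansion_imp_holomorphic[OF \<phi>] by metis
    then obtain e where e: "e > 0" "ball 0 e \<subseteq> S" using open_contains_ball by blast
    define R2 where "R2 = min e R"
    have R2: "R2 > 0" "R2 \<le> R" "ball 0 R2 \<subseteq> S" using e R by (auto simp: R2_def)
    \<comment> \<open>The interpolation numerator: at \<open>s = \<xi> \<theta>\<close> every term
      but that of \<open>\<omega> = 1\<close> contains the vanishing factor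
      \<open>s - \<xi> \<theta>\<close>.\<close>
    define q where "q = (\<lambda>s \<theta>. \<Sum>\<omega>\<in>unity_roots n. \<phi> (\<omega> * \<theta>) * (\<Prod>\<omega>'\<in>unity_roots n - {\<omega>}. s - \<xi> (\<omega>' * \<theta>)))"
    have \<phi>rot: "(\<lambda>\<theta>. \<phi> (\<omega> * \<theta>)) holomorphic_on ball 0 R2" if "\<omega> \<in> unity_roots n" for \<omega>
    proof -
      have "(\<lambda>\<theta>. \<omega> * \<theta>) ` ball 0 R2 \<subseteq> S"
        using R2(3) norm_unity_root[of \<omega> n] that n by (auto simp: norm_mult image_subset_iff subset_iff)
      then show ?thesis
        using holomorphic_on_compose_gen[OF _ S(3), of "\<lambda>\<theta>. \<omega> * \<theta>" "ball 0 R2"]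
        by (auto simp: o_def intro!: holomorphic_intros)
    qed
    have "hol2 R2 q"
      unfolding q_def
      by (intro hol2_sum hol2_mult hol2_prod hol2_diff hol2_fst hol2_snd \<phi>rot holomorphic_intros
          holomorphic_on_subset[OF \<xi>_rot subset_ball[OF R2(2)]]) auto
    moreover have "q s (\<omega>0 * \<theta>) = q s \<theta>" if \<omega>0: "\<omega>0 ^ n = 1" for s \<theta> \<omega>0
    proof -
      have nz: "\<omega>0 \<noteq> 0" using \<omega>0 n unity_root_nonzero by blast
      have "(\<Prod>\<omega>'\<in>unity_roots n - {\<omega>}. s - \<xi> (\<omega>' * (\<omega>0 * \<theta>))) =
          (\<Prod>\<omega>'\<in>unity_roots n - {\<omega> * \<omega>0}. s - \<xi> (\<omega>' * \<theta>))" for \<omega>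
        by (rule prod.reindex_bij_witness[of _ "\<lambda>\<omega>. \<omega> / \<omega>0" "\<lambda>\<omega>. \<omega> * \<omega>0"])
           (use \<omega>0 nz in \<open>auto simp: power_mult_distrib power_divide mult_ac\<close>)
      then have "q s (\<omega>0 * \<theta>) = (\<Sum>\<omega>\<in>unity_roots n. \<phi> (\<omega> * \<omega>0 * \<theta>) * (\<Prod>\<omega>'\<in>unity_roots n - {\<omega> * \<omega>0}. s - \<xi> (\<omega>' * \<theta>)))"
        by (simp add: q_def mult_ac)
      also have "\<dots> = q s \<theta>"
        unfolding q_def
        by (rule sum.reindex_bij_witness[of _ "\<lambda>\<omega>. \<omega> / \<omega>0" "\<lambda>\<omega>. \<omega> * \<omega>0"])
           (use \<omega>0 nz in \<open>auto simp: power_mult_distrib power_divide\<close>)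
      finally show ?thesis .
    qed
    ultimately obtain \<rho> X where \<rho>: "\<rho> > 0" and X: "hol2 \<rho> X"
      and X_eq: "\<And>s \<theta>. s \<in> ball 0 \<rho> \<Longrightarrow> \<theta> ^ n \<in> ball 0 \<rho> \<Longrightarrow> X s (\<theta> ^ n) = q s \<theta>"
      using hol2_descend[OF n R2(1), of q] by blast
    have "\<forall>\<^sub>F \<theta> in nhds 0. \<delta> \<theta> * \<phi> \<theta> = X (curve \<theta> $ 1) (curve \<theta> $ 2)"
      using eventually_curve[OF eventually_in_polydisc[OF \<rho>]]
    proof eventually_elim
      case (elim \<theta>)
      have "q (\<xi> \<theta>) \<theta> = (\<Sum>\<omega>\<in>unity_roots n. if \<omega> = 1 then \<delta> \<theta> * \<phi> \<theta> else 0)"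
        unfolding q_def
      proof (rule sum.cong)
        fix \<omega> assume "\<omega> \<in> unity_roots n"
        show "\<phi> (\<omega> * \<theta>) * (\<Prod>\<omega>'\<in>unity_roots n - {\<omega>}. \<xi> \<theta> - \<xi> (\<omega>' * \<theta>)) = (if \<omega> = 1 then \<delta> \<theta> * \<phi> \<theta> else 0)"
        proof (cases "\<omega> = 1")
          case True
          then show ?thesis by (simp add: \<delta>_def)
        next
          case False
          then have "(\<Prod>\<omega>'\<in>unity_roots n - {\<omega>}. \<xi> \<theta> - \<xi> (\<omega>' * \<theta>)) = 0"
            using finite_unity_roots[OF n] by (intro prod_zero bexI[of _ 1]) auto
          then show ?thesis using False by simp
        qed
      qed simp
      also have "\<dots> = \<delta> \<theta> * \<phi> \<theta>" using finite_unity_roots[OF n] by (simp add: sum.delta)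
      finally show ?case using X_eq[of "\<xi> \<theta>" \<theta>] elim by simp
    qed
    from has_fps_expansion_cong[OF this refl] has_fps_expansion_mult[OF \<delta> \<phi>]
    have "(\<lambda>\<theta>. X (curve \<theta> $ 1) (curve \<theta> $ 2)) has_fps_expansion fps_expansion \<delta> 0 * F"
      by simp
    then show ?thesis
      using holo_at_germ_hol2[OF \<rho> X] by (intro exI[of _ "\<lambda>x :: complex ^ 2. X (x $ 1) (x $ 2)"]) simp
  qed
  ultimately show ?thesis by blast
qed

end

section \<open>Codimension of an ideal by counting orders\<close>

interpretation hgerm_pair: vector_space_pair scale_hgerm scale_hgerm ..

text \<open>The size of \<open>B\<close> has to be compared with that of any other finite
  \<open>B'\<close>. A linear projection \<open>q\<close> with kernel \<open>I\<close> stands in for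
  the quotient map: it keeps \<open>B\<close> independent, while the image of \<open>B'\<close>
  spans the image of \<open>q\<close>, so the usual exchange bound applies.\<close>

lemma codim_hgerm_eqI:
  assumes I: "hgerm.subspace I" and B: "finite B"
    and indep: "\<And>c. (\<Sum>b\<in>B. scale_hgerm (c b) b) \<in> I \<Longrightarrow> \<forall>b\<in>B. c b = 0"
    and span: "hgerm.span (I \<union> B) = UNIV"
  shows "codim_hgerm I = card B"
proof -
  obtain K where K: "K \<subseteq> I" "hgerm.independent K" "I \<subseteq> hgerm.span K"
    using hgerm.maximal_independent_subset by blast
  \<comment> \<open>A basis of \<open>I\<close> is extended to a basis of the ring; \<open>q\<close>
    kills the former and fixes the added elements.\<close>
  obtain E where E: "K \<subseteq> E" "E \<subseteq> UNIV" "hgerm.independent E" "UNIV \<subseteq> hgerm.span E"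
    using hgerm.maximal_independent_subset_extend[of K UNIV] K(2) by blast
  obtain q where q: "Vector_Spaces.linear scale_hgerm scale_hgerm q" "\<forall>x\<in>E. q x = (if x \<in> K then 0 else x)"
    using hgerm_pair.linear_independent_extend[OF E(3), of "\<lambda>x. if x \<in> K then 0 else x"] by blast
  interpret q: Vector_Spaces.linear scale_hgerm scale_hgerm q by (rule q(1))
  have qI: "q x = 0" if "x \<in> I" for x
  proof -
    have "x \<in> hgerm.span K" using that K(3) by blast
    moreover have "q b = 0" if "b \<in> K" for b using that q(2) E(1) by auto
    ultimately show ?thesis using q.eq_0_on_span by blast
  qed
  have sub: "x - q x \<in> I" for x
  proof -
    have "x \<in> hgerm.span E" using E(4) by blast
    then show ?thesis
    proof (induction rule: hgerm.span_induct)
      case base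
      show ?case
        unfolding hgerm.subspace_def
      proof (intro conjI ballI allI CollectI; (elim CollectE)?)
        show "0 - q 0 \<in> I" using hgerm.subspace_0[OF I] by (simp add: q.zero)
        show "x + y - q (x + y) \<in> I" if "x - q x \<in> I" "y - q y \<in> I" for x y
          using hgerm.subspace_add[OF I that] by (simp add: q.add algebra_simps)
        show "scale_hgerm c x - q (scale_hgerm c x) \<in> I" if "x - q x \<in> I" for c x
          using hgerm.subspace_scale[OF I that, of c] by (simp add: q.scale hgerm.scale_right_diff_distrib)
      qed
    next
      case (step x)
      then show ?case using q(2) K(1) hgerm.subspace_0[OF I] by auto
    qed
  qed
  have ker: "x \<in> I" if "q x = 0" for x using sub[of x] that by simp
  have lower: "card B \<le> card B'" if B': "finite B'" "hgerm.span (I \<union> B') = UNIV" for B'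
  proof -
    have inj: "inj_on q B"
    proof (rule inj_onI)
      fix b b' assume b: "b \<in> B" "b' \<in> B" "q b = q b'"
      show "b = b'"
      proof (rule ccontr)
        assume ne: "b \<noteq> b'"
        \<comment> \<open>The coefficients of \<open>b - b'\<close>, so that \<open>indep\<close>
          also shows \<open>q\<close> to be injective on \<open>B\<close>.\<close>
        let ?c = "\<lambda>x. if x = b then 1 else if x = b' then - 1 else (0::complex)"
        have "(\<Sum>x\<in>B. scale_hgerm (?c x) x) = (\<Sum>x\<in>{b, b'}. scale_hgerm (?c x) x)"
          using b B by (intro sum.mono_neutral_right) auto
        also have "\<dots> = b - b'" using ne by (simp add: hgerm.scale_minus_left)
        finally have "(\<Sum>x\<in>B. scale_hgerm (?c x) x) \<in> I"
          using ker[of "b - b'"] b by (simp add: q.diff)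
        from indep[OF this] b show False by auto
      qed
    qed
    have "hgerm.independent (q ` B)"
      unfolding hgerm.dependent_finite[OF finite_imageI[OF B]]
    proof clarsimp
      fix u b assume b: "b \<in> B" "u (q b) \<noteq> 0" and 0: "(\<Sum>v\<in>q ` B. scale_hgerm (u v) v) = 0"
      have "q (\<Sum>b\<in>B. scale_hgerm (u (q b)) b) = 0"
        using 0 by (simp add: q.sum q.scale sum.reindex[OF inj])
      from indep[OF ker[OF this]] b show False by auto
    qed
    moreover have "q ` B \<subseteq> hgerm.span (q ` B')"
    proof -
      have "q ` (I \<union> B') \<subseteq> hgerm.span (q ` B')"
        using qI by (auto intro: hgerm.span_zero hgerm.span_base)
      then have "hgerm.span (q ` (I \<union> B')) \<subseteq> hgerm.span (q ` B')"
        by (rule hgerm.span_minimal) (rule hgerm.subspace_span)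
      then show ?thesis using q.span_image[of "I \<union> B'"] B'(2) by auto
    qed
    ultimately have "card (q ` B) \<le> card (q ` B')"
      using hgerm.independent_span_bound B'(1) by blast
    then show ?thesis using card_image[OF inj] card_image_le[OF B'(1), of q] by linarith
  qed
  show ?thesis
    unfolding codim_hgerm_def
  proof (rule Least_equality)
    show "\<exists>B'. finite B' \<and> card B' = card B \<and> hgerm.span (I \<union> B') = UNIV" using B span by blast
  qed (use lower in blast)
qed

text \<open>If \<open>m\<close> elements of \<Gamma> lie below \<open>c\<close>, then
  \<open>m + e\<close> lie below \<open>c + e\<close>, and exactly \<open>m\<close> elements of the
  shifted set lie there. From \<open>c + e\<close> on both sets contain everything.\<close>

lemma card_semigroup_gaps:
  fixes \<Gamma> :: "nat set"
  assumes cof: "\<And>k. k \<ge> c \<Longrightarrow> k \<in> \<Gamma>" and shift: "\<And>k. k \<in> \<Gamma> \<Longrightarrow> e + k \<in> \<Gamma>"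
  shows "finite (\<Gamma> - (+) e ` \<Gamma>)" "card (\<Gamma> - (+) e ` \<Gamma>) = e"
proof -
  let ?A = "\<Gamma> \<inter> {..<c}"
  have 1: "\<Gamma> - (+) e ` \<Gamma> = (?A \<union> {c..<c + e}) - (+) e ` ?A"
  proof (intro equalityI subsetI)
    fix k assume k: "k \<in> \<Gamma> - (+) e ` \<Gamma>"
    have "k < c + e"
    proof (rule ccontr)
      assume "\<not> k < c + e"
      then have "k = e + (k - e)" "k - e \<in> \<Gamma>" using cof[of "k - e"] by auto
      with k show False by blast
    qed
    with k show "k \<in> (?A \<union> {c..<c + e}) - (+) e ` ?A" by auto
  next
    fix k assume k: "k \<in> (?A \<union> {c..<c + e}) - (+) e ` ?A"
    then have "k \<in> \<Gamma>" "k < c + e" using cof by auto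
    moreover have False if "k = e + j" "j \<in> \<Gamma>" for j using that k \<open>k < c + e\<close> by auto
    ultimately show "k \<in> \<Gamma> - (+) e ` \<Gamma>" by auto
  qed
  have sub: "(+) e ` ?A \<subseteq> ?A \<union> {c..<c + e}"
  proof
    fix k assume "k \<in> (+) e ` ?A"
    then obtain j where "k = e + j" "j \<in> \<Gamma>" "j < c" by auto
    then show "k \<in> ?A \<union> {c..<c + e}" using shift[of j] by auto
  qed
  show "finite (\<Gamma> - (+) e ` \<Gamma>)" unfolding 1 by auto
  have "card (\<Gamma> - (+) e ` \<Gamma>) = card (?A \<union> {c..<c + e}) - card ((+) e ` ?A)"
    unfolding 1 by (rule card_Diff_subset[OF _ sub]) auto
  also have "card (?A \<union> {c..<c + e}) = card ?A + e"
    by (subst card_Un_disjoint) auto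
  also have "card ((+) e ` ?A) = card ?A" by (rule card_image) auto
  finally show "card (\<Gamma> - (+) e ` \<Gamma>) = e" by simp
qed

lemma scale_hgerm_mult: "scale_hgerm c (u * v) = scale_hgerm c u * v"
proof -
  obtain f where f: "holo_at f 0" "u = germ f" by (rule germ_cases)
  obtain g where g: "holo_at g 0" "v = germ g" by (rule germ_cases)
  show ?thesis
    using f g by (simp add: germ_scale germ_mult holo_at_mult holo_at_const mult.assoc)
qed

lemma fps_cancel_leading:
  fixes F G :: "complex fps"
  assumes "subdegree F = j" "subdegree G = j" "G \<noteq> 0"
  defines "H \<equiv> F - fps_const (F $ j / G $ j) * G"
  shows "H = 0 \<or> Suc j \<le> subdegree H"
proof (cases "H = 0")
  case False
  have "G $ j \<noteq> 0" using nth_subdegree_nonzero[OF assms(3)] assms(2) by simp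
  have "H $ i = 0" if "i < Suc j" for i
  proof (cases "i = j")
    case True
    then show ?thesis using \<open>G $ j \<noteq> 0\<close> by (simp add: H_def)
  next
    case False
    then have "i < j" using that by simp
    then have "F $ i = 0" "G $ i = 0"
      using assms(1,2) by (metis nth_less_subdegree_zero)+
    then show ?thesis unfolding H_def by simp
  qed
  then show ?thesis using subdegree_geI[OF False, of "Suc j"] by simp
qed simp

text \<open>The quotient has a basis of elements whose orders are the \<open>e\<close> numbers in
  the value semigroup \<Gamma> but not in \<open>e + \<Gamma>\<close>, with \<open>e\<close> the
  order of \<open>M\<close>. They are independent because the nonzero values of \<open>P\<close> on
  the ideal have orders in \<open>e + \<Gamma>\<close>. They span because leading terms can be
  removed until the order reaches \<open>N\<close>, where \<open>big\<close> puts the element into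
  the ideal.\<close>

lemma codim_by_orders:
  fixes P :: "'n::finite hgerm \<Rightarrow> complex fps"
  assumes add: "\<And>u v. P (u + v) = P u + P v" and mult: "\<And>u v. P (u * v) = P u * P v"
    and scale: "\<And>c u. P (scale_hgerm c u) = fps_const c * P u"
    and ker: "\<And>u. P u = 0 \<longleftrightarrow> A dvd u" and M: "P M \<noteq> 0"
    and big: "\<And>u. N \<le> subdegree (P u) \<Longrightarrow> \<exists>v. P u = P M * P v"
    and cof: "\<And>k. k \<ge> c \<Longrightarrow> \<exists>u. P u \<noteq> 0 \<and> subdegree (P u) = k"
  shows "codim_hgerm {u * M + v * A | u v. True} = subdegree (P M)"
proof -
  define e where "e = subdegree (P M)"
  define I where "I = {u * M + v * A | u v. True}"
  define \<Gamma> where "\<Gamma> = {subdegree (P u) | u. P u \<noteq> 0}"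
  define T where "T = \<Gamma> - (+) e ` \<Gamma>"
  have zero: "P 0 = 0" using ker[of 0] by simp
  have minus: "P (u - v) = P u - P v" for u v
    using add[of "u - v" v] by simp
  have PA: "P A = 0" using ker[of A] by simp
  have Psum: "P (sum h S) = (\<Sum>x\<in>S. P (h x))" for h :: "nat \<Rightarrow> 'n hgerm" and S
    by (induction S rule: infinite_finite_induct) (auto simp: zero add)
  have I: "hgerm.subspace I"
    unfolding hgerm.subspace_def
  proof (intro conjI ballI allI)
    show "0 \<in> I" unfolding I_def by (auto intro!: exI[of _ 0])
    show "x + y \<in> I" if "x \<in> I" "y \<in> I" for x y
    proof -
      obtain u v u' v' where "x = u * M + v * A" "y = u' * M + v' * A"
        using \<open>x \<in> I\<close> \<open>y \<in> I\<close> unfolding I_def by blast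
      then have "x + y = (u + u') * M + (v + v') * A" by (simp add: algebra_simps)
      then show ?thesis unfolding I_def by blast
    qed
    show "scale_hgerm k x \<in> I" if "x \<in> I" for k x
    proof -
      obtain u v where "x = u * M + v * A" using \<open>x \<in> I\<close> unfolding I_def by blast
      then have "scale_hgerm k x = scale_hgerm k u * M + scale_hgerm k v * A"
        by (simp add: hgerm.scale_right_distrib scale_hgerm_mult)
      then show ?thesis unfolding I_def by blast
    qed
  qed
  have shift: "e + k \<in> \<Gamma>" if k: "k \<in> \<Gamma>" for k
  proof -
    obtain u where "P u \<noteq> 0" "k = subdegree (P u)" using k unfolding \<Gamma>_def by blast
    then have "P (u * M) \<noteq> 0" "e + k = subdegree (P (u * M))"
      using M by (simp_all add: mult e_def)
    then show ?thesis unfolding \<Gamma>_def by blast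
  qed
  have \<Gamma>cof: "k \<in> \<Gamma>" if "k \<ge> c" for k using cof[OF that] unfolding \<Gamma>_def by blast
  have T: "finite T" "card T = e"
    unfolding T_def using card_semigroup_gaps[of c \<Gamma> e] \<Gamma>cof shift by blast+
  have "\<forall>k\<in>T. \<exists>u. P u \<noteq> 0 \<and> subdegree (P u) = k" unfolding T_def \<Gamma>_def by blast
  then obtain bb where bb: "\<And>k. k \<in> T \<Longrightarrow> P (bb k) \<noteq> 0 \<and> subdegree (P (bb k)) = k" by metis
  have inj: "inj_on bb T" using bb by (metis inj_onI)
  define B where "B = bb ` T"
  have PI: "\<exists>u. P x = P u * P M" if "x \<in> I" for x
    using that unfolding I_def by (auto simp: add mult PA)
  have in_I: "x \<in> I" if "P x = P M * P v" for x v
  proof -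
    have "P (x - v * M) = 0" using that by (simp add: minus mult)
    then obtain w where "x - v * M = A * w" using ker by (auto elim: dvdE)
    then have "x = v * M + w * A" by (simp add: algebra_simps)
    then show ?thesis unfolding I_def by blast
  qed
  have indep: "\<forall>b\<in>B. c b = 0" if sumI: "(\<Sum>b\<in>B. scale_hgerm (c b) b) \<in> I" for c
  proof (rule ccontr)
    assume "\<not> (\<forall>b\<in>B. c b = 0)"
    then have ne: "{k\<in>T. c (bb k) \<noteq> 0} \<noteq> {}" by (auto simp: B_def)
    \<comment> \<open>The orders in \<open>T\<close> are distinct, so the smallest one that occurs
      cannot cancel and is the order of the whole sum.\<close>
    define k0 where "k0 = Min {k\<in>T. c (bb k) \<noteq> 0}"
    have k0: "k0 \<in> T" "c (bb k0) \<noteq> 0" and k0_min: "\<And>k. k \<in> T \<Longrightarrow> c (bb k) \<noteq> 0 \<Longrightarrow> k0 \<le> k"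
      using Min_in[OF _ ne] T(1) unfolding k0_def by (auto intro: Min_le)
    define F where "F = (\<Sum>k\<in>T. fps_const (c (bb k)) * P (bb k))"
    have PF: "P (\<Sum>b\<in>B. scale_hgerm (c b) b) = F"
      unfolding B_def F_def by (simp add: sum.reindex[OF inj] Psum scale)
    have term0: "c (bb k) * P (bb k) $ j = 0" if "k \<in> T" "j \<le> k0" "k \<noteq> k0 \<or> j < k0" for j k
    proof (cases "c (bb k) = 0")
      case False
      then have "k0 \<le> k" using k0_min that by blast
      then have "j < subdegree (P (bb k))" using bb[OF that(1)] that by auto
      then have "P (bb k) $ j = 0" by (rule nth_less_subdegree_zero)
      then show ?thesis by simp
    qed simp
    have Fnth: "F $ j = (\<Sum>k\<in>T. c (bb k) * P (bb k) $ j)" for j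
      by (simp add: F_def fps_sum_nth)
    have low: "F $ j = 0" if "j < k0" for j
      unfolding Fnth by (intro sum.neutral ballI term0) (use that in auto)
    have "(\<Sum>k\<in>T - {k0}. c (bb k) * P (bb k) $ k0) = 0"
      by (intro sum.neutral ballI term0) auto
    then have "F $ k0 = c (bb k0) * P (bb k0) $ k0"
      unfolding Fnth sum.remove[OF T(1) k0(1)] by simp
    moreover have "P (bb k0) $ k0 \<noteq> 0"
      using bb[OF k0(1)] nth_subdegree_nonzero[of "P (bb k0)"] by simp
    ultimately have Fk0: "F $ k0 \<noteq> 0" using k0(2) by simp
    have F: "F \<noteq> 0" "subdegree F = k0" using Fk0 subdegreeI[OF Fk0 low] by auto
    obtain u where u: "F = P u * P M" using PI[OF sumI] PF by auto
    with F(1) have "P u \<noteq> 0" by auto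
    then have "k0 = e + subdegree (P u)" using F(2) M unfolding u by (simp add: e_def)
    moreover have "subdegree (P u) \<in> \<Gamma>" using \<open>P u \<noteq> 0\<close> unfolding \<Gamma>_def by blast
    ultimately show False using k0(1) unfolding T_def by blast
  qed
  have base: "x \<in> hgerm.span (I \<union> B)" if "x \<in> I" for x
    using that by (intro hgerm.span_base) simp
  \<comment> \<open>Descending induction on the order: \<open>k\<close> bounds its distance to
    \<open>N\<close>, and for \<open>k = N\<close> the condition holds for every
    \<open>u\<close>.\<close>
  have span: "u \<in> hgerm.span (I \<union> B)" if "P u = 0 \<or> N - k \<le> subdegree (P u)" for k u
    using that
  proof (induction k arbitrary: u)
    case 0
    then have "\<exists>v. P u = P M * P v"
      using big[of u] zero by (metis diff_zero mult_zero_right)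
    then show ?case using in_I base by blast
  next
    case (Suc k)
    show ?case
    proof (cases "P u = 0 \<or> N - k \<le> subdegree (P u)")
      case True
      then show ?thesis by (rule Suc.IH)
    next
      case False
      define j where "j = subdegree (P u)"
      have j: "N - k \<le> Suc j" "P u \<noteq> 0" using False Suc.prems by (auto simp: j_def)
      have red: "u \<in> hgerm.span (I \<union> B)"
        if b: "b \<in> hgerm.span (I \<union> B)" "P b \<noteq> 0" "subdegree (P b) = j" for b
      proof -
        define z where "z = P u $ j / P b $ j"
        have "P (u - scale_hgerm z b) = 0 \<or> Suc j \<le> subdegree (P (u - scale_hgerm z b))"
          using fps_cancel_leading[of "P u" j "P b"] b by (simp add: minus scale z_def j_def)
        then have "u - scale_hgerm z b \<in> hgerm.span (I \<union> B)"
          using j(1) by (intro Suc.IH) auto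
        then have "u - scale_hgerm z b + scale_hgerm z b \<in> hgerm.span (I \<union> B)"
          using b(1) by (intro hgerm.span_add hgerm.span_scale)
        then show ?thesis by simp
      qed
      show ?thesis
      proof (cases "j \<in> T")
        case True
        show ?thesis
          by (rule red[of "bb j"]) (use True bb[OF True] in \<open>auto simp: B_def intro: hgerm.span_base\<close>)
      next
        case False
        \<comment> \<open>For an order in \<open>e + \<Gamma>\<close> a multiple of
          \<open>M\<close>, hence an element of the ideal itself, has the right leading
          order.\<close>
        have "j \<in> \<Gamma>" using j(2) unfolding \<Gamma>_def j_def by blast
        then obtain j' where "j = e + j'" "j' \<in> \<Gamma>" using False unfolding T_def by blast
        then obtain v where v: "P v \<noteq> 0" "j = e + subdegree (P v)" unfolding \<Gamma>_def by blast
        show ?thesis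
        proof (rule red[of "v * M"])
          have "P (v * M) = P M * P v" by (simp add: mult mult.commute)
          from base[OF in_I[OF this]] show "v * M \<in> hgerm.span (I \<union> B)" .
        qed (use v M in \<open>auto simp: mult e_def\<close>)
      qed
    qed
  qed
  have "u \<in> hgerm.span (I \<union> B)" for u using span[of u N] by simp
  then have "hgerm.span (I \<union> B) = UNIV" by blast
  from codim_hgerm_eqI[OF I _ indep this] T
  have "codim_hgerm I = card B" by (simp add: B_def)
  also have "\<dots> = e" unfolding B_def using card_image[OF inj] T(2) by simp
  finally show ?thesis unfolding I_def e_def .
qed

section \<open>Pulling back germs along arcs\<close>

definition germ_arc :: "(complex \<Rightarrow> complex ^ 2) \<Rightarrow> bool" where
  "germ_arc \<gamma> \<longleftrightarrow> \<gamma> 0 = 0 \<and> (\<forall>i. (\<lambda>\<theta>. \<gamma> \<theta> $ i) analytic_on {0})"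

text \<open>The Taylor series of the chosen representative; by \<open>pullback_germ\<close> every
  representative has the same one.\<close>

definition pullback :: "(complex \<Rightarrow> complex ^ 2) \<Rightarrow> 2 hgerm \<Rightarrow> complex fps" where
  "pullback \<gamma> u = fps_expansion (\<lambda>\<theta>. rep_hgerm u (\<gamma> \<theta>)) 0"

lemma arc_tendsto: "germ_arc \<gamma> \<Longrightarrow> filterlim \<gamma> (nhds 0) (nhds 0)"
proof -
  assume \<gamma>: "germ_arc \<gamma>"
  have "((\<lambda>\<theta>. \<gamma> \<theta> $ i) \<longlongrightarrow> \<gamma> 0 $ i) (nhds 0)" for i
    using \<gamma> by (intro isCont_tendsto_nhds analytic_at_imp_isCont) (simp add: germ_arc_def)
  then have "(\<gamma> \<longlongrightarrow> \<gamma> 0) (nhds 0)" by (rule tendsto_cvec)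
  then show ?thesis using \<gamma> by (simp add: germ_arc_def)
qed

lemma eventually_arc: "germ_arc \<gamma> \<Longrightarrow> \<forall>\<^sub>F x in nhds 0. Q x \<Longrightarrow> \<forall>\<^sub>F \<theta> in nhds 0. Q (\<gamma> \<theta>)"
  by (rule eventually_compose_filterlim[OF _ arc_tendsto])

lemma pullback_germ:
  assumes \<gamma>: "germ_arc \<gamma>" and b: "holo_at b 0"
  shows "(\<lambda>\<theta>. b (\<gamma> \<theta>)) has_fps_expansion pullback \<gamma> (germ b)"
proof -
  have "(\<lambda>\<theta>. rep_hgerm (germ b) (\<gamma> \<theta>)) analytic_on {0}"
    by (rule holo_at_comp_analytic) (use \<gamma> rep_germ(1)[OF b] in \<open>simp_all add: germ_arc_def\<close>)
  then have 1: "(\<lambda>\<theta>. rep_hgerm (germ b) (\<gamma> \<theta>)) has_fps_expansion pullback \<gamma> (germ b)"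
    unfolding pullback_def by (rule analytic_at_imp_has_fps_expansion_0)
  have "\<forall>\<^sub>F \<theta> in nhds 0. rep_hgerm (germ b) (\<gamma> \<theta>) = b (\<gamma> \<theta>)"
    by (rule eventually_arc[OF \<gamma> rep_germ(2)[OF b]])
  from has_fps_expansion_cong[OF this refl] 1 show ?thesis by simp
qed

lemma pullback_eqI:
  assumes "germ_arc \<gamma>" "holo_at b 0" "(\<lambda>\<theta>. b (\<gamma> \<theta>)) has_fps_expansion F"
  shows "pullback \<gamma> (germ b) = F"
  using fps_expansion_unique_complex[OF pullback_germ[OF assms(1,2)] assms(3)] .

lemma pullback_add:
  assumes "germ_arc \<gamma>" shows "pullback \<gamma> (u + v) = pullback \<gamma> u + pullback \<gamma> v"
proof -
  obtain f where f: "holo_at f 0" "u = germ f" by (rule germ_cases)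
  obtain g where g: "holo_at g 0" "v = germ g" by (rule germ_cases)
  show ?thesis unfolding f(2) g(2) germ_add[OF f(1) g(1)]
    by (intro pullback_eqI assms holo_at_add has_fps_expansion_add pullback_germ f g)
qed

lemma pullback_mult:
  assumes "germ_arc \<gamma>" shows "pullback \<gamma> (u * v) = pullback \<gamma> u * pullback \<gamma> v"
proof -
  obtain f where f: "holo_at f 0" "u = germ f" by (rule germ_cases)
  obtain g where g: "holo_at g 0" "v = germ g" by (rule germ_cases)
  show ?thesis unfolding f(2) g(2) germ_mult[OF f(1) g(1)]
    by (intro pullback_eqI assms holo_at_mult has_fps_expansion_mult pullback_germ f g)
qed

lemma pullback_scale:
  assumes "germ_arc \<gamma>" shows "pullback \<gamma> (scale_hgerm c u) = fps_const c * pullback \<gamma> u"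
proof -
  obtain f where f: "holo_at f 0" "u = germ f" by (rule germ_cases)
  show ?thesis unfolding f(2) germ_scale[OF f(1)]
    by (intro pullback_eqI assms holo_at_mult holo_at_const has_fps_expansion_mult
        has_fps_expansion_const pullback_germ f)
qed

lemma pullback_one: "germ_arc \<gamma> \<Longrightarrow> pullback \<gamma> 1 = 1"
  unfolding germ_one by (intro pullback_eqI holo_at_const) auto

lemma pullback_eq_0_iff:
  assumes "germ_arc \<gamma>" "holo_at b 0"
  shows "pullback \<gamma> (germ b) = 0 \<longleftrightarrow> (\<forall>\<^sub>F \<theta> in nhds 0. b (\<gamma> \<theta>) = 0)"
proof
  assume "pullback \<gamma> (germ b) = 0"
  with pullback_germ[OF assms] have "(\<lambda>\<theta>. b (\<gamma> \<theta>)) has_fps_expansion 0" by simp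
  then show "\<forall>\<^sub>F \<theta> in nhds 0. b (\<gamma> \<theta>) = 0" by (simp only: has_fps_expansion_0_iff)
next
  assume "\<forall>\<^sub>F \<theta> in nhds 0. b (\<gamma> \<theta>) = 0"
  then show "pullback \<gamma> (germ b) = 0"
    by (intro pullback_eqI assms) (simp only: has_fps_expansion_0_iff)
qed

lemma pullback_unit:
  assumes "germ_arc \<gamma>" "u dvd 1"
  shows "pullback \<gamma> u \<noteq> 0" "subdegree (pullback \<gamma> u) = 0"
proof -
  obtain v where "1 = u * v" using assms(2) by (elim dvdE)
  then have 1: "1 = pullback \<gamma> u * pullback \<gamma> v"
    using pullback_one[OF assms(1)] pullback_mult[OF assms(1)] by metis
  then show nz: "pullback \<gamma> u \<noteq> 0" by auto
  from 1 have "pullback \<gamma> v \<noteq> 0" by auto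
  with nz have "subdegree (pullback \<gamma> u * pullback \<gamma> v) = subdegree (pullback \<gamma> u) + subdegree (pullback \<gamma> v)"
    by simp
  then show "subdegree (pullback \<gamma> u) = 0" unfolding 1[symmetric] by simp
qed

lemma pullback_nonunit:
  assumes "germ_arc \<gamma>" "\<not> u dvd 1" "pullback \<gamma> u \<noteq> 0"
  shows "subdegree (pullback \<gamma> u) > 0"
proof -
  obtain f where f: "holo_at f 0" "u = germ f" by (rule germ_cases)
  have "f 0 = 0" using assms(2) f germ_unit_iff by auto
  moreover have "f (\<gamma> 0) = pullback \<gamma> u $ 0"
    using pullback_germ[OF assms(1) f(1)] f(2) has_fps_expansion_imp_0_eq_fps_nth_0 by auto
  ultimately have "pullback \<gamma> u $ 0 = 0" using assms(1) by (simp add: germ_arc_def)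
  then show ?thesis using nth_subdegree_nonzero[OF assms(3)] by (cases "subdegree (pullback \<gamma> u) = 0") auto
qed

section \<open>The order on the line \<open>t = 0\<close> and the factorization of
  \<open>d\<close>\<close>

definition saxis :: "complex \<Rightarrow> complex ^ 2" where "saxis s = vector [s, 0]"

lemma arc_saxis: "germ_arc saxis"
  unfolding germ_arc_def
proof (intro conjI allI)
  fix i :: 2
  show "(\<lambda>s. saxis s $ i) analytic_on {0}"
    using exhaust_2[of i] by (auto simp: saxis_def intro!: analytic_intros)
qed (simp add: saxis_def)

text \<open>The order on the axis is additive and positive on nonunits, so it strictly drops when a
  nonunit factor is split off, and splitting must stop.\<close>

lemma irreducible_factor_exists:
  fixes u :: "2 hgerm"
  assumes "pullback saxis u \<noteq> 0" "\<not> u dvd 1"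
  shows "\<exists>q. irreducible q \<and> q dvd u"
  using assms
proof (induction "subdegree (pullback saxis u)" arbitrary: u rule: less_induct)
  case less
  show ?case
  proof (cases "irreducible u")
    case False
    have "u \<noteq> 0"
    proof
      assume "u = 0"
      then have "pullback saxis u = 0"
        using pullback_mult[OF arc_saxis, of 0 0] pullback_add[OF arc_saxis, of 0 0] by simp
      with less.prems show False by simp
    qed
    then obtain a b where ab: "u = a * b" "\<not> a dvd 1" "\<not> b dvd 1"
      using False less.prems(2) unfolding irreducible_def by blast
    have nz: "pullback saxis a \<noteq> 0" "pullback saxis b \<noteq> 0"
      using less.prems(1) unfolding ab(1) pullback_mult[OF arc_saxis] by auto
    have "subdegree (pullback saxis a) < subdegree (pullback saxis u)"
      using pullback_nonunit[OF arc_saxis ab(3) nz(2)] nz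
      unfolding ab(1) pullback_mult[OF arc_saxis] by simp
    from less.hyps[OF this nz(1) ab(2)] obtain q where "irreducible q" "q dvd a" by blast
    then show ?thesis unfolding ab(1) by (meson dvd_mult2)
  qed auto
qed

lemma subdegree_prod_fps:
  fixes F :: "nat \<Rightarrow> complex fps"
  assumes "finite S" "\<And>i. i \<in> S \<Longrightarrow> F i \<noteq> 0"
  shows "(\<Prod>i\<in>S. F i) \<noteq> 0 \<and> subdegree (\<Prod>i\<in>S. F i) = (\<Sum>i\<in>S. subdegree (F i))"
  using assms by (induction S rule: finite_induct) auto

text \<open>Up to a unit \<open>d\<close> is the product of the \<open>D i\<close>: by primality the
  product divides \<open>d\<close>, and a nonunit cofactor would have an irreducible factor, so that
  some \<open>D i\<close> would divide \<open>d\<close> twice. The order on the axis turns the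
  product into a sum.\<close>

lemma axis_order_sum:
  assumes D: "irreducible_components d l D"
    and prime: "\<And>i u v. i \<in> {1..l} \<Longrightarrow> germ (D i) dvd u * v \<Longrightarrow> germ (D i) dvd u \<or> germ (D i) dvd v"
    and reduced: "\<And>i. i \<in> {1..l} \<Longrightarrow> \<not> germ (D i) * germ (D i) dvd germ d"
    and d: "pullback saxis (germ d) \<noteq> 0"
  shows "subdegree (pullback saxis (germ d)) = (\<Sum>i\<in>{1..l}. subdegree (pullback saxis (germ (D i))))"
proof -
  have irr: "irreducible (germ (D i))" "germ (D i) dvd germ d" if "i \<in> {1..l}" for i
    using D that unfolding irreducible_components_def by blast+
  have na: "\<not> germ (D i) dvd germ (D k)" if "i \<in> {1..l}" "k \<in> {1..l}" "i \<noteq> k" for i k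
    using D that unfolding irreducible_components_def by blast
  have comp: "\<exists>i\<in>{1..l}. q dvd germ (D i) \<and> germ (D i) dvd q" if "irreducible q" "q dvd germ d" for q
    using D that unfolding irreducible_components_def by blast
  \<comment> \<open>Primality carries non-divisibility from single components to products of
    them.\<close>
  have nodvd: "\<not> germ (D i) dvd (\<Prod>k\<in>S. germ (D k))" if "finite S" "S \<subseteq> {1..l}" "i \<in> {1..l}" "i \<notin> S" for i S
    using that
  proof (induction S rule: finite_induct)
    case empty
    then show ?case using irr(1)[of i] by (simp add: irreducible_def)
  next
    case (insert k S)
    then have "\<not> germ (D i) dvd germ (D k)" "\<not> germ (D i) dvd (\<Prod>k\<in>S. germ (D k))"
      using na[of i k] by auto
    then show ?case using prime[OF insert.prems(2)] insert.hyps by auto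
  qed
  have "(\<Prod>k\<in>S. germ (D k)) dvd germ d" if "finite S" "S \<subseteq> {1..l}" for S
    using that
  proof (induction S rule: finite_induct)
    case (insert i S)
    then obtain e where e: "germ d = (\<Prod>k\<in>S. germ (D k)) * e" by (auto elim: dvdE)
    have i: "i \<in> {1..l}" using insert by auto
    have "germ (D i) dvd e"
      using prime[OF i irr(2)[OF i, unfolded e]] nodvd[of S i] insert i by auto
    then show ?case unfolding e using insert.hyps by (auto simp: mult_ac intro: mult_dvd_mono)
  qed auto
  from this[of "{1..l}"] obtain e where e: "germ d = (\<Prod>k\<in>{1..l}. germ (D k)) * e" by (auto elim: dvdE)
  have Pprod: "pullback saxis (\<Prod>k\<in>S. germ (D k)) = (\<Prod>k\<in>S. pullback saxis (germ (D k)))" for S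
    by (induction S rule: infinite_finite_induct)
       (auto simp: pullback_one[OF arc_saxis] pullback_mult[OF arc_saxis])
  have nz: "(\<Prod>k\<in>{1..l}. pullback saxis (germ (D k))) \<noteq> 0" "pullback saxis e \<noteq> 0"
    using d unfolding e pullback_mult[OF arc_saxis] Pprod by auto
  have "e dvd 1"
  proof (rule ccontr)
    assume "\<not> e dvd 1"
    from irreducible_factor_exists[OF nz(2) this] obtain q where q: "irreducible q" "q dvd e" by blast
    have "q dvd germ d" unfolding e using q(2) by (rule dvd_mult)
    from comp[OF q(1) this] obtain i where i: "i \<in> {1..l}" "germ (D i) dvd q" by blast
    then have "germ (D i) dvd e" using q(2) dvd_trans by blast
    moreover have "germ (D i) dvd (\<Prod>k\<in>{1..l}. germ (D k))" using i(1) by (intro dvd_prodI) auto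
    ultimately have "germ (D i) * germ (D i) dvd germ d" unfolding e by (intro mult_dvd_mono)
    with reduced[OF i(1)] show False by simp
  qed
  from pullback_unit(2)[OF arc_saxis this] have e0: "subdegree (pullback saxis e) = 0" .
  have "pullback saxis (germ (D i)) \<noteq> 0" if "i \<in> {1..l}" for i
    using nz(1) that by auto
  from subdegree_prod_fps[OF _ this, of "{1..l}"] show ?thesis
    unfolding e pullback_mult[OF arc_saxis] Pprod using e0 nz by simp
qed

text \<open>Division by the coordinate \<open>t\<close>, as a case of \<open>hol2_divide\<close>
  with the two coordinates exchanged. It turns the assumption that \<open>t\<close> does not divide
  \<open>d\<close> into a finite order on the axis.\<close>

lemma dvd_of_vanish_on_axis:
  assumes b: "holo_at b (0 :: complex ^ 2)" and b0: "\<forall>\<^sub>F s in nhds 0. b (saxis s) = 0"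
  shows "germ (\<lambda>x. x $ 2) dvd germ b"
proof -
  obtain r0 where r0: "r0 > 0" "hol2 r0 (\<lambda>s t. b (vector [s, t]))" using holo_at_imp_hol2[OF b] .
  obtain \<delta>0 where \<delta>0: "\<delta>0 > 0" "\<And>s. norm s < \<delta>0 \<Longrightarrow> b (saxis s) = 0"
    using b0 unfolding eventually_nhds_metric by auto
  define \<delta> where "\<delta> = min \<delta>0 r0"
  have \<delta>: "0 < \<delta>" "\<delta> \<le> r0" "\<delta> \<le> \<delta>0" using r0 \<delta>0 by (auto simp: \<delta>_def)
  define B where "B = (\<lambda>w t. b (vector [t, w]))"
  have B: "hol2 r0 B" unfolding B_def by (rule hol2_swap[OF r0(2)])
  have "\<exists>\<rho>>0. \<exists>Q. hol2 \<rho> Q \<and> \<rho> \<le> r0 \<and> (\<forall>s\<in>ball 0 \<rho>. \<forall>t\<in>ball 0 \<rho>. B s t = (\<lambda>s t. s) s t * Q s t)"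
  proof (rule hol2_divide[OF _ B, of _ "r0 / 2" \<delta>])
    show "hol2 r0 (\<lambda>s t. s)" by (intro hol2_fst holomorphic_intros)
    fix t :: complex assume t: "t \<in> ball 0 \<delta>" "t \<noteq> 0"
    have "(\<lambda>w. B w t) holomorphic_on ball 0 r0"
      by (rule hol2D(3)[OF B]) (use t \<delta> in auto)
    moreover have "B 0 t = 0" using \<delta>0(2)[of t] t \<delta> by (simp add: B_def saxis_def)
    ultimately show "\<exists>q. q holomorphic_on ball 0 r0 \<and> (\<forall>w\<in>ball 0 r0. B w t = (\<lambda>s t. s) w t * q w)"
      using holomorphic_factor_roots[of "{0}" r0 "\<lambda>w. B w t"] r0(1) by simp
  qed (use r0 \<delta> in auto)
  then obtain \<rho> Q where Q: "\<rho> > 0" "hol2 \<rho> Q"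
    "\<And>s t. s \<in> ball 0 \<rho> \<Longrightarrow> t \<in> ball 0 \<rho> \<Longrightarrow> B s t = s * Q s t" by auto
  have "\<forall>\<^sub>F x in nhds 0. b x = x $ 2 * Q (x $ 2) (x $ 1)"
    using eventually_in_polydisc[OF Q(1)]
  proof eventually_elim
    case (elim x)
    then show ?case using Q(3)[of "x $ 2" "x $ 1"] by (simp add: B_def)
  qed
  moreover have "holo_at (\<lambda>x. Q (x $ 2) (x $ 1)) (0 :: complex ^ 2)"
    using holo_at_germ_hol2[OF Q(1) hol2_swap[OF Q(2)]] .
  moreover have "holo_at (\<lambda>x. x $ 2) (0 :: complex ^ 2)"
    using holo_at_germ_hol2[OF Q(1) hol2_snd, of "\<lambda>t. t"] by (simp add: holomorphic_on_ident)
  ultimately show ?thesis using b by (subst germ_dvd_iff) blast+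
qed

section \<open>Intersection numbers as orders along a branch\<close>

context plane_branch
begin

lemma arc_curve: "germ_arc curve"
  unfolding germ_arc_def using curve_analytic by simp

text \<open>The branch equation \<open>a\<close> divides \<open>b\<close> and is not a unit, so
  irreducibility makes the two associated, and \<open>b\<close> inherits what
  \<open>branch_equation\<close> says of \<open>a\<close>. The first conclusion is the source of
  primality, since the pullback takes values in an integral domain.\<close>

lemma irreducible_curve_equation:
  assumes b: "holo_at b 0" "irreducible (germ b)" "\<forall>\<^sub>F \<theta> in nhds 0. b (curve \<theta>) = 0"
  shows "pullback curve u = 0 \<longleftrightarrow> germ b dvd u"
    and "pullback saxis (germ b) \<noteq> 0 \<and> subdegree (pullback saxis (germ b)) = n"
    and "\<forall>\<^sub>F x in nhds (0 :: complex ^ 2). \<forall>\<theta>. b x = 0 \<longrightarrow> x $ 2 = \<theta> ^ n \<longrightarrow>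
           (\<exists>\<omega>. \<omega> ^ n = 1 \<and> x $ 1 = \<xi> (\<omega> * \<theta>))"
proof -
  obtain a where a: "holo_at a 0" "\<forall>\<^sub>F s in nhds 0. a (vector [s, 0]) = s ^ n"
    and prod: "\<forall>\<^sub>F x in nhds (0 :: complex ^ 2). \<forall>\<theta>. x $ 2 = \<theta> ^ n \<longrightarrow>
      a x = (\<Prod>\<omega>\<in>unity_roots n. x $ 1 - \<xi> (\<omega> * \<theta>))"
    and van: "\<And>b. holo_at b 0 \<Longrightarrow> (\<forall>\<^sub>F \<theta> in nhds 0. b (curve \<theta>) = 0) \<longleftrightarrow> germ a dvd germ b"
    using branch_equation by blast
  obtain q where q: "germ b = germ a * q" using van[OF b(1)] b(3) by (auto elim: dvdE)
  have "a 0 = 0"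
    using eventually_nhds_x_imp_x[OF a(2)] n by (simp add: power_0_left)
  then have "\<not> germ a dvd 1" using germ_unit_iff[OF a(1)] by simp
  with b(2) q have qu: "q dvd 1" unfolding irreducible_def by blast
  then obtain q' where q': "1 = q * q'" by (elim dvdE)
  have "germ a = germ b * q'" using q q' by (metis mult.assoc mult.right_neutral)
  then have assoc: "germ a dvd u \<longleftrightarrow> germ b dvd u" for u
    using q by (metis dvd_triv_left dvd_trans)
  show "pullback curve u = 0 \<longleftrightarrow> germ b dvd u"
  proof -
    obtain f where f: "holo_at f 0" "u = germ f" by (rule germ_cases)
    show ?thesis unfolding f(2) pullback_eq_0_iff[OF arc_curve f(1)] van[OF f(1)] assoc ..
  qed
  have "germ b dvd germ a" using assoc[of "germ a"] by simp
  then obtain k where "\<forall>\<^sub>F x in nhds 0. a x = b x * k x" using germ_dvd_iff[OF b(1) a(1)] by blast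
  then show "\<forall>\<^sub>F x in nhds (0 :: complex ^ 2). \<forall>\<theta>. b x = 0 \<longrightarrow> x $ 2 = \<theta> ^ n \<longrightarrow>
           (\<exists>\<omega>. \<omega> ^ n = 1 \<and> x $ 1 = \<xi> (\<omega> * \<theta>))"
    using prod
  proof eventually_elim
    case (elim x)
    show ?case
    proof (intro allI impI)
      fix \<theta> assume "b x = 0" "x $ 2 = \<theta> ^ n"
      then have "(\<Prod>\<omega>\<in>unity_roots n. x $ 1 - \<xi> (\<omega> * \<theta>)) = 0" using elim by simp
      then show "\<exists>\<omega>. \<omega> ^ n = 1 \<and> x $ 1 = \<xi> (\<omega> * \<theta>)"
        using finite_unity_roots[OF n] by (auto simp: prod_zero_iff)
    qed
  qed
  have "\<forall>\<^sub>F s in nhds 0. s ^ n = a (saxis s)"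
    using a(2) by (simp add: saxis_def eq_commute)
  from has_fps_expansion_cong[OF this refl] have "(\<lambda>s. a (saxis s)) has_fps_expansion fps_X ^ n"
    using has_fps_expansion_fps_X_power by blast
  then have "pullback saxis (germ a) = fps_X ^ n" by (intro pullback_eqI arc_saxis a)
  then show "pullback saxis (germ b) \<noteq> 0 \<and> subdegree (pullback saxis (germ b)) = n"
    unfolding q pullback_mult[OF arc_saxis] using pullback_unit[OF arc_saxis qu] by simp
qed

text \<open>\<open>codim_by_orders\<close> for the pullback along the branch. The conductor \<Delta>
  supplies the two bounds: every order from that of \<Delta> on occurs, and a pullback whose order
  is at least that of \<open>M\<close> plus that of \<Delta> is the pullback of \<open>M\<close>
  times another pullback.\<close>

theorem intersection_mult_branch:
  assumes b: "holo_at b 0" "irreducible (germ b)" "\<forall>\<^sub>F \<theta> in nhds 0. b (curve \<theta>) = 0"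
    and M: "pullback curve (germ M) \<noteq> 0"
  shows "intersection_mult M b = subdegree (pullback curve (germ M))"
proof -
  obtain \<Delta> where \<Delta>: "\<Delta> \<noteq> 0" and cond: "\<And>\<phi> F. \<phi> has_fps_expansion F \<Longrightarrow>
     \<exists>b. holo_at b 0 \<and> (\<lambda>\<theta>. b (curve \<theta>)) has_fps_expansion \<Delta> * F"
    using conductor by blast
  have cond': "\<exists>v. pullback curve v = \<Delta> * F" if "\<phi> has_fps_expansion F" for \<phi> F
    using cond[OF that] pullback_eqI[OF arc_curve] by blast
  let ?P = "pullback curve"
  have conv: "\<exists>f. f has_fps_expansion ?P u" for u
    using germ_cases[of u] pullback_germ[OF arc_curve] by metis
  obtain v1 where v1: "?P v1 = \<Delta>" using cond'[of "\<lambda>_. 1" 1] by auto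
  show ?thesis
    unfolding intersection_mult_def
  proof (rule codim_by_orders[where P="?P" and N="subdegree (?P (germ M) * \<Delta>)" and c="subdegree \<Delta>"])
    fix u assume u: "subdegree (?P (germ M) * \<Delta>) \<le> subdegree (?P u)"
    have MD: "?P (germ M) * \<Delta> \<noteq> 0" using M \<Delta> by simp
    obtain f where f: "f has_fps_expansion ?P u" using conv by blast
    obtain h where h: "h has_fps_expansion ?P (germ M * v1)" using conv by blast
    have h': "h has_fps_expansion ?P (germ M) * \<Delta>" using h by (simp add: pullback_mult[OF arc_curve] v1)
    \<comment> \<open>The quotient is a convergent series, so its product with \<Delta> is again a
      pullback.\<close>
    from has_fps_expansion_divide[OF f h' u MD refl]
    obtain v where v: "?P v = \<Delta> * (?P u / (?P (germ M) * \<Delta>))" using cond' by blast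
    have "?P u = 0 \<or> ?P (germ M) * \<Delta> dvd ?P u" using u fps_dvd_iff[OF MD] by blast
    then have "?P (germ M) * \<Delta> dvd ?P u" by auto
    from dvd_mult_div_cancel[OF this] have "?P u = ?P (germ M) * ?P v"
      unfolding v by (simp add: mult.assoc)
    then show "\<exists>v. ?P u = ?P (germ M) * ?P v" ..
  next
    fix k assume k: "subdegree \<Delta> \<le> k"
    obtain v where v: "?P v = \<Delta> * fps_X ^ (k - subdegree \<Delta>)"
      using cond'[OF has_fps_expansion_fps_X_power] by blast
    show "\<exists>u. ?P u \<noteq> 0 \<and> subdegree (?P u) = k"
      by (rule exI[of _ v]) (use \<Delta> k in \<open>simp add: v\<close>)
  qed (use M pullback_add[OF arc_curve] pullback_mult[OF arc_curve] pullback_scale[OF arc_curve]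
        irreducible_curve_equation(1)[OF b] in auto)
qed

end

section \<open>The product of the coefficients at a double point\<close>

text \<open>Mean value inequality for \<open>f z - a * z\<close>. With a bound smaller than
  \<open>norm a\<close> it gives injectivity, and it drives the contraction in
  \<open>hol3_implicit\<close>.\<close>

lemma deriv_near_constant:
  fixes f :: "complex \<Rightarrow> complex"
  assumes "convex S" "\<And>z. z \<in> S \<Longrightarrow> (f has_field_derivative f' z) (at z)"
    and "\<And>z. z \<in> S \<Longrightarrow> norm (f' z - a) \<le> B" and "z \<in> S" "w \<in> S"
  shows "norm (f z - f w - a * (z - w)) \<le> B * norm (z - w)"
proof -
  have "norm ((f z - a * z) - (f w - a * w)) \<le> B * norm (z - w)"
  proof (rule field_differentiable_bound[OF assms(1), where f'="\<lambda>z. f' z - a"])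
    show "((\<lambda>z. f z - a * z) has_field_derivative f' z - a) (at z within S)" if "z \<in> S" for z
      by (rule has_field_derivative_at_within, rule DERIV_diff[OF assms(2)[OF that] DERIV_cmult_Id])
  qed (fact assms)+
  moreover have "(f z - a * z) - (f w - a * w) = f z - f w - a * (z - w)"
    by (simp add: right_diff_distrib)
  ultimately show ?thesis by simp
qed

text \<open>The derivatives along the direction \<open>e\<close> are taken in an extra variable
  \<open>h\<close>, so that \<open>continuous_on_deriv_param\<close> yields their continuity in the
  base point, up to second order.\<close>

lemma holo_at_line_derivs:
  fixes f :: "complex ^ 'n \<Rightarrow> complex" and e :: "complex ^ 'n"
  assumes f: "holo_at f a"
  defines "k \<equiv> \<lambda>x h. f (x + h *s e)"
  obtains r where "r > 0"
    "continuous_on (ball a r \<times> ball 0 r) (\<lambda>(x, h). k x h)"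
    "\<And>x. x \<in> ball a r \<Longrightarrow> k x holomorphic_on ball 0 r"
    "continuous_on (ball a r \<times> ball 0 r) (\<lambda>(x, h). deriv (k x) h)"
    "continuous_on (ball a r \<times> ball 0 r) (\<lambda>(x, h). deriv (deriv (k x)) h)"
proof -
  obtain \<epsilon> where \<epsilon>: "\<epsilon> > 0" "continuous_on (ball a \<epsilon>) f" "\<And>x. x \<in> ball a \<epsilon> \<Longrightarrow> \<exists>L. cdiff_at f L x"
    using holo_at_imp_continuous_on[OF f] by blast
  \<comment> \<open>Chosen so that \<open>x + h *s e\<close> stays within distance
    \<open>\<epsilon> / 2\<close> of \<open>a\<close>.\<close>
  define r where "r = \<epsilon> / 2 / (1 + norm e)"
  have ne: "1 + norm e > 0" by (simp add: add_pos_nonneg)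
  have r: "r > 0" using \<epsilon> ne by (simp add: r_def)
  have "c / X * X = c" if "X > 0" for c X :: real using that by simp
  from this[OF ne] have re: "r * (1 + norm e) = \<epsilon> / 2" unfolding r_def .
  have norm_smult: "norm (h *s e) = norm h * norm e" for h :: complex
    by (simp add: norm_vec_def L2_set_def norm_mult power_mult_distrib sum_distrib_left[symmetric]
        real_sqrt_mult)
  have inb: "x + h *s e \<in> ball a \<epsilon>" if "x \<in> ball a r" "h \<in> ball 0 r" for x h
  proof -
    have "dist a (x + h *s e) \<le> dist a x + norm (h *s e)"
      using dist_triangle[of a "x + h *s e" x] by (simp add: dist_norm)
    also have "\<dots> \<le> r + r * norm e"
      unfolding norm_smult using that by (intro add_mono mult_right_mono) auto
    also have "\<dots> = \<epsilon> / 2" using re by (simp add: algebra_simps)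
    finally show ?thesis using \<epsilon>(1) by simp
  qed
  have lin: "bounded_linear (\<lambda>h :: complex. h *s e)"
    by (rule linear_conv_bounded_linear[THEN iffD1], rule linearI)
       (auto simp: vec_eq_iff algebra_simps)
  have c: "continuous_on (ball a r \<times> ball 0 r) (\<lambda>(x, h). k x h)"
    unfolding case_prod_unfold k_def
    by (rule continuous_on_compose2[OF \<epsilon>(2)])
       (use inb in \<open>auto intro!: continuous_on_add continuous_on_fst continuous_on_snd continuous_on_id
          bounded_linear.continuous_on[OF lin]\<close>)
  have hol: "k x holomorphic_on ball 0 r" if x: "x \<in> ball a r" for x
    unfolding holomorphic_on_open[OF open_ball]
  proof
    fix h :: complex assume "h \<in> ball 0 r"
    then obtain L where L: "cdiff_at f L (x + h *s e)" using inb[OF x] \<epsilon>(3) by blast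
    have "((\<lambda>h. f (x + h *s e)) has_field_derivative L e) (at h)"
    proof (rule cdiff_at_chain[where \<gamma>="\<lambda>h. x + h *s e", OF L])
      show "((\<lambda>z. (x + z *s e) $ i) has_field_derivative e $ i) (at h)" for i
        by (auto intro!: derivative_eq_intros)
    qed
    then show "\<exists>f'. (k x has_field_derivative f') (at h)" unfolding k_def by blast
  qed
  have c1: "continuous_on (ball a r \<times> ball 0 r) (\<lambda>(x, h). deriv (k x) h)"
    by (rule continuous_on_deriv_param[OF c open_ball hol])
  have hol1: "deriv (k x) holomorphic_on ball 0 r" if x: "x \<in> ball a r" for x
    by (rule holomorphic_deriv[OF hol[OF x] open_ball])
  have c2: "continuous_on (ball a r \<times> ball 0 r) (\<lambda>(x, h). deriv (deriv (k x)) h)"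
    by (rule continuous_on_deriv_param[OF c1 open_ball hol1])
  show thesis by (rule that[OF r c hol c1 c2])
qed

abbreviation e3 :: "complex ^ 3" where "e3 \<equiv> axis 3 1"

text \<open>At a double point this is twice the product of the vertical derivatives of the two
  factors of \<open>f\<close>, a quantity that does not depend on how \<open>f\<close> is
  factored.\<close>

definition second_vertical_derivative :: "(complex ^ 3 \<Rightarrow> complex) \<Rightarrow> complex ^ 3 \<Rightarrow> complex" where
  "second_vertical_derivative f q = deriv (deriv (\<lambda>h. f (q + h *s e3))) 0"

text \<open>Together with the value at 0 this shows later that the second vertical derivative has
  order 0 along the curve \<open>p\<close>.\<close>

lemma second_vertical_derivative_isCont:
  assumes "holo_at f a" shows "isCont (second_vertical_derivative f) a"
proof -
  obtain r where r: "r > 0"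
    and c: "continuous_on (ball a r \<times> ball 0 r) (\<lambda>(x, h). deriv (deriv (\<lambda>h. f (x + h *s e3))) h)"
    using holo_at_line_derivs[OF assms, of e3] by metis
  have "continuous_on (ball a r) (\<lambda>x. deriv (deriv (\<lambda>h. f (x + h *s e3))) 0)"
  proof (rule continuous_on_compose2[OF c, of "ball a r" "\<lambda>x. (x, 0)", simplified prod.case])
    show "(\<lambda>x. (x, 0)) ` ball a r \<subseteq> ball a r \<times> ball 0 r" using r by auto
  qed (intro continuous_on_Pair continuous_on_id continuous_on_const)
  then show ?thesis
    using r unfolding second_vertical_derivative_def[abs_def]
    by (simp add: continuous_on_eq_continuous_at)
qed

lemma second_derivative_fps:
  fixes F :: "complex fps"
  assumes "\<phi> has_fps_expansion F"
  shows "deriv (deriv \<phi>) 0 = 2 * F $ 2" "deriv \<phi> 0 = F $ 1"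
proof -
  have F: "F = fps_expansion \<phi> 0"
    using assms has_fps_expansion_imp_analytic_0[OF assms]
      fps_expansion_unique_complex[OF assms analytic_at_imp_has_fps_expansion_0] by blast
  show "deriv (deriv \<phi>) 0 = 2 * F $ 2" "deriv \<phi> 0 = F $ 1"
    unfolding F by (simp_all add: fps_expansion_def numeral_2_eq_2)
qed

lemma cdiff_line_fps:
  assumes f: "holo_at f q"
  shows "(\<lambda>h. f (q + h *s e)) has_fps_expansion fps_expansion (\<lambda>h. f (q + h *s e)) 0"
proof (rule analytic_at_imp_has_fps_expansion_0)
  show "(\<lambda>h. f (q + h *s e)) analytic_on {0}"
    by (rule holo_at_comp_analytic[where \<gamma>="\<lambda>h. q + h *s e"]) (use f in \<open>auto intro!: analytic_intros\<close>)
qed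

text \<open>Both factors vanish at \<open>q\<close>, so only the mixed term of Leibniz' rule
  survives.\<close>

lemma second_vertical_derivative_mult:
  assumes f1: "holo_at f1 q" and f2: "holo_at f2 q" and f: "\<forall>\<^sub>F z in nhds q. f z = f1 z * f2 z"
    and 0: "f1 q = 0" "f2 q = 0" and L: "cdiff_at f1 L1 q" "cdiff_at f2 L2 q"
  shows "second_vertical_derivative f q = 2 * L1 e3 * L2 e3"
proof -
  let ?k = "\<lambda>f h. f (q + h *s e3) :: complex"
  let ?F1 = "fps_expansion (?k f1) 0" and ?F2 = "fps_expansion (?k f2) 0"
  note F1 = cdiff_line_fps[OF f1, of e3] and F2 = cdiff_line_fps[OF f2, of e3]
  have "((\<lambda>h. q + h *s e3) \<longlongrightarrow> q + 0 *s e3) (nhds 0)"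
    by (intro tendsto_cvec) (auto intro!: tendsto_eq_intros simp: filterlim_ident)
  then have lim: "((\<lambda>h. q + h *s e3) \<longlongrightarrow> q) (nhds 0)" by simp
  have "\<forall>\<^sub>F h in nhds 0. ?k f h = ?k f1 h * ?k f2 h"
    by (rule eventually_compose_filterlim[OF f lim])
  from has_fps_expansion_cong[OF this refl] has_fps_expansion_mult[OF F1 F2]
  have "?k f has_fps_expansion ?F1 * ?F2" by simp
  from second_derivative_fps(1)[OF this]
  have "second_vertical_derivative f q = 2 * (?F1 * ?F2) $ 2"
    by (simp add: second_vertical_derivative_def)
  also have "(?F1 * ?F2) $ 2 = ?F1 $ 1 * ?F2 $ 1"
    using 0 has_fps_expansion_imp_0_eq_fps_nth_0[OF F1] has_fps_expansion_imp_0_eq_fps_nth_0[OF F2]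
    by (simp add: fps_mult_nth numeral_2_eq_2 sum.atLeast0_atMost_Suc)
  also have "?F1 $ 1 = L1 e3"
    using second_derivative_fps(2)[OF F1] DERIV_imp_deriv[OF cdiff_at_line[OF L(1), of e3]] by simp
  also have "?F2 $ 1 = L2 e3"
    using second_derivative_fps(2)[OF F2] DERIV_imp_deriv[OF cdiff_at_line[OF L(2), of e3]] by simp
  finally show ?thesis by simp
qed

text \<open>At a zero of \<open>d\<close> the third coordinate \<open>t * d\<close> has derivative
  \<open>t\<close> times that of \<open>d\<close>; the other term of the product rule drops
  out.\<close>

lemma cdiff_comp_line:
  fixes \<Phi> :: "complex ^ 2 \<Rightarrow> complex ^ 3" and x v :: "complex ^ 2"
  assumes \<Phi>: "\<forall>\<^sub>F x' in nhds x. \<Phi> x' = vector [x' $ 1, (x' $ 2)\<^sup>2, x' $ 2 * d x']"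
    and d: "cdiff_at d Ld x" "d x = 0" and h: "cdiff_at h L (\<Phi> x)"
  shows "((\<lambda>z. h (\<Phi> (x + z *s v))) has_field_derivative L (vector [v $ 1, 2 * x $ 2 * v $ 2, x $ 2 * Ld v])) (at 0)"
proof -
  let ?\<gamma> = "\<lambda>z. vector [(x + z *s v) $ 1, ((x + z *s v) $ 2)\<^sup>2, (x + z *s v) $ 2 * d (x + z *s v)] :: complex ^ 3"
  have g0: "?\<gamma> 0 = \<Phi> x" using eventually_nhds_x_imp_x[OF \<Phi>] by simp
  have "((\<lambda>z. h (?\<gamma> z)) has_field_derivative L (vector [v $ 1, 2 * x $ 2 * v $ 2, x $ 2 * Ld v])) (at 0)"
  proof (rule cdiff_at_chain[where \<gamma>="?\<gamma>"])
    show "cdiff_at h L (?\<gamma> 0)" unfolding g0 by (rule h)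
    fix i :: 3
    show "((\<lambda>z. ?\<gamma> z $ i) has_field_derivative vector [v $ 1, 2 * x $ 2 * v $ 2, x $ 2 * Ld v] $ i) (at 0)"
      using exhaust_3[of i] d(2)
      by (auto intro!: derivative_eq_intros cdiff_at_line[OF d(1)])
  qed
  moreover have "\<forall>\<^sub>F z in nhds 0. h (?\<gamma> z) = h (\<Phi> (x + z *s v))"
  proof -
    have "((\<lambda>z. x + z *s v) \<longlongrightarrow> x + 0 *s v) (nhds 0)"
      by (intro tendsto_cvec) (auto intro!: tendsto_eq_intros simp: filterlim_ident)
    then have "((\<lambda>z. x + z *s v) \<longlongrightarrow> x) (nhds 0)" by simp
    from eventually_compose_filterlim[OF \<Phi> this] show ?thesis by eventually_elim simp
  qed
  ultimately show ?thesis by (subst (asm) DERIV_cong_ev[OF refl _ refl]) auto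
qed

lemma cdiff_at_vec3:
  fixes L :: "complex ^ 3 \<Rightarrow> complex" and w :: "complex ^ 3"
  assumes "cdiff_at f L q"
  shows "L w = w $ 1 * L (axis 1 1) + w $ 2 * L (axis 2 1) + w $ 3 * L e3"
proof -
  have w: "w = w $ 1 *s axis 1 1 + (w $ 2 *s axis 2 1 + w $ 3 *s e3)"
    by (simp add: vec_eq_iff forall_3 axis_def)
  show ?thesis
    by (subst w) (simp add: cdiff_at_add[OF assms] cdiff_at_scale[OF assms] del: vector_add_component)
qed

text \<open>\<open>L\<close> kills the tangent plane of the branch, which two vectors span; solving
  the two equations determines \<open>L\<close> by its value on the vertical vector. At the other
  preimage the same formulas hold with the opposite sign of \<open>t\<close>.\<close>

lemma vanishing_on_branch:
  fixes \<Phi> :: "complex ^ 2 \<Rightarrow> complex ^ 3" and x :: "complex ^ 2"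
  assumes \<Phi>: "\<forall>\<^sub>F x' in nhds x. \<Phi> x' = vector [x' $ 1, (x' $ 2)\<^sup>2, x' $ 2 * d x']"
    and d: "cdiff_at d Ld x" "d x = 0" and Ld: "\<And>v :: complex ^ 2. Ld v = v $ 1 * G1 + 2 * x $ 2 * v $ 2 * G2"
    and t: "x $ 2 \<noteq> 0"
    and f: "cdiff_at f L (\<Phi> x)" and f0: "\<forall>\<^sub>F x' in nhds x. f (\<Phi> x') = 0"
  shows "L (axis 1 1) = - (x $ 2 * G1 * L e3)" "L (axis 2 1) = - (x $ 2 * G2 * L e3)"
proof -
  have L0: "L (vector [v $ 1, 2 * x $ 2 * v $ 2, x $ 2 * Ld v]) = 0" for v :: "complex ^ 2"
  proof -
    have "((\<lambda>z. x + z *s v) \<longlongrightarrow> x + 0 *s v) (nhds 0)"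
      by (intro tendsto_cvec) (auto intro!: tendsto_eq_intros simp: filterlim_ident)
    then have "((\<lambda>z. x + z *s v) \<longlongrightarrow> x) (nhds 0)" by simp
    from eventually_compose_filterlim[OF f0 this]
    have "((\<lambda>z. f (\<Phi> (x + z *s v))) has_field_derivative 0) (at 0)"
      by (subst DERIV_cong_ev[OF refl _ refl, of _ "\<lambda>_. 0"]) auto
    from DERIV_unique[OF cdiff_comp_line[OF \<Phi> d f] this] show ?thesis .
  qed
  show "L (axis 1 1) = - (x $ 2 * G1 * L e3)"
    using L0[of "vector [1, 0]"]
    by (subst (asm) cdiff_at_vec3[OF f]) (simp add: Ld add_eq_0_iff mult_ac)
  have "2 * x $ 2 * L (axis 2 1) + x $ 2 * (2 * x $ 2 * G2) * L e3 = 0"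
    using L0[of "vector [0, 1]"] by (subst (asm) cdiff_at_vec3[OF f]) (simp add: Ld)
  then have "(2 * x $ 2) * (L (axis 2 1) + x $ 2 * G2 * L e3) = 0" by (simp only: algebra_simps)
  then show "L (axis 2 1) = - (x $ 2 * G2 * L e3)" using t by (simp add: add_eq_0_iff)
qed

section \<open>Coordinatewise derivatives and limits of vector-valued maps\<close>

lemma has_derivative_cvec_general:
  fixes F :: "complex ^ 'n \<Rightarrow> complex ^ 'm"
  assumes "\<And>i. ((\<lambda>x. F x $ i) has_derivative L i) (at x)"
  shows "(F has_derivative (\<lambda>v. \<chi> i. L i v)) (at x)"
proof -
  have "((\<lambda>x. \<Sum>i\<in>UNIV. axis i (F x $ i)) has_derivative (\<lambda>v. \<Sum>i\<in>UNIV. axis i (L i v))) (at x)"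
    by (intro has_derivative_sum bounded_linear.has_derivative[OF bounded_linear_axis] assms)
  moreover have "(\<Sum>i\<in>UNIV. axis i (L i v)) = (\<chi> i. L i v)" for v
    by (subst cvec_eq_sum_axis[of "\<chi> i. L i v"]) simp
  ultimately show ?thesis by (simp add: cvec_eq_sum_axis[symmetric])
qed

lemma cdiff_at_nth: "cdiff_at (\<lambda>x :: complex ^ 'n. x $ i) (\<lambda>v. v $ i) a"
  unfolding cdiff_at_def
  by (auto intro!: bounded_linear.has_derivative[OF bounded_linear_vec_nth] has_derivative_ident)

lemma holo_at_nth: "holo_at (\<lambda>x :: complex ^ 'n. x $ i) a"
  unfolding holo_at_iff using cdiff_at_nth by (intro always_eventually) blast

lemma tendsto_line: "((\<lambda>z. x + z *s v) \<longlongrightarrow> (x :: complex ^ 'n)) (nhds 0)"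
proof -
  have "((\<lambda>z. x + z *s v) \<longlongrightarrow> x + 0 *s v) (nhds 0)"
    by (intro tendsto_cvec) (auto intro!: tendsto_eq_intros simp: filterlim_ident)
  then show ?thesis by simp
qed

lemma tendsto_vector_2:
  assumes "(f \<longlongrightarrow> a) F" "(h \<longlongrightarrow> b) F"
  shows "((\<lambda>x. vector [f x, h x] :: complex ^ 2) \<longlongrightarrow> vector [a, b]) F"
proof (rule tendsto_cvec)
  fix i :: 2
  show "((\<lambda>x. (vector [f x, h x] :: complex ^ 2) $ i) \<longlongrightarrow> vector [a, b] $ i) F"
    using exhaust_2[of i] assms by auto
qed

lemma tendsto_vector_3:
  assumes "(f \<longlongrightarrow> a) F" "(h \<longlongrightarrow> b) F" "(k \<longlongrightarrow> c) F"
  shows "((\<lambda>x. vector [f x, h x, k x] :: complex ^ 3) \<longlongrightarrow> vector [a, b, c]) F"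
proof (rule tendsto_cvec)
  fix i :: 3
  show "((\<lambda>x. (vector [f x, h x, k x] :: complex ^ 3) $ i) \<longlongrightarrow> vector [a, b, c] $ i) F"
    using exhaust_3[of i] assms by auto
qed

lemma vector_3_0 [simp]: "vector [0, 0, 0] = (0 :: complex ^ 3)"
  by (simp add: vec_eq_iff forall_3)

lemma tendsto_nth_0: "((\<lambda>x. x $ i) \<longlongrightarrow> 0) (nhds (0 :: complex ^ 'n))"
  using tendsto_vec_nth[OF filterlim_ident[of "nhds (0 :: complex ^ 'n)"], of i] by simp

lemma tendsto_nth_sq_0: "((\<lambda>x. (x $ i)\<^sup>2) \<longlongrightarrow> 0) (nhds (0 :: complex ^ 'n))"
  using tendsto_power[OF tendsto_nth_0[of i], of 2] by simp

lemma holo_at_comp_square: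
  assumes "holo_at g (0 :: complex ^ 2)"
  shows "holo_at (\<lambda>x. g (vector [x $ 1, (x $ 2)\<^sup>2])) (0 :: complex ^ 2)"
proof -
  obtain r where r: "r > 0" "hol2 r (\<lambda>s t. g (vector [s, t]))" using holo_at_imp_hol2[OF assms] .
  define \<rho> where "\<rho> = min r 1"
  have \<rho>: "\<rho> > 0" "\<rho> \<le> r" "\<rho> \<le> 1" using r by (auto simp: \<rho>_def)
  have sq: "t\<^sup>2 \<in> ball 0 r" if "t \<in> ball 0 \<rho>" for t :: complex
  proof -
    have "norm t * norm t \<le> norm t * 1" using that \<rho> by (intro mult_left_mono) auto
    then show ?thesis using that \<rho> by (simp add: power2_eq_square norm_mult)
  qed
  have inc: "s \<in> ball 0 r" if "s \<in> ball 0 \<rho>" for s :: complex using that \<rho> by auto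
  have "hol2 \<rho> (\<lambda>s t. g (vector [s, t\<^sup>2]))"
    unfolding hol2_def case_prod_unfold
  proof (intro conjI ballI)
    show "continuous_on (ball 0 \<rho> \<times> ball 0 \<rho>) (\<lambda>p. g (vector [fst p, (snd p)\<^sup>2]))"
      by (rule hol2_continuous_on_compose[OF r(2)])
         (use sq inc in \<open>auto intro!: continuous_on_fst continuous_on_snd continuous_on_id continuous_on_power\<close>)
    show "(\<lambda>t. g (vector [s, t\<^sup>2])) holomorphic_on ball 0 \<rho>" if "s \<in> ball 0 \<rho>" for s
    proof -
      have "(\<lambda>t. t\<^sup>2) ` ball 0 \<rho> \<subseteq> ball (0::complex) r" by (rule image_subsetI) (rule sq)
      from holomorphic_on_compose_gen[OF holomorphic_on_power[OF holomorphic_on_ident] hol2D(2)[OF r(2) inc[OF that]] this]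
      show ?thesis by (simp add: o_def)
    qed
    show "(\<lambda>s. g (vector [s, t\<^sup>2])) holomorphic_on ball 0 \<rho>" if "t \<in> ball 0 \<rho>" for t
      by (rule holomorphic_on_subset[OF hol2D(3)[OF r(2) sq[OF that]] subset_ball[OF \<rho>(2)]])
  qed
  from holo_at_germ_hol2[OF \<rho>(1) this] show ?thesis .
qed

lemma isCont_of_holo_at: "holo_at h a \<Longrightarrow> isCont h a"
  using holo_at_imp_continuous_on continuous_on_eq_continuous_at centre_in_ball open_ball by metis

section \<open>The fold normal form at its double points\<close>

locale double_fold =
  fixes \<Phi> :: "complex ^ 2 \<Rightarrow> complex ^ 3" and g d :: "complex ^ 2 \<Rightarrow> complex"
  assumes g: "holo_at g 0"
    and d_eq: "\<forall>\<^sub>F x in nhds 0. d x = g (vector [x $ 1, (x $ 2)\<^sup>2])"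
    and d_axis: "\<not> germ (\<lambda>x. x $ 2) dvd germ d"
    and \<Phi>_eq: "\<forall>\<^sub>F x in nhds 0. \<Phi> x = vector [x $ 1, (x $ 2)\<^sup>2, x $ 2 * d x]"
begin

lemma d: "holo_at d 0"
proof (rule holo_at_cong)
  show "\<forall>\<^sub>F x in nhds 0. g (vector [x $ 1, (x $ 2)\<^sup>2]) = d x"
    using d_eq by eventually_elim simp
qed (rule holo_at_comp_square[OF g])

lemma pullback_d_nonzero: "pullback saxis (germ d) \<noteq> 0"
  using dvd_of_vanish_on_axis[OF d] d_axis pullback_eq_0_iff[OF arc_saxis d] by blast

text \<open>Collects what is differentiated at a point \<open>x\<close>. The equation for \<Phi> is
  kept in a neighbourhood of \<open>x\<close>, since the value at \<open>x\<close> alone says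
  nothing about derivatives. The factor \<open>2 * x $ 2\<close> in \<open>Ld\<close> comes from
  \<open>t \<mapsto> t^2\<close>.\<close>

definition good :: "complex ^ 2 \<Rightarrow> (complex ^ 2 \<Rightarrow> complex) \<Rightarrow> (complex ^ 2 \<Rightarrow> complex) \<Rightarrow> bool" where
  "good x Lg Ld \<longleftrightarrow> cdiff_at g Lg (vector [x $ 1, (x $ 2)\<^sup>2]) \<and> cdiff_at d Ld x \<and>
     (\<forall>v. Ld v = v $ 1 * Lg (axis 1 1) + 2 * x $ 2 * v $ 2 * Lg (axis 2 1)) \<and>
     d x = g (vector [x $ 1, (x $ 2)\<^sup>2]) \<and>
     (\<forall>\<^sub>F x' in nhds x. \<Phi> x' = vector [x' $ 1, (x' $ 2)\<^sup>2, x' $ 2 * d x'])"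

text \<open>The formula for \<open>Ld\<close> is the chain rule for \<open>d x = g (s, t^2)\<close>
  along the lines through \<open>x\<close>, read off by uniqueness of derivatives.\<close>

lemma eventually_good: "\<forall>\<^sub>F x in nhds 0. \<exists>Lg Ld. good x Lg Ld"
proof -
  have "((\<lambda>x :: complex ^ 2. vector [x $ 1, (x $ 2)\<^sup>2]) \<longlongrightarrow> (0 :: complex ^ 2)) (nhds 0)"
    using tendsto_vector_2[OF tendsto_nth_0[of 1] tendsto_nth_sq_0[of 2]] by simp
  from eventually_compose_filterlim[OF g[unfolded holo_at_iff] this]
  have 1: "\<forall>\<^sub>F x in nhds (0 :: complex ^ 2). \<exists>Lg. cdiff_at g Lg (vector [x $ 1, (x $ 2)\<^sup>2])" .
  have 2: "\<forall>\<^sub>F x in nhds 0. \<forall>\<^sub>F x' in nhds x. d x' = g (vector [x' $ 1, (x' $ 2)\<^sup>2])"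
    using d_eq by (subst eventually_eventually)
  have 3: "\<forall>\<^sub>F x in nhds 0. \<forall>\<^sub>F x' in nhds x. \<Phi> x' = vector [x' $ 1, (x' $ 2)\<^sup>2, x' $ 2 * d x']"
    using \<Phi>_eq by (subst eventually_eventually)
  show ?thesis
    using 1 2 3 d[unfolded holo_at_iff]
  proof eventually_elim
    case (elim x)
    obtain Lg where Lg: "cdiff_at g Lg (vector [x $ 1, (x $ 2)\<^sup>2])" using elim by blast
    obtain Ld where Ld: "cdiff_at d Ld x" using elim by blast
    have "Ld v = v $ 1 * Lg (axis 1 1) + 2 * x $ 2 * v $ 2 * Lg (axis 2 1)" for v
    proof -
      let ?\<gamma> = "\<lambda>z. vector [(x + z *s v) $ 1, ((x + z *s v) $ 2)\<^sup>2] :: complex ^ 2"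
      have "((\<lambda>z. g (?\<gamma> z)) has_field_derivative Lg (vector [v $ 1, 2 * x $ 2 * v $ 2])) (at 0)"
      proof (rule cdiff_at_chain[where \<gamma>="?\<gamma>"])
        show "cdiff_at g Lg (?\<gamma> 0)" using Lg by simp
        fix i :: 2
        show "((\<lambda>z. ?\<gamma> z $ i) has_field_derivative vector [v $ 1, 2 * x $ 2 * v $ 2] $ i) (at 0)"
          using exhaust_2[of i] by (auto intro!: derivative_eq_intros)
      qed
      moreover have "\<forall>\<^sub>F z in nhds 0. d (x + z *s v) = g (?\<gamma> z)"
        using eventually_compose_filterlim[OF elim(2) tendsto_line] .
      ultimately have "((\<lambda>z. d (x + z *s v)) has_field_derivative Lg (vector [v $ 1, 2 * x $ 2 * v $ 2])) (at 0)"
        by (subst DERIV_cong_ev[OF refl _ refl]) auto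
      from DERIV_unique[OF cdiff_at_line[OF Ld] this]
      have "Ld v = Lg (vector [v $ 1, 2 * x $ 2 * v $ 2])" .
      also have "vector [v $ 1, 2 * x $ 2 * v $ 2] =
          v $ 1 *s axis 1 1 + (2 * x $ 2 * v $ 2) *s (axis 2 1 :: complex ^ 2)"
        by (simp add: vec_eq_iff forall_2 axis_def)
      also have "Lg \<dots> = v $ 1 * Lg (axis 1 1) + 2 * x $ 2 * v $ 2 * Lg (axis 2 1)"
        by (simp add: cdiff_at_add[OF Lg] cdiff_at_scale[OF Lg])
      finally show ?thesis .
    qed
    then show ?case
      unfolding good_def using Lg Ld elim(3) eventually_nhds_x_imp_x[OF elim(2)] by blast
  qed
qed

text \<open>Transversality of \<open>H\<close> forces \<open>d\<close> to be reduced along the double curve.\<close>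

lemma beta_value:
  assumes good: "\<And>x. x \<in> ball 0 \<rho> \<Longrightarrow> (\<exists>Lg Ld. good x Lg Ld) \<and>
        (\<forall>\<^sub>F x' in nhds x. H (\<Phi> x') = d x' * dsharp x') \<and> (\<exists>Ls. cdiff_at dsharp Ls x)"
    and LH: "cdiff_at H LH q" and H1: "\<exists>v. LH v \<noteq> 0"
    and H2: "\<And>x. x \<in> ball 0 \<rho> \<Longrightarrow> \<Phi> x = q \<Longrightarrow>
       {u + w | u w. LH u = 0 \<and> w \<in> range (frechet_derivative \<Phi> (at x))} = UNIV"
    and f: "holo_at f q" and \<beta>: "beta_product \<Phi> f H \<rho> q c"
  shows "\<exists>x\<in>ball 0 \<rho>. x $ 2 \<noteq> 0 \<and> q = vector [x $ 1, (x $ 2)\<^sup>2, 0] \<and>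
     c * (- 2 * (x $ 2)\<^sup>2 * second_vertical_derivative f q) = dsharp x * dsharp (vector [x $ 1, - x $ 2]) \<and>
     (\<exists>Lg w. cdiff_at g Lg (vector [x $ 1, (x $ 2)\<^sup>2]) \<and> Lg w \<noteq> 0)"
proof -
  obtain x y f1 f2 \<beta>1 \<beta>2 where xy: "x \<in> ball 0 \<rho>" "y \<in> ball 0 \<rho>" "x \<noteq> y" "\<Phi> x = q" "\<Phi> y = q"
    and f12: "holo_at f1 q" "holo_at f2 q" "\<forall>\<^sub>F z in nhds q. f z = f1 z * f2 z"
    and f1: "\<forall>\<^sub>F x' in nhds x. f1 (\<Phi> x') = 0" and f2: "\<forall>\<^sub>F y' in nhds y. f2 (\<Phi> y') = 0"
    and dH: "\<And>v. frechet_derivative H (at q) v =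
             \<beta>1 * frechet_derivative f1 (at q) v + \<beta>2 * frechet_derivative f2 (at q) v"
    and c: "c = \<beta>1 * \<beta>2"
    using \<beta> unfolding beta_product_def by blast
  obtain Lg Ld where gx: "good x Lg Ld" using good[OF xy(1)] by blast
  obtain Lg' Ld' where gy: "good y Lg' Ld'" using good[OF xy(2)] by blast
  have \<Phi>x: "\<forall>\<^sub>F x' in nhds x. \<Phi> x' = vector [x' $ 1, (x' $ 2)\<^sup>2, x' $ 2 * d x']"
    and \<Phi>y: "\<forall>\<^sub>F x' in nhds y. \<Phi> x' = vector [x' $ 1, (x' $ 2)\<^sup>2, x' $ 2 * d x']"
    using gx gy by (auto simp: good_def)
  have qx: "q = vector [x $ 1, (x $ 2)\<^sup>2, x $ 2 * d x]" and qy: "q = vector [y $ 1, (y $ 2)\<^sup>2, y $ 2 * d y]"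
    using eventually_nhds_x_imp_x[OF \<Phi>x] eventually_nhds_x_imp_x[OF \<Phi>y] xy by auto
  have eqs: "x $ 1 = y $ 1" "(x $ 2)\<^sup>2 = (y $ 2)\<^sup>2" "x $ 2 * d x = y $ 2 * d y"
    using arg_cong[OF trans[OF qx[symmetric] qy], of "\<lambda>v :: complex ^ 3. v $ 1"]
      arg_cong[OF trans[OF qx[symmetric] qy], of "\<lambda>v :: complex ^ 3. v $ 2"]
      arg_cong[OF trans[OF qx[symmetric] qy], of "\<lambda>v :: complex ^ 3. v $ 3"] by simp_all
  \<comment> \<open>Equal images leave only \<open>t\<close> and \<open>- t\<close> for the second
    coordinate, and distinctness rules out equal signs.\<close>
  have y2: "y $ 2 = - x $ 2"
  proof -
    have "y $ 2 \<noteq> x $ 2" using xy(3) eqs(1) by (auto simp: vec_eq_iff forall_2)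
    then show ?thesis using eqs(2) by (metis power2_eq_iff)
  qed
  then have x2: "x $ 2 \<noteq> 0" using xy(3) eqs(1) by (auto simp: vec_eq_iff forall_2)
  have yv: "y = vector [x $ 1, - x $ 2]" using eqs(1) y2 by (simp add: vec_eq_iff forall_2)
  have dxy: "d y = d x" using gx gy eqs by (simp add: good_def)
  \<comment> \<open>\<open>d\<close> is even in \<open>t\<close>, so the third coordinates
    \<open>t * d\<close> and \<open>- t * d\<close> agree only where \<open>d\<close>
    vanishes.\<close>
  have dx: "d x = 0" using eqs(3) x2 unfolding y2 dxy by simp
  have dy: "d y = 0" using dx dxy by simp
  have q0: "q = vector [x $ 1, (x $ 2)\<^sup>2, 0]" using qx dx by simp
  have Lg: "cdiff_at g Lg (vector [x $ 1, (x $ 2)\<^sup>2])" using gx by (simp add: good_def)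
  have "cdiff_at g Lg' (vector [x $ 1, (x $ 2)\<^sup>2])" using gy eqs by (simp add: good_def)
  then have LL: "Lg' = Lg" using cdiff_at_frechet[OF Lg] cdiff_at_frechet by metis
  define G1 where "G1 = Lg (axis 1 1)"
  define G2 where "G2 = Lg (axis 2 1)"
  have Ld: "cdiff_at d Ld x" "\<And>v. Ld v = v $ 1 * G1 + 2 * x $ 2 * v $ 2 * G2"
    and Ld': "cdiff_at d Ld' y" "\<And>v. Ld' v = v $ 1 * G1 + 2 * y $ 2 * v $ 2 * G2"
    using gx gy by (simp_all add: good_def G1_def G2_def LL)
  obtain L1 L2 where L: "cdiff_at f1 L1 q" "cdiff_at f2 L2 q"
    using f12(1,2)[unfolded holo_at_iff, THEN eventually_nhds_x_imp_x] by blast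
  have f0: "f1 q = 0" "f2 q = 0"
    using eventually_nhds_x_imp_x[OF f1] eventually_nhds_x_imp_x[OF f2] xy by auto
  have dH': "LH v = \<beta>1 * L1 v + \<beta>2 * L2 v" for v
    using dH[of v] by (simp add: cdiff_at_frechet[OF LH] cdiff_at_frechet[OF L(1)] cdiff_at_frechet[OF L(2)])
  note V1 = vanishing_on_branch[OF \<Phi>x Ld(1) dx Ld(2) x2 L(1)[folded xy(4)] f1]
  have "y $ 2 \<noteq> 0" using y2 x2 by simp
  note V2 = vanishing_on_branch[OF \<Phi>y Ld'(1) dy Ld'(2) this L(2)[folded xy(5)] f2]
  \<comment> \<open>The equation between \<open>H\<close> composed with \<Phi> and
    \<open>d * dsharp\<close>, differentiated at a zero of \<open>d\<close>: the term with the
    derivative of \<open>dsharp\<close> drops out.\<close>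
  have key: "LH (vector [v $ 1, 2 * z $ 2 * v $ 2, z $ 2 * Lz v]) = Lz v * dsharp z"
    if z: "z \<in> ball 0 \<rho>" "\<Phi> z = q" "d z = 0" "cdiff_at d Lz z"
      "\<forall>\<^sub>F x' in nhds z. \<Phi> x' = vector [x' $ 1, (x' $ 2)\<^sup>2, x' $ 2 * d x']" for z Lz and v :: "complex ^ 2"
  proof -
    obtain Ls where Ls: "cdiff_at dsharp Ls z" and ev: "\<forall>\<^sub>F x' in nhds z. H (\<Phi> x') = d x' * dsharp x'"
      using good[OF z(1)] by blast
    have "((\<lambda>w. d (z + w *s v) * dsharp (z + w *s v)) has_field_derivative Lz v * dsharp z) (at 0)"
      using DERIV_mult[OF cdiff_at_line[OF z(4), of v] cdiff_at_line[OF Ls, of v]] z(3) by simp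
    moreover have "\<forall>\<^sub>F w in nhds 0. H (\<Phi> (z + w *s v)) = d (z + w *s v) * dsharp (z + w *s v)"
      using eventually_compose_filterlim[OF ev tendsto_line] .
    ultimately have "((\<lambda>w. H (\<Phi> (z + w *s v))) has_field_derivative Lz v * dsharp z) (at 0)"
      by (subst DERIV_cong_ev[OF refl _ refl]) auto
    from DERIV_unique[OF cdiff_comp_line[OF z(5,4,3) LH[folded z(2)]] this] show ?thesis .
  qed
  note Kx = key[OF xy(1,4) dx Ld(1) \<Phi>x] and Ky = key[OF xy(2,5) dy Ld'(1) \<Phi>y]
  \<comment> \<open>If the differential of \<open>g\<close> vanished, the image of the differential
    of \<Phi> would lie in the kernel of that of \<open>H\<close>, and the two could not span the
    space.\<close>
  have Lg0: "\<exists>w. Lg w \<noteq> 0"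
  proof (rule ccontr)
    assume "\<not> (\<exists>w. Lg w \<noteq> 0)"
    then have G0: "G1 = 0" "G2 = 0" by (auto simp: G1_def G2_def)
    then have Ld0: "Ld v = 0" for v by (simp add: Ld(2))
    define L\<Phi> where "L\<Phi> = (\<lambda>(i::3) v :: complex ^ 2. (vector [v $ 1, 2 * x $ 2 * v $ 2, 0] :: complex ^ 3) $ i)"
    have "((\<lambda>x. vector [x $ 1, (x $ 2)\<^sup>2, x $ 2 * d x] :: complex ^ 3) has_derivative (\<lambda>v. \<chi> i. L\<Phi> i v)) (at x)"
    proof (rule has_derivative_cvec_general)
      fix i :: 3
      have n: "((\<lambda>x :: complex ^ 2. x $ j) has_derivative (\<lambda>v. v $ j)) (at x)" for j
        using cdiff_at_nth[of j x] by (simp add: cdiff_at_def)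
      have dd: "(d has_derivative Ld) (at x)" using Ld(1) by (simp add: cdiff_at_def)
      have "((\<lambda>x. (x $ 2)\<^sup>2) has_derivative (\<lambda>v. 2 * x $ 2 * v $ 2)) (at x)"
        by (rule has_derivative_eq_rhs[OF has_derivative_power[OF n]]) (simp add: fun_eq_iff mult_ac)
      moreover have "((\<lambda>x. x $ 2 * d x) has_derivative (\<lambda>v. 0)) (at x)"
        by (rule has_derivative_eq_rhs[OF has_derivative_mult[OF n dd]]) (simp add: fun_eq_iff dx Ld0)
      ultimately show "((\<lambda>x. (vector [x $ 1, (x $ 2)\<^sup>2, x $ 2 * d x] :: complex ^ 3) $ i) has_derivative L\<Phi> i) (at x)"
        using exhaust_3[of i] n by (auto simp: L\<Phi>_def)
    qed
    then have "(\<Phi> has_derivative (\<lambda>v. \<chi> i. L\<Phi> i v)) (at x)"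
      by (rule has_derivative_transform_eventually)
         (use \<Phi>x eventually_nhds_x_imp_x[OF \<Phi>x] in \<open>auto simp: eventually_at_filter elim: eventually_mono\<close>)
    then have fr: "frechet_derivative \<Phi> (at x) = (\<lambda>v. \<chi> i. L\<Phi> i v)" using frechet_derivative_at by metis
    have "(\<chi> i. L\<Phi> i v) = vector [v $ 1, 2 * x $ 2 * v $ 2, x $ 2 * Ld v]" for v
      by (simp add: vec_eq_iff L\<Phi>_def Ld0)
    then have "LH (frechet_derivative \<Phi> (at x) v) = 0" for v
      using Kx[of v] by (simp add: fr Ld0)
    then have "LH z = 0" if "z \<in> {u + w | u w. LH u = 0 \<and> w \<in> range (frechet_derivative \<Phi> (at x))}" for z
      using that by (auto simp: cdiff_at_add[OF LH])
    then show False using H2[OF xy(1,4)] H1 by blast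
  qed
  have GG: "G1 \<noteq> 0 \<or> G2 \<noteq> 0"
  proof (rule ccontr)
    assume n: "\<not> (G1 \<noteq> 0 \<or> G2 \<noteq> 0)"
    have "Lg w = 0" for w
    proof -
      have "w = w $ 1 *s axis 1 1 + w $ 2 *s (axis 2 1 :: complex ^ 2)"
        by (simp add: vec_eq_iff forall_2 axis_def)
      then have "Lg w = w $ 1 * Lg (axis 1 1) + w $ 2 * Lg (axis 2 1)"
        using cdiff_at_add[OF Lg] cdiff_at_scale[OF Lg] by metis
      then show ?thesis using n by (simp add: G1_def G2_def)
    qed
    with Lg0 show False by blast
  qed
  define t where "t = x $ 2"
  define u1 where "u1 = L1 e3"
  define u2 where "u2 = L2 e3"
  \<comment> \<open>By \<open>vanishing_on_branch\<close> the linear term of each factor is its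
    vertical derivative times \<open>w3 - t * G\<close> or \<open>w3 + t * G\<close>, where
    \<open>G\<close> is the differential of \<open>g\<close> applied to
    \<open>(w1, w2)\<close>.\<close>
  have LHw: "LH w = \<beta>1 * u1 * (w $ 3 - t * (G1 * w $ 1 + G2 * w $ 2)) + \<beta>2 * u2 * (w $ 3 + t * (G1 * w $ 1 + G2 * w $ 2))" for w
    unfolding dH' cdiff_at_vec3[OF L(1), of w] cdiff_at_vec3[OF L(2), of w] V1 V2 y2 t_def u1_def u2_def
    by (simp add: algebra_simps)
  \<comment> \<open>On tangent vectors at \<open>x\<close> the first factor contributes nothing,
    being zero on that branch. The second test vector is scaled so that \<open>Ld\<close> takes the
    value \<open>G2\<close> on it.\<close>
  have E2: "(2 * t * \<beta>2 * u2) * G1 = dsharp x * G1" "(2 * t * \<beta>2 * u2) * G2 = dsharp x * G2"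
    using Kx[of "vector [1, 0]"] Kx[of "vector [0, 1 / (2 * t)]"] x2
    by (simp_all add: LHw Ld(2) t_def[symmetric] algebra_simps)
  have E1: "(- 2 * t * \<beta>1 * u1) * G1 = dsharp y * G1" "(- 2 * t * \<beta>1 * u1) * G2 = dsharp y * G2"
    using Ky[of "vector [1, 0]"] Ky[of "vector [0, 1 / (2 * t)]"] x2
    by (simp_all add: LHw Ld'(2) y2 t_def[symmetric] algebra_simps)
  have cancel: "A = B" if "A * G1 = B * G1" "A * G2 = B * G2" for A B
    using that GG by auto
  have "dsharp x * dsharp y = (2 * t * \<beta>2 * u2) * (- 2 * t * \<beta>1 * u1)"
    unfolding cancel[OF E2] cancel[OF E1] ..
  also have "\<dots> = \<beta>1 * \<beta>2 * (- 2 * t\<^sup>2 * (2 * u1 * u2))"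
    by (simp add: power2_eq_square)
  also have "2 * u1 * u2 = second_vertical_derivative f q"
    using second_vertical_derivative_mult[OF f12 f0 L] by (simp add: u1_def u2_def)
  finally have "c * (- 2 * (x $ 2)\<^sup>2 * second_vertical_derivative f q) = dsharp x * dsharp (vector [x $ 1, - x $ 2])"
    by (simp add: c yv t_def)
  then show ?thesis using xy(1) x2 q0 Lg Lg0 by (intro bexI[of _ x]) auto
qed

text \<open>The image has multiplicity two along the vertical direction: its equation divides
  \<open>z\<^sup>2 - y g\<^sup>2\<close>, and a surface that is a graph over the \<open>(x, y)\<close>-plane would force \<open>t d = - t d\<close>.\<close>

lemma second_vertical_derivative_nonzero:
  assumes f: "reduced_image_equation \<Phi> f"
  shows "second_vertical_derivative f 0 \<noteq> 0"
proof -
  have fh: "holo_at f 0" using f by (simp add: reduced_image_equation_def)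
  have f\<Phi>: "\<forall>\<^sub>F x in nhds 0. f (\<Phi> x) = 0"
    using f fh dvd_refl[of "germ f"] unfolding reduced_image_equation_def by blast
  let ?k = "\<lambda>x h. f (x + h *s e3)"
  obtain r where r: "r > 0" and hol: "\<And>x. x \<in> ball 0 r \<Longrightarrow> ?k x holomorphic_on ball 0 r"
    and c1: "continuous_on (ball 0 r \<times> ball 0 r) (\<lambda>(x, h). deriv (?k x) h)"
    using holo_at_line_derivs[OF fh, of e3] by metis
  have \<Phi>0: "\<Phi> 0 = 0"
    using eventually_nhds_x_imp_x[OF \<Phi>_eq] by (simp add: vec_eq_iff forall_3)
  have f0: "f 0 = 0" using eventually_nhds_x_imp_x[OF f\<Phi>] \<Phi>0 by simp
  \<comment> \<open>Otherwise \<open>f\<close> would be injective in the vertical variable near 0,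
    although it vanishes at both heights \<open>t * d\<close> and \<open>- t * d\<close> over the
    same point.\<close>
  have d1: "deriv (?k 0) 0 = 0"
  proof (rule ccontr)
    define a where "a = deriv (?k 0) 0"
    assume "deriv (?k 0) 0 \<noteq> 0"
    then have a: "norm a / 2 > 0" by (simp add: a_def)
    have "isCont (\<lambda>(x, h). deriv (?k x) h) (0, 0)"
      using c1 r by (subst (asm) continuous_on_eq_continuous_at) (auto intro: open_Times)
    then have "\<forall>\<^sub>F p in nhds (0, 0). dist ((\<lambda>(x, h). deriv (?k x) h) p) a < norm a / 2"
      using tendstoD[OF isCont_tendsto_nhds a] by (fastforce simp: a_def)
    then obtain \<epsilon> where \<epsilon>: "\<epsilon> > 0" "\<And>x h. dist (x, h) (0, 0) < \<epsilon> \<Longrightarrow> dist (deriv (?k x) h) a < norm a / 2"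
      unfolding eventually_nhds_metric by auto
    define \<eta> where "\<eta> = min r (\<epsilon> / 2)"
    have \<eta>: "\<eta> > 0" "\<eta> \<le> r" "\<eta> \<le> \<epsilon> / 2" using r \<epsilon> by (auto simp: \<eta>_def)
    have bd: "norm (deriv (?k x) h - a) \<le> norm a / 2" if "x \<in> ball 0 \<eta>" "h \<in> ball 0 \<eta>" for x h
    proof -
      have "dist (x, h) (0, 0) \<le> norm x + norm h" using norm_Pair_le[of x h] by (simp add: dist_norm)
      then show ?thesis using \<epsilon>(2)[of x h] that \<eta> by (auto simp: dist_norm)
    qed
    have inj: "h = h'" if x: "x \<in> ball 0 \<eta>" and h: "h \<in> ball 0 \<eta>" "h' \<in> ball 0 \<eta>" and eq: "?k x h = ?k x h'" for x h h'
    proof -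
      have xr: "x \<in> ball 0 r" using x \<eta> by auto
      have "norm (?k x h - ?k x h' - a * (h - h')) \<le> norm a / 2 * norm (h - h')"
      proof (rule deriv_near_constant[where S="ball 0 \<eta>" and f'="deriv (?k x)"])
        show "(?k x has_field_derivative deriv (?k x) z) (at z)" if "z \<in> ball 0 \<eta>" for z
          using holomorphic_derivI[OF hol[OF xr] open_ball, of z] that \<eta> by auto
      qed (use bd x h in auto)
      then have "norm a * norm (h - h') \<le> norm a / 2 * norm (h - h')" using eq by (simp add: norm_mult)
      then have "norm a / 2 * norm (h - h') \<le> 0" by (simp add: field_simps)
      then show ?thesis using a by (simp add: mult_le_0_iff)
    qed
    define m where "m = (\<lambda>x :: complex ^ 2. vector [x $ 1, - x $ 2] :: complex ^ 2)"
    have lim1: "((\<lambda>x :: complex ^ 2. m x) \<longlongrightarrow> (0 :: complex ^ 2)) (nhds 0)"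
      unfolding m_def using tendsto_vector_2[OF tendsto_nth_0[of 1] tendsto_minus[OF tendsto_nth_0[of 2]]] by simp
    define Q where "Q = (\<lambda>x :: complex ^ 2. vector [x $ 1, (x $ 2)\<^sup>2, 0] :: complex ^ 3)"
    have lim2: "((\<lambda>x :: complex ^ 2. Q x) \<longlongrightarrow> (0 :: complex ^ 3)) (nhds 0)"
      unfolding Q_def using tendsto_vector_3[OF tendsto_nth_0[of 1] tendsto_nth_sq_0[of 2] tendsto_const[of 0]] by simp
    have "(d \<longlongrightarrow> d 0) (nhds 0)" by (rule isCont_tendsto_nhds[OF isCont_of_holo_at[OF d]])
    then have lim3: "((\<lambda>x. x $ 2 * d x) \<longlongrightarrow> 0) (nhds 0)"
      using tendsto_mult[OF tendsto_nth_0[of 2]] by fastforce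
    have ball_ev: "\<forall>\<^sub>F y in nhds 0. y \<in> ball (0::'z::real_normed_vector) \<eta>"
      using \<eta> by (intro eventually_nhds_in_open) auto
    have "\<forall>\<^sub>F x in nhds 0. x $ 2 * d x = 0"
      using f\<Phi> \<Phi>_eq d_eq eventually_compose_filterlim[OF f\<Phi> lim1] eventually_compose_filterlim[OF \<Phi>_eq lim1]
        eventually_compose_filterlim[OF d_eq lim1]
        eventually_compose_filterlim[OF ball_ev lim2] eventually_compose_filterlim[OF ball_ev lim3]
    proof eventually_elim
      case (elim x)
      have dm: "d (m x) = d x" using elim by (simp add: m_def)
      have 1: "\<Phi> x = Q x + (x $ 2 * d x) *s e3"
        using elim by (simp add: vec_eq_iff forall_3 axis_def Q_def)
      have 2: "\<Phi> (m x) = Q x + (- (x $ 2 * d x)) *s e3"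
        using elim dm by (simp add: vec_eq_iff forall_3 axis_def Q_def m_def)
      have "x $ 2 * d x = - (x $ 2 * d x)"
      proof (rule inj[of "Q x"])
        show "x $ 2 * d x \<in> ball 0 \<eta>" "Q x \<in> ball 0 \<eta>" by (fact elim)+
        then show "- (x $ 2 * d x) \<in> ball 0 \<eta>" by simp
        show "f (Q x + (x $ 2 * d x) *s e3) = f (Q x + (- (x $ 2 * d x)) *s e3)"
          using elim(1,4) unfolding 1 2 by simp
      qed
      then have "x $ 2 * d x + x $ 2 * d x = 0" by (simp only: eq_neg_iff_add_eq_0)
      then have "2 * (x $ 2 * d x) = 0" by (simp only: mult_2)
      then show ?case by (simp only: mult_eq_0_iff) simp
    qed
    \<comment> \<open>This gives \<open>d = 0\<close> only off the axis; on the axis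
      \<open>d\<close> vanishes by continuity in \<open>t\<close>, against the assumption that
      \<open>t\<close> does not divide \<open>d\<close>.\<close>
    then obtain e where e: "e > 0" "\<And>x. norm x < e \<Longrightarrow> x $ 2 * d x = 0"
      unfolding eventually_nhds_metric by auto
    obtain r2 where r2: "r2 > 0" "hol2 r2 (\<lambda>s t. d (vector [s, t]))" using holo_at_imp_hol2[OF d] .
    define e' where "e' = min r2 (e / 2)"
    have e': "e' > 0" "e' \<le> r2" "e' \<le> e / 2" using r2 e by (auto simp: e'_def)
    have "d (saxis s) = 0" if s: "s \<in> ball 0 e'" for s
    proof -
      have "isCont (\<lambda>t. d (vector [s, t])) 0"
        using holomorphic_on_imp_continuous_on[OF hol2D(2)[OF r2(2), of s]] s e' r2(1)
        by (simp add: continuous_on_eq_continuous_at)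
      then have l: "((\<lambda>t. d (vector [s, t])) \<longlongrightarrow> d (vector [s, 0])) (at 0)" unfolding isCont_def .
      have "d (vector [s, t]) = 0" if "norm t < e'" "t \<noteq> 0" for t
        using e(2)[of "vector [s, t]"] norm_vector_2_le[of s t] that s e' by simp
      then have "\<forall>\<^sub>F t in at 0. d (vector [s, t]) = 0"
        unfolding eventually_at using e'(1) by (intro exI[of _ e']) simp
      from tendsto_unique[OF at_neq_bot l tendsto_eventually[OF this]]
      show ?thesis by (simp add: saxis_def)
    qed
    then have "\<forall>\<^sub>F s in nhds 0. d (saxis s) = 0"
      unfolding eventually_nhds_metric using e'(1) by (intro exI[of _ e']) simp
    then show False using pullback_d_nonzero pullback_eq_0_iff[OF arc_saxis d] by blast
  qed
  \<comment> \<open>Vanishes on the image, hence is a multiple of \<open>f\<close>, and restricts to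
    \<open>z^2\<close> on the vertical axis.\<close>
  define h where "h = (\<lambda>x :: complex ^ 3. (x $ 3)\<^sup>2 - x $ 2 * (g (vector [x $ 1, x $ 2]))\<^sup>2)"
  have gh: "holo_at (\<lambda>x :: complex ^ 3. g (vector [x $ 1, x $ 2])) 0"
  proof -
    have "((\<lambda>x :: complex ^ 3. vector [x $ 1, x $ 2]) \<longlongrightarrow> (0 :: complex ^ 2)) (nhds 0)"
      using tendsto_vector_2[OF tendsto_nth_0[of 1] tendsto_nth_0[of 2]] by simp
    from eventually_compose_filterlim[OF g[unfolded holo_at_iff] this]
    show ?thesis
      unfolding holo_at_iff
    proof eventually_elim
      case (elim x)
      then obtain L where L: "cdiff_at g L (vector [x $ 1, x $ 2])" by blast
      define i2 where "i2 = (\<lambda>v :: complex ^ 3. vector [v $ 1, v $ 2] :: complex ^ 2)"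
      have "(i2 has_derivative (\<lambda>v. \<chi> i. i2 v $ i)) (at x)"
      proof (rule has_derivative_cvec_general)
        fix i :: 2
        show "((\<lambda>x. i2 x $ i) has_derivative (\<lambda>v. i2 v $ i)) (at x)"
          using exhaust_2[of i] cdiff_at_nth[of 1 x] cdiff_at_nth[of 2 x] by (auto simp: i2_def cdiff_at_def)
      qed
      then have "(i2 has_derivative i2) (at x)" by simp
      from has_derivative_compose[OF this, of g L] L
      have "((\<lambda>x. g (i2 x)) has_derivative (\<lambda>v. L (i2 v))) (at x)" by (simp add: cdiff_at_def i2_def)
      moreover have "L (i2 (c *s v)) = c * L (i2 v)" for c v
      proof -
        have "i2 (c *s v) = c *s i2 v" by (simp add: i2_def vec_eq_iff forall_2)
        then show ?thesis using cdiff_at_scale[OF L] by simp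
      qed
      ultimately show ?case unfolding cdiff_at_def i2_def by blast
    qed
  qed
  have hh: "holo_at h 0"
    unfolding h_def power2_eq_square by (intro holo_at_diff holo_at_mult gh holo_at_nth)
  have "\<forall>\<^sub>F x in nhds 0. h (\<Phi> x) = 0"
    using \<Phi>_eq d_eq
  proof eventually_elim
    case (elim x)
    then show ?case by (simp add: h_def power_mult_distrib)
  qed
  then have "germ f dvd germ h"
    using f hh unfolding reduced_image_equation_def by blast
  then obtain A where A: "holo_at A 0" "\<forall>\<^sub>F x in nhds 0. h x = f x * A x"
    using germ_dvd_iff[OF fh hh] by blast
  have lim: "((\<lambda>z. 0 + z *s e3) \<longlongrightarrow> (0 :: complex ^ 3)) (nhds 0)" by (rule tendsto_line)
  have hz: "h (0 + z *s e3) = z ^ 2" for z by (simp add: h_def axis_def)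
  have ev: "\<forall>\<^sub>F z in nhds 0. z ^ 2 = ?k 0 z * A (0 + z *s e3)"
    using eventually_compose_filterlim[OF A(2) lim] unfolding hz .
  let ?F = "fps_expansion (?k 0) 0"
  note F = cdiff_line_fps[OF fh, of e3] and FA = cdiff_line_fps[OF A(1), of e3]
  have "(\<lambda>z. z ^ 2) has_fps_expansion ?F * fps_expansion (\<lambda>z. A (0 + z *s e3)) 0"
    using has_fps_expansion_cong[OF ev refl] has_fps_expansion_mult[OF F FA] by simp
  from fps_expansion_unique_complex[OF has_fps_expansion_fps_X_power this]
  have X2: "fps_X ^ 2 = ?F * fps_expansion (\<lambda>z. A (0 + z *s e3)) 0" .
  have F01: "?F $ 0 = 0" "?F $ 1 = 0"
    using f0 has_fps_expansion_imp_0_eq_fps_nth_0[OF F] d1 second_derivative_fps(2)[OF F] by simp_all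
  \<comment> \<open>On the vertical axis \<open>f\<close> has order at least 2 and divides a
    function of order 2.\<close>
  have "?F $ 2 \<noteq> 0"
  proof
    assume "?F $ 2 = 0"
    then have "(?F * fps_expansion (\<lambda>z. A (0 + z *s e3)) 0) $ 2 = 0"
      using F01 by (simp add: fps_mult_nth numeral_2_eq_2 sum.atLeast0_atMost_Suc)
    then show False unfolding X2[symmetric] by simp
  qed
  then show ?thesis
    using second_derivative_fps(1)[OF F] by (simp add: second_vertical_derivative_def)
qed

end

section \<open>Orders of vanishing\<close>

text \<open>The exponent is an integer, because \<beta>1\<beta>2 may have a pole. A limit replaces
  the series, because some of the functions compared are controlled only near 0 and not at
  0.\<close>

definition has_order :: "(complex \<Rightarrow> complex) \<Rightarrow> int \<Rightarrow> bool" where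
  "has_order f v \<longleftrightarrow> (\<exists>c. c \<noteq> 0 \<and> ((\<lambda>z. f z / z powi v) \<longlongrightarrow> c) (at 0))"

lemma eventually_at_0_nonzero: "\<forall>\<^sub>F z in at (0::complex). z \<noteq> 0"
  by (simp add: eventually_at_filter)

lemma has_order_cong:
  assumes "\<forall>\<^sub>F z in at 0. f z = h z" shows "has_order f v \<longleftrightarrow> has_order h v"
proof -
  have "\<forall>\<^sub>F z in at 0. f z / z powi v = h z / z powi v" using assms by eventually_elim simp
  then show ?thesis unfolding has_order_def by (simp only: tendsto_cong)
qed

lemma has_order_nonzero: "has_order f v \<Longrightarrow> \<forall>\<^sub>F z in at 0. f z \<noteq> 0"
  unfolding has_order_def by (auto dest!: tendsto_imp_eventually_ne elim: eventually_mono)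

lemma has_order_mult:
  assumes "has_order f v" "has_order h w" shows "has_order (\<lambda>z. f z * h z) (v + w)"
proof -
  obtain a b where ab: "a \<noteq> 0" "b \<noteq> 0" "((\<lambda>z. f z / z powi v) \<longlongrightarrow> a) (at 0)" "((\<lambda>z. h z / z powi w) \<longlongrightarrow> b) (at 0)"
    using assms unfolding has_order_def by blast
  have "\<forall>\<^sub>F z in at 0. (f z / z powi v) * (h z / z powi w) = f z * h z / z powi (v + w)"
    using eventually_at_0_nonzero by eventually_elim (simp add: power_int_add)
  from Lim_transform_eventually[OF tendsto_mult[OF ab(3,4)] this] ab(1,2)
  show ?thesis unfolding has_order_def by (intro exI[of _ "a * b"]) simp
qed

lemma has_order_0: "(f \<longlongrightarrow> c) (at 0) \<Longrightarrow> c \<noteq> 0 \<Longrightarrow> has_order f 0"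
  unfolding has_order_def by (intro exI[of _ c]) simp

lemma has_order_power: "has_order (\<lambda>z. z ^ k) (int k)"
proof -
  have "\<forall>\<^sub>F z in at 0. (1::complex) = z ^ k / z powi int k"
    using eventually_at_0_nonzero by eventually_elim simp
  from Lim_transform_eventually[OF tendsto_const this]
  show ?thesis unfolding has_order_def by (intro exI[of _ 1]) simp
qed

text \<open>The quotient for the smaller exponent is the other quotient times a positive power of
  \<open>z\<close>, so it would tend to 0.\<close>

lemma has_order_less:
  assumes "has_order f v" "has_order f w" shows "\<not> v < w"
proof
  assume vw: "v < w"
  obtain a b where ab: "a \<noteq> 0" "b \<noteq> 0" "((\<lambda>z. f z / z powi v) \<longlongrightarrow> a) (at 0)" "((\<lambda>z. f z / z powi w) \<longlongrightarrow> b) (at 0)"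
    using assms unfolding has_order_def by blast
  define k where "k = nat (w - v)"
  have k: "w = v + int k" "k > 0" using vw by (auto simp: k_def)
  have "\<forall>\<^sub>F z in at 0. (f z / z powi w) * z ^ k = f z / z powi v"
    using eventually_at_0_nonzero by eventually_elim (simp add: k(1) power_int_add)
  moreover have "((\<lambda>z. (f z / z powi w) * z ^ k) \<longlongrightarrow> b * 0 ^ k) (at 0)"
    by (intro tendsto_mult ab tendsto_power tendsto_ident_at)
  ultimately have "((\<lambda>z. f z / z powi v) \<longlongrightarrow> b * 0 ^ k) (at 0)"
    by (rule Lim_transform_eventually[rotated])
  from tendsto_unique[OF at_neq_bot ab(3) this] ab(1) k(2) show False by (simp add: power_0_left)
qed

lemma has_order_unique: "has_order f v \<Longrightarrow> has_order f w \<Longrightarrow> v = w"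
  using has_order_less[of f v w] has_order_less[of f w v] by linarith

lemma has_order_laurent:
  assumes "f has_laurent_expansion F" "F \<noteq> 0" shows "has_order f (fls_subdegree F)"
proof -
  define n where "n = fls_subdegree F"
  define c where "c = fls_nth F n"
  have c: "c \<noteq> 0" using assms(2) by (simp add: c_def n_def)
  have "f \<sim>[at 0] (\<lambda>z. c * z powi n)"
    using has_laurent_expansion_imp_asymp_equiv_0[OF assms(1)] by (simp add: c_def n_def)
  moreover have "\<forall>\<^sub>F z in at 0. f z \<noteq> 0 \<or> c * z powi n \<noteq> 0"
    using eventually_at_0_nonzero by eventually_elim (simp add: c)
  ultimately have "((\<lambda>z. f z / (c * z powi n)) \<longlongrightarrow> 1) (at 0)"
    by (rule asymp_equivD_strong)
  from tendsto_mult[OF tendsto_const[of c] this]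
  have "((\<lambda>z. f z / z powi n) \<longlongrightarrow> c) (at 0)" using c by simp
  with c show ?thesis unfolding has_order_def n_def by blast
qed

lemma has_order_fps:
  assumes "f has_fps_expansion F" "F \<noteq> 0" shows "has_order f (int (subdegree F))"
  using has_order_laurent[OF has_laurent_expansion_fps[OF assms(1)]] assms(2)
  by (simp add: fls_subdegree_fls_to_fps)

text \<open>\<open>\<phi>\<close> behaves like \<open>a * z\<close>, so only the leading coefficient
  changes, by the factor \<open>a powi v\<close>.\<close>

lemma has_order_compose:
  assumes f: "has_order f v" and \<phi>: "filterlim \<phi> (at 0) (at 0)" "((\<lambda>z. \<phi> z / z) \<longlongrightarrow> a) (at 0)" "a \<noteq> 0"
  shows "has_order (\<lambda>z. f (\<phi> z)) v"
proof -
  obtain c where c: "c \<noteq> 0" "((\<lambda>z. f z / z powi v) \<longlongrightarrow> c) (at 0)"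
    using f unfolding has_order_def by blast
  have "((\<lambda>z. f (\<phi> z) / \<phi> z powi v * (\<phi> z / z) powi v) \<longlongrightarrow> c * a powi v) (at 0)"
    by (intro tendsto_mult filterlim_compose[OF c(2) \<phi>(1)] tendsto_power_int \<phi>(2,3))
  moreover have "\<forall>\<^sub>F z in at 0. \<phi> z \<noteq> 0"
    using \<phi>(1) by (simp add: filterlim_at)
  then have "\<forall>\<^sub>F z in at 0. f (\<phi> z) / \<phi> z powi v * (\<phi> z / z) powi v = f (\<phi> z) / z powi v"
    using eventually_at_0_nonzero by eventually_elim (simp add: power_int_divide_distrib)
  ultimately have "((\<lambda>z. f (\<phi> z) / z powi v) \<longlongrightarrow> c * a powi v) (at 0)"
    by (rule Lim_transform_eventually)
  then show ?thesis unfolding has_order_def using c \<phi>(3) by (intro exI[of _ "c * a powi v"]) simp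
qed

lemma has_order_compose_linear:
  assumes f: "has_order f v" and a: "a \<noteq> 0" shows "has_order (\<lambda>z. f (a * z)) v"
proof (rule has_order_compose[OF f _ _ a])
  show "filterlim (\<lambda>z. a * z) (at 0) (at 0)"
    unfolding filterlim_at using a tendsto_mult[OF tendsto_const[of a] tendsto_ident_at[of 0 UNIV]]
    by (auto simp: eventually_at_filter)
  have "\<forall>\<^sub>F z in at 0. a = a * z / z" using eventually_at_0_nonzero by eventually_elim simp
  from Lim_transform_eventually[OF tendsto_const this] show "((\<lambda>z. a * z / z) \<longlongrightarrow> a) (at 0)" .
qed

lemma filterlim_square_at_0: "filterlim (\<lambda>z :: complex. z\<^sup>2) (at 0) (at 0)"
  unfolding filterlim_at using tendsto_power[OF tendsto_ident_at[of "0::complex" UNIV], of 2]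
  by (auto simp: eventually_at_filter)

lemma has_order_compose_square:
  assumes f: "has_order f v" shows "has_order (\<lambda>z. f (z\<^sup>2)) (2 * v)"
proof -
  obtain c where c: "c \<noteq> 0" "((\<lambda>z. f z / z powi v) \<longlongrightarrow> c) (at 0)"
    using f unfolding has_order_def by blast
  have eq: "(z\<^sup>2) powi v = z powi (2 * v)" for z :: complex
    using power_int_mult[of z 2 v] by simp
  from filterlim_compose[OF c(2) filterlim_square_at_0] c(1)
  show ?thesis unfolding has_order_def eq by blast
qed

text \<open>Write \<open>h = \<psi> ^ N\<close> with \<open>\<psi>\<close> locally biholomorphic,
  using an \<open>N\<close>-th root of the nonvanishing part of \<open>h\<close>; then
  \<open>\<phi>\<close> is the inverse of \<open>\<psi>\<close>. The number \<open>a\<close> is its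
  derivative at 0, recorded for \<open>has_order_compose\<close>.\<close>

lemma reparametrize:
  assumes h: "h analytic_on {0}" "h 0 = 0" "\<not> (\<forall>\<^sub>F z in nhds 0. h z = 0)"
  obtains N \<phi> r a where "N > 0" "r > 0" "\<phi> holomorphic_on ball 0 r" "\<phi> 0 = 0" "inj_on \<phi> (ball 0 r)"
    "\<And>\<theta>. \<theta> \<in> ball 0 r \<Longrightarrow> h (\<phi> \<theta>) = \<theta> ^ N" "((\<lambda>z. \<phi> z / z) \<longlongrightarrow> a) (at 0)" "a \<noteq> 0"
proof -
  obtain S where S: "open S" "0 \<in> S" "h holomorphic_on S" using h(1) unfolding analytic_at by blast
  let ?F = "fps_expansion h 0"
  have F: "h has_fps_expansion ?F" using h(1) by (rule analytic_at_imp_has_fps_expansion_0)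
  have F0: "?F \<noteq> 0"
  proof
    assume "?F = 0"
    with F have "h has_fps_expansion 0" by simp
    then show False using h(3) by (simp only: has_fps_expansion_0_iff)
  qed
  define N where "N = subdegree ?F"
  have nth: "(deriv ^^ k) h 0 = fact k * fps_nth ?F k" for k by (simp add: fps_expansion_def)
  have N: "N > 0"
  proof (rule ccontr)
    assume "\<not> N > 0"
    then have "fps_nth ?F 0 \<noteq> 0" using nth_subdegree_nonzero[OF F0] by (simp add: N_def)
    then show False using has_fps_expansion_imp_0_eq_fps_nth_0[OF F] h(2) by simp
  qed
  have "fps_nth ?F N \<noteq> 0" unfolding N_def using F0 by (rule nth_subdegree_nonzero)
  then have dN: "(deriv ^^ N) h 0 \<noteq> 0" unfolding nth by simp
  have d0: "(deriv ^^ i) h 0 = 0" if "i < N" for i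
    unfolding nth using nth_less_subdegree_zero[of i ?F] that by (simp add: N_def)
  obtain g r where g: "0 < r" "g holomorphic_on ball 0 r"
    "\<And>w. w \<in> ball 0 r \<Longrightarrow> h w - h 0 = ((w - 0) * g w) ^ N" "\<And>w. w \<in> ball 0 r \<Longrightarrow> g w \<noteq> 0"
    by (rule holomorphic_factor_order_of_zero_strong[OF S(3,1,2) N dN]) (use d0 in auto)
  define \<psi> where "\<psi> = (\<lambda>w. w * g w)"
  have \<psi>: "\<psi> holomorphic_on ball 0 r" unfolding \<psi>_def by (intro holomorphic_intros g)
  have g0: "(g has_field_derivative deriv g 0) (at 0)"
    using holomorphic_derivI[OF g(2) open_ball] g(1) by simp
  have "(\<psi> has_field_derivative g 0) (at 0)"
    unfolding \<psi>_def using DERIV_mult[OF DERIV_ident g0] by simp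
  then have d\<psi>: "deriv \<psi> 0 \<noteq> 0" using g(4)[of 0] g(1) by (simp add: DERIV_imp_deriv)
  have in0: "(0::complex) \<in> ball 0 r" using g(1) by simp
  obtain r1 where r1: "r1 > 0" "ball (0::complex) r1 \<subseteq> ball 0 r" "inj_on \<psi> (ball 0 r1)"
    by (rule has_complex_derivative_locally_injective[OF \<psi> in0 open_ball d\<psi>])
  have \<psi>1: "\<psi> holomorphic_on ball 0 r1" using \<psi> r1(2) by (rule holomorphic_on_subset)
  obtain \<phi> where \<phi>: "\<phi> holomorphic_on (\<psi> ` ball 0 r1)"
    "\<And>z. z \<in> ball 0 r1 \<Longrightarrow> deriv \<psi> z * deriv \<phi> (\<psi> z) = 1" "\<And>z. z \<in> ball 0 r1 \<Longrightarrow> \<phi> (\<psi> z) = z"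
    using holomorphic_has_inverse[OF \<psi>1 open_ball r1(3)] by metis
  have op: "open (\<psi> ` ball 0 r1)" by (rule open_mapping_thm3[OF \<psi>1 open_ball r1(3)])
  have \<psi>0: "\<psi> 0 = 0" by (simp add: \<psi>_def)
  then have "0 \<in> \<psi> ` ball 0 r1" using r1(1) by (metis centre_in_ball imageI)
  then obtain r2 where r2: "r2 > 0" "ball 0 r2 \<subseteq> \<psi> ` ball 0 r1" using op open_contains_ball by blast
  have \<phi>0: "\<phi> 0 = 0" using \<phi>(3)[of 0] \<psi>0 r1(1) by simp
  have \<phi>2: "\<phi> holomorphic_on ball 0 r2" using \<phi>(1) r2(2) by (rule holomorphic_on_subset)
  have inv: "\<phi> \<theta> \<in> ball 0 r1 \<and> \<psi> (\<phi> \<theta>) = \<theta>" if \<theta>: "\<theta> \<in> ball 0 r2" for \<theta>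
  proof -
    obtain z where "z \<in> ball 0 r1" "\<theta> = \<psi> z" using \<theta> r2(2) by blast
    then show ?thesis using \<phi>(3) by simp
  qed
  show thesis
  proof (rule that[OF N r2(1) \<phi>2 \<phi>0])
    show "inj_on \<phi> (ball 0 r2)" using inv by (metis inj_onI)
    show "h (\<phi> \<theta>) = \<theta> ^ N" if "\<theta> \<in> ball 0 r2" for \<theta>
    proof -
      have "\<phi> \<theta> \<in> ball 0 r" "\<psi> (\<phi> \<theta>) = \<theta>" using inv[OF that] r1(2) by auto
      then show ?thesis using g(3)[of "\<phi> \<theta>"] h(2) by (simp add: \<psi>_def)
    qed
    have "(\<phi> has_field_derivative deriv \<phi> 0) (at 0)"
      using holomorphic_derivI[OF \<phi>2 open_ball] r2(1) by simp
    then show "((\<lambda>z. \<phi> z / z) \<longlongrightarrow> deriv \<phi> 0) (at 0)"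
      unfolding has_field_derivative_iff using \<phi>0 by simp
    show "deriv \<phi> 0 \<noteq> 0" using \<phi>(2)[of 0] \<psi>0 r1(1) by auto
  qed
qed

section \<open>Branches of the double curve and vertical indices\<close>

definition flip :: "complex ^ 2 \<Rightarrow> complex ^ 2" where "flip x = vector [x $ 1, - x $ 2]"

lemma flip_vector [simp]: "flip (vector [s, t]) = vector [s, - t]"
  by (simp add: flip_def)

lemma flip_tendsto: "(flip \<longlongrightarrow> 0) (nhds 0)"
  unfolding flip_def[abs_def]
  using tendsto_vector_2[OF tendsto_nth_0[of 1] tendsto_minus[OF tendsto_nth_0[of 2]]] by simp

lemma holo_at_flip:
  assumes "holo_at b 0" shows "holo_at (\<lambda>x. b (flip x)) 0"
proof -
  have lin: "(flip has_derivative flip) (at x)" for x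
  proof -
    have "(flip has_derivative (\<lambda>v. \<chi> i. flip v $ i)) (at x)"
    proof (rule has_derivative_cvec_general)
      fix i :: 2
      show "((\<lambda>x. flip x $ i) has_derivative (\<lambda>v. flip v $ i)) (at x)"
        using exhaust_2[of i] cdiff_at_nth[of 1 x] has_derivative_minus[of "\<lambda>x :: complex ^ 2. x $ 2" "\<lambda>v :: complex ^ 2. v $ 2" "at x"] cdiff_at_nth[of 2 x]
        by (auto simp: flip_def cdiff_at_def)
    qed
    then show ?thesis by simp
  qed
  show ?thesis
    unfolding holo_at_iff using eventually_compose_filterlim[OF assms[unfolded holo_at_iff] flip_tendsto]
  proof eventually_elim
    case (elim x)
    then obtain L where L: "cdiff_at b L (flip x)" by blast
    have "((\<lambda>x. b (flip x)) has_derivative (\<lambda>v. L (flip v))) (at x)"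
      using has_derivative_compose[OF lin, of b L] L by (simp add: cdiff_at_def)
    moreover have "L (flip (c *s v)) = c * L (flip v)" for c v
    proof -
      have "flip (c *s v) = c *s flip v" by (simp add: flip_def vec_eq_iff forall_2)
      then show ?thesis using cdiff_at_scale[OF L] by simp
    qed
    ultimately show ?case unfolding cdiff_at_def by blast
  qed
qed

context plane_branch
begin

lemma order_along_curve:
  assumes "holo_at u 0" "\<not> (\<forall>\<^sub>F \<theta> in nhds 0. u (curve \<theta>) = 0)"
  shows "pullback curve (germ u) \<noteq> 0"
    "has_order (\<lambda>\<theta>. u (curve \<theta>)) (int (subdegree (pullback curve (germ u))))"
proof -
  show nz: "pullback curve (germ u) \<noteq> 0"
    using pullback_eq_0_iff[OF arc_curve assms(1)] assms(2) by blast
  show "has_order (\<lambda>\<theta>. u (curve \<theta>)) (int (subdegree (pullback curve (germ u))))"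
    by (rule has_order_fps[OF pullback_germ[OF arc_curve assms(1)] nz])
qed

text \<open>Identity theorem along the branch: a nonzero power series has an order. This dichotomy
  is used to resolve alternatives that hold only pointwise.\<close>

lemma order_cases:
  assumes "holo_at u 0"
  shows "(\<forall>\<^sub>F \<theta> in nhds 0. u (curve \<theta>) = 0) \<or> (\<exists>m. has_order (\<lambda>\<theta>. u (curve \<theta>)) m)"
  using order_along_curve[OF assms] by blast

end

section \<open>Lifting an image curve through the fold\<close>

context double_fold
begin

text \<open>The last condition is the form in which transversality is remembered: the differential
  of \<open>g\<close> is nonzero at the image points off 0, which have coordinates
  \<open>(s, t^2)\<close>, hence the square.\<close>

definition branch_of :: "(complex ^ 2 \<Rightarrow> complex) \<Rightarrow> nat \<Rightarrow> bool" where
  "branch_of b n \<longleftrightarrow> (\<exists>\<xi> R. plane_branch n \<xi> R \<and>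
     (\<forall>\<^sub>F \<theta> in nhds 0. b (vector [\<xi> \<theta>, \<theta> ^ n]) = 0) \<and>
     (\<forall>\<^sub>F \<theta> in at 0. \<exists>Lg w. cdiff_at g Lg (vector [\<xi> \<theta>, (\<theta> ^ n)\<^sup>2]) \<and> Lg w \<noteq> 0))"

text \<open>Primality comes from the pullback into power series. If the square of \<open>b\<close>
  divided \<open>d\<close>, the differential of \<open>d\<close> would vanish along the branch, and
  with it that of \<open>g\<close>, since \<open>t = \<theta> ^ n\<close> is nonzero off 0.\<close>

lemma branch_of_props:
  assumes b: "holo_at b 0" "irreducible (germ b)" and n: "branch_of b n"
  shows "germ b dvd u * v \<Longrightarrow> germ b dvd u \<or> germ b dvd v"
    and "subdegree (pullback saxis (germ b)) = n"
    and "\<not> germ b * germ b dvd germ d"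
proof -
  obtain \<xi> R where "plane_branch n \<xi> R" and van: "\<forall>\<^sub>F \<theta> in nhds 0. b (vector [\<xi> \<theta>, \<theta> ^ n]) = 0"
    and grad: "\<forall>\<^sub>F \<theta> in at 0. \<exists>Lg w. cdiff_at g Lg (vector [\<xi> \<theta>, (\<theta> ^ n)\<^sup>2]) \<and> Lg w \<noteq> 0"
    using n unfolding branch_of_def by blast
  interpret B: plane_branch n \<xi> R by fact
  have van': "\<forall>\<^sub>F \<theta> in nhds 0. b (B.curve \<theta>) = 0" using van by (simp add: B.curve_def)
  note I = B.irreducible_curve_equation[OF b van']
  show "germ b dvd u \<or> germ b dvd v" if "germ b dvd u * v"
    using that unfolding I(1)[symmetric] pullback_mult[OF B.arc_curve] by simp
  show "subdegree (pullback saxis (germ b)) = n" using I(2) by blast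
  show "\<not> germ b * germ b dvd germ d"
  proof
    assume "germ b * germ b dvd germ d"
    then have "germ (\<lambda>x. b x * b x) dvd germ d" by (simp add: germ_mult b)
    then obtain e where e: "holo_at e 0" "\<forall>\<^sub>F x in nhds 0. d x = b x * b x * e x"
      using germ_dvd_iff[OF holo_at_mult[OF b(1,1)] d] by blast
    have "\<forall>\<^sub>F x in nhds 0. \<forall>\<^sub>F x' in nhds x. d x' = b x' * b x' * e x'"
      using e(2) by (subst eventually_eventually)
    then have "\<forall>\<^sub>F x in nhds 0. (\<exists>Lb. cdiff_at b Lb x) \<and> (\<exists>Le. cdiff_at e Le x) \<and> (\<exists>Lg Ld. good x Lg Ld) \<and>
        (\<forall>\<^sub>F x' in nhds x. d x' = b x' * b x' * e x')"
      using b(1)[unfolded holo_at_iff] e(1)[unfolded holo_at_iff] eventually_good by eventually_elim blast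
    from B.eventually_curve[OF this] van'
    have "\<forall>\<^sub>F \<theta> in nhds 0. (\<exists>Lb. cdiff_at b Lb (B.curve \<theta>)) \<and> (\<exists>Le. cdiff_at e Le (B.curve \<theta>)) \<and>
        (\<exists>Lg Ld. good (B.curve \<theta>) Lg Ld) \<and>
        (\<forall>\<^sub>F x' in nhds (B.curve \<theta>). d x' = b x' * b x' * e x') \<and> b (B.curve \<theta>) = 0"
      by eventually_elim blast
    then have "\<forall>\<^sub>F \<theta> in at 0. (\<exists>Lb. cdiff_at b Lb (B.curve \<theta>)) \<and> (\<exists>Le. cdiff_at e Le (B.curve \<theta>)) \<and>
        (\<exists>Lg Ld. good (B.curve \<theta>) Lg Ld) \<and>
        (\<forall>\<^sub>F x' in nhds (B.curve \<theta>). d x' = b x' * b x' * e x') \<and> b (B.curve \<theta>) = 0"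
      by (simp add: eventually_nhds_conv_at)
    then have "\<forall>\<^sub>F \<theta> in at (0::complex). False"
      using grad eventually_at_0_nonzero
    proof eventually_elim
      case (elim \<theta>)
      let ?x = "B.curve \<theta>"
      obtain Lb Le where Lb: "cdiff_at b Lb ?x" and Le: "cdiff_at e Le ?x" using elim by blast
      obtain Lg Ld where gd: "good ?x Lg Ld" using elim by blast
      have bx: "b ?x = 0" and ev: "\<forall>\<^sub>F x' in nhds ?x. d x' = b x' * b x' * e x'" using elim by blast+
      have Ld: "cdiff_at d Ld ?x" "\<And>v. Ld v = v $ 1 * Lg (axis 1 1) + 2 * ?x $ 2 * v $ 2 * Lg (axis 2 1)"
        and Lg: "cdiff_at g Lg (vector [\<xi> \<theta>, (\<theta> ^ n)\<^sup>2])"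
        using gd by (simp_all add: good_def)
      have Ld0: "Ld v = 0" for v
      proof -
        have "((\<lambda>z. b (?x + z *s v) * b (?x + z *s v) * e (?x + z *s v)) has_field_derivative 0) (at 0)"
          using DERIV_mult[OF DERIV_mult[OF cdiff_at_line[OF Lb, of v] cdiff_at_line[OF Lb, of v]] cdiff_at_line[OF Le, of v]] bx
          by simp
        moreover have "\<forall>\<^sub>F z in nhds 0. d (?x + z *s v) = b (?x + z *s v) * b (?x + z *s v) * e (?x + z *s v)"
          by (rule eventually_compose_filterlim[OF ev tendsto_line])
        ultimately have "((\<lambda>z. d (?x + z *s v)) has_field_derivative 0) (at 0)"
          by (subst DERIV_cong_ev[OF refl _ refl]) auto
        from DERIV_unique[OF cdiff_at_line[OF Ld(1)] this] show ?thesis .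
      qed
      have "\<theta> \<noteq> 0" using elim by simp
      then have G: "Lg (axis 1 1) = 0" "Lg (axis 2 1) = 0"
        using Ld0[of "vector [1, 0]"] Ld0[of "vector [0, 1]"] by (simp_all add: Ld(2))
      have "Lg w = 0" for w
      proof -
        have "w = w $ 1 *s axis 1 1 + w $ 2 *s (axis 2 1 :: complex ^ 2)"
          by (simp add: vec_eq_iff forall_2 axis_def)
        then have "Lg w = w $ 1 * Lg (axis 1 1) + w $ 2 * Lg (axis 2 1)"
          using cdiff_at_add[OF Lg] cdiff_at_scale[OF Lg] by metis
        then show ?thesis using G by simp
      qed
      moreover obtain Lg' w where "cdiff_at g Lg' (vector [\<xi> \<theta>, (\<theta> ^ n)\<^sup>2])" "Lg' w \<noteq> 0" using elim by blast
      moreover from this have "Lg' = Lg" using cdiff_at_frechet[OF Lg] cdiff_at_frechet by metis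
      ultimately show ?case by simp
    qed
    then show False by simp
  qed
qed

text \<open>What the image curve \<open>p\<close>, reparametrized so that its second coordinate is \<open>\<theta>\<^sup>N\<close>, tells about
  the two preimages \<open>(s, t)\<close> and \<open>(s, -t)\<close>; \<open>E\<close> is the product of the values of \<open>dsharp\<close> there.\<close>

definition image_data :: "(complex ^ 2 \<Rightarrow> complex) \<Rightarrow> (complex ^ 2 \<Rightarrow> complex) \<Rightarrow> nat \<Rightarrow>
    (complex \<Rightarrow> complex) \<Rightarrow> real \<Rightarrow> (complex \<Rightarrow> complex) \<Rightarrow> bool" where
  "image_data b dsharp N \<xi> R E \<longleftrightarrow> N > 0 \<and> R > 0 \<and> \<xi> holomorphic_on ball 0 R \<and> \<xi> 0 = 0 \<and>
     (\<forall>\<theta>\<in>ball 0 R. \<forall>\<omega>. \<theta> \<noteq> 0 \<longrightarrow> \<omega> ^ N = 1 \<longrightarrow> \<xi> (\<omega> * \<theta>) = \<xi> \<theta> \<longrightarrow> \<omega> = 1) \<and>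
     (\<forall>\<^sub>F \<theta> in at 0. \<forall>t. t\<^sup>2 = \<theta> ^ N \<longrightarrow>
        E \<theta> = dsharp (vector [\<xi> \<theta>, t]) * dsharp (vector [\<xi> \<theta>, - t]) \<and>
        (b (vector [\<xi> \<theta>, t]) = 0 \<or> b (vector [\<xi> \<theta>, - t]) = 0) \<and>
        (\<exists>Lg w. cdiff_at g Lg (vector [\<xi> \<theta>, t\<^sup>2]) \<and> Lg w \<noteq> 0))"

lemma not_eventually_zero_of_order:
  assumes E: "has_order E v" and eq: "\<forall>\<^sub>F \<theta> in at 0. E \<theta> = u \<theta> * w \<theta>"
  shows "\<not> (\<forall>\<^sub>F \<theta> in nhds 0. u \<theta> = 0)"
proof
  assume "\<forall>\<^sub>F \<theta> in nhds 0. u \<theta> = 0"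
  then have "\<forall>\<^sub>F \<theta> in at 0. u \<theta> = 0" by (simp add: eventually_nhds_conv_at)
  with eq has_order_nonzero[OF E] have "\<forall>\<^sub>F \<theta> in at (0::complex). False" by eventually_elim simp
  then show False by simp
qed

text \<open>The product of two functions that have an order has an order itself, so it is nonzero
  near 0. Thus an alternative at each point becomes an alternative between whole branches.\<close>

lemma vanish_of_product:
  fixes b b' :: "complex ^ 2 \<Rightarrow> complex"
  assumes "plane_branch n \<xi> R" "holo_at b 0" "holo_at b' 0"
    and "plane_branch n' \<xi>' R'"
    and 0: "\<forall>\<^sub>F \<theta> in at 0. b (vector [\<xi> \<theta>, \<theta> ^ n]) = 0 \<or> b' (vector [\<xi>' (a * \<theta>), (a * \<theta>) ^ n']) = 0" and a: "a \<noteq> 0"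
  shows "(\<forall>\<^sub>F \<theta> in nhds 0. b (vector [\<xi> \<theta>, \<theta> ^ n]) = 0) \<or> (\<forall>\<^sub>F \<theta> in nhds 0. b' (vector [\<xi>' \<theta>, \<theta> ^ n']) = 0)"
proof (rule ccontr)
  assume neg: "\<not> ?thesis"
  interpret B: plane_branch n \<xi> R by fact
  interpret B': plane_branch n' \<xi>' R' by fact
  obtain m m' where "has_order (\<lambda>\<theta>. b (vector [\<xi> \<theta>, \<theta> ^ n])) m" "has_order (\<lambda>\<theta>. b' (vector [\<xi>' \<theta>, \<theta> ^ n'])) m'"
    using B.order_cases[OF assms(2)] B'.order_cases[OF assms(3)] neg
    unfolding B.curve_def B'.curve_def by blast
  from has_order_nonzero[OF has_order_mult[OF this(1) has_order_compose_linear[OF this(2) a]]] 0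
  have "\<forall>\<^sub>F \<theta> in at (0::complex). False" by eventually_elim auto
  then show False by simp
qed

text \<open>For odd \<open>N\<close> the equation \<open>t^2 = \<theta> ^ N\<close> is solved after
  replacing \<theta> by its square, with \<open>t = \<theta> ^ N\<close>. Changing the sign of the
  parameter then changes the sign of \<open>t\<close>. So one branch carries both preimages, it is
  invariant under \<open>flip\<close>, and both sides of the order count are doubled.\<close>

lemma odd_branch:
  assumes data: "image_data b dsharp N \<xi> R E" and N: "odd N" and E: "has_order E v"
    and b: "holo_at b 0" "irreducible (germ b)" and ds: "holo_at dsharp 0"
  shows "branch_of b N \<and> germ b dvd germ (\<lambda>x. b (flip x)) \<and> v = int (intersection_mult dsharp b)"
proof -
  define \<xi>2 where "\<xi>2 = (\<lambda>\<theta>. \<xi> (\<theta>\<^sup>2))"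
  define R2 where "R2 = min R 1"
  have dat: "N > 0" "R > 0" "\<xi> holomorphic_on ball 0 R" "\<xi> 0 = 0"
    "\<And>\<theta> \<omega>. \<theta> \<in> ball 0 R \<Longrightarrow> \<theta> \<noteq> 0 \<Longrightarrow> \<omega> ^ N = 1 \<Longrightarrow> \<xi> (\<omega> * \<theta>) = \<xi> \<theta> \<Longrightarrow> \<omega> = 1"
    using data unfolding image_data_def by blast+
  have R2: "R2 > 0" "R2 \<le> R" "R2 \<le> 1" using dat by (auto simp: R2_def)
  have sq: "\<theta>\<^sup>2 \<in> ball 0 R" if "\<theta> \<in> ball 0 R2" for \<theta> :: complex
  proof -
    have "norm \<theta> * norm \<theta> \<le> norm \<theta> * 1" using that R2 by (intro mult_left_mono) auto
    then show ?thesis using that R2 by (simp add: norm_mult power2_eq_square)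
  qed
  have PB: "plane_branch N \<xi>2 R2"
  proof
    show "N > 0" "R2 > 0" "\<xi>2 0 = 0" using dat R2 by (simp_all add: \<xi>2_def)
    have "(\<lambda>t. t\<^sup>2) ` ball 0 R2 \<subseteq> ball (0::complex) R" by (rule image_subsetI) (rule sq)
    from holomorphic_on_compose_gen[OF holomorphic_on_power[OF holomorphic_on_ident] dat(3) this]
    show "\<xi>2 holomorphic_on ball 0 R2" by (simp add: o_def \<xi>2_def)
    fix \<theta> \<omega> :: complex
    assume \<theta>: "\<theta> \<in> ball 0 R2" "\<theta> \<noteq> 0" and \<omega>: "\<omega> ^ N = 1" and eq: "\<xi>2 (\<omega> * \<theta>) = \<xi>2 \<theta>"
    \<comment> \<open>The hypothesis on \<xi> applies to the square of \<omega>; oddness of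
      \<open>N\<close> then recovers \<omega> itself.\<close>
    have "(\<omega>\<^sup>2) ^ N = 1" using \<omega> by (metis power_commutes power_mult power_one mult.commute)
    then have w2: "\<omega>\<^sup>2 = 1"
      using dat(5)[of "\<theta>\<^sup>2" "\<omega>\<^sup>2"] sq[OF \<theta>(1)] \<theta>(2) eq by (simp add: \<xi>2_def power_mult_distrib)
    obtain k where k: "N = 2 * k + 1" using N by (elim oddE)
    show "\<omega> = 1" using \<omega> w2 by (simp add: k power_add power_mult)
  qed
  interpret B: plane_branch N \<xi>2 R2 by (rule PB)
  have ev: "\<forall>\<^sub>F \<theta> in at 0. E (\<theta>\<^sup>2) = dsharp (B.curve \<theta>) * dsharp (B.curve (-1 * \<theta>)) \<and>
        (b (B.curve \<theta>) = 0 \<or> b (B.curve (-1 * \<theta>)) = 0) \<and>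
        (\<exists>Lg w. cdiff_at g Lg (vector [\<xi>2 \<theta>, (\<theta> ^ N)\<^sup>2]) \<and> Lg w \<noteq> 0)"
  proof -
    have "\<forall>\<^sub>F \<theta> in at 0. \<forall>t. t\<^sup>2 = \<theta> ^ N \<longrightarrow>
        E \<theta> = dsharp (vector [\<xi> \<theta>, t]) * dsharp (vector [\<xi> \<theta>, - t]) \<and>
        (b (vector [\<xi> \<theta>, t]) = 0 \<or> b (vector [\<xi> \<theta>, - t]) = 0) \<and>
        (\<exists>Lg w. cdiff_at g Lg (vector [\<xi> \<theta>, t\<^sup>2]) \<and> Lg w \<noteq> 0)"
      using data unfolding image_data_def by blast
    from eventually_compose_filterlim[OF this filterlim_square_at_0] show ?thesis
    proof eventually_elim
      case (elim \<theta>)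
      have "(\<theta> ^ N)\<^sup>2 = (\<theta>\<^sup>2) ^ N" by (metis power_mult mult.commute)
      note el = elim[rule_format, OF this]
      have c: "B.curve \<theta> = vector [\<xi> (\<theta>\<^sup>2), \<theta> ^ N]" "B.curve (-1 * \<theta>) = vector [\<xi> (\<theta>\<^sup>2), - (\<theta> ^ N)]"
        unfolding B.curve_def using N by (simp_all add: \<xi>2_def)
      show ?case using el unfolding c by (simp add: \<xi>2_def)
    qed
  qed
  \<comment> \<open>The second curve is the first with parameter \<open>- \<theta>\<close>, so both
    alternatives are the same statement.\<close>
  have "(\<forall>\<^sub>F \<theta> in nhds 0. b (vector [\<xi>2 \<theta>, \<theta> ^ N]) = 0) \<or> (\<forall>\<^sub>F \<theta> in nhds 0. b (vector [\<xi>2 \<theta>, \<theta> ^ N]) = 0)"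
    by (rule vanish_of_product[OF PB b(1,1) PB, of "-1"])
       (use ev in \<open>auto simp: B.curve_def elim: eventually_mono\<close>)
  then have van: "\<forall>\<^sub>F \<theta> in nhds 0. b (B.curve \<theta>) = 0" by (simp add: B.curve_def)
  have 1: "branch_of b N"
    unfolding branch_of_def
    using PB van ev by (intro exI[of _ \<xi>2] exI[of _ R2]) (auto simp: B.curve_def elim: eventually_mono)
  have "((\<lambda>\<theta>. - \<theta>) \<longlongrightarrow> (0::complex)) (nhds 0)"
    using tendsto_minus[OF filterlim_ident[of "nhds (0::complex)"]] by simp
  from eventually_compose_filterlim[OF van this]
  have "\<forall>\<^sub>F \<theta> in nhds 0. b (B.curve (- \<theta>)) = 0" .
  moreover have "B.curve (- \<theta>) = flip (B.curve \<theta>)" for \<theta>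
    unfolding B.curve_def using N by (simp add: \<xi>2_def)
  ultimately have "\<forall>\<^sub>F \<theta> in nhds 0. b (flip (B.curve \<theta>)) = 0" by simp
  then have 2: "germ b dvd germ (\<lambda>x. b (flip x))"
    using B.irreducible_curve_equation(1)[OF b van] pullback_eq_0_iff[OF B.arc_curve holo_at_flip[OF b(1)]] by blast
  have E2: "has_order (\<lambda>\<theta>. E (\<theta>\<^sup>2)) (2 * v)" by (rule has_order_compose_square[OF E])
  have eqE: "\<forall>\<^sub>F \<theta> in at 0. E (\<theta>\<^sup>2) = dsharp (B.curve \<theta>) * dsharp (B.curve (-1 * \<theta>))"
    using ev by eventually_elim blast
  note nz = not_eventually_zero_of_order[OF E2 eqE]
  note O = B.order_along_curve[OF ds nz]
  from has_order_mult[OF O(2) has_order_compose_linear[OF O(2), of "-1"]]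
  have "has_order (\<lambda>\<theta>. E (\<theta>\<^sup>2)) (2 * int (subdegree (pullback B.curve (germ dsharp))))"
    unfolding has_order_cong[OF eqE] by simp
  from has_order_unique[OF E2 this] have "v = int (subdegree (pullback B.curve (germ dsharp)))" by simp
  also have "subdegree (pullback B.curve (germ dsharp)) = intersection_mult dsharp b"
    using B.intersection_mult_branch[OF b van O(1)] by simp
  finally show ?thesis using 1 2 by blast
qed

end

context double_fold
begin

text \<open>For even \<open>N\<close> there are the two solutions
  \<open>t = \<plusminus>\<theta> ^ k\<close>, hence two branches exchanged by \<open>flip\<close>,
  and \<open>E\<close> is the product of the values of \<open>dsharp\<close> along them. It is not
  known on which of the two \<open>b\<close> vanishes, so both cases are carried along.\<close>

lemma even_branch:
  assumes data: "image_data b dsharp N \<xi> R E" and N: "N = 2 * k" and E: "has_order E v"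
    and b: "holo_at b 0" "irreducible (germ b)" and b': "holo_at b' 0" "irreducible (germ b')"
    and bb': "germ b' dvd germ (\<lambda>x. b (flip x))" "germ (\<lambda>x. b (flip x)) dvd germ b'"
    and ds: "holo_at dsharp 0"
  shows "branch_of b k \<and> branch_of b' k \<and> \<not> germ b' dvd germ b \<and>
    v = int (intersection_mult dsharp b) + int (intersection_mult dsharp b')"
proof -
  have dat: "N > 0" "R > 0" "\<xi> holomorphic_on ball 0 R" "\<xi> 0 = 0"
    "\<And>\<theta> \<omega>. \<theta> \<in> ball 0 R \<Longrightarrow> \<theta> \<noteq> 0 \<Longrightarrow> \<omega> ^ N = 1 \<Longrightarrow> \<xi> (\<omega> * \<theta>) = \<xi> \<theta> \<Longrightarrow> \<omega> = 1"
    using data unfolding image_data_def by blast+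
  have k: "k > 0" using dat(1) N by simp
  \<comment> \<open>A \<open>k\<close>-th root of -1 brings the branch
    \<open>(\<xi> \<theta>, - \<theta> ^ k)\<close> into the standard form with second coordinate
    \<open>\<theta> ^ k\<close>; its inverse \<open>a\<close> leads back.\<close>
  obtain \<omega>0 :: complex where w0: "- 1 = \<omega>0 ^ k" using exists_complex_root[of k "-1"] k by auto
  have w0': "\<omega>0 ^ k = - 1" using w0 by simp
  have w0N: "\<omega>0 ^ N = 1" using w0' unfolding N by (subst mult.commute) (simp add: power_mult)
  have w0z: "\<omega>0 \<noteq> 0" using w0' k by (auto simp: power_0_left)
  define a where "a = inverse \<omega>0"
  have a: "a \<noteq> 0" "a ^ k = - 1" "\<omega>0 * a = 1" using w0z w0' by (simp_all add: a_def power_inverse)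
  define \<xi>' where "\<xi>' = (\<lambda>\<theta>. \<xi> (\<omega>0 * \<theta>))"
  have n0: "norm \<omega>0 = 1" by (rule norm_unity_root[OF w0N dat(1)])
  have powN: "\<omega> ^ k = 1 \<Longrightarrow> \<omega> ^ N = 1" for \<omega> :: complex
    unfolding N by (subst mult.commute) (simp add: power_mult)
  have PB1: "plane_branch k \<xi> R"
  proof
    show "k > 0" "R > 0" "\<xi> holomorphic_on ball 0 R" "\<xi> 0 = 0" by (fact k dat)+
    show "\<omega> = 1" if "\<theta> \<in> ball 0 R" "\<theta> \<noteq> 0" "\<omega> ^ k = 1" "\<xi> (\<omega> * \<theta>) = \<xi> \<theta>" for \<theta> \<omega>
      by (rule dat(5)[OF that(1,2) powN[OF that(3)] that(4)])
  qed
  have PB2: "plane_branch k \<xi>' R"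
  proof
    show "k > 0" "R > 0" "\<xi>' 0 = 0" using k dat by (simp_all add: \<xi>'_def)
    have "(\<lambda>\<theta>. \<omega>0 * \<theta>) ` ball 0 R \<subseteq> ball 0 R" using n0 by (auto simp: norm_mult)
    from holomorphic_on_compose_gen[OF _ dat(3) this]
    show "\<xi>' holomorphic_on ball 0 R" by (auto simp: o_def \<xi>'_def intro!: holomorphic_intros)
    fix \<theta> \<omega> :: complex
    assume \<theta>: "\<theta> \<in> ball 0 R" "\<theta> \<noteq> 0" and \<omega>: "\<omega> ^ k = 1" and eq: "\<xi>' (\<omega> * \<theta>) = \<xi>' \<theta>"
    show "\<omega> = 1"
    proof (rule dat(5)[of "\<omega>0 * \<theta>"])
      show "\<xi> (\<omega> * (\<omega>0 * \<theta>)) = \<xi> (\<omega>0 * \<theta>)" using eq by (simp add: \<xi>'_def mult_ac)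
    qed (use \<theta> n0 w0z powN[OF \<omega>] in \<open>auto simp: norm_mult\<close>)
  qed
  interpret B1: plane_branch k \<xi> R by (rule PB1)
  interpret B2: plane_branch k \<xi>' R by (rule PB2)
  have c2a: "B2.curve (a * \<theta>) = vector [\<xi> \<theta>, - (\<theta> ^ k)]" for \<theta>
  proof -
    have "\<xi>' (a * \<theta>) = \<xi> \<theta>" using a(3) by (simp add: \<xi>'_def mult.assoc[symmetric])
    moreover have "(a * \<theta>) ^ k = - (\<theta> ^ k)" using a(2) by (simp add: power_mult_distrib)
    ultimately show ?thesis by (simp add: B2.curve_def)
  qed
  have c1w: "B1.curve (\<omega>0 * \<theta>) = vector [\<xi>' \<theta>, - (\<theta> ^ k)]" for \<theta>
    unfolding B1.curve_def \<xi>'_def using w0' by (simp add: power_mult_distrib)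
  have flip1: "flip (B1.curve \<theta>) = B2.curve (a * \<theta>)" for \<theta>
    unfolding c2a B1.curve_def by simp
  have flip2: "flip (B2.curve \<theta>) = B1.curve (\<omega>0 * \<theta>)" for \<theta>
    unfolding c1w B2.curve_def by simp
  have lin0: "((\<lambda>\<theta>. z * \<theta>) \<longlongrightarrow> 0) (nhds 0)" for z :: complex
    using tendsto_mult[OF tendsto_const[of z] filterlim_ident[of "nhds (0::complex)"]] by simp
  have lin1: "filterlim (\<lambda>\<theta>. \<omega>0 * \<theta>) (at 0) (at 0)"
    unfolding filterlim_at using w0z tendsto_mult[OF tendsto_const[of \<omega>0] tendsto_ident_at[of 0 UNIV]]
    by (auto simp: eventually_at_filter)
  have base: "\<forall>\<^sub>F \<theta> in at 0. \<forall>t. t\<^sup>2 = \<theta> ^ N \<longrightarrow>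
        E \<theta> = dsharp (vector [\<xi> \<theta>, t]) * dsharp (vector [\<xi> \<theta>, - t]) \<and>
        (b (vector [\<xi> \<theta>, t]) = 0 \<or> b (vector [\<xi> \<theta>, - t]) = 0) \<and>
        (\<exists>Lg w. cdiff_at g Lg (vector [\<xi> \<theta>, t\<^sup>2]) \<and> Lg w \<noteq> 0)"
    using data unfolding image_data_def by blast
  have sqN: "(\<theta> ^ k)\<^sup>2 = \<theta> ^ N" for \<theta> :: complex unfolding N by (metis power_mult mult.commute)
  have ev: "\<forall>\<^sub>F \<theta> in at 0. E \<theta> = dsharp (B1.curve \<theta>) * dsharp (B2.curve (a * \<theta>)) \<and>
        (b (B1.curve \<theta>) = 0 \<or> b (B2.curve (a * \<theta>)) = 0) \<and>
        (\<exists>Lg w. cdiff_at g Lg (vector [\<xi> \<theta>, (\<theta> ^ k)\<^sup>2]) \<and> Lg w \<noteq> 0)"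
    using base
  proof eventually_elim
    case (elim \<theta>)
    show ?case using elim[rule_format, OF sqN] unfolding c2a B1.curve_def .
  qed
  have grad1: "\<forall>\<^sub>F \<theta> in at 0. \<exists>Lg w. cdiff_at g Lg (vector [\<xi> \<theta>, (\<theta> ^ k)\<^sup>2]) \<and> Lg w \<noteq> 0"
    using ev by eventually_elim blast
  have grad2: "\<forall>\<^sub>F \<theta> in at 0. \<exists>Lg w. cdiff_at g Lg (vector [\<xi>' \<theta>, (\<theta> ^ k)\<^sup>2]) \<and> Lg w \<noteq> 0"
    using eventually_compose_filterlim[OF grad1 lin1]
  proof eventually_elim
    case (elim \<theta>)
    have "((\<omega>0 * \<theta>) ^ k)\<^sup>2 = (\<theta> ^ k)\<^sup>2" by (simp add: power_mult_distrib w0')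
    with elim show ?case by (simp add: \<xi>'_def)
  qed
  have "(\<forall>\<^sub>F \<theta> in nhds 0. b (vector [\<xi> \<theta>, \<theta> ^ k]) = 0) \<or> (\<forall>\<^sub>F \<theta> in nhds 0. b (vector [\<xi>' \<theta>, \<theta> ^ k]) = 0)"
    by (rule vanish_of_product[OF PB1 b(1,1) PB2 _ a(1)])
       (use ev in \<open>auto simp: B1.curve_def B2.curve_def elim: eventually_mono\<close>)
  then have van: "(\<forall>\<^sub>F \<theta> in nhds 0. b (B1.curve \<theta>) = 0) \<or> (\<forall>\<^sub>F \<theta> in nhds 0. b (B2.curve \<theta>) = 0)"
    by (simp add: B1.curve_def B2.curve_def)
  have dvd_van: "pullback \<gamma> (germ u') = 0" if "germ_arc \<gamma>" "germ u dvd germ u'" "pullback \<gamma> (germ u) = 0" for \<gamma> u u'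
  proof -
    obtain q where "germ u' = germ u * q" using \<open>germ u dvd germ u'\<close> by (elim dvdE)
    then show ?thesis using pullback_mult[OF that(1)] that(3) by simp
  qed
  have van12: "\<forall>\<^sub>F \<theta> in nhds 0. b' (B2.curve \<theta>) = 0" if "\<forall>\<^sub>F \<theta> in nhds 0. b (B1.curve \<theta>) = 0"
  proof -
    have "\<forall>\<^sub>F \<theta> in nhds 0. b (flip (B2.curve \<theta>)) = 0"
      using eventually_compose_filterlim[OF that lin0] unfolding flip2 .
    then have "pullback B2.curve (germ (\<lambda>x. b (flip x))) = 0"
      by (simp add: pullback_eq_0_iff[OF B2.arc_curve holo_at_flip[OF b(1)]])
    from dvd_van[OF B2.arc_curve bb'(2) this] show ?thesis
      by (simp add: pullback_eq_0_iff[OF B2.arc_curve b'(1)])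
  qed
  have van21: "\<forall>\<^sub>F \<theta> in nhds 0. b' (B1.curve \<theta>) = 0" if "\<forall>\<^sub>F \<theta> in nhds 0. b (B2.curve \<theta>) = 0"
  proof -
    have "\<forall>\<^sub>F \<theta> in nhds 0. b (flip (B1.curve \<theta>)) = 0"
      using eventually_compose_filterlim[OF that lin0] unfolding flip1 .
    then have "pullback B1.curve (germ (\<lambda>x. b (flip x))) = 0"
      by (simp add: pullback_eq_0_iff[OF B1.arc_curve holo_at_flip[OF b(1)]])
    from dvd_van[OF B1.arc_curve bb'(2) this] show ?thesis
      by (simp add: pullback_eq_0_iff[OF B1.arc_curve b'(1)])
  qed
  \<comment> \<open>If \<open>b\<close> vanished on both branches they would coincide, and
    \<open>\<omega>0\<close> would be a \<open>k\<close>-th root of unity.\<close>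
  have both: False if v1: "\<forall>\<^sub>F \<theta> in nhds 0. b (B1.curve \<theta>) = 0" and v2: "\<forall>\<^sub>F \<theta> in nhds 0. b (B2.curve \<theta>) = 0"
  proof -
    have "\<forall>\<^sub>F \<theta> in nhds 0. \<theta> \<in> ball (0::complex) R" using dat(2) by (intro eventually_nhds_in_open) auto
    with B2.eventually_curve[OF B1.irreducible_curve_equation(3)[OF b v1]] v2
    have "\<forall>\<^sub>F \<theta> in nhds 0. \<theta> \<in> ball 0 R \<and> (\<exists>\<omega>. \<omega> ^ k = 1 \<and> \<xi>' \<theta> = \<xi> (\<omega> * \<theta>))"
    proof eventually_elim
      case (elim \<theta>)
      then have "\<exists>\<omega>. \<omega> ^ k = 1 \<and> B2.curve \<theta> $ 1 = \<xi> (\<omega> * \<theta>)"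
        using B2.curve_nth(2)[of \<theta>] by blast
      then show ?case using elim by simp
    qed
    then have "\<forall>\<^sub>F \<theta> in at 0. \<theta> \<in> ball 0 R \<and> (\<exists>\<omega>. \<omega> ^ k = 1 \<and> \<xi>' \<theta> = \<xi> (\<omega> * \<theta>))"
      by (simp add: eventually_nhds_conv_at)
    with eventually_at_0_nonzero have "\<forall>\<^sub>F \<theta> in at (0::complex). False"
    proof eventually_elim
      case (elim \<theta>)
      then obtain \<omega> where \<omega>: "\<omega> ^ k = 1" "\<xi> (\<omega>0 * \<theta>) = \<xi> (\<omega> * \<theta>)" by (auto simp: \<xi>'_def)
      have wz: "\<omega> \<noteq> 0" by (rule unity_root_nonzero[OF \<omega>(1) k])
      have nw: "norm \<omega> = 1" by (rule norm_unity_root[OF \<omega>(1) k])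
      have "\<omega>0 / \<omega> = 1"
      proof (rule dat(5)[of "\<omega> * \<theta>"])
        show "\<xi> (\<omega>0 / \<omega> * (\<omega> * \<theta>)) = \<xi> (\<omega> * \<theta>)" using \<omega>(2) wz by simp
        show "(\<omega>0 / \<omega>) ^ N = 1" using w0N powN[OF \<omega>(1)] by (simp add: power_divide)
      qed (use elim wz nw in \<open>auto simp: norm_mult\<close>)
      then have "\<omega>0 = \<omega>" using wz by simp
      then show ?case using \<omega>(1) w0' by simp
    qed
    then show False by simp
  qed
  \<comment> \<open>\<open>b'\<close> vanishes on the branch that \<open>b\<close> misses, so it
    cannot divide \<open>b\<close>.\<close>
  have ndvd: "\<not> germ b' dvd germ b"
  proof
    assume dv: "germ b' dvd germ b"
    from van show False
    proof
      assume v1: "\<forall>\<^sub>F \<theta> in nhds 0. b (B1.curve \<theta>) = 0"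
      have "pullback B2.curve (germ b') = 0"
        using van12[OF v1] by (simp add: pullback_eq_0_iff[OF B2.arc_curve b'(1)])
      from dvd_van[OF B2.arc_curve dv this] have "\<forall>\<^sub>F \<theta> in nhds 0. b (B2.curve \<theta>) = 0"
        by (simp add: pullback_eq_0_iff[OF B2.arc_curve b(1)])
      from both[OF v1 this] show False .
    next
      assume v2: "\<forall>\<^sub>F \<theta> in nhds 0. b (B2.curve \<theta>) = 0"
      have "pullback B1.curve (germ b') = 0"
        using van21[OF v2] by (simp add: pullback_eq_0_iff[OF B1.arc_curve b'(1)])
      from dvd_van[OF B1.arc_curve dv this] have "\<forall>\<^sub>F \<theta> in nhds 0. b (B1.curve \<theta>) = 0"
        by (simp add: pullback_eq_0_iff[OF B1.arc_curve b(1)])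
      from both[OF this v2] show False .
    qed
  qed
  have br1: "branch_of u k" if "\<forall>\<^sub>F \<theta> in nhds 0. u (B1.curve \<theta>) = 0" for u
    unfolding branch_of_def
    by (intro exI[of _ \<xi>] exI[of _ R] conjI PB1 grad1) (use that in \<open>simp add: B1.curve_def\<close>)
  have br2: "branch_of u k" if "\<forall>\<^sub>F \<theta> in nhds 0. u (B2.curve \<theta>) = 0" for u
    unfolding branch_of_def
    by (intro exI[of _ \<xi>'] exI[of _ R] conjI PB2 grad2) (use that in \<open>simp add: B2.curve_def\<close>)
  have eqE: "\<forall>\<^sub>F \<theta> in at 0. E \<theta> = dsharp (B1.curve \<theta>) * dsharp (B2.curve (a * \<theta>))"
    using ev by eventually_elim blast
  have nz1: "\<not> (\<forall>\<^sub>F \<theta> in nhds 0. dsharp (B1.curve \<theta>) = 0)"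
    by (rule not_eventually_zero_of_order[OF E eqE])
  have nz2: "\<not> (\<forall>\<^sub>F \<theta> in nhds 0. dsharp (B2.curve \<theta>) = 0)"
  proof
    assume "\<forall>\<^sub>F \<theta> in nhds 0. dsharp (B2.curve \<theta>) = 0"
    from eventually_compose_filterlim[OF this lin0[of a]]
    have z: "\<forall>\<^sub>F \<theta> in nhds 0. dsharp (B2.curve (a * \<theta>)) = 0" .
    have "\<forall>\<^sub>F \<theta> in at 0. E \<theta> = dsharp (B2.curve (a * \<theta>)) * dsharp (B1.curve \<theta>)"
      using eqE by eventually_elim simp
    from not_eventually_zero_of_order[OF E this] z show False by contradiction
  qed
  note O1 = B1.order_along_curve[OF ds nz1] and O2 = B2.order_along_curve[OF ds nz2]
  from has_order_mult[OF O1(2) has_order_compose_linear[OF O2(2) a(1)]]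
  have "has_order E (int (subdegree (pullback B1.curve (germ dsharp))) + int (subdegree (pullback B2.curve (germ dsharp))))"
    unfolding has_order_cong[OF eqE] .
  from has_order_unique[OF E this]
  have v: "v = int (subdegree (pullback B1.curve (germ dsharp))) + int (subdegree (pullback B2.curve (germ dsharp)))" .
  from van show ?thesis
  proof
    assume v1: "\<forall>\<^sub>F \<theta> in nhds 0. b (B1.curve \<theta>) = 0"
    note v2 = van12[OF v1]
    show ?thesis
      using br1[OF v1] br2[OF v2] ndvd v B1.intersection_mult_branch[OF b v1 O1(1)]
        B2.intersection_mult_branch[OF b' v2 O2(1)] by simp
  next
    assume v2: "\<forall>\<^sub>F \<theta> in nhds 0. b (B2.curve \<theta>) = 0"
    note v1 = van21[OF v2]
    show ?thesis
      using br2[OF v2] br1[OF v1] ndvd v B2.intersection_mult_branch[OF b v2 O2(1)]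
        B1.intersection_mult_branch[OF b' v1 O1(1)] by simp
  qed
qed

end

lemma at_0_le_nhds: "at (0::complex) \<le> nhds 0"
  unfolding at_within_def by simp

section \<open>From a transverse section and a normalization to the lifted curve\<close>

context double_fold
begin

text \<open>\<open>beta_value\<close> is applied at the points of \<open>p\<close> off 0. There
  \<open>t^2\<close> is the second coordinate, which \<open>reparametrize\<close> turns into
  \<open>\<theta> ^ N\<close>. The factor in front of \<beta>1\<beta>2 therefore has order
  \<open>N\<close>, whence the shift from \<open>v\<close> to \<open>v + int N\<close>.\<close>

lemma image_data_exists:
  assumes f: "reduced_image_equation \<Phi> f" and H: "transverse_section \<Phi> H"
    and ds: "holo_at dsharp 0" and H\<Phi>: "\<forall>\<^sub>F x in nhds 0. H (\<Phi> x) = d x * dsharp x"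
    and p: "normalization_of_image \<Phi> b p" and v: "is_v_exponent \<Phi> f H p v"
  shows "\<exists>N \<xi> R E. image_data b dsharp N \<xi> R E \<and> has_order E (v + int N)"
proof -
  obtain bb B where beta: "\<forall>\<^sub>F \<rho> in at_right 0. \<forall>\<^sub>F \<tau> in at 0. beta_product \<Phi> f H \<rho> (p \<tau>) (bb \<tau>)"
    and B: "bb has_laurent_expansion B" "B \<noteq> 0" "v = fls_subdegree B"
    using v unfolding is_v_exponent_def by blast
  have obb: "has_order bb v" unfolding B(3) by (rule has_order_laurent[OF B(1,2)])
  have Hh: "holo_at H 0" and trans: "\<forall>\<^sub>F \<rho> in at_right 0. \<forall>\<^sub>F q in nhds 0. q \<in> double_locus \<Phi> \<rho> \<longrightarrow>
        H q = 0 \<and> (q \<noteq> 0 \<longrightarrow> (\<exists>v. frechet_derivative H (at q) v \<noteq> 0) \<and>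
          (\<forall>x\<in>ball 0 \<rho>. \<Phi> x = q \<longrightarrow>
             {u + w | u w. frechet_derivative H (at q) u = 0 \<and>
                           w \<in> range (frechet_derivative \<Phi> (at x))} = UNIV))"
    using H unfolding transverse_section_def by blast+
  have fh: "holo_at f 0" using f by (simp add: reduced_image_equation_def)
  have pan: "(\<lambda>\<tau>. p \<tau> $ k) analytic_on {0}" and p0: "p 0 = 0" for k
    using p unfolding normalization_of_image_def by blast+
  obtain rp where rp: "rp > 0" "inj_on p (ball 0 rp)" using p unfolding normalization_of_image_def by blast
  have norm: "\<forall>\<^sub>F r in at_right 0. \<forall>\<^sub>F q in nhds 0. q \<in> p ` ball 0 r \<longleftrightarrow> q \<in> \<Phi> ` {x \<in> ball 0 r. b x = 0}"
    using p unfolding normalization_of_image_def by blast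
  have "((\<lambda>\<tau>. p \<tau> $ k) \<longlongrightarrow> p 0 $ k) (nhds 0)" for k
    by (rule isCont_tendsto_nhds[OF analytic_at_imp_isCont[OF pan]])
  then have "(p \<longlongrightarrow> p 0) (nhds 0)" by (rule tendsto_cvec)
  then have plim: "(p \<longlongrightarrow> 0) (nhds 0)" unfolding p0 .
  have "\<forall>\<^sub>F x in nhds 0. \<forall>\<^sub>F x' in nhds x. H (\<Phi> x') = d x' * dsharp x'"
    using H\<Phi> by (subst eventually_eventually)
  then have "\<forall>\<^sub>F x in nhds 0. (\<exists>Lg Ld. good x Lg Ld) \<and>
        (\<forall>\<^sub>F x' in nhds x. H (\<Phi> x') = d x' * dsharp x') \<and> (\<exists>Ls. cdiff_at dsharp Ls x)"
    using eventually_good ds[unfolded holo_at_iff] by eventually_elim blast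
  then obtain e where e: "e > 0" and good: "\<And>x. norm x < e \<Longrightarrow> (\<exists>Lg Ld. good x Lg Ld) \<and>
        (\<forall>\<^sub>F x' in nhds x. H (\<Phi> x') = d x' * dsharp x') \<and> (\<exists>Ls. cdiff_at dsharp Ls x)"
    unfolding eventually_nhds_metric by auto
  have small: "\<forall>\<^sub>F \<rho> in at_right 0. \<rho> < e \<and> \<rho> > 0"
    unfolding eventually_at_right_field using e by (intro exI[of _ e]) simp
  have "\<forall>\<^sub>F \<rho> in at_right 0. (\<rho> < e \<and> \<rho> > 0) \<and> (\<forall>\<^sub>F \<tau> in at 0. beta_product \<Phi> f H \<rho> (p \<tau>) (bb \<tau>)) \<and>
     (\<forall>\<^sub>F q in nhds 0. q \<in> double_locus \<Phi> \<rho> \<longrightarrow>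
        H q = 0 \<and> (q \<noteq> 0 \<longrightarrow> (\<exists>v. frechet_derivative H (at q) v \<noteq> 0) \<and>
          (\<forall>x\<in>ball 0 \<rho>. \<Phi> x = q \<longrightarrow>
             {u + w | u w. frechet_derivative H (at q) u = 0 \<and>
                           w \<in> range (frechet_derivative \<Phi> (at x))} = UNIV)))"
    by (rule eventually_conj[OF small eventually_conj[OF beta trans]])
  \<comment> \<open>One radius is fixed that serves both the transversality and the \<beta>-product
    conditions.\<close>
  from eventually_happens'[OF trivial_limit_at_right_real this] obtain \<rho> where \<rho>: "\<rho> < e" "\<rho> > 0"
    and beta\<rho>: "\<forall>\<^sub>F \<tau> in at 0. beta_product \<Phi> f H \<rho> (p \<tau>) (bb \<tau>)"
    and trans\<rho>: "\<forall>\<^sub>F q in nhds 0. q \<in> double_locus \<Phi> \<rho> \<longrightarrow>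
        H q = 0 \<and> (q \<noteq> 0 \<longrightarrow> (\<exists>v. frechet_derivative H (at q) v \<noteq> 0) \<and>
          (\<forall>x\<in>ball 0 \<rho>. \<Phi> x = q \<longrightarrow>
             {u + w | u w. frechet_derivative H (at q) u = 0 \<and>
                           w \<in> range (frechet_derivative \<Phi> (at x))} = UNIV))"
    by blast
  have "\<forall>\<^sub>F r in at_right 0. (r < e \<and> r > 0) \<and>
      (\<forall>\<^sub>F q in nhds 0. q \<in> p ` ball 0 r \<longleftrightarrow> q \<in> \<Phi> ` {x \<in> ball 0 r. b x = 0})"
    by (rule eventually_conj[OF small norm])
  from eventually_happens'[OF trivial_limit_at_right_real this] obtain r where r: "r < e" "r > 0"
    and norm_r: "\<forall>\<^sub>F q in nhds 0. q \<in> p ` ball 0 r \<longleftrightarrow> q \<in> \<Phi> ` {x \<in> ball 0 r. b x = 0}"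
    by blast
  have at0: "\<forall>\<^sub>F \<tau> in at 0. Q \<tau>" if "\<forall>\<^sub>F \<tau> in nhds 0. Q \<tau>" for Q :: "complex \<Rightarrow> bool"
    using that by (simp add: eventually_nhds_conv_at)
  have inr: "\<forall>\<^sub>F \<tau> in nhds 0. \<tau> \<in> ball (0::complex) \<eta>" if "\<eta> > 0" for \<eta>
    using that by (intro eventually_nhds_in_open) auto
  note evp = eventually_compose_filterlim[OF _ plim]
  have main: "\<forall>\<^sub>F \<tau> in at 0. p \<tau> $ 3 = 0 \<and> p \<tau> $ 2 \<noteq> 0 \<and>
     (\<forall>t. t\<^sup>2 = p \<tau> $ 2 \<longrightarrow>
        bb \<tau> * (- 2 * (p \<tau> $ 2) * second_vertical_derivative f (p \<tau>)) =
          dsharp (vector [p \<tau> $ 1, t]) * dsharp (vector [p \<tau> $ 1, - t]) \<and>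
        (b (vector [p \<tau> $ 1, t]) = 0 \<or> b (vector [p \<tau> $ 1, - t]) = 0) \<and>
        (\<exists>Lg w. cdiff_at g Lg (vector [p \<tau> $ 1, t\<^sup>2]) \<and> Lg w \<noteq> 0))"
    using beta\<rho> at0[OF evp[OF trans\<rho>]] at0[OF evp[OF norm_r]] at0[OF evp[OF holo_at_nearby[OF fh]]]
      at0[OF evp[OF Hh[unfolded holo_at_iff]]] at0[OF inr[OF rp(1)]] at0[OF inr[OF r(2)]] eventually_at_0_nonzero
  proof eventually_elim
    case (elim \<tau>)
    have q0: "p \<tau> \<noteq> 0" using inj_onD[OF rp(2), of \<tau> 0] p0 rp(1) elim(6,8) by auto
    have dl: "p \<tau> \<in> double_locus \<Phi> \<rho>"
      unfolding double_locus_def using elim(1) unfolding beta_product_def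
      by (intro subsetD[OF closure_subset]) blast
    obtain LH where LH: "cdiff_at H LH (p \<tau>)" using elim(5) by blast
    have tr: "\<exists>v. LH v \<noteq> 0" "\<And>x. x \<in> ball 0 \<rho> \<Longrightarrow> \<Phi> x = p \<tau> \<Longrightarrow>
       {u + w | u w. LH u = 0 \<and> w \<in> range (frechet_derivative \<Phi> (at x))} = UNIV"
      using elim(2) dl q0 unfolding cdiff_at_frechet[OF LH] by blast+
    have gd: "(\<exists>Lg Ld. good x Lg Ld) \<and>
        (\<forall>\<^sub>F x' in nhds x. H (\<Phi> x') = d x' * dsharp x') \<and> (\<exists>Ls. cdiff_at dsharp Ls x)" if "x \<in> ball 0 \<rho>" for x
      by (rule good) (use that \<rho> in auto)
    from beta_value[OF gd LH tr elim(4) elim(1)]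
    obtain x :: "complex ^ 2" where x: "x $ 2 \<noteq> 0" "p \<tau> = vector [x $ 1, (x $ 2)\<^sup>2, 0]"
      "bb \<tau> * (- 2 * (x $ 2)\<^sup>2 * second_vertical_derivative f (p \<tau>)) = dsharp x * dsharp (vector [x $ 1, - x $ 2])"
      "\<exists>Lg w. cdiff_at g Lg (vector [x $ 1, (x $ 2)\<^sup>2]) \<and> Lg w \<noteq> 0" by blast
    have p1: "p \<tau> $ 1 = x $ 1" "p \<tau> $ 2 = (x $ 2)\<^sup>2" "p \<tau> $ 3 = 0" using x(2) by simp_all
    \<comment> \<open>The normalization gives a preimage on \<open>b = 0\<close>; it may be either
      of the two, hence the disjunction.\<close>
    have "p \<tau> \<in> p ` ball 0 r" using elim(7) by (rule imageI)
    then obtain y where y: "y \<in> ball 0 r" "b y = 0" "\<Phi> y = p \<tau>" using elim(3) by auto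
    obtain Lg Ld where "good y Lg Ld" using good[of y] y(1) r by auto
    then have "\<forall>\<^sub>F x' in nhds y. \<Phi> x' = vector [x' $ 1, (x' $ 2)\<^sup>2, x' $ 2 * d x']" by (simp add: good_def)
    from eventually_nhds_x_imp_x[OF this] have y12: "p \<tau> $ 1 = y $ 1" "p \<tau> $ 2 = (y $ 2)\<^sup>2"
      unfolding y(3) by simp_all
    show ?case
    proof (intro conjI allI impI)
      show "p \<tau> $ 3 = 0" by (rule p1(3))
      show "p \<tau> $ 2 \<noteq> 0" using x(1) p1(2) by simp
      fix t assume t: "t\<^sup>2 = p \<tau> $ 2"
      then have tx: "t = x $ 2 \<or> t = - x $ 2" using p1(2) by (metis power2_eq_iff)
      have ty: "t = y $ 2 \<or> t = - y $ 2" using t y12(2) by (metis power2_eq_iff)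
      show "bb \<tau> * (- 2 * (p \<tau> $ 2) * second_vertical_derivative f (p \<tau>)) =
          dsharp (vector [p \<tau> $ 1, t]) * dsharp (vector [p \<tau> $ 1, - t])"
        using tx x(3) unfolding p1 by (auto simp: mult.commute)
      show "b (vector [p \<tau> $ 1, t]) = 0 \<or> b (vector [p \<tau> $ 1, - t]) = 0"
        using ty y(2) unfolding y12(1) by auto
      show "\<exists>Lg w. cdiff_at g Lg (vector [p \<tau> $ 1, t\<^sup>2]) \<and> Lg w \<noteq> 0"
        using x(4) unfolding t p1 .
    qed
  qed
  \<comment> \<open>Double points have \<open>t \<noteq> 0\<close>, so the second coordinate of
    \<open>p\<close> is not identically zero and can be made a power of the parameter.\<close>
  have nz2: "\<not> (\<forall>\<^sub>F \<tau> in nhds 0. p \<tau> $ 2 = 0)"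
  proof
    assume "\<forall>\<^sub>F \<tau> in nhds 0. p \<tau> $ 2 = 0"
    from at0[OF this] main have "\<forall>\<^sub>F \<tau> in at (0::complex). False" by eventually_elim blast
    then show False by simp
  qed
  have p02: "p 0 $ 2 = 0" by (simp add: p0)
  obtain N \<phi> r1 a where N: "N > 0" "r1 > 0" and \<phi>: "\<phi> holomorphic_on ball 0 r1" "\<phi> 0 = 0" "inj_on \<phi> (ball 0 r1)"
    and \<phi>N: "\<And>\<theta>. \<theta> \<in> ball 0 r1 \<Longrightarrow> p (\<phi> \<theta>) $ 2 = \<theta> ^ N" and \<phi>a: "((\<lambda>z. \<phi> z / z) \<longlongrightarrow> a) (at 0)" "a \<noteq> 0"
    by (rule reparametrize[OF pan[of 2] p02 nz2]) (rule that)
  have "isCont \<phi> 0"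
    using holomorphic_on_imp_continuous_on[OF \<phi>(1)] N(2) by (simp add: continuous_on_eq_continuous_at)
  from isCont_tendsto_nhds[OF this] have \<phi>lim: "(\<phi> \<longlongrightarrow> 0) (nhds 0)" unfolding \<phi>(2) .
  have \<phi>ne: "\<forall>\<^sub>F \<theta> in at 0. \<phi> \<theta> \<noteq> 0"
    using at0[OF inr[OF N(2)]] eventually_at_0_nonzero
  proof eventually_elim
    case (elim \<theta>)
    then show ?case using inj_onD[OF \<phi>(3), of \<theta> 0] \<phi>(2) N(2) by auto
  qed
  have \<phi>at: "filterlim \<phi> (at 0) (at 0)"
    unfolding filterlim_at using \<phi>ne tendsto_mono[OF at_0_le_nhds \<phi>lim] by simp
  define \<xi> where "\<xi> = (\<lambda>\<theta>. p (\<phi> \<theta>) $ 1)"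
  define E where "E = (\<lambda>\<theta>. bb (\<phi> \<theta>) * (- 2 * \<theta> ^ N * second_vertical_derivative f (p (\<phi> \<theta>))))"
  have p3: "\<forall>\<^sub>F \<tau> in nhds 0. p \<tau> $ 3 = 0"
    using main p0 by (subst eventually_nhds_conv_at) (auto elim: eventually_mono)
  obtain S where S: "open S" "0 \<in> S" "(\<lambda>\<tau>. p \<tau> $ 1) holomorphic_on S" using pan[of 1] unfolding analytic_at by blast
  have "\<forall>\<^sub>F \<tau> in nhds 0. p \<tau> $ 3 = 0 \<and> \<tau> \<in> ball 0 rp \<and> \<tau> \<in> S"
    using p3 inr[OF rp(1)] eventually_nhds_in_open[OF S(1,2)] by eventually_elim blast
  from eventually_conj[OF eventually_compose_filterlim[OF this \<phi>lim] inr[OF N(2)]]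
  obtain R where R: "R > 0" and RR: "\<And>\<theta>. norm \<theta> < R \<Longrightarrow> p (\<phi> \<theta>) $ 3 = 0 \<and> \<phi> \<theta> \<in> ball 0 rp \<and> \<phi> \<theta> \<in> S \<and> \<theta> \<in> ball 0 r1"
    unfolding eventually_nhds_metric by auto
  have "image_data b dsharp N \<xi> R E"
    unfolding image_data_def
  proof (intro conjI ballI allI impI)
    show "N > 0" "R > 0" by fact+
    show "\<xi> 0 = 0" by (simp add: \<xi>_def \<phi>(2) p0)
    have "\<theta> \<in> ball 0 r1 \<and> \<phi> \<theta> \<in> S" if "\<theta> \<in> ball 0 R" for \<theta>
      using RR[of \<theta>] that by simp
    then have sub: "ball (0::complex) R \<subseteq> ball 0 r1" "\<phi> ` ball 0 R \<subseteq> S" by blast+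
    from holomorphic_on_compose_gen[OF holomorphic_on_subset[OF \<phi>(1) sub(1)] S(3) sub(2)]
    show "\<xi> holomorphic_on ball 0 R" by (simp add: o_def \<xi>_def)
    fix \<theta> \<omega> :: complex
    assume \<theta>: "\<theta> \<in> ball 0 R" "\<theta> \<noteq> 0" and \<omega>: "\<omega> ^ N = 1" and eq: "\<xi> (\<omega> * \<theta>) = \<xi> \<theta>"
    have n\<theta>: "norm \<theta> < R" "norm (\<omega> * \<theta>) < R" using \<theta> norm_unity_root[OF \<omega> N(1)] by (simp_all add: norm_mult)
    \<comment> \<open>The second coordinates agree since \<open>\<omega> ^ N = 1\<close>, the third
      ones vanish, and \<xi> is the first. Injectivity of \<open>p\<close> and of
      \<open>\<phi>\<close> does the rest.\<close>
    have "p (\<phi> (\<omega> * \<theta>)) = p (\<phi> \<theta>)"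
      using RR[OF n\<theta>(1)] RR[OF n\<theta>(2)] eq \<phi>N[of \<theta>] \<phi>N[of "\<omega> * \<theta>"] \<omega>
      by (simp add: vec_eq_iff forall_3 \<xi>_def power_mult_distrib)
    then have "\<phi> (\<omega> * \<theta>) = \<phi> \<theta>" using inj_onD[OF rp(2)] RR[OF n\<theta>(1)] RR[OF n\<theta>(2)] by blast
    then have "\<omega> * \<theta> = \<theta>" using inj_onD[OF \<phi>(3)] RR[OF n\<theta>(1)] RR[OF n\<theta>(2)] by blast
    then show "\<omega> = 1" using \<theta>(2) by simp
  next
    show "\<forall>\<^sub>F \<theta> in at 0. \<forall>t. t\<^sup>2 = \<theta> ^ N \<longrightarrow>
        E \<theta> = dsharp (vector [\<xi> \<theta>, t]) * dsharp (vector [\<xi> \<theta>, - t]) \<and>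
        (b (vector [\<xi> \<theta>, t]) = 0 \<or> b (vector [\<xi> \<theta>, - t]) = 0) \<and>
        (\<exists>Lg w. cdiff_at g Lg (vector [\<xi> \<theta>, t\<^sup>2]) \<and> Lg w \<noteq> 0)"
      using eventually_compose_filterlim[OF main \<phi>at] at0[OF inr[OF N(2)]]
    proof eventually_elim
      case (elim \<theta>)
      then show ?case using \<phi>N[OF elim(2)] unfolding E_def \<xi>_def by auto
    qed
  qed
  \<comment> \<open>The summands in brackets are the orders of the constant, of
    \<open>\<theta> ^ N\<close> and of the second vertical derivative.\<close>
  moreover have "has_order E (v + (0 + int N + 0))"
    unfolding E_def
  proof (intro has_order_mult has_order_power has_order_compose[OF obb \<phi>at \<phi>a])
    show "has_order (\<lambda>\<theta>. - 2) 0" by (rule has_order_0[OF tendsto_const]) simp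
    show "has_order (\<lambda>\<theta>. second_vertical_derivative f (p (\<phi> \<theta>))) 0"
    proof (rule has_order_0)
      have "((\<lambda>\<theta>. second_vertical_derivative f (p (\<phi> \<theta>))) \<longlongrightarrow> second_vertical_derivative f 0) (nhds 0)"
        by (rule filterlim_compose[OF isCont_tendsto_nhds[OF second_vertical_derivative_isCont[OF fh]]
              filterlim_compose[OF plim \<phi>lim]])
      then show "((\<lambda>\<theta>. second_vertical_derivative f (p (\<phi> \<theta>))) \<longlongrightarrow> second_vertical_derivative f 0) (at 0)"
        by (rule tendsto_mono[OF at_0_le_nhds])
    qed (rule second_vertical_derivative_nonzero[OF f])
  qed
  ultimately show ?thesis by (intro exI[of _ N] exI[of _ \<xi>] exI[of _ R] exI[of _ E]) simp
qed

end

section \<open>Cross caps of a deformation\<close>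

lemma tendsto_zero_bounded_mult:
  fixes a b :: "'z \<Rightarrow> complex"
  assumes "(a \<longlongrightarrow> 0) F" "(b \<longlongrightarrow> l) F" shows "((\<lambda>x. a x * b x) \<longlongrightarrow> 0) F"
  using tendsto_mult[OF assms] by simp

section \<open>Differentials at a cross cap\<close>

lemma holo_at_line_deriv_continuous:
  assumes f: "holo_at f a"
  shows "\<forall>\<^sub>F x in nhds a. \<exists>L. cdiff_at f L x" "isCont (\<lambda>x. frechet_derivative f (at x) e) a"
proof -
  show ev: "\<forall>\<^sub>F x in nhds a. \<exists>L. cdiff_at f L x" using f by (simp add: holo_at_iff)
  obtain r where r: "r > 0" and c: "continuous_on (ball a r \<times> ball 0 r) (\<lambda>(x, h). deriv (\<lambda>h. f (x + h *s e)) h)"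
    using holo_at_line_derivs[OF f, of e] by metis
  have "continuous_on (ball a r) (\<lambda>x. deriv (\<lambda>h. f (x + h *s e)) 0)"
  proof (rule continuous_on_compose2[OF c, of "ball a r" "\<lambda>x. (x, 0)", simplified prod.case])
    show "(\<lambda>x. (x, 0)) ` ball a r \<subseteq> ball a r \<times> ball 0 r" using r by auto
  qed (intro continuous_on_Pair continuous_on_id continuous_on_const)
  then have "isCont (\<lambda>x. deriv (\<lambda>h. f (x + h *s e)) 0) a"
    using r by (simp add: continuous_on_eq_continuous_at)
  moreover have "\<forall>\<^sub>F x in nhds a. deriv (\<lambda>h. f (x + h *s e)) 0 = frechet_derivative f (at x) e"
    using ev
  proof eventually_elim
    case (elim x)
    then obtain L where L: "cdiff_at f L x" by blast
    show ?case using DERIV_imp_deriv[OF cdiff_at_line[OF L, of e]] cdiff_at_frechet[OF L] by simp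
  qed
  ultimately show "isCont (\<lambda>x. frechet_derivative f (at x) e) a"
    by (subst (asm) isCont_cong) auto
qed

text \<open>The inverse germ composed with \<open>h\<close> has derivative \<open>v\<close> in
  direction \<open>v\<close>, while the chain rule gives 0.\<close>

lemma biholo_germ_inj:
  fixes h :: "complex ^ 2 \<Rightarrow> complex ^ 2"
  assumes h: "biholo_germ h" and L: "\<And>i. cdiff_at (\<lambda>x. h x $ i) (L i) 0" and v: "\<And>i. L i v = 0"
  shows "v = 0"
proof -
  obtain h' where h': "holo_map_at h' 0" "\<forall>\<^sub>F x in nhds 0. h' (h x) = x" and h0: "h 0 = 0"
    using h unfolding biholo_germ_def by blast
  have "v $ j = 0" for j
  proof -
    obtain L' where L': "cdiff_at (\<lambda>x. h' x $ j) L' 0"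
      using h'(1)[unfolded holo_map_at_def holo_at_iff, rule_format, THEN eventually_nhds_x_imp_x] by blast
    have "((\<lambda>z. h' (h (0 + z *s v)) $ j) has_field_derivative L' 0) (at 0)"
    proof (rule cdiff_at_chain[where f="\<lambda>x. h' x $ j" and \<gamma>="\<lambda>z. h (0 + z *s v)"])
      show "cdiff_at (\<lambda>x. h' x $ j) L' (h (0 + 0 *s v))" using L' h0 by simp
      show "((\<lambda>z. h (0 + z *s v) $ i) has_field_derivative 0 $ i) (at 0)" for i
        using cdiff_at_line[OF L[of i], of v] v by simp
    qed
    moreover have "L' 0 = 0" using cdiff_at_scale[OF L', of 0 0] by simp
    moreover have "\<forall>\<^sub>F z in nhds 0. h' (h (0 + z *s v)) $ j = z * v $ j"
      using eventually_compose_filterlim[OF h'(2) tendsto_line[of 0 v]] by eventually_elim simp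
    ultimately have "((\<lambda>z. z * v $ j) has_field_derivative 0) (at 0)"
      by (subst (asm) DERIV_cong_ev[OF refl _ refl]) auto
    moreover have "((\<lambda>z. z * v $ j) has_field_derivative v $ j) (at 0)"
      by (auto intro!: derivative_eq_intros)
    ultimately show ?thesis using DERIV_unique by blast
  qed
  then show ?thesis by (simp add: vec_eq_iff)
qed

text \<open>The coordinate change in the target is moved to the other side, so that the normal form
  itself is a function of \<open>\<Psi>\<close> and its derivative along a vector can be read off
  from that of \<open>\<Psi>\<close>.\<close>

lemma cross_cap_coordinates:
  assumes "cross_cap \<Psi> a"
  obtains h :: "complex ^ 2 \<Rightarrow> complex ^ 2" and G :: "complex ^ 3 \<Rightarrow> complex ^ 3" where "biholo_germ h" "holo_map_at G (0 :: complex ^ 3)"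
    "\<forall>\<^sub>F x in nhds 0. vector [h x $ 1, (h x $ 2)\<^sup>2, h x $ 1 * h x $ 2] = G (\<Psi> (a + x) - \<Psi> a)"
proof -
  obtain h :: "complex ^ 2 \<Rightarrow> complex ^ 2" and k where h: "biholo_germ h" and k: "biholo_germ k"
    and eq: "\<forall>\<^sub>F x in nhds 0. \<Psi> (a + x) - \<Psi> a = k (vector [h x $ 1, (h x $ 2)\<^sup>2, h x $ 1 * h x $ 2])"
    using assms unfolding cross_cap_def A_equivalent_def by blast
  obtain k' where k': "holo_map_at k' 0" "\<forall>\<^sub>F x in nhds 0. k' (k x) = x"
    using k unfolding biholo_germ_def by blast
  have h0: "h 0 = 0" and hol: "holo_at (\<lambda>x. h x $ i) 0" for i
    using h unfolding biholo_germ_def holo_map_at_def by blast+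
  have hl: "((\<lambda>x. h x $ i) \<longlongrightarrow> 0) (nhds 0)" for i
    using isCont_tendsto_nhds[OF isCont_of_holo_at[OF hol[of i]]] h0 by simp
  have "((\<lambda>x. vector [h x $ 1, (h x $ 2)\<^sup>2, h x $ 1 * h x $ 2] :: complex ^ 3) \<longlongrightarrow> vector [0, 0\<^sup>2, 0 * 0]) (nhds 0)"
    by (intro tendsto_vector_3 tendsto_power tendsto_mult hl)
  then have "((\<lambda>x. vector [h x $ 1, (h x $ 2)\<^sup>2, h x $ 1 * h x $ 2] :: complex ^ 3) \<longlongrightarrow> 0) (nhds 0)" by simp
  from eventually_compose_filterlim[OF k'(2) this] eq
  have "\<forall>\<^sub>F x in nhds 0. vector [h x $ 1, (h x $ 2)\<^sup>2, h x $ 1 * h x $ 2] = k' (\<Psi> (a + x) - \<Psi> a)"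
    by eventually_elim simp
  from that[OF h k'(1) this] show thesis .
qed

text \<open>Along a curve \<open>c\<close> through a cross cap, let \<open>w\<close> be a vector field that the differential maps to
  \<open>m e\<^sub>3\<close>. In the coordinates of the normal form, \<open>m = o(s - s\<^sub>0)\<close> forces \<open>c\<close> to have zero velocity.\<close>

lemma cross_cap_simple:
  fixes c w :: "complex \<Rightarrow> complex ^ 2" and m :: "complex \<Rightarrow> complex"
  assumes cc: "cross_cap \<Psi> (c s0)"
    and c: "\<And>i. ((\<lambda>s. c s $ i) has_field_derivative c' $ i) (at s0)" and c'0: "c' \<noteq> 0"
    and w: "\<And>i. isCont (\<lambda>s. w s $ i) s0" and w0: "w s0 \<noteq> 0"
    and \<Psi>: "\<forall>\<^sub>F s in nhds s0. (\<Psi> has_derivative D s) (at (c s)) \<and>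
        (\<forall>z v. D s (z *s v) = z *s D s v) \<and> D s (w s) = m s *s e3"
    and m0: "m s0 = 0" and m1: "((\<lambda>s. m s / (s - s0)) \<longlongrightarrow> 0) (at s0)"
  shows False
proof -
  let ?a = "c s0"
  obtain h :: "complex ^ 2 \<Rightarrow> complex ^ 2" and G :: "complex ^ 3 \<Rightarrow> complex ^ 3" where h: "biholo_germ h" and G: "holo_map_at G 0"
    and eq: "\<forall>\<^sub>F x in nhds 0. vector [h x $ 1, (h x $ 2)\<^sup>2, h x $ 1 * h x $ 2] = G (\<Psi> (?a + x) - \<Psi> ?a)"
    using cross_cap_coordinates[OF cc] .
  have h0: "h 0 = 0" and hol: "holo_at (\<lambda>x. h x $ i) 0" for i
    using h unfolding biholo_germ_def holo_map_at_def by blast+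
  have Gh: "holo_at (\<lambda>x. G x $ i) 0" for i using G by (simp add: holo_map_at_def)
  have ccont: "isCont (\<lambda>s. c s $ i) s0" for i using DERIV_isCont[OF c] .
  define x where "x = (\<lambda>s. c s - ?a)"
  have "((\<lambda>s. x s $ i) \<longlongrightarrow> 0 $ i) (nhds s0)" for i
    using tendsto_diff[OF isCont_tendsto_nhds[OF ccont[of i]] tendsto_const[of "?a $ i"]] by (simp add: x_def)
  then have xlim: "(x \<longlongrightarrow> 0) (nhds s0)" by (rule tendsto_cvec)
  have "((\<lambda>s. c s $ i) \<longlongrightarrow> ?a $ i) (nhds s0)" for i by (rule isCont_tendsto_nhds[OF ccont])
  then have clim: "(c \<longlongrightarrow> ?a) (nhds s0)" by (rule tendsto_cvec)
  have \<Psi>a: "(\<Psi> has_derivative D s0) (at ?a)" using eventually_nhds_x_imp_x[OF \<Psi>] by simp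
  then have "isCont \<Psi> ?a" by (rule has_derivative_continuous)
  from filterlim_compose[OF isCont_tendsto_nhds[OF this] clim]
  have "((\<lambda>s. \<Psi> (c s) - \<Psi> ?a) \<longlongrightarrow> \<Psi> ?a - \<Psi> ?a) (nhds s0)" by (intro tendsto_diff tendsto_const)
  then have ylim: "((\<lambda>s. \<Psi> (c s) - \<Psi> ?a) \<longlongrightarrow> 0) (nhds s0)" by simp
  define Lh where "Lh = (\<lambda>i s. frechet_derivative (\<lambda>x. h x $ i) (at (x s)))"
  define LG where "LG = (\<lambda>i s. frechet_derivative (\<lambda>x. G x $ i) (at (\<Psi> (c s) - \<Psi> ?a)))"
  define K where "K = (\<lambda>i s. LG i s e3)"
  have cdh: "\<forall>\<^sub>F s in nhds s0. cdiff_at (\<lambda>x. h x $ i) (Lh i s) (x s)" for i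
    using eventually_compose_filterlim[OF holo_at_line_deriv_continuous(1)[OF hol[of i]] xlim]
  proof eventually_elim
    case (elim s)
    then obtain L where L: "cdiff_at (\<lambda>x. h x $ i) L (x s)" by blast
    show ?case unfolding Lh_def cdiff_at_frechet[OF L] by (rule L)
  qed
  have cdG: "\<forall>\<^sub>F s in nhds s0. cdiff_at (\<lambda>x. G x $ i) (LG i s) (\<Psi> (c s) - \<Psi> ?a)" for i
    using eventually_compose_filterlim[OF holo_at_line_deriv_continuous(1)[OF Gh[of i]] ylim]
  proof eventually_elim
    case (elim s)
    then obtain L where L: "cdiff_at (\<lambda>x. G x $ i) L (\<Psi> (c s) - \<Psi> ?a)" by blast
    show ?case unfolding LG_def cdiff_at_frechet[OF L] by (rule L)
  qed
  have Kl: "(K i \<longlongrightarrow> K i s0) (nhds s0)" for i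
    using filterlim_compose[OF isCont_tendsto_nhds[OF holo_at_line_deriv_continuous(2)[OF Gh[of i], of e3]] ylim]
    by (simp add: K_def LG_def)
  define W where "W = (\<lambda>i s. Lh i s (w s))"
  have Lhe: "((\<lambda>s. Lh i s e) \<longlongrightarrow> Lh i s0 e) (nhds s0)" for i e
    using filterlim_compose[OF isCont_tendsto_nhds[OF holo_at_line_deriv_continuous(2)[OF hol[of i], of e]] xlim]
    by (simp add: Lh_def x_def)
  have Weq: "\<forall>\<^sub>F s in nhds s0. w s $ 1 * Lh i s (axis 1 1) + w s $ 2 * Lh i s (axis 2 1) = W i s" for i
    using cdh[of i]
  proof eventually_elim
    case (elim s)
    have ws: "w s = w s $ 1 *s axis 1 1 + w s $ 2 *s axis 2 1"
      by (simp add: vec_eq_iff forall_2 axis_def)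
    show ?case unfolding W_def by (subst (3) ws) (simp add: cdiff_at_add[OF elim] cdiff_at_scale[OF elim] del: vector_add_component)
  qed
  have Wl: "(W i \<longlongrightarrow> W i s0) (nhds s0)" for i
  proof -
    have "((\<lambda>s. w s $ 1 * Lh i s (axis 1 1) + w s $ 2 * Lh i s (axis 2 1)) \<longlongrightarrow>
        w s0 $ 1 * Lh i s0 (axis 1 1) + w s0 $ 2 * Lh i s0 (axis 2 1)) (nhds s0)"
      by (intro tendsto_add tendsto_mult Lhe isCont_tendsto_nhds[OF w])
    from Lim_transform_eventually[OF this Weq[of i]] eventually_nhds_x_imp_x[OF Weq[of i]] show ?thesis by simp
  qed
  \<comment> \<open>The components \<open>X\<close>, \<open>Y^2\<close>, \<open>X * Y\<close> of the
    normal form, differentiated along \<open>w\<close>. On the other side the differential of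
    \<open>G\<close> is applied to \<open>m e3\<close>, which gives \<open>m\<close> times
    \<open>K\<close>.\<close>
  have key: "\<forall>\<^sub>F s in nhds s0. W 1 s = m s * K 1 s \<and> 2 * (h (x s) $ 2) * W 2 s = m s * K 2 s \<and>
      h (x s) $ 1 * W 2 s + h (x s) $ 2 * W 1 s = m s * K 3 s"
  proof -
    have "\<forall>\<^sub>F y in nhds 0. \<forall>\<^sub>F x in nhds y. vector [h x $ 1, (h x $ 2)\<^sup>2, h x $ 1 * h x $ 2] = G (\<Psi> (?a + x) - \<Psi> ?a)"
      using eq by (subst eventually_eventually)
    from eventually_compose_filterlim[OF this xlim] \<Psi> cdh[of 1] cdh[of 2] cdG[of 1] cdG[of 2] cdG[of 3]
    show ?thesis
    proof eventually_elim
      case (elim s)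
      have ax: "?a + x s = c s" by (simp add: x_def)
      have \<Psi>l: "((\<lambda>z. \<Psi> (?a + (x s + z *s w s)) - \<Psi> ?a) has_derivative (\<lambda>z. z *s (m s *s e3))) (at 0)"
      proof -
        have 0: "((\<lambda>z. c s + z *s w s) has_derivative (\<lambda>z. z *s w s)) (at 0)"
          by (rule has_derivative_cvec) (auto intro!: derivative_eq_intros)
        have "(\<Psi> has_derivative D s) (at (c s + 0 *s w s))" using elim(2) by simp
        from has_derivative_compose[OF 0 this]
        have 1: "((\<lambda>z. \<Psi> (c s + z *s w s)) has_derivative (\<lambda>z. D s (z *s w s))) (at 0)" .
        have 2: "D s (z *s w s) = z *s (m s *s e3)" for z using elim(2) by simp
        show ?thesis
          using has_derivative_diff[OF 1 has_derivative_const[of "\<Psi> ?a"]] unfolding 2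
          by (simp add: add.assoc[symmetric] ax)
      qed
      have R: "((\<lambda>z. G (\<Psi> (?a + (x s + z *s w s)) - \<Psi> ?a) $ j) has_field_derivative m s * K j s) (at 0)"
        if cd: "cdiff_at (\<lambda>x. G x $ j) (LG j s) (\<Psi> (c s) - \<Psi> ?a)" for j
      proof -
        have y0: "\<Psi> (?a + (x s + 0 *s w s)) - \<Psi> ?a = \<Psi> (c s) - \<Psi> ?a" by (simp add: ax)
        have "((\<lambda>x. G x $ j) has_derivative LG j s) (at (\<Psi> (?a + (x s + 0 *s w s)) - \<Psi> ?a))"
          unfolding y0 using cd by (simp add: cdiff_at_def)
        from has_derivative_compose[OF \<Psi>l this]
        have "((\<lambda>z. G (\<Psi> (?a + (x s + z *s w s)) - \<Psi> ?a) $ j) has_derivative (\<lambda>z. LG j s (z *s (m s *s e3)))) (at 0)" .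
        moreover have "LG j s (z *s (m s *s e3)) = m s * K j s * z" for z
          by (simp only: cdiff_at_scale[OF cd] K_def mult_ac)
        ultimately show ?thesis by (simp add: has_field_derivative_def)
      qed
      have hd: "((\<lambda>z. h (x s + z *s w s) $ 1) has_field_derivative W 1 s) (at 0)"
        "((\<lambda>z. h (x s + z *s w s) $ 2) has_field_derivative W 2 s) (at 0)"
        unfolding W_def by (rule cdiff_at_line[OF elim(3)], rule cdiff_at_line[OF elim(4)])
      have ev: "\<forall>\<^sub>F z in nhds 0. (vector [h (x s + z *s w s) $ 1, (h (x s + z *s w s) $ 2)\<^sup>2,
          h (x s + z *s w s) $ 1 * h (x s + z *s w s) $ 2] :: complex ^ 3) = G (\<Psi> (?a + (x s + z *s w s)) - \<Psi> ?a)"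
        by (rule eventually_compose_filterlim[OF elim(1) tendsto_line])
      have ev1: "\<forall>\<^sub>F z in nhds 0. G (\<Psi> (?a + (x s + z *s w s)) - \<Psi> ?a) $ 1 = h (x s + z *s w s) $ 1"
        using ev
      proof eventually_elim
        case (elim z)
        show ?case unfolding elim[symmetric] by simp
      qed
      have ev2: "\<forall>\<^sub>F z in nhds 0. G (\<Psi> (?a + (x s + z *s w s)) - \<Psi> ?a) $ 2 = h (x s + z *s w s) $ 2 * h (x s + z *s w s) $ 2"
        using ev
      proof eventually_elim
        case (elim z)
        show ?case unfolding elim[symmetric] by (simp add: power2_eq_square)
      qed
      have ev3: "\<forall>\<^sub>F z in nhds 0. G (\<Psi> (?a + (x s + z *s w s)) - \<Psi> ?a) $ 3 = h (x s + z *s w s) $ 1 * h (x s + z *s w s) $ 2"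
        using ev
      proof eventually_elim
        case (elim z)
        show ?case unfolding elim[symmetric] by simp
      qed
      have "m s * K 1 s = W 1 s"
        using R[OF elim(5)] hd(1) unfolding DERIV_cong_ev[OF refl ev1 refl] by (rule DERIV_unique)
      moreover have "m s * K 2 s = W 2 s * h (x s + 0 *s w s) $ 2 + W 2 s * h (x s + 0 *s w s) $ 2"
        using R[OF elim(6)] DERIV_mult[OF hd(2) hd(2)] unfolding DERIV_cong_ev[OF refl ev2 refl] by (rule DERIV_unique)
      moreover have "m s * K 3 s = W 1 s * h (x s + 0 *s w s) $ 2 + W 2 s * h (x s + 0 *s w s) $ 1"
        using R[OF elim(7)] DERIV_mult[OF hd(1) hd(2)] unfolding DERIV_cong_ev[OF refl ev3 refl] by (rule DERIV_unique)
      ultimately show ?case by (simp add: mult_ac)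
    qed
  qed
  have inj: "v = 0" if "\<And>i. Lh i s0 v = 0" for v
  proof (rule biholo_germ_inj[OF h])
    show "cdiff_at (\<lambda>x. h x $ i) (Lh i s0) 0" for i
      using eventually_nhds_x_imp_x[OF cdh[of i]] by (simp add: x_def)
  qed (rule that)
  \<comment> \<open>At \<open>s0\<close> the first equation gives \<open>W 1 = 0\<close>. As the
    differential of \<open>h\<close> is injective and \<open>w s0\<close> is nonzero,
    \<open>W 2\<close> is nonzero and may be divided by.\<close>
  have W10: "W 1 s0 = 0" using eventually_nhds_x_imp_x[OF key] m0 by simp
  have W20: "W 2 s0 \<noteq> 0"
  proof
    assume W2: "W 2 s0 = 0"
    have "Lh i s0 (w s0) = 0" for i using exhaust_2[of i] W10 W2 by (auto simp: W_def)
    with inj w0 show False by blast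
  qed
  have at_le: "at s0 \<le> nhds s0" unfolding at_within_def by simp
  note Wa = tendsto_mono[OF at_le Wl] and Ka = tendsto_mono[OF at_le Kl]
  have W2ne: "\<forall>\<^sub>F s in at s0. W 2 s \<noteq> 0" by (rule tendsto_imp_eventually_ne[OF Wa W20])
  have key': "\<forall>\<^sub>F s in at s0. W 1 s = m s * K 1 s \<and> 2 * (h (x s) $ 2) * W 2 s = m s * K 2 s \<and>
      h (x s) $ 1 * W 2 s + h (x s) $ 2 * W 1 s = m s * K 3 s"
    using key by (rule filter_leD[OF at_le])
  \<comment> \<open>The second equation is solved for \<open>Y\<close>, then the third for
    \<open>X\<close>; both inherit \<open>o(s - s0)\<close> from \<open>m\<close>.\<close>
  have l2: "((\<lambda>s. h (x s) $ 2 / (s - s0)) \<longlongrightarrow> 0) (at s0)"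
  proof -
    have "((\<lambda>s. m s / (s - s0) * (K 2 s / (2 * W 2 s))) \<longlongrightarrow> 0) (at s0)"
      by (rule tendsto_zero_bounded_mult[OF m1 tendsto_divide[OF Ka[of 2] tendsto_mult[OF tendsto_const[of 2] Wa[of 2]]]])
         (use W20 in simp)
    moreover have "\<forall>\<^sub>F s in at s0. m s / (s - s0) * (K 2 s / (2 * W 2 s)) = h (x s) $ 2 / (s - s0)"
      using key' W2ne
    proof eventually_elim
      case (elim s)
      then have "m s * K 2 s / (2 * W 2 s) = h (x s) $ 2" by (simp add: field_simps)
      then have "m s * K 2 s / (2 * W 2 s) / (s - s0) = h (x s) $ 2 / (s - s0)" by simp
      then show ?case by (simp add: mult_ac)
    qed
    ultimately show ?thesis by (rule Lim_transform_eventually)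
  qed
  have l1: "((\<lambda>s. h (x s) $ 1 / (s - s0)) \<longlongrightarrow> 0) (at s0)"
  proof -
    have "((\<lambda>s. m s / (s - s0) * (K 3 s / W 2 s) - h (x s) $ 2 / (s - s0) * (W 1 s / W 2 s)) \<longlongrightarrow> 0) (at s0)"
      using tendsto_diff[OF tendsto_zero_bounded_mult[OF m1 tendsto_divide[OF Ka[of 3] Wa[of 2] W20]]
          tendsto_zero_bounded_mult[OF l2 tendsto_divide[OF Wa[of 1] Wa[of 2] W20]]] by simp
    moreover have "\<forall>\<^sub>F s in at s0. m s / (s - s0) * (K 3 s / W 2 s) - h (x s) $ 2 / (s - s0) * (W 1 s / W 2 s) = h (x s) $ 1 / (s - s0)"
      using key' W2ne
    proof eventually_elim
      case (elim s)
      have e: "h (x s) $ 1 * W 2 s + h (x s) $ 2 * W 1 s = m s * K 3 s" using elim(1) by blast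
      have "(m s * K 3 s - h (x s) $ 2 * W 1 s) / W 2 s = h (x s) $ 1"
        unfolding e[symmetric] using elim(2) by simp
      then have "(m s * K 3 s - h (x s) $ 2 * W 1 s) / W 2 s / (s - s0) = h (x s) $ 1 / (s - s0)" by simp
      then show ?case by (simp add: diff_divide_distrib mult_ac)
    qed
    ultimately show ?thesis by (rule Lim_transform_eventually)
  qed
  have hx: "((\<lambda>s. h (x s) $ i) has_field_derivative Lh i s0 c') (at s0)" for i
  proof (rule cdiff_at_chain[where f="\<lambda>x. h x $ i" and \<gamma>=x])
    show "cdiff_at (\<lambda>x. h x $ i) (Lh i s0) (x s0)" by (rule eventually_nhds_x_imp_x[OF cdh])
    show "((\<lambda>z. x z $ j) has_field_derivative c' $ j) (at s0)" for j
      unfolding x_def using DERIV_diff[OF c[of j] DERIV_const[of "?a $ j"]] by simp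
  qed
  have x0: "h (x s0) = 0" by (simp add: x_def h0)
  have "Lh i s0 c' = 0" for i
  proof -
    have "((\<lambda>s. h (x s) $ i / (s - s0)) \<longlongrightarrow> Lh i s0 c') (at s0)"
      using hx[of i] unfolding has_field_derivative_iff by (simp add: x0)
    moreover have "((\<lambda>s. h (x s) $ i / (s - s0)) \<longlongrightarrow> 0) (at s0)"
      using exhaust_2[of i] l1 l2 by auto
    ultimately show ?thesis by (rule tendsto_unique[OF at_neq_bot])
  qed
  with inj c'0 show False by blast
qed

text \<open>Along the curve that is the \<open>Y\<close>-axis in the source coordinates the normal
  form is \<open>(0, z^2, 0)\<close>, so its image has zero velocity at 0, while the curve itself
  has not.\<close>

lemma cross_cap_singular:
  fixes \<Psi> :: "complex ^ 2 \<Rightarrow> complex ^ 3"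
  assumes cc: "cross_cap \<Psi> a" and D: "(\<Psi> has_derivative D) (at a)"
  shows "\<not> inj D"
proof
  assume inj: "inj D"
  obtain h :: "complex ^ 2 \<Rightarrow> complex ^ 2" and k :: "complex ^ 3 \<Rightarrow> complex ^ 3" where h: "biholo_germ h" and k: "biholo_germ k"
    and eq: "\<forall>\<^sub>F x in nhds 0. \<Psi> (a + x) - \<Psi> a = k (vector [h x $ 1, (h x $ 2)\<^sup>2, h x $ 1 * h x $ 2])"
    using cc unfolding cross_cap_def A_equivalent_def by blast
  obtain h' where h': "holo_map_at h' 0" "h' 0 = 0" "\<forall>\<^sub>F x in nhds 0. h' (h x) = x" "\<forall>\<^sub>F x in nhds 0. h (h' x) = x"
    using h unfolding biholo_germ_def by blast
  have bh': "biholo_germ h'" using h h' unfolding biholo_germ_def by blast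
  have hh': "holo_at (\<lambda>x. h' x $ i) 0" and kh: "holo_at (\<lambda>x. k x $ j) 0" and k0: "k 0 = 0" for i j
    using h'(1) k unfolding holo_map_at_def biholo_germ_def by blast+
  define L' where "L' = (\<lambda>i. frechet_derivative (\<lambda>x. h' x $ i) (at 0))"
  have L': "cdiff_at (\<lambda>x. h' x $ i) (L' i) 0" for i
  proof -
    obtain L where L: "cdiff_at (\<lambda>x. h' x $ i) L 0"
      using eventually_nhds_x_imp_x[OF hh'[of i, unfolded holo_at_iff]] by blast
    show ?thesis unfolding L'_def cdiff_at_frechet[OF L] by (rule L)
  qed
  define e :: "complex ^ 2" where "e = axis 2 1"
  define v where "v = (\<chi> i. L' i e)"
  have vh: "((\<lambda>z. h' (0 + z *s e)) has_derivative (\<lambda>z. z *s v)) (at 0)"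
  proof (rule has_derivative_cvec)
    show "((\<lambda>z. h' (0 + z *s e) $ i) has_field_derivative v $ i) (at 0)" for i
      using cdiff_at_line[OF L'[of i], of e] by (simp add: v_def)
  qed
  have v0: "v \<noteq> 0"
  proof
    assume "v = 0"
    then have "L' i e = 0" for i by (simp add: v_def vec_eq_iff)
    from biholo_germ_inj[OF bh' L' this] show False by (simp add: e_def axis_eq_0_iff)
  qed
  have ah: "((\<lambda>z. a + h' (0 + z *s e)) has_derivative (\<lambda>z. z *s v)) (at 0)"
    using has_derivative_add[OF has_derivative_const[of a] vh] by simp
  have "(\<Psi> has_derivative D) (at (a + h' (0 + 0 *s e)))" using D h'(2) by simp
  from has_derivative_diff[OF has_derivative_compose[OF ah this] has_derivative_const[of "\<Psi> a"]]
  have 1: "((\<lambda>z. \<Psi> (a + h' (0 + z *s e)) - \<Psi> a) has_derivative (\<lambda>z. D (z *s v))) (at 0)" by simp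
  have 2: "((\<lambda>z. k (vector [0, z\<^sup>2, 0])) has_derivative (\<lambda>z. z *s 0)) (at 0)"
  proof (rule has_derivative_cvec)
    fix j
    obtain L where L: "cdiff_at (\<lambda>x. k x $ j) L 0"
      using eventually_nhds_x_imp_x[OF kh[of j, unfolded holo_at_iff]] by blast
    have "((\<lambda>z. k (vector [0, z\<^sup>2, 0]) $ j) has_field_derivative L 0) (at 0)"
    proof (rule cdiff_at_chain[where f="\<lambda>x. k x $ j" and \<gamma>="\<lambda>z. vector [0, z\<^sup>2, 0]"])
      show "cdiff_at (\<lambda>x. k x $ j) L (vector [0, 0\<^sup>2, 0])" using L by simp
      show "((\<lambda>z. (vector [0, z\<^sup>2, 0] :: complex ^ 3) $ i) has_field_derivative 0 $ i) (at 0)" for i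
        using exhaust_3[of i] by (auto intro!: derivative_eq_intros)
    qed
    moreover have "L 0 = 0" using cdiff_at_scale[OF L, of 0 0] by simp
    ultimately show "((\<lambda>z. k (vector [0, z\<^sup>2, 0]) $ j) has_field_derivative 0 $ j) (at 0)" by simp
  qed
  have hl: "((\<lambda>x. h' x $ i) \<longlongrightarrow> h' 0 $ i) (nhds 0)" for i
    by (rule isCont_tendsto_nhds[OF isCont_of_holo_at[OF hh'[of i]]])
  then have "(h' \<longlongrightarrow> h' 0) (nhds 0)" by (rule tendsto_cvec)
  then have hl': "(h' \<longlongrightarrow> 0) (nhds 0)" unfolding h'(2) .
  have "\<forall>\<^sub>F z in nhds 0. \<Psi> (a + h' (0 + z *s e)) - \<Psi> a = k (vector [0, z\<^sup>2, 0])"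
    using eventually_compose_filterlim[OF eventually_compose_filterlim[OF eq hl'] tendsto_line[of 0 e]]
      eventually_compose_filterlim[OF h'(4) tendsto_line[of 0 e]]
  proof eventually_elim
    case (elim z)
    then show ?case by (simp add: e_def axis_def)
  qed
  then have ev: "\<forall>\<^sub>F z in at 0. \<Psi> (a + h' (0 + z *s e)) - \<Psi> a = k (vector [0, z\<^sup>2, 0])"
    and e0: "\<Psi> (a + h' (0 + 0 *s e)) - \<Psi> a = k (vector [0, 0\<^sup>2, 0])"
    by (simp_all add: eventually_nhds_conv_at)
  from has_derivative_transform_eventually[OF 1 ev e0]
  have "((\<lambda>z. k (vector [0, z\<^sup>2, 0])) has_derivative (\<lambda>z. D (z *s v))) (at 0)" by simp
  from has_derivative_unique[OF this 2] have "(\<lambda>z. D (z *s v)) = (\<lambda>z. z *s 0)" .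
  from fun_cong[OF this, of 1] have "D v = 0" by simp
  moreover have "D 0 = 0"
    using D has_derivative_bounded_linear linear_simps(3) by blast
  ultimately have "v = 0" using injD[OF inj, of v 0] by simp
  with v0 show False by simp
qed

text \<open>A continuous parameter \<open>e\<close> is enough here: it makes the slices uniformly
  close to the one at \<open>e = 0\<close>, as Rouche's theorem requires.\<close>

definition hol3 :: "real \<Rightarrow> (complex \<Rightarrow> complex \<Rightarrow> complex \<Rightarrow> complex) \<Rightarrow> bool" where
  "hol3 r f \<longleftrightarrow> continuous_on ((ball 0 r \<times> ball 0 r) \<times> ball 0 r) (\<lambda>((e, s), t). f e s t) \<and>
     (\<forall>e\<in>ball 0 r. hol2 r (f e))"

lemma hol3D:
  assumes "hol3 r f"
  shows "continuous_on ((ball 0 r \<times> ball 0 r) \<times> ball 0 r) (\<lambda>((e, s), t). f e s t)"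
    "\<And>e. e \<in> ball 0 r \<Longrightarrow> hol2 r (f e)"
  using assms unfolding hol3_def by blast+

lemma hol3_mult: "hol3 r f \<Longrightarrow> hol3 r h \<Longrightarrow> hol3 r (\<lambda>e s t. f e s t * h e s t)"
  unfolding hol3_def case_prod_unfold by (auto intro!: continuous_on_mult hol2_mult)

lemma hol3_diff: "hol3 r f \<Longrightarrow> hol3 r h \<Longrightarrow> hol3 r (\<lambda>e s t. f e s t - h e s t)"
  unfolding hol3_def case_prod_unfold by (auto intro!: continuous_on_diff hol2_diff)

lemma hol3_swap:
  assumes f: "hol3 r f" shows "hol3 r (\<lambda>e s t. f e t s)"
  unfolding hol3_def
proof (intro conjI ballI)
  have c: "continuous_on ((ball 0 r \<times> ball 0 r) \<times> ball 0 r) (\<lambda>p. f (fst (fst p)) (snd (fst p)) (snd p))"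
    using hol3D(1)[OF f] by (simp add: case_prod_unfold)
  show "continuous_on ((ball 0 r \<times> ball 0 r) \<times> ball 0 r) (\<lambda>((e, s), t). f e t s)"
    unfolding case_prod_unfold
  proof (rule continuous_on_compose2[OF c, of _ "\<lambda>p. ((fst (fst p), snd p), snd (fst p))", simplified fst_conv snd_conv])
    show "(\<lambda>p. ((fst (fst p), snd p), snd (fst p))) ` ((ball 0 r \<times> ball 0 r) \<times> ball 0 r) \<subseteq>
        (ball 0 r \<times> ball 0 r) \<times> ball 0 r" by auto
  qed (intro continuous_on_Pair continuous_on_fst continuous_on_snd continuous_on_id)
qed (rule hol2_swap[OF hol3D(2)[OF f]])

lemma hol3_deriv_snd:
  assumes f: "hol3 r f" shows "hol3 r (\<lambda>e s t. deriv (f e s) t)"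
  unfolding hol3_def
proof (intro conjI ballI hol2_deriv_snd hol3D(2)[OF f])
  have 1: "continuous_on ((ball 0 r \<times> ball 0 r) \<times> ball 0 r) (\<lambda>(p, t). f (fst p) (snd p) t)"
    using hol3D(1)[OF f] by (simp add: case_prod_unfold)
  have "continuous_on ((ball 0 r \<times> ball 0 r) \<times> ball 0 r) (\<lambda>(p, t). deriv (f (fst p) (snd p)) t)"
    by (rule continuous_on_deriv_param[OF 1 open_ball]) (use hol2D(2)[OF hol3D(2)[OF f]] in auto)
  then show "continuous_on ((ball 0 r \<times> ball 0 r) \<times> ball 0 r) (\<lambda>((e, s), t). deriv (f e s) t)"
    by (simp add: case_prod_unfold)
qed

lemma hol3_deriv_fst: "hol3 r f \<Longrightarrow> hol3 r (\<lambda>e s t. deriv (\<lambda>s. f e s t) s)"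
  using hol3_swap[OF hol3_deriv_snd[OF hol3_swap]] .

lemma hol3_mono: "hol3 r f \<Longrightarrow> r' \<le> r \<Longrightarrow> hol3 r' f"
  unfolding hol3_def
proof (intro conjI ballI; elim conjE)
  assume r: "r' \<le> r" and c: "continuous_on ((ball 0 r \<times> ball 0 r) \<times> ball 0 r) (\<lambda>((e, s), t). f e s t)"
  have sub: "ball (0::complex) r' \<subseteq> ball 0 r" using r by (rule subset_ball)
  show "continuous_on ((ball 0 r' \<times> ball 0 r') \<times> ball 0 r') (\<lambda>((e, s), t). f e s t)"
    by (rule continuous_on_subset[OF c]) (use sub in blast)
qed (auto intro: hol2_mono)

lemma hol3_nearby:
  assumes f: "hol3 r f" and r: "r > 0" and \<epsilon>: "\<epsilon> > 0"
  shows "\<exists>\<eta>>0. \<eta> \<le> r \<and> (\<forall>e s t. norm e < \<eta> \<longrightarrow> norm s < \<eta> \<longrightarrow> norm t < \<eta> \<longrightarrow> norm (f e s t - f 0 0 0) < \<epsilon>)"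
proof -
  have "isCont (\<lambda>((e, s), t). f e s t) ((0, 0), 0)"
    using hol3D(1)[OF f] r by (subst (asm) continuous_on_eq_continuous_at) (auto intro: open_Times)
  from tendstoD[OF isCont_tendsto_nhds[OF this] \<epsilon>]
  obtain \<eta>0 where \<eta>0: "\<eta>0 > 0" "\<And>e s t. dist ((e, s), t) ((0, 0), 0) < \<eta>0 \<Longrightarrow> dist (f e s t) (f 0 0 0) < \<epsilon>"
    unfolding eventually_nhds_metric by auto
  define \<eta> where "\<eta> = min r (\<eta>0 / 3)"
  have \<eta>: "\<eta> > 0" "\<eta> \<le> r" "\<eta> \<le> \<eta>0 / 3" using \<eta>0 r by (auto simp: \<eta>_def)
  have "norm (f e s t - f 0 0 0) < \<epsilon>" if "norm e < \<eta>" "norm s < \<eta>" "norm t < \<eta>" for e s t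
  proof -
    have "dist ((e, s), t) ((0, 0), 0) \<le> norm (e, s) + norm t" using norm_Pair_le[of "(e, s)" t] by (simp add: dist_norm)
    also have "norm (e, s) \<le> norm e + norm s" by (rule norm_Pair_le)
    finally have "dist ((e, s), t) ((0, 0), 0) < \<eta>0" using that \<eta> by simp
    from \<eta>0(2)[OF this] show ?thesis by (simp add: dist_norm)
  qed
  then show ?thesis using \<eta> by blast
qed

text \<open>Tube argument: compactness of the closed disc in \<open>s\<close> makes the bound
  uniform there, while only \<open>e\<close> and \<open>t\<close> are small.\<close>

lemma hol3_uniform:
  assumes f: "hol3 r f" and r: "0 < r" "\<rho> < r" and \<epsilon>: "\<epsilon> > 0"
  shows "\<exists>\<eta>>0. \<eta> \<le> r \<and> (\<forall>e s t. norm e < \<eta> \<longrightarrow> norm s \<le> \<rho> \<longrightarrow> norm t < \<eta> \<longrightarrow> norm (f e s t - f 0 s 0) < \<epsilon>)"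
proof -
  have c: "continuous_on ((ball 0 r \<times> ball 0 r) \<times> ball 0 r) (\<lambda>p. f (fst (fst p)) (snd (fst p)) (snd p))"
    using hol3D(1)[OF f] by (simp add: case_prod_unfold)
  have c2: "continuous_on ((ball 0 r \<times> ball 0 r) \<times> cball 0 \<rho>) (\<lambda>q. f (fst (fst q)) (snd q) (snd (fst q)))"
  proof (rule continuous_on_compose2[OF c, of _ "\<lambda>q. ((fst (fst q), snd q), snd (fst q))", simplified fst_conv snd_conv])
    show "(\<lambda>q. ((fst (fst q), snd q), snd (fst q))) ` ((ball 0 r \<times> ball 0 r) \<times> cball 0 \<rho>) \<subseteq>
        (ball 0 r \<times> ball 0 r) \<times> ball 0 r" using r by auto
  qed (intro continuous_on_Pair continuous_on_fst continuous_on_snd continuous_on_id)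
  have "(0, 0) \<in> ball (0::complex) r \<times> ball (0::complex) r" using r by simp
  from continuous_on_prod_compactE[OF c2 compact_cball this half_gt_zero[OF \<epsilon>]]
  obtain X0 where X0: "(0, 0) \<in> X0" "open X0"
    "\<forall>x\<in>X0 \<inter> ball 0 r \<times> ball 0 r. \<forall>t\<in>cball 0 \<rho>. dist (f (fst x) t (snd x)) (f 0 t 0) \<le> \<epsilon> / 2"
    by auto
  obtain \<eta>0 where \<eta>0: "\<eta>0 > 0" "ball (0, 0) \<eta>0 \<subseteq> X0" using X0(1,2) open_contains_ball by blast
  define \<eta> where "\<eta> = min r (\<eta>0 / 2)"
  have \<eta>: "\<eta> > 0" "\<eta> \<le> r" "\<eta> \<le> \<eta>0 / 2" using \<eta>0 r by (auto simp: \<eta>_def)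
  have "norm (f e s t - f 0 s 0) < \<epsilon>" if "norm e < \<eta>" "norm s \<le> \<rho>" "norm t < \<eta>" for e s t
  proof -
    have "dist (0, 0) (e, t) \<le> norm e + norm t" using norm_Pair_le[of e t] by (simp add: dist_norm norm_Pair)
    then have "(e, t) \<in> X0 \<inter> ball 0 r \<times> ball 0 r" using that \<eta> \<eta>0(2) by auto
    from X0(3)[rule_format, OF this, of s] that(2) have "dist (f e s t) (f 0 s 0) \<le> \<epsilon> / 2" by simp
    then show ?thesis using \<epsilon> by (simp add: dist_norm)
  qed
  then show ?thesis using \<eta> by blast
qed

lemma holo_at_imp_hol3:
  assumes "holo_at \<phi> (0 :: complex ^ 3)"
  shows "\<exists>r>0. hol3 r (\<lambda>e s t. \<phi> (vector [s, t, e]))"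
proof -
  obtain \<epsilon> where \<epsilon>: "\<epsilon> > 0" "continuous_on (ball 0 \<epsilon>) \<phi>" "\<And>x. x \<in> ball 0 \<epsilon> \<Longrightarrow> \<exists>L. cdiff_at \<phi> L x"
    using holo_at_imp_continuous_on[OF assms] by blast
  define r where "r = \<epsilon> / 3"
  have r: "r > 0" using \<epsilon> by (simp add: r_def)
  have inb: "(vector [s, t, e] :: complex ^ 3) \<in> ball 0 \<epsilon>" if "s \<in> ball 0 r" "t \<in> ball 0 r" "e \<in> ball 0 r" for s t e
  proof -
    have "norm (vector [s, t, e] :: complex ^ 3) \<le> norm s + norm t + norm e"
      using L2_set_le_sum[of UNIV "\<lambda>i. norm ((vector [s, t, e] :: complex ^ 3) $ i)"]
      by (simp add: norm_vec_def sum_3)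
    then show ?thesis using that by (simp add: r_def)
  qed
  have vc: "continuous_on X (\<lambda>x. vector [a x, b x, c x] :: complex ^ 3)"
    if "continuous_on X a" "continuous_on X b" "continuous_on X c" for X :: "'z::topological_space set" and a b c
    using that unfolding continuous_on_def by (auto intro!: tendsto_vector_3)
  have d1: "(\<lambda>s. \<phi> (vector [s, t, e])) holomorphic_on ball 0 r" if te: "t \<in> ball 0 r" "e \<in> ball 0 r" for t e
    unfolding holomorphic_on_open[OF open_ball]
  proof
    fix s :: complex assume "s \<in> ball 0 r"
    then obtain L where L: "cdiff_at \<phi> L (vector [s, t, e])" using inb te \<epsilon>(3) by blast
    have "((\<lambda>s. \<phi> (vector [s, t, e])) has_field_derivative L (vector [1, 0, 0])) (at s)"
    proof (rule cdiff_at_chain[where \<gamma>="\<lambda>s. vector [s, t, e]", OF L])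
      show "((\<lambda>z. vector [z, t, e] $ i) has_field_derivative vector [1, 0, 0] $ i) (at s)" for i :: 3
        using exhaust_3[of i] by auto
    qed
    then show "\<exists>f'. ((\<lambda>s. \<phi> (vector [s, t, e])) has_field_derivative f') (at s)" by blast
  qed
  have d2: "(\<lambda>t. \<phi> (vector [s, t, e])) holomorphic_on ball 0 r" if te: "s \<in> ball 0 r" "e \<in> ball 0 r" for s e
    unfolding holomorphic_on_open[OF open_ball]
  proof
    fix t :: complex assume "t \<in> ball 0 r"
    then obtain L where L: "cdiff_at \<phi> L (vector [s, t, e])" using inb te \<epsilon>(3) by blast
    have "((\<lambda>t. \<phi> (vector [s, t, e])) has_field_derivative L (vector [0, 1, 0])) (at t)"
    proof (rule cdiff_at_chain[where \<gamma>="\<lambda>t. vector [s, t, e]", OF L])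
      show "((\<lambda>z. vector [s, z, e] $ i) has_field_derivative vector [0, 1, 0] $ i) (at t)" for i :: 3
        using exhaust_3[of i] by auto
    qed
    then show "\<exists>f'. ((\<lambda>t. \<phi> (vector [s, t, e])) has_field_derivative f') (at t)" by blast
  qed
  have "hol3 r (\<lambda>e s t. \<phi> (vector [s, t, e]))"
    unfolding hol3_def hol2_def case_prod_unfold
  proof (intro conjI ballI d1 d2)
    show "continuous_on ((ball 0 r \<times> ball 0 r) \<times> ball 0 r) (\<lambda>p. \<phi> (vector [snd (fst p), snd p, fst (fst p)]))"
      by (rule continuous_on_compose2[OF \<epsilon>(2)], intro vc continuous_on_fst continuous_on_snd continuous_on_id)
         (use inb in auto)
    show "continuous_on (ball 0 r \<times> ball 0 r) (\<lambda>p. \<phi> (vector [fst p, snd p, e]))" if "e \<in> ball 0 r" for e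
      by (rule continuous_on_compose2[OF \<epsilon>(2)], intro vc continuous_on_fst continuous_on_snd continuous_on_id continuous_on_const)
         (use inb that in auto)
  qed
  with r show ?thesis by blast
qed

text \<open>Implicit functions by the contraction \<open>t \<mapsto> t - A / 2\<close>.\<close>

lemma hol3_implicit:
  assumes A: "hol3 r A" and r: "r > 0" and A0: "\<And>s. norm s < r \<Longrightarrow> A 0 s 0 = 0"
    and A2: "\<And>e s t. norm e < r \<Longrightarrow> norm s < r \<Longrightarrow> norm t < r \<Longrightarrow> norm (deriv (A e s) t - 2) \<le> 1"
  shows "\<exists>\<eta>>0. \<eta> \<le> r \<and> (\<exists>\<theta>. \<forall>e s. norm e < \<eta> \<longrightarrow> norm s \<le> r / 2 \<longrightarrow>
     norm (\<theta> e s) < r \<and> A e s (\<theta> e s) = 0 \<and> norm (\<theta> e s) \<le> norm (A e s 0) \<and>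
     (\<forall>t. norm t < r \<longrightarrow> A e s t = 0 \<longrightarrow> t = \<theta> e s))"
    and "\<And>e s t t'. norm e < r \<Longrightarrow> norm s < r \<Longrightarrow> norm t < r \<Longrightarrow> norm t' < r \<Longrightarrow>
      norm (t - t') \<le> norm (A e s t - A e s t')"
proof -
  \<comment> \<open>The slope of \<open>A\<close> in \<open>t\<close> deviates from 2 by at most 1.
    Hence \<open>t - A / 2\<close> contracts by the factor \<open>1 / 2\<close>, and
    \<open>A\<close> separates points at least as far as they are apart.\<close>
  have lin: "norm (A e s t - A e s t' - 2 * (t - t')) \<le> 1 * norm (t - t')"
    if "norm e < r" "norm s < r" "norm t < r" "norm t' < r" for e s t t'
  proof (rule deriv_near_constant[where S="ball 0 r" and f'="deriv (A e s)"])
    show "(A e s has_field_derivative deriv (A e s) z) (at z)" if "z \<in> ball 0 r" for z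
      using hol2D(2)[OF hol3D(2)[OF A, of e], of s] \<open>norm e < r\<close> \<open>norm s < r\<close> that
      by (intro holomorphic_derivI[OF _ open_ball]) auto
  qed (use that A2 in auto)
  show low: "norm (t - t') \<le> norm (A e s t - A e s t')"
    if "norm e < r" "norm s < r" "norm t < r" "norm t' < r" for e s t t'
  proof -
    have "norm (2 * (t - t')) \<le> norm (A e s t - A e s t') + norm (A e s t - A e s t' - 2 * (t - t'))"
      using norm_triangle_sub[of "2 * (t - t')" "A e s t - A e s t'"]
      unfolding norm_minus_commute[of "2 * (t - t')"] .
    moreover have "norm (2 * (t - t')) = 2 * norm (t - t')" by (simp only: norm_mult norm_numeral)
    ultimately show ?thesis using lin[OF that] by linarith
  qed
  \<comment> \<open>A value of \<open>A e s 0\<close> below \<open>r / 2\<close> makes the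
    contraction map the disc of radius \<open>r / 2\<close> into itself, by the estimate
    \<open>r / 4 + r / 4\<close>.\<close>
  obtain \<eta> where \<eta>: "\<eta> > 0" "\<eta> \<le> r" and small: "\<And>e s t. norm e < \<eta> \<Longrightarrow> norm s \<le> r / 2 \<Longrightarrow> norm t < \<eta> \<Longrightarrow> norm (A e s t - A 0 s 0) < r / 2"
    using hol3_uniform[OF A r, of "r / 2" "r / 2"] r by auto
  have unique_fix: "\<exists>!t. t \<in> cball 0 (r / 2) \<and> t - A e s t / 2 = t" if e: "norm e < \<eta>" and s: "norm s \<le> r / 2" for e s
  proof -
    have er: "norm e < r" "norm s < r" using e s \<eta> r by auto
    have contr: "dist (t - A e s t / 2) (t' - A e s t' / 2) \<le> 1 / 2 * dist t t'" if "norm t < r" "norm t' < r" for t t'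
    proof -
      have eq: "(t - A e s t / 2) - (t' - A e s t' / 2) = - ((A e s t - A e s t' - 2 * (t - t')) / 2)"
        by (simp add: field_simps)
      have "dist (t - A e s t / 2) (t' - A e s t' / 2) = norm (A e s t - A e s t' - 2 * (t - t')) / 2"
        unfolding dist_norm eq by (simp only: norm_minus_cancel norm_divide norm_numeral)
      then show ?thesis using lin[OF er that] unfolding dist_norm by linarith
    qed
    have "\<exists>!t\<in>cball 0 (r / 2). t - A e s t / 2 = t"
    proof (rule Banach_fix[where c="1 / 2"])
      show "(\<lambda>t. t - A e s t / 2) ` cball 0 (r / 2) \<subseteq> cball 0 (r / 2)"
      proof (rule image_subsetI)
        fix t :: complex assume t: "t \<in> cball 0 (r / 2)"
        have "norm (t - A e s t / 2) \<le> dist (t - A e s t / 2) (0 - A e s 0 / 2) + norm (0 - A e s 0 / 2)"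
          using norm_triangle_ineq[of "(t - A e s t / 2) - (0 - A e s 0 / 2)" "0 - A e s 0 / 2"] by (simp add: dist_norm)
        also have "\<dots> \<le> 1 / 2 * dist t 0 + norm (A e s 0) / 2"
          using contr[of t 0] t r by (simp add: norm_divide)
        also have "\<dots> \<le> r / 4 + r / 4"
          using small[OF e s, of 0] A0[OF er(2)] \<eta>(1) t by simp
        finally show "t - A e s t / 2 \<in> cball 0 (r / 2)" by simp
      qed
      show "dist (x - A e s x / 2) (y - A e s y / 2) \<le> 1 / 2 * dist x y"
        if "x \<in> cball 0 (r / 2)" "y \<in> cball 0 (r / 2)" for x y
        using contr that r by auto
    qed (use r in \<open>auto simp: complete_eq_closed\<close>)
    then show ?thesis by blast
  qed
  have ex: "\<exists>t. norm t \<le> r / 2 \<and> A e s t = 0" if es: "norm e < \<eta>" "norm s \<le> r / 2" for e s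
  proof -
    obtain t where "t \<in> cball 0 (r / 2)" "t - A e s t / 2 = t" using ex1_implies_ex[OF unique_fix[OF es]] by (elim exE conjE)
    then have "norm t \<le> r / 2 \<and> A e s t = 0" by simp
    then show ?thesis ..
  qed
  define \<theta> where "\<theta> = (\<lambda>e s. SOME t. norm t \<le> r / 2 \<and> A e s t = 0)"
  have \<theta>: "norm (\<theta> e s) \<le> r / 2 \<and> A e s (\<theta> e s) = 0" if "norm e < \<eta>" "norm s \<le> r / 2" for e s
    unfolding \<theta>_def using ex[OF that] by (rule someI_ex)
  have "norm (\<theta> e s) < r \<and> A e s (\<theta> e s) = 0 \<and> norm (\<theta> e s) \<le> norm (A e s 0) \<and>
     (\<forall>t. norm t < r \<longrightarrow> A e s t = 0 \<longrightarrow> t = \<theta> e s)" if es: "norm e < \<eta>" "norm s \<le> r / 2" for e s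
  proof -
    have b: "norm e < r" "norm s < r" "norm (\<theta> e s) < r" and z: "A e s (\<theta> e s) = 0" using es \<theta>[OF es] \<eta> r by auto
    have "norm (\<theta> e s) \<le> norm (A e s 0)" using low[OF b, of 0] r z by simp
    moreover have "t = \<theta> e s" if "norm t < r" "A e s t = 0" for t
      using low[OF b(1,2) that(1) b(3)] that(2) z by simp
    ultimately show ?thesis using b z by blast
  qed
  then show "\<exists>\<eta>>0. \<eta> \<le> r \<and> (\<exists>\<theta>. \<forall>e s. norm e < \<eta> \<longrightarrow> norm s \<le> r / 2 \<longrightarrow>
     norm (\<theta> e s) < r \<and> A e s (\<theta> e s) = 0 \<and> norm (\<theta> e s) \<le> norm (A e s 0) \<and>
     (\<forall>t. norm t < r \<longrightarrow> A e s t = 0 \<longrightarrow> t = \<theta> e s))"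
    using \<eta> by blast
qed

text \<open>\<theta> is known only as a zero of \<open>A\<close>. By \<open>low\<close> the
  difference \<open>\<theta> s - \<theta> s0\<close> is at most of the size of
  \<open>A s (\<theta> s0)\<close>; with the linear expansion of \<open>A s\<close> in
  \<open>t\<close> this yields the usual implicit derivative.\<close>

lemma implicit_has_derivative:
  assumes A: "hol2 r A" and s0: "norm s0 < r" and \<theta>0: "norm (\<theta> s0) < r"
    and ev: "\<forall>\<^sub>F s in nhds s0. norm (\<theta> s) < r \<and> A s (\<theta> s) = 0"
    and low: "\<And>s t t'. norm s < r \<Longrightarrow> norm t < r \<Longrightarrow> norm t' < r \<Longrightarrow> norm (t - t') \<le> norm (A s t - A s t')"
    and A2: "deriv (A s0) (\<theta> s0) \<noteq> 0"
  shows "(\<theta> has_field_derivative - (deriv (\<lambda>s. A s (\<theta> s0)) s0 / deriv (A s0) (\<theta> s0))) (at s0)"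
proof -
  define t0 where "t0 = \<theta> s0"
  define a where "a = deriv (A s0) t0"
  define X0 where "X0 = deriv (\<lambda>s. A s t0) s0"
  have z0: "A s0 t0 = 0" using eventually_nhds_x_imp_x[OF ev] by (simp add: t0_def)
  have t0: "t0 \<in> ball 0 r" and s0b: "s0 \<in> ball 0 r" using \<theta>0 s0 by (simp_all add: t0_def)
  have a: "a \<noteq> 0" using A2 by (simp add: a_def t0_def)
  have dX: "((\<lambda>s. A s t0) has_field_derivative X0) (at s0)"
    unfolding X0_def by (rule holomorphic_derivI[OF hol2D(3)[OF A t0] open_ball s0b])
  define X where "X = (\<lambda>s. A s t0 / (s - s0))"
  define Y where "Y = (\<lambda>s. (\<theta> s - t0) / (s - s0))"
  have X: "(X \<longlongrightarrow> X0) (at s0)" using dX unfolding has_field_derivative_iff X_def by (simp add: z0)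
  have evr: "\<forall>\<^sub>F s in nhds s0. norm s < r"
    using eventually_nhds_in_open[OF open_ball s0b] by simp
  have bound: "\<forall>\<^sub>F s in nhds s0. norm (\<theta> s - t0) \<le> norm (A s t0)"
    using ev evr
  proof eventually_elim
    case (elim s)
    then show ?case using low[of s "\<theta> s" t0] \<theta>0 by (simp add: t0_def)
  qed
  have "isCont (\<lambda>s. A s t0) s0" using dX by (rule DERIV_isCont)
  from isCont_tendsto_nhds[OF this] have "((\<lambda>s. A s t0) \<longlongrightarrow> 0) (nhds s0)" unfolding z0 .
  then have "((\<lambda>s. \<theta> s - t0) \<longlongrightarrow> 0) (nhds s0)" by (rule Lim_null_comparison[OF bound tendsto_norm_zero])
  then have \<theta>lim: "(\<theta> \<longlongrightarrow> t0) (nhds s0)" by (simp add: LIM_zero_iff)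
  have "isCont (\<lambda>(s, t). deriv (A s) t) (s0, t0)"
    using hol2D(1)[OF hol2_deriv_snd[OF A]] s0b t0
    by (subst (asm) continuous_on_eq_continuous_at) (auto intro: open_Times)
  then have cont: "((\<lambda>(s, t). deriv (A s) t) \<longlongrightarrow> a) (nhds (s0, t0))"
    using isCont_tendsto_nhds by (fastforce simp: a_def)
  have "((\<lambda>s. Y s + X s / a) \<longlongrightarrow> 0) (at s0)"
  proof (rule tendstoI)
    fix \<epsilon> :: real assume \<epsilon>: "\<epsilon> > 0"
    \<comment> \<open>\<open>C\<close> bounds the difference quotient \<open>X\<close> near
      \<open>s0\<close>; \<open>\<delta>\<close> is then chosen so that the final estimate is
      \<open>\<epsilon> / 2\<close>.\<close>
    define C where "C = norm X0 + 1"
    have C: "C > 0" by (simp add: C_def add_nonneg_pos)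
    define \<delta> where "\<delta> = \<epsilon> * norm a / (2 * C)"
    have \<delta>: "\<delta> > 0" using \<epsilon> a C by (simp add: \<delta>_def)
    obtain \<eta> where \<eta>: "\<eta> > 0" "\<And>s t. dist (s, t) (s0, t0) < \<eta> \<Longrightarrow> dist (deriv (A s) t) a < \<delta>"
      using tendstoD[OF cont \<delta>] unfolding eventually_nhds_metric by auto
    define \<mu> where "\<mu> = min (\<eta> / 2) (r - norm t0)"
    have \<mu>2: "\<mu> \<le> \<eta> / 2" "\<mu> \<le> r - norm t0"
      unfolding \<mu>_def by (rule min.cobounded1, rule min.cobounded2)
    have "\<mu> > 0" using \<eta>(1) t0 by (simp add: \<mu>_def)
    note \<mu> = this \<mu>2
    have n1: "\<forall>\<^sub>F s in nhds s0. dist s s0 < \<mu>" using \<mu>(1) by (auto simp: eventually_nhds_metric)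
    have n2: "\<forall>\<^sub>F s in nhds s0. dist (\<theta> s) t0 < \<mu>" by (rule tendstoD[OF \<theta>lim \<mu>(1)])
    have le: "at s0 \<le> nhds s0" unfolding at_within_def by simp
    have n3: "\<forall>\<^sub>F s in at s0. dist (X s) X0 < 1" by (rule tendstoD[OF X]) simp
    have n4: "\<forall>\<^sub>F s in at s0. s \<noteq> s0" by (simp add: eventually_at_filter)
    show "\<forall>\<^sub>F s in at s0. dist (Y s + X s / a) 0 < \<epsilon>"
      using filter_leD[OF le n1] filter_leD[OF le n2] n3 n4 filter_leD[OF le ev] filter_leD[OF le evr] filter_leD[OF le bound]
    proof eventually_elim
      case (elim s)
      have "norm (A s (\<theta> s) - A s t0 - a * (\<theta> s - t0)) \<le> \<delta> * norm (\<theta> s - t0)"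
      proof (rule deriv_near_constant[where S="ball t0 \<mu>" and f'="deriv (A s)"])
        fix z assume z: "z \<in> ball t0 \<mu>"
        have "norm z \<le> norm t0 + dist t0 z" using norm_triangle_sub[of z t0] by (simp add: dist_norm norm_minus_commute)
        then have zr: "z \<in> ball 0 r" using z \<mu>(3) by simp
        show "(A s has_field_derivative deriv (A s) z) (at z)"
          by (rule holomorphic_derivI[OF hol2D(2)[OF A] open_ball zr]) (use elim(6) in simp)
        have "dist (s, z) (s0, t0) \<le> dist s s0 + dist z t0"
          using norm_Pair_le[of "s - s0" "z - t0"] by (simp add: dist_norm)
        then have "dist (s, z) (s0, t0) < \<eta>" using elim(1) z \<mu>(2) by (simp add: dist_commute)
        from \<eta>(2)[OF this] show "norm (deriv (A s) z - a) \<le> \<delta>" by (simp add: dist_norm)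
      qed (use elim(2) \<mu>(1) in \<open>auto simp: dist_commute\<close>)
      then have "norm (A s t0 + a * (\<theta> s - t0)) \<le> \<delta> * norm (\<theta> s - t0)"
        using elim(5) norm_minus_cancel[of "A s t0 + a * (\<theta> s - t0)"] by simp
      also have "\<dots> \<le> \<delta> * norm (A s t0)" using elim(7) \<delta> by simp
      finally have 1: "norm (A s t0 + a * (\<theta> s - t0)) \<le> \<delta> * norm (A s t0)" .
      have "v / k + u / k / a = (u + a * v) / (a * k)" if "k \<noteq> 0" for u v k
        using a that by (simp add: field_simps)
      then have "Y s + X s / a = (A s t0 + a * (\<theta> s - t0)) / (a * (s - s0))"
        using elim(4) unfolding X_def Y_def by simp
      then have "norm (Y s + X s / a) = norm (A s t0 + a * (\<theta> s - t0)) / (norm a * norm (s - s0))"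
        by (simp add: norm_divide norm_mult)
      also have "\<dots> \<le> \<delta> * norm (A s t0) / (norm a * norm (s - s0))"
        using 1 by (rule divide_right_mono) simp
      also have "\<dots> = \<delta> / norm a * norm (X s)" by (simp add: X_def norm_divide)
      also have "\<dots> \<le> \<delta> / norm a * C"
      proof (rule mult_left_mono)
        show "norm (X s) \<le> C" using elim(3) norm_triangle_sub[of "X s" X0] by (simp add: C_def dist_norm)
      qed (use \<delta> in simp)
      also have "\<dots> = \<epsilon> / 2" using a C by (simp add: \<delta>_def)
      also have "\<dots> < \<epsilon>" using \<epsilon> by simp
      finally show ?case by simp
    qed
  qed
  from tendsto_diff[OF this tendsto_divide[OF X tendsto_const[of a] a]]
  have "(Y \<longlongrightarrow> - (X0 / a)) (at s0)" by simp
  then show ?thesis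
    unfolding has_field_derivative_iff Y_def X0_def a_def t0_def .
qed

section \<open>Counting cross caps by the zeros of one function\<close>

context double_fold
begin

text \<open>\<open>A\<close> and \<open>M\<close> are the components of the differential of \<open>F\<^sub>e\<close> on the vector field
  \<open>(- \<partial>\<^sub>t F\<^sub>1, \<partial>\<^sub>s F\<^sub>1)\<close>, so the slice is singular where both vanish. At \<open>e = 0\<close> they are \<open>2 t\<close> and
  \<open>d + t \<partial>\<^sub>t d\<close>: the curve \<open>A = 0\<close> is a graph \<open>t = \<tau> s\<close>, and \<open>m\<close> is the restriction of \<open>M\<close> to it.\<close>

theorem cross_caps_eq:
  assumes stab: "stabilization \<Phi> F" and num: "number_of_cross_caps F C"
  shows "C = subdegree (pullback saxis (germ d))"
proof -
  have Fh: "holo_at (\<lambda>x. F x $ i) 0" for i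
    using stab unfolding stabilization_def holo_map_at_def by blast
  define f where "f = (\<lambda>i e s t. F (vector [s, t, e]) $ i)"
  have "\<exists>r>0. hol3 r (f i)" for i
    using holo_at_imp_hol3[OF Fh[of i]] unfolding f_def .
  then obtain rr where rr: "\<And>i. rr i > 0" "\<And>i. hol3 (rr i) (f i)" by metis
  define r0 where "r0 = Min (range rr)"
  have r0: "r0 > 0" "\<And>i. r0 \<le> rr i" using rr(1) by (simp_all add: r0_def)
  have f3: "hol3 r0 (f i)" for i by (rule hol3_mono[OF rr(2) r0(2)])
  define P where "P = (\<lambda>i e s t. deriv (\<lambda>s. f i e s t) s)"
  define Q where "Q = (\<lambda>i e s t. deriv (f i e s) t)"
  have P3: "hol3 r0 (P i)" and Q3: "hol3 r0 (Q i)" for i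
    unfolding P_def Q_def by (rule hol3_deriv_fst[OF f3], rule hol3_deriv_snd[OF f3])
  define A where "A = (\<lambda>e s t. P 1 e s t * Q 2 e s t - Q 1 e s t * P 2 e s t)"
  define M where "M = (\<lambda>e s t. P 1 e s t * Q 3 e s t - Q 1 e s t * P 3 e s t)"
  have A3: "hol3 r0 A" and M3: "hol3 r0 M"
    unfolding A_def M_def by (intro hol3_diff hol3_mult P3 Q3)+
  have dA3: "hol3 r0 (\<lambda>e s t. deriv (A e s) t)" by (rule hol3_deriv_snd[OF A3])
  have "\<forall>\<^sub>F x in nhds 0. slice F 0 x = \<Phi> x" using stab unfolding stabilization_def by blast
  then have "\<forall>\<^sub>F x in nhds 0. slice F 0 x = vector [x $ 1, (x $ 2)\<^sup>2, x $ 2 * d x]"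
    using \<Phi>_eq by eventually_elim simp
  then obtain e0 where e0: "e0 > 0" "\<And>x. norm x < e0 \<Longrightarrow> slice F 0 x = vector [x $ 1, (x $ 2)\<^sup>2, x $ 2 * d x]"
    unfolding eventually_nhds_metric by auto
  obtain rd where rd: "rd > 0" "hol2 rd (\<lambda>s t. d (vector [s, t]))" using holo_at_imp_hol2[OF d] .
  define e1 where "e1 = Min {e0 / 2, rd, r0}"
  have e1: "e1 > 0" "e1 \<le> e0 / 2" "e1 \<le> rd" "e1 \<le> r0" using e0 rd r0 by (simp_all add: e1_def)
  have f0: "f 1 0 s t = s" "f 2 0 s t = t\<^sup>2" "f 3 0 s t = t * d (vector [s, t])" if "norm s < e1" "norm t < e1" for s t
    using e0(2)[of "vector [s, t]"] norm_vector_2_le[of s t] that e1 by (simp_all add: f_def slice_def)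
  have near: "\<forall>\<^sub>F z' in nhds z. norm z' < e1" if "norm z < e1" for z :: complex
    using eventually_nhds_in_open[OF open_ball, of z 0 e1] that by simp
  have P0: "P 1 0 s t = 1" "P 2 0 s t = 0" and Q0: "Q 1 0 s t = 0" "Q 2 0 s t = 2 * t" and Q30: "Q 3 0 s 0 = d (vector [s, 0])"
    if st: "norm s < e1" "norm t < e1" for s t
  proof -
    have "deriv (\<lambda>s. f 1 0 s t) s = deriv (\<lambda>s. s) s"
      by (rule deriv_cong_ev[OF _ refl]) (use near[OF st(1)] f0(1) st(2) in \<open>auto elim: eventually_mono\<close>)
    then show "P 1 0 s t = 1" by (simp add: P_def)
    have "deriv (\<lambda>s. f 2 0 s t) s = deriv (\<lambda>s. t\<^sup>2) s"
      by (rule deriv_cong_ev[OF _ refl]) (use near[OF st(1)] f0(2) st(2) in \<open>auto elim: eventually_mono\<close>)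
    then show "P 2 0 s t = 0" by (simp add: P_def)
    have "deriv (f 1 0 s) t = deriv (\<lambda>t. s) t"
      by (rule deriv_cong_ev[OF _ refl]) (use near[OF st(2)] f0(1) st(1) in \<open>auto elim: eventually_mono\<close>)
    then show "Q 1 0 s t = 0" by (simp add: Q_def)
    have "deriv (f 2 0 s) t = deriv (\<lambda>t. t\<^sup>2) t"
      by (rule deriv_cong_ev[OF _ refl]) (use near[OF st(2)] f0(2) st(1) in \<open>auto elim: eventually_mono\<close>)
    moreover have "((\<lambda>t. t\<^sup>2) has_field_derivative 2 * t) (at t)" by (auto intro!: derivative_eq_intros)
    ultimately show "Q 2 0 s t = 2 * t" by (simp add: Q_def DERIV_imp_deriv)
    have "deriv (f 3 0 s) 0 = deriv (\<lambda>t. t * d (vector [s, t])) 0"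
      by (rule deriv_cong_ev[OF _ refl]) (use near[of 0] e1(1) f0(3) st(1) in \<open>auto elim: eventually_mono\<close>)
    moreover have "((\<lambda>t. d (vector [s, t])) has_field_derivative deriv (\<lambda>t. d (vector [s, t])) 0) (at 0)"
      by (rule holomorphic_derivI[OF hol2D(2)[OF rd(2)] open_ball]) (use st e1 rd in auto)
    from DERIV_mult[OF DERIV_ident this]
    have "((\<lambda>t. t * d (vector [s, t])) has_field_derivative d (vector [s, 0])) (at 0)" by simp
    ultimately show "Q 3 0 s 0 = d (vector [s, 0])" by (simp add: Q_def DERIV_imp_deriv)
  qed
  have A0: "A 0 s t = 2 * t" if "norm s < e1" "norm t < e1" for s t
    using P0[OF that] Q0[OF that] by (simp add: A_def)
  have M0: "M 0 s 0 = d (saxis s)" if "norm s < e1" for s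
    using P0[of s 0] Q0[of s 0] Q30[of s 0] that e1(1) by (simp add: M_def saxis_def)
  have dA0: "deriv (A 0 0) 0 = 2"
  proof -
    have "deriv (A 0 0) 0 = deriv (\<lambda>t. 2 * t) 0"
      by (rule deriv_cong_ev[OF _ refl]) (use near[of 0] e1(1) A0 in \<open>auto elim: eventually_mono\<close>)
    also have "\<dots> = 2" by (rule DERIV_imp_deriv) (auto intro!: derivative_eq_intros)
    finally show ?thesis .
  qed
  obtain a1 where a1: "a1 > 0" "a1 \<le> r0"
    "\<And>e s t. norm e < a1 \<Longrightarrow> norm s < a1 \<Longrightarrow> norm t < a1 \<Longrightarrow> norm (deriv (A e s) t - 2) < 1"
    using hol3_nearby[OF dA3 r0(1), of 1] unfolding dA0 by auto
  have P100: "P 1 0 0 0 = 1" using P0(1)[of 0 0] e1(1) by simp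
  obtain a2 where a2: "a2 > 0" "a2 \<le> r0"
    "\<And>e s t. norm e < a2 \<Longrightarrow> norm s < a2 \<Longrightarrow> norm t < a2 \<Longrightarrow> norm (P 1 e s t - 1) < 1"
    using hol3_nearby[OF P3[of 1] r0(1), of 1] unfolding P100 by auto
  let ?D = "pullback saxis (germ d)"
  note dexp = pullback_germ[OF arc_saxis d]
  obtain a3 where a3: "a3 > 0" "\<And>s. norm s < a3 \<Longrightarrow> s \<noteq> 0 \<Longrightarrow> d (saxis s) \<noteq> 0"
  proof -
    have "\<forall>\<^sub>F s in at 0. d (saxis s) \<noteq> 0" by (rule has_order_nonzero[OF has_order_fps[OF dexp pullback_d_nonzero]])
    then show thesis unfolding eventually_at using that by auto
  qed
  \<comment> \<open>Within radius \<open>r\<close> the formulas at \<open>e = 0\<close> hold, the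
    slope of \<open>A\<close> is near 2, \<open>P 1\<close> is nonzero, and \<open>d\<close> has no
    zero on the axis except possibly 0.\<close>
  define r where "r = Min {e1, a1, a2, a3}"
  have r: "r > 0" "r \<le> e1" "r \<le> a1" "r \<le> a2" "r \<le> a3" using e1 a1 a2 a3 by (simp_all add: r_def)
  have rr0: "r \<le> r0" using r(2) e1(4) by simp
  have Ar: "hol3 r A" and Mr: "hol3 r M" and fr: "hol3 r (f i)" and Pr: "hol3 r (P i)" and Qr: "hol3 r (Q i)" for i
    by (rule hol3_mono[OF _ rr0], fact A3 M3 f3 P3 Q3)+
  have P1nz: "P 1 e s t \<noteq> 0" if "norm e < r" "norm s < r" "norm t < r" for e s t
    using a2(3)[of e s t] that r by auto
  have dA: "norm (deriv (A e s) t - 2) \<le> 1" if "norm e < r" "norm s < r" "norm t < r" for e s t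
    using a1(3)[of e s t] that r by auto
  have Az: "A 0 s 0 = 0" if "norm s < r" for s using A0[of s 0] that r e1(1) by simp
  obtain \<eta> \<theta> where \<eta>: "\<eta> > 0" "\<eta> \<le> r" and \<theta>: "\<And>e s. norm e < \<eta> \<Longrightarrow> norm s \<le> r / 2 \<Longrightarrow>
     norm (\<theta> e s) < r \<and> A e s (\<theta> e s) = 0 \<and> norm (\<theta> e s) \<le> norm (A e s 0) \<and>
     (\<forall>t. norm t < r \<longrightarrow> A e s t = 0 \<longrightarrow> t = \<theta> e s)"
    using hol3_implicit(1)[OF Ar r(1) Az dA] by blast
  have low: "norm (t - t') \<le> norm (A e s t - A e s t')"
    if "norm e < r" "norm s < r" "norm t < r" "norm t' < r" for e s t t'
    by (rule hol3_implicit(2)[OF Ar r(1) Az dA that])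
  obtain \<rho>0 where \<rho>0: "\<rho>0 > 0" "\<forall>\<^sub>F e in at 0. stable_on (ball 0 \<rho>0) (slice F e)"
    using stab unfolding stabilization_def by blast
  \<comment> \<open>The count holds for all small radii and parameters, so one suitable \<rho> and
    later one suitable \<open>e\<close> suffice.\<close>
  have "\<forall>\<^sub>F \<rho> in at_right 0. 0 < \<rho> \<and> \<rho> < min \<rho>0 (r / 2)"
    unfolding eventually_at_right_field using \<rho>0 r by (intro exI[of _ "min \<rho>0 (r / 2)"]) simp
  from eventually_happens'[OF trivial_limit_at_right_real eventually_conj[OF this num[unfolded number_of_cross_caps_def]]]
  obtain \<rho> where \<rho>: "0 < \<rho>" "\<rho> < \<rho>0" "\<rho> < r / 2"
    and cnt: "\<forall>\<^sub>F e in at 0. finite {x \<in> ball 0 \<rho>. cross_cap (slice F e) x} \<and>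
        card {x \<in> ball 0 \<rho>. cross_cap (slice F e) x} = C"
    by auto
  have \<rho>r: "\<rho> < r" using \<rho> r by simp
  define d0 where "d0 = (\<lambda>s. M 0 s 0)"
  have d0_eq: "d0 s = d (saxis s)" if "norm s < r" for s using M0[of s] that r by (simp add: d0_def)
  have d0_hol: "d0 holomorphic_on ball 0 r"
    unfolding d0_def using hol2D(3)[OF hol3D(2)[OF Mr, of 0], of 0] r(1) by simp
  \<comment> \<open>Half of \<rho>, so that a zero \<open>s\<close> of \<open>m\<close> and the
    value \<open>\<tau> s\<close>, both smaller than \<open>\<delta>\<close>, give a point of the
    ball of radius \<rho>.\<close>
  define \<delta> where "\<delta> = \<rho> / 2"
  have \<delta>: "0 < \<delta>" "\<delta> < \<rho>" using \<rho> by (simp_all add: \<delta>_def)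
  \<comment> \<open>On this annulus \<open>d0\<close> has absolute value at least \<mu>. This
    confines the zeros of \<open>m\<close> to the disc of radius \<open>\<delta>\<close> and also
    serves as the Rouche bound on its boundary.\<close>
  define K where "K = cball (0::complex) \<rho> - ball 0 \<delta>"
  have K: "compact K" unfolding K_def by (intro compact_diff compact_cball open_ball)
  have "complex_of_real \<delta> \<in> K" using \<delta> by (simp add: K_def)
  then have Kne: "K \<noteq> {}" by blast
  have "continuous_on K (\<lambda>s. norm (d0 s))"
    by (rule continuous_on_norm[OF continuous_on_subset[OF holomorphic_on_imp_continuous_on[OF d0_hol]]])
       (use \<rho>r in \<open>auto simp: K_def\<close>)
  from continuous_attains_inf[OF K Kne this] obtain s1 where s1: "s1 \<in> K" "\<And>s. s \<in> K \<Longrightarrow> norm (d0 s1) \<le> norm (d0 s)" by blast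
  define \<mu> where "\<mu> = norm (d0 s1)"
  have s1n: "norm s1 \<le> \<rho>" "norm s1 \<ge> \<delta>" using s1(1) by (auto simp: K_def)
  have "norm s1 < a3" "s1 \<noteq> 0" using s1n \<rho>r r(5) \<delta>(1) by auto
  then have "d (saxis s1) \<noteq> 0" using a3(2)[of s1] by simp
  then have \<mu>: "\<mu> > 0" using d0_eq[of s1] s1n \<rho>r by (simp add: \<mu>_def)
  have \<mu>K: "\<mu> \<le> norm (d0 s)" if "\<delta> \<le> norm s" "norm s \<le> \<rho>" for s
    using s1(2)[of s] that by (simp add: K_def \<mu>_def)
  obtain \<eta>1 where \<eta>1: "\<eta>1 > 0" "\<And>e s t. norm e < \<eta>1 \<Longrightarrow> norm s \<le> \<rho> \<Longrightarrow> norm t < \<eta>1 \<Longrightarrow> norm (M e s t - M 0 s 0) < \<mu>"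
    using hol3_uniform[OF Mr r(1) \<rho>r \<mu>] by blast
  \<comment> \<open>The bound for \<tau>: at most \<open>\<eta>1\<close> for the comparison of
    \<open>M\<close> with \<open>d0\<close>, at most \<open>\<delta>\<close> to stay in the
    ball.\<close>
  define \<beta> where "\<beta> = min \<eta>1 \<delta>"
  have \<beta>: "\<beta> > 0" "\<beta> \<le> \<eta>1" "\<beta> \<le> \<delta>"
    using \<eta>1(1) \<delta>(1) by (auto simp: \<beta>_def)
  obtain \<eta>2 where \<eta>2: "\<eta>2 > 0" "\<And>e s t. norm e < \<eta>2 \<Longrightarrow> norm s \<le> \<rho> \<Longrightarrow> norm t < \<eta>2 \<Longrightarrow> norm (A e s t - A 0 s 0) < \<beta>"
    using hol3_uniform[OF Ar r(1) \<rho>r \<beta>(1)] by blast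
  define \<nu> where "\<nu> = Min {\<eta>, \<eta>1, \<eta>2}"
  have \<nu>: "\<nu> > 0" "\<nu> \<le> \<eta>" "\<nu> \<le> \<eta>1" "\<nu> \<le> \<eta>2" using \<eta> \<eta>1 \<eta>2 by (simp_all add: \<nu>_def)
  have "\<forall>\<^sub>F e in at (0::complex). norm e < \<nu>"
    unfolding eventually_at using \<nu>(1) by (intro exI[of _ \<nu>]) simp
  from eventually_happens'[OF at_neq_bot eventually_conj[OF this eventually_conj[OF \<rho>0(2) cnt]]]
  obtain e where e: "norm e < \<nu>" and st: "stable_on (ball 0 \<rho>0) (slice F e)"
    and fin: "finite {x \<in> ball 0 \<rho>. cross_cap (slice F e) x}" and card: "card {x \<in> ball 0 \<rho>. cross_cap (slice F e) x} = C"
    by blast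
  have e\<eta>: "norm e < \<eta>" "norm e < r" "e \<in> ball 0 r" using e \<nu> \<eta> by auto
  define \<Psi> where "\<Psi> = slice F e"
  define \<tau> where "\<tau> = \<theta> e"
  define m where "m = (\<lambda>s. M e s (\<tau> s))"
  have \<tau>: "norm (\<tau> s) < r" "A e s (\<tau> s) = 0" "\<And>t. norm t < r \<Longrightarrow> A e s t = 0 \<Longrightarrow> t = \<tau> s" if "norm s \<le> r / 2" for s
    using \<theta>[OF e\<eta>(1) that] unfolding \<tau>_def by blast+
  have \<tau>small: "norm (\<tau> s) < \<beta>" if "norm s \<le> \<rho>" for s
  proof -
    have s: "norm s \<le> r / 2" "norm s < r" using that \<rho> \<rho>r by auto
    have "norm (\<tau> s) \<le> norm (A e s 0)" using \<theta>[OF e\<eta>(1) s(1)] unfolding \<tau>_def by blast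
    also have "\<dots> < \<beta>" using \<eta>2(2)[of e s 0] Az[OF s(2)] that e \<nu> \<eta>2(1) by simp
    finally show ?thesis .
  qed
  have close: "norm (m s - d0 s) < \<mu>" if "norm s \<le> \<rho>" for s
    using \<eta>1(2)[of e s "\<tau> s"] \<tau>small[OF that] that e \<nu> \<beta> by (simp add: m_def d0_def)
  have comp: "\<Psi> x $ i = f i e (x $ 1) (x $ 2)" for x :: "complex ^ 2" and i by (simp add: \<Psi>_def slice_def f_def)
  define DD where "DD = (\<lambda>s t v :: complex ^ 2. (\<chi> i. P i e s t * v $ 1 + Q i e s t * v $ 2) :: complex ^ 3)"
  have \<Psi>D: "(\<Psi> has_derivative DD (x $ 1) (x $ 2)) (at x)" if "norm (x $ 1) < r" "norm (x $ 2) < r" for x :: "complex ^ 2"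
    unfolding DD_def
  proof (rule has_derivative_cvec_general)
    fix i
    have "cdiff_at (\<lambda>x. f i e (x $ 1) (x $ 2)) (\<lambda>v. P i e (x $ 1) (x $ 2) * v $ 1 + Q i e (x $ 1) (x $ 2) * v $ 2) x"
      unfolding P_def Q_def by (rule hol2_cdiff_at[OF hol3D(2)[OF fr e\<eta>(3)]]) (use that in auto)
    then show "((\<lambda>x. \<Psi> x $ i) has_derivative (\<lambda>v. P i e (x $ 1) (x $ 2) * v $ 1 + Q i e (x $ 1) (x $ 2) * v $ 2)) (at x)"
      unfolding comp by (simp add: cdiff_at_def)
  qed
  have DDlin: "DD s t (z *s v) = z *s DD s t v" for s t z v
    by (simp add: DD_def vec_eq_iff algebra_simps)
  have DDker: "DD s t (vector [- Q 1 e s t, P 1 e s t]) = vector [0, A e s t, M e s t]" for s t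
    by (simp add: DD_def vec_eq_iff forall_3 A_def M_def algebra_simps)
  have DD0: "DD s t 0 = 0" for s t by (simp add: DD_def vec_eq_iff)
  \<comment> \<open>As \<open>P 1\<close> is nonzero, a kernel vector must be a multiple of
    \<open>(- Q 1, P 1)\<close>.\<close>
  have sing: "\<not> inj (DD s t) \<longleftrightarrow> A e s t = 0 \<and> M e s t = 0" if "norm s < r" "norm t < r" for s t
  proof
    assume "\<not> inj (DD s t)"
    then obtain v w where vw: "v \<noteq> w" "DD s t v = DD s t w" unfolding inj_def by blast
    define u where "u = v - w"
    have u: "u \<noteq> 0" using vw(1) by (simp add: u_def)
    have "DD s t u $ i = DD s t v $ i - DD s t w $ i" for i by (simp add: DD_def u_def algebra_simps)
    then have Du: "P i e s t * u $ 1 + Q i e s t * u $ 2 = 0" for i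
      using vw(2) by (simp add: DD_def vec_eq_iff)
    have p: "P 1 e s t \<noteq> 0" by (rule P1nz[OF e\<eta>(2) that])
    have u2: "u $ 2 \<noteq> 0"
    proof
      assume "u $ 2 = 0"
      then have "u $ 1 = 0" using Du[of 1] p by simp
      with \<open>u $ 2 = 0\<close> u show False by (simp add: vec_eq_iff forall_2)
    qed
    have cancel: "P 1 e s t * Q i e s t - Q 1 e s t * P i e s t = 0" for i
    proof -
      have "(P 1 e s t * Q i e s t - Q 1 e s t * P i e s t) * u $ 2 =
          P 1 e s t * (P i e s t * u $ 1 + Q i e s t * u $ 2) - P i e s t * (P 1 e s t * u $ 1 + Q 1 e s t * u $ 2)"
        by (simp add: algebra_simps)
      then show ?thesis using u2 by (simp add: Du)
    qed
    show "A e s t = 0 \<and> M e s t = 0" using cancel[of 2] cancel[of 3] by (simp add: A_def M_def)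
  next
    assume 0: "A e s t = 0 \<and> M e s t = 0"
    then have "DD s t (vector [- Q 1 e s t, P 1 e s t]) = DD s t 0" unfolding DDker DD0 by simp
    moreover have "vector [- Q 1 e s t, P 1 e s t] \<noteq> (0 :: complex ^ 2)"
      using P1nz[OF e\<eta>(2) that] by (simp add: vec_eq_iff forall_2)
    ultimately show "\<not> inj (DD s t)" unfolding inj_def by blast
  qed
  define Z where "Z = {s \<in> ball 0 \<rho>. m s = 0}"
  define X where "X = {x \<in> ball 0 \<rho>. cross_cap \<Psi> x}"
  have Zsmall: "norm s < \<delta>" if "s \<in> Z" for s
  proof (rule ccontr)
    assume "\<not> norm s < \<delta>"
    then have "\<mu> \<le> norm (d0 s)" using \<mu>K[of s] that by (simp add: Z_def)
    moreover have "norm (m s - d0 s) < \<mu>" using close[of s] that by (simp add: Z_def)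
    ultimately show False using that by (simp add: Z_def)
  qed
  have ZX: "vector [s, \<tau> s] \<in> X" if s: "s \<in> Z" for s
  proof -
    let ?x = "vector [s, \<tau> s] :: complex ^ 2"
    have n: "norm s \<le> \<rho>" "norm s \<le> r / 2" "norm s < r" using s \<rho> \<rho>r by (auto simp: Z_def)
    have x\<rho>: "?x \<in> ball 0 \<rho>"
      using norm_vector_2_le[of s "\<tau> s"] Zsmall[OF s] \<tau>small[OF n(1)] \<beta>(3) by (simp add: \<delta>_def)
    have ni: "\<not> inj (frechet_derivative \<Psi> (at ?x))"
      using sing[OF n(3) \<tau>(1)[OF n(2)]] \<tau>(2)[OF n(2)] s frechet_derivative_at[OF \<Psi>D[of ?x]] n \<tau>(1)[OF n(2)]
      by (simp add: Z_def m_def)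
    have xS: "?x \<in> {x \<in> ball 0 \<rho>0. \<Psi> x = \<Psi> ?x}" using x\<rho> \<rho> by simp
    \<comment> \<open>A singular point cannot belong to the immersive alternative of stability, so
      it is a cross cap.\<close>
    have "stable_on (ball 0 \<rho>0) \<Psi>" using st by (simp add: \<Psi>_def)
    from this[unfolded stable_on_def Let_def, THEN conjunct2, THEN spec, of "\<Psi> ?x"]
    have "cross_cap \<Psi> ?x"
    proof (elim disjE)
      assume "\<exists>x. {x \<in> ball 0 \<rho>0. \<Psi> x = \<Psi> ?x} = {x} \<and> cross_cap \<Psi> x"
      then obtain x where x: "{x \<in> ball 0 \<rho>0. \<Psi> x = \<Psi> ?x} = {x}" "cross_cap \<Psi> x" by (elim exE conjE)
      have "?x = x" using xS unfolding x(1) by (rule singletonD)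
      then show ?thesis using x(2) by simp
    next
      assume *: "finite {x \<in> ball 0 \<rho>0. \<Psi> x = \<Psi> ?x} \<and> card {x \<in> ball 0 \<rho>0. \<Psi> x = \<Psi> ?x} \<le> 3 \<and>
         (\<forall>x\<in>{x \<in> ball 0 \<rho>0. \<Psi> x = \<Psi> ?x}. inj (frechet_derivative \<Psi> (at x))) \<and>
         (\<forall>x\<in>{x \<in> ball 0 \<rho>0. \<Psi> x = \<Psi> ?x}. \<forall>y\<in>{x \<in> ball 0 \<rho>0. \<Psi> x = \<Psi> ?x}. x \<noteq> y \<longrightarrow>
            range (frechet_derivative \<Psi> (at x)) \<noteq> range (frechet_derivative \<Psi> (at y))) \<and>
         (\<forall>x\<in>{x \<in> ball 0 \<rho>0. \<Psi> x = \<Psi> ?x}. \<forall>y\<in>{x \<in> ball 0 \<rho>0. \<Psi> x = \<Psi> ?x}.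
            \<forall>z\<in>{x \<in> ball 0 \<rho>0. \<Psi> x = \<Psi> ?x}. x \<noteq> y \<and> y \<noteq> z \<and> x \<noteq> z \<longrightarrow>
            range (frechet_derivative \<Psi> (at x)) \<inter> range (frechet_derivative \<Psi> (at y)) \<inter>
            range (frechet_derivative \<Psi> (at z)) = {0})"
      from *[THEN conjunct2, THEN conjunct2, THEN conjunct1, THEN bspec, OF xS] ni show ?thesis by (elim notE)
    qed
    then show ?thesis using x\<rho> by (simp add: X_def)
  qed
  have XZ: "x $ 1 \<in> Z \<and> x = vector [x $ 1, \<tau> (x $ 1)]" if x: "x \<in> X" for x
  proof -
    have n: "norm (x $ 1) < \<rho>" "norm (x $ 2) < \<rho>"
      using x Finite_Cartesian_Product.norm_nth_le[of x 1] Finite_Cartesian_Product.norm_nth_le[of x 2]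
      by (auto simp: X_def)
    have n': "norm (x $ 1) < r" "norm (x $ 2) < r" "norm (x $ 1) \<le> r / 2" using n \<rho> \<rho>r by auto
    have "\<not> inj (DD (x $ 1) (x $ 2))"
      by (rule cross_cap_singular[OF _ \<Psi>D[OF n'(1,2)]]) (use x in \<open>simp add: X_def\<close>)
    then have AM: "A e (x $ 1) (x $ 2) = 0" "M e (x $ 1) (x $ 2) = 0" using sing[OF n'(1,2)] by blast+
    have x2: "x $ 2 = \<tau> (x $ 1)" by (rule \<tau>(3)[OF n'(3,2) AM(1)])
    have "x $ 1 \<in> Z" using AM(2) n(1) unfolding x2 by (simp add: Z_def m_def)
    moreover have "x = vector [x $ 1, \<tau> (x $ 1)]" using x2 by (simp add: vec_eq_iff forall_2)
    ultimately show ?thesis by blast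
  qed
  have bij: "bij_betw (\<lambda>s. vector [s, \<tau> s] :: complex ^ 2) Z X"
    by (rule bij_betw_byWitness[where f'="\<lambda>x :: complex ^ 2. x $ 1"]) (use ZX XZ in auto)
  have Xfin: "finite X" "card X = C" using fin card by (simp_all add: X_def \<Psi>_def)
  have Zfin: "finite Z" "card Z = C" using bij_betw_finite[OF bij] bij_betw_same_card[OF bij] Xfin by simp_all
  have \<tau>': "(\<tau> has_field_derivative - (deriv (\<lambda>s. A e s (\<tau> s0)) s0 / deriv (A e s0) (\<tau> s0))) (at s0)"
    if s0: "norm s0 < r / 2" for s0
  proof (rule implicit_has_derivative[OF hol3D(2)[OF Ar e\<eta>(3)]])
    have n: "norm s0 \<le> r / 2" "norm s0 < r" using s0 r by auto
    show "norm s0 < r" "norm (\<tau> s0) < r" using n \<tau>(1)[OF n(1)] by auto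
    have "\<forall>\<^sub>F s in nhds s0. norm s < r / 2"
      using eventually_nhds_in_open[OF open_ball, of s0 0 "r / 2"] s0 by simp
    then show "\<forall>\<^sub>F s in nhds s0. norm (\<tau> s) < r \<and> A e s (\<tau> s) = 0"
    proof eventually_elim
      case (elim s)
      then have "norm s \<le> r / 2" by simp
      from \<tau>(1,2)[OF this] show ?case by blast
    qed
    show "norm (t - t') \<le> norm (A e s t - A e s t')" if "norm s < r" "norm t < r" "norm t' < r" for s t t'
      by (rule low[OF e\<eta>(2) that])
    show "deriv (A e s0) (\<tau> s0) \<noteq> 0" using dA[OF e\<eta>(2) n(2) \<tau>(1)[OF n(1)]] by auto
  qed
  define c where "c = (\<lambda>s. vector [s, \<tau> s] :: complex ^ 2)"
  have c': "((\<lambda>s. c s $ i) has_field_derivative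
      (vector [1, - (deriv (\<lambda>s. A e s (\<tau> s0)) s0 / deriv (A e s0) (\<tau> s0))] :: complex ^ 2) $ i) (at s0)"
    if "norm s0 < r / 2" for s0 i
    using exhaust_2[of i] \<tau>'[OF that] by (auto simp: c_def)
  have along: "\<exists>l. ((\<lambda>s. B e s (\<tau> s)) has_field_derivative l) (at s0)"
    if B: "hol3 r B" and s0: "norm s0 < r / 2" for B s0
  proof -
    have n: "norm s0 \<le> r / 2" "norm s0 < r" using s0 r by auto
    have "cdiff_at (\<lambda>x. B e (x $ 1) (x $ 2)) (\<lambda>v. deriv (\<lambda>s. B e s (c s0 $ 2)) (c s0 $ 1) * v $ 1 +
        deriv (B e (c s0 $ 1)) (c s0 $ 2) * v $ 2) (c s0)"
      by (rule hol2_cdiff_at[OF hol3D(2)[OF B e\<eta>(3)]]) (use n \<tau>(1)[OF n(1)] in \<open>auto simp: c_def\<close>)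
    from cdiff_at_chain[where \<gamma>=c, OF this c'[OF s0]] show ?thesis by (auto simp: c_def)
  qed
  have m_hol: "m holomorphic_on ball 0 (r / 2)"
    unfolding holomorphic_on_open[OF open_ball] m_def using along[OF Mr] by simp
  \<comment> \<open>A multiple zero of \<open>m\<close> would satisfy the hypotheses of
    \<open>cross_cap_simple\<close> for the graph of \<tau>, whose velocity has first coordinate
    1.\<close>
  have simple: "deriv m s0 \<noteq> 0" if s0: "s0 \<in> Z" for s0
  proof
    assume d0: "deriv m s0 = 0"
    have n: "norm s0 < \<rho>" "norm s0 < r / 2" "norm s0 \<le> r / 2" "norm s0 < r" and ms: "m s0 = 0"
      using s0 \<rho> \<rho>r by (auto simp: Z_def)
    have md: "(m has_field_derivative 0) (at s0)"
      using holomorphic_derivI[OF m_hol open_ball, of s0] n(2) d0 by simp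
    define w where "w = (\<lambda>s. vector [- Q 1 e s (\<tau> s), P 1 e s (\<tau> s)] :: complex ^ 2)"
    show False
    proof (rule cross_cap_simple[of \<Psi> c s0 _ w "\<lambda>s. DD s (\<tau> s)" m])
      show "cross_cap \<Psi> (c s0)" using ZX[OF s0] by (simp add: X_def c_def)
      show "((\<lambda>s. c s $ i) has_field_derivative
        (vector [1, - (deriv (\<lambda>s. A e s (\<tau> s0)) s0 / deriv (A e s0) (\<tau> s0))] :: complex ^ 2) $ i) (at s0)" for i
        by (rule c'[OF n(2)])
      show "vector [1, - (deriv (\<lambda>s. A e s (\<tau> s0)) s0 / deriv (A e s0) (\<tau> s0))] \<noteq> (0 :: complex ^ 2)"
        by (simp add: vec_eq_iff forall_2)
      show "isCont (\<lambda>s. w s $ i) s0" for i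
      proof -
        obtain l1 l2 where l: "((\<lambda>s. Q 1 e s (\<tau> s)) has_field_derivative l1) (at s0)" "((\<lambda>s. P 1 e s (\<tau> s)) has_field_derivative l2) (at s0)"
          using along[OF Qr n(2)] along[OF Pr n(2)] by blast
        show ?thesis using exhaust_2[of i] DERIV_isCont[OF l(1)] DERIV_isCont[OF l(2)] by (auto simp: w_def)
      qed
      show "w s0 \<noteq> 0" using P1nz[OF e\<eta>(2) n(4) \<tau>(1)[OF n(3)]] by (simp add: w_def vec_eq_iff forall_2)
      have "\<forall>\<^sub>F s in nhds s0. norm s < r / 2"
        using eventually_nhds_in_open[OF open_ball, of s0 0 "r / 2"] n(2) by simp
      then show "\<forall>\<^sub>F s in nhds s0. (\<Psi> has_derivative DD s (\<tau> s)) (at (c s)) \<and>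
          (\<forall>z v. DD s (\<tau> s) (z *s v) = z *s DD s (\<tau> s) v) \<and> DD s (\<tau> s) (w s) = m s *s e3"
      proof eventually_elim
        case (elim s)
        then have s: "norm s \<le> r / 2" "norm s < r" using r by auto
        have "(\<Psi> has_derivative DD s (\<tau> s)) (at (c s))"
          using \<Psi>D[of "c s"] s \<tau>(1)[OF s(1)] by (simp add: c_def)
        moreover have "DD s (\<tau> s) (w s) = m s *s e3"
          unfolding w_def DDker \<tau>(2)[OF s(1)] by (simp add: m_def vec_eq_iff forall_3 axis_def)
        ultimately show ?case using DDlin by blast
      qed
      show "m s0 = 0" by (rule ms)
      show "((\<lambda>s. m s / (s - s0)) \<longlongrightarrow> 0) (at s0)"
        using md unfolding has_field_derivative_iff by (simp add: ms)
    qed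
  qed
  have sub: "ball (0::complex) \<rho> \<subseteq> ball 0 (r / 2)" "ball (0::complex) \<rho> \<subseteq> ball 0 r" using \<rho> \<rho>r by (auto intro: subset_ball)
  have mh: "m holomorphic_on ball 0 \<rho>" and dh: "d0 holomorphic_on ball 0 \<rho>"
    by (rule holomorphic_on_subset[OF m_hol sub(1)], rule holomorphic_on_subset[OF d0_hol sub(2)])
  define Z0 where "Z0 = {s \<in> ball 0 \<rho>. d0 s = 0}"
  have Z0sub: "Z0 \<subseteq> {0}"
  proof
    fix s assume s: "s \<in> Z0"
    then have "norm s < r" "d (saxis s) = 0" using \<rho>r d0_eq[of s] by (auto simp: Z0_def)
    then show "s \<in> {0}" using a3(2)[of s] r(5) by auto
  qed
  then have Z0fin: "finite Z0" using finite_subset by blast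
  have wn: "winding_number (circlepath 0 \<delta>) s = 1" if "norm s < \<delta>" for s
    using winding_number_circlepath[of s 0 \<delta>] that by simp
  \<comment> \<open>Rouche on the circle of radius \<open>\<delta>\<close>: on the left all zeros
    are simple with winding number 1, on the right the only possible zero is 0, with its full
    order.\<close>
  have "(\<Sum>p\<in>{p \<in> ball 0 \<rho>. d0 p + (m p - d0 p) = 0}. winding_number (circlepath 0 \<delta>) p * zorder (\<lambda>p. d0 p + (m p - d0 p)) p)
      = (\<Sum>p\<in>{p \<in> ball 0 \<rho>. d0 p = 0}. winding_number (circlepath 0 \<delta>) p * zorder d0 p)"
  proof (rule Rouche_theorem)
    show "finite {p \<in> ball 0 \<rho>. d0 p + (m p - d0 p) = 0}" using Zfin(1) by (simp add: Z_def)
    show "finite {p \<in> ball 0 \<rho>. d0 p = 0}" using Z0fin by (simp add: Z0_def)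
    show "(\<lambda>p. m p - d0 p) holomorphic_on ball 0 \<rho>" by (intro holomorphic_intros mh dh)
    show "path_image (circlepath 0 \<delta>) \<subseteq> ball 0 \<rho>" using \<delta> by auto
    show "\<forall>z\<in>path_image (circlepath 0 \<delta>). norm (m z - d0 z) < norm (d0 z)"
    proof
      fix z assume "z \<in> path_image (circlepath 0 \<delta>)"
      then have "norm z = \<delta>" using \<delta> by simp
      then show "norm (m z - d0 z) < norm (d0 z)" using close[of z] \<mu>K[of z] \<delta> by simp
    qed
    show "\<forall>z. z \<notin> ball 0 \<rho> \<longrightarrow> winding_number (circlepath 0 \<delta>) z = 0"
      by (intro allI impI winding_number_zero_outside[where s="ball 0 \<rho>"]) (use \<delta> in auto)
  qed (use dh in auto)
  then have rouche: "(\<Sum>p\<in>Z. winding_number (circlepath 0 \<delta>) p * zorder m p) = (\<Sum>p\<in>Z0. winding_number (circlepath 0 \<delta>) p * zorder d0 p)"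
    by (simp add: Z_def Z0_def)
  have "(\<Sum>p\<in>Z. winding_number (circlepath 0 \<delta>) p * zorder m p) = (\<Sum>p\<in>Z. 1)"
  proof (rule sum.cong)
    fix p assume p: "p \<in> Z"
    have "zorder m p = 1"
      by (rule zorder_zero_eqI[OF mh open_ball]) (use p simple[OF p] in \<open>auto simp: Z_def\<close>)
    then show "winding_number (circlepath 0 \<delta>) p * zorder m p = 1" using wn[OF Zsmall[OF p]] by simp
  qed simp
  also have "\<dots> = of_nat C" using Zfin by simp
  finally have 1: "(\<Sum>p\<in>Z. winding_number (circlepath 0 \<delta>) p * zorder m p) = of_nat C" .
  have d0exp: "d0 has_fps_expansion ?D"
  proof -
    have "\<forall>\<^sub>F s in nhds 0. d (saxis s) = d0 s"
      using eventually_nhds_in_open[OF open_ball, of 0 0 r] r(1) d0_eq by (auto elim: eventually_mono)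
    from has_fps_expansion_cong[OF this refl] dexp show ?thesis by simp
  qed
  then have Dexp: "?D = fps_expansion d0 0"
    using fps_expansion_unique_complex[OF _ analytic_at_imp_has_fps_expansion_0[OF has_fps_expansion_imp_analytic_0]] by blast
  have nth: "(deriv ^^ k) d0 0 = fact k * fps_nth ?D k" for k unfolding Dexp by (simp add: fps_expansion_def)
  have "(\<Sum>p\<in>Z0. winding_number (circlepath 0 \<delta>) p * zorder d0 p) = of_nat (subdegree ?D)"
  proof (cases "d0 0 = 0")
    case True
    then have Z0: "Z0 = {0}" using Z0sub \<rho>(1) by (auto simp: Z0_def)
    have "zorder d0 0 = int (subdegree ?D)"
    proof (rule zorder_zero_eqI[OF dh open_ball])
      show "(deriv ^^ i) d0 0 = 0" if "i < nat (int (subdegree ?D))" for i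
        using nth_less_subdegree_zero[of i ?D] that unfolding nth by simp
      show "(deriv ^^ nat (int (subdegree ?D))) d0 0 \<noteq> 0"
        unfolding nth using nth_subdegree_nonzero[OF pullback_d_nonzero] by simp
    qed (use \<rho> in auto)
    then show ?thesis unfolding Z0 using wn[of 0] \<delta> by simp
  next
    case False
    then have Z0: "Z0 = {}" using Z0sub by (auto simp: Z0_def)
    have "fps_nth ?D 0 \<noteq> 0" using nth[of 0] False by simp
    then have "subdegree ?D = 0" by (rule subdegree_eq_0)
    then show ?thesis unfolding Z0 by simp
  qed
  with 1 rouche have "(of_nat C :: complex) = of_nat (subdegree ?D)" by simp
  then show ?thesis by (simp only: of_nat_eq_iff)
qed

end

section \<open>Orbits of the involution and the final sum\<close>

lemma flip_flip [simp]: "flip (flip x) = x"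
  by (simp add: flip_def vec_eq_iff forall_2)

lemma germ_dvd_flip:
  assumes a: "holo_at a 0" and b: "holo_at b 0" and dvd: "germ a dvd germ b"
  shows "germ (\<lambda>x. a (flip x)) dvd germ (\<lambda>x. b (flip x))"
proof -
  obtain q where q: "holo_at q 0" "\<forall>\<^sub>F x in nhds 0. b x = a x * q x"
    using dvd germ_dvd_iff[OF a b] by blast
  from eventually_compose_filterlim[OF q(2) flip_tendsto] holo_at_flip[OF q(1)]
  show ?thesis unfolding germ_dvd_iff[OF holo_at_flip[OF a] holo_at_flip[OF b]] by blast
qed

lemma irreducible_componentsD:
  assumes D: "irreducible_components d l D" and i: "i \<in> {1..l}"
  shows "holo_at (D i) 0" "irreducible (germ (D i))" "\<And>k. k \<in> {1..l} \<Longrightarrow> germ (D i) dvd germ (D k) \<Longrightarrow> i = k"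
proof -
  note D1 = D[unfolded irreducible_components_def, THEN conjunct1, THEN bspec, OF i]
  show "holo_at (D i) 0" by (rule conjunct1[OF D1])
  show "irreducible (germ (D i))" by (rule conjunct1[OF conjunct2[OF D1]])
  show "i = k" if "k \<in> {1..l}" "germ (D i) dvd germ (D k)" for k
    using D[unfolded irreducible_components_def, THEN conjunct2, THEN conjunct1, THEN bspec, OF i, THEN bspec, OF that(1)] that(2)
    by argo
qed

lemma involution_permutationD:
  assumes \<sigma>: "involution_permutation l D \<sigma>" and i: "i \<in> {1..l}"
  shows "\<sigma> i \<in> {1..l}" "germ (D (\<sigma> i)) dvd germ (\<lambda>x. D i (flip x))" "germ (\<lambda>x. D i (flip x)) dvd germ (D (\<sigma> i))"
proof -
  note h = \<sigma>[unfolded involution_permutation_def]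
  show "\<sigma> i \<in> {1..l}" using permutes_in_image[OF conjunct1[OF h]] i by simp
  note h2 = h[THEN conjunct2, THEN bspec, OF i]
  show "germ (D (\<sigma> i)) dvd germ (\<lambda>x. D i (flip x))" "germ (\<lambda>x. D i (flip x)) dvd germ (D (\<sigma> i))"
    unfolding flip_def by (rule conjunct1[OF h2], rule conjunct2[OF h2])
qed

context double_fold
begin

text \<open>The order \<open>v + int N\<close> of \<open>E\<close> is the sum of the intersection
  numbers of \<open>dsharp\<close> with the components in \<open>j\<close>, which cancels the
  \<open>dsharp\<close> part of the \<lambda>-indices. What remains is \<open>- N\<close>. For odd
  \<open>N\<close> this is minus the order of the single component on the axis, for
  \<open>N = 2 * k\<close> each of the two components has order \<open>k\<close>. The parity of
  \<open>N\<close> also decides whether \<open>\<sigma> i = i\<close>.\<close>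

lemma vertical_index:
  assumes f: "reduced_image_equation \<Phi> f" and D: "irreducible_components d l D"
    and \<sigma>: "involution_permutation l D \<sigma>" and vi: "is_vertical_index \<Phi> f d l D \<sigma> j m"
  defines "S \<equiv> \<lambda>i. \<Sum>k\<in>{1..l} - {i}. int (intersection_mult (D k) (D i))"
  shows "(\<forall>i\<in>j. \<exists>n. branch_of (D i) n) \<and>
    m = (\<Sum>i\<in>j. - S i - int (subdegree (pullback saxis (germ (D i)))))"
proof -
  obtain i H dsharp p v where i: "i \<in> {1..l}" and j: "j = {i, \<sigma> i}" and H: "transverse_section \<Phi> H"
    and ds: "holo_at dsharp 0" and Hd: "\<forall>\<^sub>F x in nhds 0. H (\<Phi> x) = d x * dsharp x"
    and p: "normalization_of_image \<Phi> (D i) p" and v: "is_v_exponent \<Phi> f H p v"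
    and m: "m = (if i \<noteq> \<sigma> i then lambda_index l D dsharp i + lambda_index l D dsharp (\<sigma> i) + v
               else lambda_index l D dsharp i + v)"
    using vi unfolding is_vertical_index_def by (elim bexE exE conjE) (rule that; assumption)
  note comp = irreducible_componentsD[OF D]
  note si = involution_permutationD(1)[OF \<sigma> i]
  note b = comp(1,2)[OF i] and b' = comp(1,2)[OF si] and flips = involution_permutationD(2,3)[OF \<sigma> i]
  have lam: "lambda_index l D dsharp k = - S k - int (intersection_mult dsharp (D k))" for k
    by (simp add: lambda_index_def S_def)
  obtain N \<xi> R E where data: "image_data (D i) dsharp N \<xi> R E" and E: "has_order E (v + int N)"
    using image_data_exists[OF f H ds Hd p v] by blast
  show ?thesis
  proof (cases "odd N")
    case True
    from odd_branch[OF data True E b ds] have o: "branch_of (D i) N" "germ (D i) dvd germ (\<lambda>x. D i (flip x))"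
      "v + int N = int (intersection_mult dsharp (D i))" by blast+
    have "germ (D i) dvd germ (D (\<sigma> i))" using o(2) flips(2) by (rule dvd_trans)
    then have \<sigma>i: "\<sigma> i = i" using comp(3)[OF i si] by simp
    have "j = {i}" using j \<sigma>i by simp
    then show ?thesis using o branch_of_props(2)[OF b o(1)] m \<sigma>i by (auto simp: lam)
  next
    case False
    then obtain k where N: "N = 2 * k" by (auto elim: evenE)
    from even_branch[OF data N E b b' flips ds]
    have e: "branch_of (D i) k" "branch_of (D (\<sigma> i)) k" "\<not> germ (D (\<sigma> i)) dvd germ (D i)"
      "v + int N = int (intersection_mult dsharp (D i)) + int (intersection_mult dsharp (D (\<sigma> i)))" by blast+
    have \<sigma>i: "i \<noteq> \<sigma> i" using e(3) by (metis dvd_refl)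
    show ?thesis
      using e m \<sigma>i branch_of_props(2)[OF b e(1)] branch_of_props(2)[OF b' e(2)] by (auto simp: lam j N)
  qed
qed

text \<open>\<open>D (\<sigma> (\<sigma> i))\<close> divides \<open>D i\<close> flipped twice, and
  different components do not divide each other.\<close>

lemma involution_permutation_involutive:
  assumes D: "irreducible_components d l D" and \<sigma>: "involution_permutation l D \<sigma>" and i: "i \<in> {1..l}"
  shows "\<sigma> (\<sigma> i) = i"
proof -
  note comp = irreducible_componentsD[OF D]
  note si = involution_permutationD(1)[OF \<sigma> i]
  note ssi = involution_permutationD(1)[OF \<sigma> si]
  have "germ (D (\<sigma> (\<sigma> i))) dvd germ (\<lambda>x. D (\<sigma> i) (flip x))" by (rule involution_permutationD(2)[OF \<sigma> si])
  also have "\<dots> dvd germ (\<lambda>x. D i (flip (flip x)))"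
    using germ_dvd_flip[OF comp(1)[OF si] holo_at_flip[OF comp(1)[OF i]] involution_permutationD(2)[OF \<sigma> i]] .
  finally have "germ (D (\<sigma> (\<sigma> i))) dvd germ (D i)" by simp
  then show ?thesis by (rule comp(3)[OF ssi i])
qed

end

text \<open>The fibre of \<open>i \<mapsto> {i, \<sigma> i}\<close> over \<open>j\<close> is
  \<open>j\<close> itself, so the double sum is a sum over fibres.\<close>

lemma sum_involution_orbits:
  fixes h :: "nat \<Rightarrow> 'a :: comm_monoid_add"
  assumes \<sigma>: "\<And>i. i \<in> {1..l} \<Longrightarrow> \<sigma> i \<in> {1..l} \<and> \<sigma> (\<sigma> i) = i"
  shows "(\<Sum>j\<in>(\<lambda>i. {i, \<sigma> i}) ` {1..l}. \<Sum>i\<in>j. h i) = (\<Sum>i\<in>{1..l}. h i)"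
proof -
  have "{x \<in> {1..l}. {x, \<sigma> x} = j} = j" if jJ: "j \<in> (\<lambda>i. {i, \<sigma> i}) ` {1..l}" for j
  proof -
    obtain i where i: "i \<in> {1..l}" "j = {i, \<sigma> i}" using jJ by blast
    note s = \<sigma>[OF i(1)]
    show ?thesis
    proof
      show "{x \<in> {1..l}. {x, \<sigma> x} = j} \<subseteq> j" by blast
      have "{\<sigma> i, \<sigma> (\<sigma> i)} = j" using s i(2) by auto
      then have "i \<in> {x \<in> {1..l}. {x, \<sigma> x} = j}" "\<sigma> i \<in> {x \<in> {1..l}. {x, \<sigma> x} = j}" using s i by simp_all
      then show "j \<subseteq> {x \<in> {1..l}. {x, \<sigma> x} = j}" unfolding i(2) by (intro insert_subsetI empty_subsetI)
    qed
  qed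
  then have "(\<Sum>j\<in>(\<lambda>i. {i, \<sigma> i}) ` {1..l}. \<Sum>i\<in>j. h i) =
      (\<Sum>j\<in>(\<lambda>i. {i, \<sigma> i}) ` {1..l}. \<Sum>i\<in>{x \<in> {1..l}. {x, \<sigma> x} = j}. h i)"
    by (intro sum.cong refl) simp
  also have "\<dots> = (\<Sum>i\<in>{1..l}. h i)" by (rule sum.image_gen[symmetric]) simp
  finally show ?thesis .
qed

theorem proposition4p1:
  fixes \<Phi> :: "complex ^ 2 \<Rightarrow> complex ^ 3"
    and g d :: "complex ^ 2 \<Rightarrow> complex"
    and f :: "complex ^ 3 \<Rightarrow> complex"
    and l C :: nat
    and D :: "nat \<Rightarrow> complex ^ 2 \<Rightarrow> complex"
    and \<sigma> :: "nat \<Rightarrow> nat"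
    and vi :: "nat set \<Rightarrow> int"
    and F :: "complex ^ 3 \<Rightarrow> complex ^ 3"
  assumes "holo_at g 0"
    and "\<forall>\<^sub>F x in nhds 0. d x = g (vector [x $ 1, (x $ 2)\<^sup>2])"
    and "\<not> germ (\<lambda>x. x $ 2) dvd germ d"
    and "\<forall>\<^sub>F x in nhds 0. \<Phi> x = vector [x $ 1, (x $ 2)\<^sup>2, x $ 2 * d x]"
    and "finitely_A_determined \<Phi>"
    and "Sigma_1_0 \<Phi>"
    and "reduced_image_equation \<Phi> f"
    and "irreducible_components d l D"
    and "involution_permutation l D \<sigma>"
    and "\<forall>j\<in>(\<lambda>i. {i, \<sigma> i}) ` {1..l}. is_vertical_index \<Phi> f d l D \<sigma> j (vi j)"
    and "stabilization \<Phi> F"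
    and "number_of_cross_caps F C"
  shows "(\<Sum>j\<in>(\<lambda>i. {i, \<sigma> i}) ` {1..l}. vi j) =
     - (\<Sum>(i, k)\<in>{(i, k). i \<in> {1..l} \<and> k \<in> {1..l} \<and> i \<noteq> k}.
          int (intersection_mult (D i) (D k)))
     - int C"
proof -
  interpret double_fold \<Phi> g d by unfold_locales (fact assms(1-4))+
  note D = assms(8) and \<sigma> = assms(9)
  define S where "S = (\<lambda>i. \<Sum>k\<in>{1..l} - {i}. int (intersection_mult (D k) (D i)))"
  define ord where "ord = (\<lambda>i. subdegree (pullback saxis (germ (D i))))"
  let ?J = "(\<lambda>i. {i, \<sigma> i}) ` {1..l}"
  have vi: "(\<forall>i\<in>j. \<exists>n. branch_of (D i) n) \<and> vi j = (\<Sum>i\<in>j. - S i - int (ord i))" if "j \<in> ?J" for j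
    unfolding S_def ord_def by (rule vertical_index[OF assms(7) D \<sigma>]) (use assms(10) that in blast)
  have inv: "\<sigma> i \<in> {1..l} \<and> \<sigma> (\<sigma> i) = i" if "i \<in> {1..l}" for i
    using involution_permutation_involutive[OF D \<sigma> that] involution_permutationD(1)[OF \<sigma> that] by simp
  note comp = irreducible_componentsD(1,2)[OF D]
  have branch: "\<exists>n. branch_of (D i) n" if "i \<in> {1..l}" for i
    using vi[OF imageI[OF that]] by blast
  have "(\<Sum>j\<in>?J. vi j) = (\<Sum>j\<in>?J. \<Sum>i\<in>j. - S i - int (ord i))"
    using vi by (intro sum.cong refl) blast
  also have "\<dots> = (\<Sum>i\<in>{1..l}. - S i - int (ord i))" by (rule sum_involution_orbits[OF inv])
  also have "\<dots> = - (\<Sum>i\<in>{1..l}. S i) - int (\<Sum>i\<in>{1..l}. ord i)"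
    by (simp add: sum_subtractf sum_negf)
  also have "(\<Sum>i\<in>{1..l}. ord i) = subdegree (pullback saxis (germ d))"
    unfolding ord_def
  proof (rule axis_order_sum[OF D, symmetric])
    show "germ (D i) dvd u \<or> germ (D i) dvd v" if i: "i \<in> {1..l}" and dvd: "germ (D i) dvd u * v" for i u v
      using branch[OF i] branch_of_props(1)[OF comp[OF i] _ dvd] by blast
    show "\<not> germ (D i) * germ (D i) dvd germ d" if i: "i \<in> {1..l}" for i
      using branch[OF i] branch_of_props(3)[OF comp[OF i]] by blast
  qed (rule pullback_d_nonzero)
  also have "subdegree (pullback saxis (germ d)) = C" using cross_caps_eq[OF assms(11,12)] by simp
  \<comment> \<open>In \<open>S i\<close> the fixed index stands second in the intersection number;
    exchanging the members of each pair afterwards gives the stated order without using symmetry of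
    the multiplicity.\<close>
  also have "(\<Sum>i\<in>{1..l}. S i) = (\<Sum>(i, k)\<in>(SIGMA i:{1..l}. {1..l} - {i}). int (intersection_mult (D k) (D i)))"
    unfolding S_def by (rule sum.Sigma) auto
  also have "\<dots> = (\<Sum>(i, k)\<in>{(i, k). i \<in> {1..l} \<and> k \<in> {1..l} \<and> i \<noteq> k}. int (intersection_mult (D i) (D k)))"
    by (rule sum.reindex_bij_witness[where i=prod.swap and j=prod.swap]) auto
  finally show ?thesis .
qed

end
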